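(* (The lifting property.) Let $K/K_0$ be a PAC extension and consider a rational double embedding problem for $K/K_0$, given by data $(E,\mathbf{t},F_0)$ with $\mathbf{t}=(t_1,\ldots,t_e)$, $F=F_0K$, $L_0=F_0\cap K_{0s}$, $L=F\cap K_s$. Let $\theta\colon\mathrm{Gal}(K)\to\mathrm{Gal}(F/E)$ be a weak solution of the lower embedding problem. Then there exists a geometric weak solution $(\Phi^*,\Phi_0^* )$ of the double embedding problem such that $\theta=\Phi^*$. Moreover, if $r(\mathbf{t})\in K(\mathbf{t})$ is nonzero, then $\Phi$ can be chosen such that $\mathbf{a}=\Phi(\mathbf{t})\in K_0^e$ and $r(\mathbf{a})\neq 0,\infty$.
   Context: PAC extension: a field extension $K/K_0$ (not necessarily algebraic) is PAC if for every absolutely irreducible variety $V$ of dimension $r\geq 1$ defined over $K$ and every separable dominating rational map $\nu\colon V\to\mathbb{A}^r$ defined over $K$ there exists $a\in V(K)$ with $\nu(a)\in K_0^r$. $K_s$ denotes the separable closure of a field $K$, $\mathrm{Gal}(K)=\mathrm{Gal}(K_s/K)$, and $K_{0s}\subseteq K_s$ is the separable closure of $K_0$. Embedding problems: an embedding problem for $K$ is a pair of continuous epimorphisms of profinite groups $(\mu\colon\mathrm{Gal}(K)\to A,\ \alpha\colon G\to A)$. A weak solution is a continuous homomorphism $\theta\colon\mathrm{Gal}(K)\to G$ (not necessarily surjective) with $\alpha\theta=\mu$. Rational double embedding problem for $K/K_0$: it is given by a finitely generated regular extension $E/K$, a separating transcendence basis $\mathbf{t}=(t_1,\ldots,t_e)$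 of $E/K$, and a finite Galois extension $F_0/K_0(\mathbf{t})$ such that $E\subseteq F:=F_0K$ (here $F_0$ and $K$ lie in a common field in which $\mathbf{t}$ is algebraically independent over $K$). Put $L_0=F_0\cap K_{0s}$ and $L=F\cap K_s$ (so $L=L_0K$). The upper embedding problem is $(\mu_0\colon\mathrm{Gal}(K_0)\to\mathrm{Gal}(L_0/K_0),\ \alpha_0\colon\mathrm{Gal}(F_0/K_0(\mathbf{t}))\to\mathrm{Gal}(L_0/K_0))$ and the lower embedding problem is $(\mu\colon\mathrm{Gal}(K)\to\mathrm{Gal}(L/K),\ \alpha\colon\mathrm{Gal}(F/E)\to\mathrm{Gal}(L/K))$, all maps being restriction maps. $\mathrm{Gal}(F/E)$ embeds into $\mathrm{Gal}(F_0/K_0(\mathbf{t}))$ by restriction to $F_0$, and $\mathrm{Gal}(L/K)$ embeds into $\mathrm{Gal}(L_0/K_0)$ by restriction to $L_0$. A weak solution of the double embedding problem is a pair $(\theta,\theta_0)$ where $\theta_0$ and $\theta$ are weak solutions of the upper and lower embedding problems respectively, and $\theta(\sigma)|_{F_0}=\theta_0(\sigma|_{K_{0s}})$ for all $\sigma\in\mathrm{Gal}(K)$. Places: places of $E$, $F$ are trivial on $K$ (i.e. $\phi(x)=x$ for $x\in K$), places of $F$ are taken trivial on $L$, and have values in an algebraic closure of $K$ together with $\infty$ when $\bar E=K$; a bar denotes residue fields. For a finite Galois extension $F/E$, a place $\Phi$ of $F$ is unramified over $E$ if its inertia group in $\mathrm{Gal}(F/E)$ is trivial. If $\Phi$ is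 a place of $F$, trivial on $L$, unramified over $E$, with $\bar E=K$, then $\Phi^*\colon\mathrm{Gal}(K)\to\mathrm{Gal}(F/E)$ denotes the induced weak solution of the lower embedding problem: its image is the decomposition group of $\Phi$ and $\Phi(\Phi^*(\sigma)(x))=\sigma(\Phi(x))$ for all $\sigma\in\mathrm{Gal}(K)$ and all $x\in F$ with $\Phi(x)\neq\infty$. The same definition applies to $F_0/K_0(\mathbf{t})$ over $K_0$. A weak solution $(\theta,\theta_0)$ of the double embedding problem is geometric if $(\theta,\theta_0)=(\Phi^*,\Phi_0^* )$ for some place $\Phi$ of $F$ trivial on $L$ that is unramified over $E$ with $\bar E=K$, where $\Phi_0=\Phi|_{F_0}$ is unramified over $K_0(\mathbf{t})$ and the residue field of $K_0(\mathbf{t})$ is $K_0$. *)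

theory Defs
  imports
    "HOL-Algebra.Algebraic_Closure_Type"
    "HOL-Algebra.Bij"
    "HOL-Algebra.Generated_Fields"
    "HOL-Algebra.Finite_Extensions"
    "HOL-Analysis.Function_Topology"
    "HOL-Library.Poly_Mapping"
    "HOL-Computational_Algebra.Fraction_Field"
begin

section \<open>Field extensions inside an algebraically closed field\<close>

text \<open>
  All fields are subfields of the field formed by an algebraically closed type.  Tuples of
  length \<open>n\<close> are functions on \<open>nat\<close> of which only the values at \<open>i < n\<close> matter.
\<close>

abbreviation univ_field :: "'a::field ring"
  where "univ_field \<equiv> ring_of_type_algebra"

definition field_extension :: "'a::field set \<Rightarrow> 'a set \<Rightarrow> bool"
  where "field_extension K N \<longleftrightarrow>
    subfield K univ_field \<and> subfield N univ_field \<and> K \<subseteq> N"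

definition adjoin :: "'a::field set \<Rightarrow> (nat \<Rightarrow> 'a) \<Rightarrow> nat \<Rightarrow> 'a set"
  where "adjoin K t n = generate_field univ_field (K \<union> t ` {..<n})"

definition compositum :: "'a::field set \<Rightarrow> 'a set \<Rightarrow> 'a set"
  where "compositum M N = generate_field univ_field (M \<union> N)"

definition poly_over :: "'a::field set \<Rightarrow> 'a poly \<Rightarrow> bool"
  where "poly_over K p \<longleftrightarrow> (\<forall>i. poly.coeff p i \<in> K)"

definition algebraic_over :: "'a::field set \<Rightarrow> 'a \<Rightarrow> bool"
  where "algebraic_over K x \<longleftrightarrow> (\<exists>p. p \<noteq> 0 \<and> poly_over K p \<and> poly p x = 0)"

definition is_min_poly :: "'a::field set \<Rightarrow> 'a \<Rightarrow> 'a poly \<Rightarrow> bool"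
  where "is_min_poly K x p \<longleftrightarrow>
    poly_over K p \<and> lead_coeff p = 1 \<and> poly p x = 0 \<and>
    (\<forall>q. q \<noteq> 0 \<and> poly_over K q \<and> poly q x = 0 \<longrightarrow> Polynomial.degree p \<le> Polynomial.degree q)"

text \<open>
  The type is algebraically closed, so \<^const>\<open>rsquarefree\<close> says that all roots of the
  polynomial in an algebraic closure are simple.
\<close>

definition separable_over :: "'a::alg_closed_field set \<Rightarrow> 'a \<Rightarrow> bool"
  where "separable_over K x \<longleftrightarrow> (\<exists>p. is_min_poly K x p \<and> rsquarefree p)"

definition separable_algebraic_extension :: "'a::alg_closed_field set \<Rightarrow> 'a set \<Rightarrow> bool"
  where "separable_algebraic_extension K N \<longleftrightarrow>
    field_extension K N \<and> (\<forall>x\<in>N. separable_over K x)"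

definition algebraic_closure_of :: "'a::alg_closed_field set \<Rightarrow> 'a set"
  where "algebraic_closure_of K = {x. algebraic_over K x}"

definition separable_closure_of :: "'a::alg_closed_field set \<Rightarrow> 'a set"
  where "separable_closure_of K = {x. separable_over K x}"

definition normal_extension :: "'a::alg_closed_field set \<Rightarrow> 'a set \<Rightarrow> bool"
  where "normal_extension K N \<longleftrightarrow>
    field_extension K N \<and> (\<forall>x\<in>N. \<exists>p. is_min_poly K x p \<and> {y. poly p y = 0} \<subseteq> N)"

definition finite_galois_extension :: "'a::alg_closed_field set \<Rightarrow> 'a set \<Rightarrow> bool"
  where "finite_galois_extension K N \<longleftrightarrow>
    separable_algebraic_extension K N \<and> normal_extension K N \<and>
    ring.finite_dimension univ_field K N"

text \<open>Regularity: \<open>N\<close> is linearly disjoint from the algebraic closure of \<open>K\<close> over \<open>K\<close>.\<close>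

definition regular_extension :: "'a::alg_closed_field set \<Rightarrow> 'a set \<Rightarrow> bool"
  where "regular_extension K N \<longleftrightarrow>
    field_extension K N \<and>
    (\<forall>us. set us \<subseteq> N \<and> ring.independent univ_field K us \<longrightarrow>
          ring.independent univ_field (algebraic_closure_of K) us)"

definition finitely_generated_extension :: "'a::field set \<Rightarrow> 'a set \<Rightarrow> bool"
  where "finitely_generated_extension K N \<longleftrightarrow>
    field_extension K N \<and> (\<exists>S. finite S \<and> N = generate_field univ_field (K \<union> S))"


section \<open>Polynomials in several variables\<close>

type_synonym 'a mpoly = "(nat \<Rightarrow>\<^sub>0 nat) \<Rightarrow>\<^sub>0 'a"

text \<open>\<open>K[X\<^sub>0, \<dots>, X\<^sub>n\<^sub>-\<^sub>1]\<close>\<close>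

definition mpoly_ring :: "'a::field set \<Rightarrow> nat \<Rightarrow> 'a mpoly ring"
  where "mpoly_ring K n = (ring_of_type_algebra :: 'a mpoly ring)
    \<lparr>carrier := {p. (\<forall>m. Poly_Mapping.lookup p m \<in> K) \<and>
                    (\<forall>m\<in>Poly_Mapping.keys p. Poly_Mapping.keys m \<subseteq> {..<n})}\<rparr>"

text \<open>The coefficients are moved along \<open>h\<close> before the variables are replaced by \<open>x\<close>.\<close>

definition mpoly_eval :: "('a::field \<Rightarrow> 'b::field) \<Rightarrow> (nat \<Rightarrow> 'b) \<Rightarrow> 'a mpoly \<Rightarrow> 'b"
  where "mpoly_eval h x p =
    (\<Sum>m\<in>Poly_Mapping.keys p. h (Poly_Mapping.lookup p m) *
       (\<Prod>i\<in>Poly_Mapping.keys m. x i ^ Poly_Mapping.lookup m i))"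

definition algebraically_independent :: "'a::field set \<Rightarrow> (nat \<Rightarrow> 'a) \<Rightarrow> nat \<Rightarrow> bool"
  where "algebraically_independent K t n \<longleftrightarrow>
    (\<forall>p\<in>carrier (mpoly_ring K n). mpoly_eval id t p = 0 \<longrightarrow> p = 0)"

definition transcendence_basis ::
    "'a::field set \<Rightarrow> 'a set \<Rightarrow> (nat \<Rightarrow> 'a) \<Rightarrow> nat \<Rightarrow> bool"
  where "transcendence_basis K N t n \<longleftrightarrow>
    (\<forall>i<n. t i \<in> N) \<and> algebraically_independent K t n \<and>
    (\<forall>x\<in>N. algebraic_over (adjoin K t n) x)"

definition separating_transcendence_basis ::
    "'a::alg_closed_field set \<Rightarrow> 'a set \<Rightarrow> (nat \<Rightarrow> 'a) \<Rightarrow> nat \<Rightarrow> bool"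
  where "separating_transcendence_basis K N t n \<longleftrightarrow>
    transcendence_basis K N t n \<and> separable_algebraic_extension (adjoin K t n) N"


section \<open>Varieties and PAC extensions\<close>

text \<open>
  An affine variety \<open>V\<close> in \<open>n\<close>-space over \<open>K\<close> is given by its ideal \<open>I\<close> in
  \<open>K[X\<^sub>0, \<dots>, X\<^sub>n\<^sub>-\<^sub>1]\<close>.  It is absolutely irreducible and defined over \<open>K\<close> if \<open>I\<close> generates
  a prime ideal over the algebraic closure of \<open>K\<close>.  Affine varieties suffice for the PAC
  property: it only asks for one \<open>K\<close>-rational point, which may be sought in an affine open part.
\<close>

definition absolutely_irreducible_variety ::
    "'a::alg_closed_field set \<Rightarrow> nat \<Rightarrow> 'a mpoly set \<Rightarrow> bool"
  where "absolutely_irreducible_variety K n I \<longleftrightarrow>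
    ideal I (mpoly_ring K n) \<and>
    primeideal (Idl\<^bsub>mpoly_ring (algebraic_closure_of K) n\<^esub> I)
      (mpoly_ring (algebraic_closure_of K) n)"

definition rational_points ::
    "'a::field set \<Rightarrow> nat \<Rightarrow> 'a mpoly set \<Rightarrow> (nat \<Rightarrow> 'a) set"
  where "rational_points K n I =
    {a. (\<forall>i<n. a i \<in> K) \<and> (\<forall>f\<in>I. mpoly_eval id a f = 0)}"

text \<open>
  The function field \<open>K(V)\<close> is realised as \<open>K(x)\<close> for a generic point \<open>x\<close> of \<open>V\<close> over \<open>K\<close>.
  Its coordinates are taken from an algebraically closed field of infinite transcendence degree
  over the given type, so that every variety has a generic point.
\<close>

type_synonym 'a universal_domain = "'a mpoly fract alg_closure"

definition embed :: "'a::field \<Rightarrow> 'a universal_domain"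
  where "embed c = to_ac (Fract (Poly_Mapping.single 0 c) 1)"

definition generic_point ::
    "'a::field set \<Rightarrow> nat \<Rightarrow> 'a mpoly set \<Rightarrow> (nat \<Rightarrow> 'a universal_domain) \<Rightarrow> bool"
  where "generic_point K n I x \<longleftrightarrow>
    (\<forall>f\<in>carrier (mpoly_ring K n). mpoly_eval embed x f = 0 \<longleftrightarrow> f \<in> I)"

text \<open>
  Let \<open>y \<in> K(x)\<close> be a rational function on the variety with generic point \<open>x\<close>.  It is defined
  at the point \<open>a\<close> with value \<open>b\<close> if it has some representation \<open>y = p(x)/q(x)\<close> with
  \<open>q(a) \<noteq> 0\<close> and \<open>b = p(a)/q(a)\<close>.
\<close>

definition has_value_at ::
    "('a::field \<Rightarrow> 'b::field) \<Rightarrow> 'a set \<Rightarrow> nat \<Rightarrow> (nat \<Rightarrow> 'b) \<Rightarrow> 'b \<Rightarrow> (nat \<Rightarrow> 'a) \<Rightarrow> 'a \<Rightarrow> bool"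
  where "has_value_at h K n x y a b \<longleftrightarrow>
    (\<exists>p\<in>carrier (mpoly_ring K n). \<exists>q\<in>carrier (mpoly_ring K n).
       mpoly_eval h x q \<noteq> 0 \<and> y = mpoly_eval h x p / mpoly_eval h x q \<and>
       mpoly_eval id a q \<noteq> 0 \<and> b = mpoly_eval id a p / mpoly_eval id a q)"

text \<open>
  In the next definition \<open>\<nu>\<close> is the tuple of the coordinate functions in \<open>K(V) = K(x)\<close> of a
  rational map from \<open>V\<close> to affine \<open>r\<close>-space.
\<close>

definition separable_dominating_rational_map ::
    "'a::field set \<Rightarrow> nat \<Rightarrow> (nat \<Rightarrow> 'a universal_domain) \<Rightarrow> nat \<Rightarrow>
     (nat \<Rightarrow> 'a universal_domain) \<Rightarrow> bool"
  where "separable_dominating_rational_map K n x r \<nu> \<longleftrightarrow>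
    (\<forall>i<r. \<nu> i \<in> adjoin (embed ` K) x n) \<and>
    algebraically_independent (embed ` K) \<nu> r \<and>
    separable_algebraic_extension (adjoin (embed ` K) \<nu> r) (adjoin (embed ` K) x n)"

definition pac_extension :: "'a::alg_closed_field set \<Rightarrow> 'a set \<Rightarrow> bool"
  where "pac_extension K0 K \<longleftrightarrow>
    field_extension K0 K \<and>
    (\<forall>n r I x \<nu>.
       r \<ge> 1 \<and>
       absolutely_irreducible_variety K n I \<and>
       generic_point K n I x \<and>
       (\<exists>s. transcendence_basis (embed ` K) (adjoin (embed ` K) x n) s r) \<and>
       separable_dominating_rational_map K n x r \<nu> \<longrightarrow>
       (\<exists>a\<in>rational_points K n I. \<forall>i<r. \<exists>b\<in>K0. has_value_at embed K n x (\<nu> i) a b))"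


section \<open>Galois groups and embedding problems\<close>

definition galois_group :: "'a::field set \<Rightarrow> 'a set \<Rightarrow> ('a \<Rightarrow> 'a) monoid"
  where "galois_group N M = (BijGroup N)
    \<lparr>carrier := {\<sigma> \<in> Bij N.
       \<sigma> \<in> ring_hom (univ_field\<lparr>carrier := N\<rparr>) (univ_field\<lparr>carrier := N\<rparr>) \<and>
       (\<forall>x\<in>M. \<sigma> x = x)}\<rparr>"

text \<open>
  The Krull topology is the topology of pointwise convergence for the discrete topology on \<open>N\<close>.
\<close>

definition krull_topology :: "'a::field set \<Rightarrow> 'a set \<Rightarrow> ('a \<Rightarrow> 'a) topology"
  where "krull_topology N M =
    subtopology (product_topology (\<lambda>_. discrete_topology N) N) (carrier (galois_group N M))"

abbreviation absolute_galois_group :: "'a::alg_closed_field set \<Rightarrow> ('a \<Rightarrow> 'a) monoid"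
  where "absolute_galois_group K \<equiv> galois_group (separable_closure_of K) K"

definition weak_solution ::
    "('g, 'm) monoid_scheme \<Rightarrow> 'g topology \<Rightarrow> ('h, 'n) monoid_scheme \<Rightarrow> 'h topology \<Rightarrow>
     ('g \<Rightarrow> 'c) \<Rightarrow> ('h \<Rightarrow> 'c) \<Rightarrow> ('g \<Rightarrow> 'h) \<Rightarrow> bool"
  where "weak_solution \<Gamma> T\<^sub>\<Gamma> G T\<^sub>G \<mu> \<alpha> \<theta> \<longleftrightarrow>
    \<theta> \<in> hom \<Gamma> G \<and> continuous_map T\<^sub>\<Gamma> T\<^sub>G \<theta> \<and> (\<forall>\<sigma>\<in>carrier \<Gamma>. \<alpha> (\<theta> \<sigma>) = \<mu> \<sigma>)"

text \<open>
  The upper and the lower embedding problem have the same shape: for \<open>E\<close> an extension of \<open>K\<close>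
  and \<open>F\<close> finite Galois over \<open>E\<close>, with \<open>L\<close> the part of \<open>F\<close> in the separable closure of \<open>K\<close>,
  they consist of the restriction maps \<open>Gal(K) \<rightarrow> Gal(L/K)\<close> and \<open>Gal(F/E) \<rightarrow> Gal(L/K)\<close>.
\<close>

definition constants_of :: "'a::alg_closed_field set \<Rightarrow> 'a set \<Rightarrow> 'a set"
  where "constants_of K F = F \<inter> separable_closure_of K"

definition restriction_weak_solution ::
    "'a::alg_closed_field set \<Rightarrow> 'a set \<Rightarrow> 'a set \<Rightarrow> (('a \<Rightarrow> 'a) \<Rightarrow> ('a \<Rightarrow> 'a)) \<Rightarrow> bool"
  where "restriction_weak_solution K E F \<theta> \<longleftrightarrow>
    weak_solution
      (absolute_galois_group K) (krull_topology (separable_closure_of K) K)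
      (galois_group F E) (krull_topology F E)
      (\<lambda>\<sigma>. restrict \<sigma> (constants_of K F)) (\<lambda>\<tau>. restrict \<tau> (constants_of K F)) \<theta>"

definition rational_double_embedding_problem ::
    "'a::alg_closed_field set \<Rightarrow> 'a set \<Rightarrow> 'a set \<Rightarrow> (nat \<Rightarrow> 'a) \<Rightarrow> nat \<Rightarrow> 'a set \<Rightarrow> bool"
  where "rational_double_embedding_problem K0 K E t e F0 \<longleftrightarrow>
    field_extension K0 K \<and>
    finitely_generated_extension K E \<and> regular_extension K E \<and>
    separating_transcendence_basis K E t e \<and>
    finite_galois_extension (adjoin K0 t e) F0 \<and>
    E \<subseteq> compositum F0 K"

definition lower_weak_solution ::
    "'a::alg_closed_field set \<Rightarrow> 'a set \<Rightarrow> 'a set \<Rightarrow> (('a \<Rightarrow> 'a) \<Rightarrow> ('a \<Rightarrow> 'a)) \<Rightarrow> bool"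
  where "lower_weak_solution K E F0 \<theta> \<longleftrightarrow> restriction_weak_solution K E (compositum F0 K) \<theta>"

definition upper_weak_solution ::
    "'a::alg_closed_field set \<Rightarrow> (nat \<Rightarrow> 'a) \<Rightarrow> nat \<Rightarrow> 'a set \<Rightarrow>
     (('a \<Rightarrow> 'a) \<Rightarrow> ('a \<Rightarrow> 'a)) \<Rightarrow> bool"
  where "upper_weak_solution K0 t e F0 \<theta>0 \<longleftrightarrow> restriction_weak_solution K0 (adjoin K0 t e) F0 \<theta>0"

definition double_weak_solution ::
    "'a::alg_closed_field set \<Rightarrow> 'a set \<Rightarrow> 'a set \<Rightarrow> (nat \<Rightarrow> 'a) \<Rightarrow> nat \<Rightarrow> 'a set \<Rightarrow>
     (('a \<Rightarrow> 'a) \<Rightarrow> ('a \<Rightarrow> 'a)) \<Rightarrow> (('a \<Rightarrow> 'a) \<Rightarrow> ('a \<Rightarrow> 'a)) \<Rightarrow> bool"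
  where "double_weak_solution K0 K E t e F0 \<theta> \<theta>0 \<longleftrightarrow>
    upper_weak_solution K0 t e F0 \<theta>0 \<and> lower_weak_solution K E F0 \<theta> \<and>
    (\<forall>\<sigma>\<in>carrier (absolute_galois_group K).
       restrict (\<theta> \<sigma>) F0 = \<theta>0 (restrict \<sigma> (separable_closure_of K0)))"


section \<open>Places and geometric solutions\<close>

text \<open>
  A place of \<open>N\<close> with values in \<open>M \<union> {\<infinity>}\<close>, where \<^const>\<open>None\<close> stands for \<open>\<infinity>\<close>.  The rules for
  sums and products are required whenever the right-hand side is defined; \<open>\<infinity> + \<infinity>\<close> and
  \<open>0 * \<infinity>\<close> are not.  Places that are finite everywhere are allowed, which matters only for the
  degenerate case \<open>e = 0\<close>.
\<close>

definition is_place :: "'a::field set \<Rightarrow> 'a set \<Rightarrow> ('a \<Rightarrow> 'a option) \<Rightarrow> bool"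
  where "is_place N M \<phi> \<longleftrightarrow>
    (\<forall>x\<in>N. \<forall>a. \<phi> x = Some a \<longrightarrow> a \<in> M) \<and>
    \<phi> 1 = Some 1 \<and>
    (\<forall>x\<in>N. \<forall>y\<in>N. \<forall>a b. \<phi> x = Some a \<and> \<phi> y = Some b \<longrightarrow>
       \<phi> (x + y) = Some (a + b) \<and> \<phi> (x * y) = Some (a * b)) \<and>
    (\<forall>x\<in>N. \<forall>y\<in>N. \<phi> x = None \<and> \<phi> y \<noteq> None \<longrightarrow> \<phi> (x + y) = None) \<and>
    (\<forall>x\<in>N. \<forall>y\<in>N. \<phi> x = None \<and> \<phi> y \<noteq> Some 0 \<longrightarrow> \<phi> (x * y) = None)"

definition residue_field :: "('a \<Rightarrow> 'a option) \<Rightarrow> 'a set \<Rightarrow> 'a set"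
  where "residue_field \<phi> N = {a. \<exists>x\<in>N. \<phi> x = Some a}"

definition decomposition_group ::
    "('a::field \<Rightarrow> 'a option) \<Rightarrow> 'a set \<Rightarrow> 'a set \<Rightarrow> ('a \<Rightarrow> 'a) set"
  where "decomposition_group \<phi> F E =
    {\<sigma> \<in> carrier (galois_group F E). \<forall>x\<in>F. \<phi> (\<sigma> x) = None \<longleftrightarrow> \<phi> x = None}"

definition inertia_group ::
    "('a::field \<Rightarrow> 'a option) \<Rightarrow> 'a set \<Rightarrow> 'a set \<Rightarrow> ('a \<Rightarrow> 'a) set"
  where "inertia_group \<phi> F E =
    {\<sigma> \<in> decomposition_group \<phi> F E. \<forall>x\<in>F. \<phi> x \<noteq> None \<longrightarrow> \<phi> (\<sigma> x) = \<phi> x}"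

definition unramified_place ::
    "('a::field \<Rightarrow> 'a option) \<Rightarrow> 'a set \<Rightarrow> 'a set \<Rightarrow> bool"
  where "unramified_place \<phi> F E \<longleftrightarrow> inertia_group \<phi> F E = {\<one>\<^bsub>galois_group F E\<^esub>}"

definition unramified_rational_place ::
    "'a::alg_closed_field set \<Rightarrow> 'a set \<Rightarrow> 'a set \<Rightarrow> ('a \<Rightarrow> 'a option) \<Rightarrow> bool"
  where "unramified_rational_place K E F \<phi> \<longleftrightarrow>
    is_place F (algebraic_closure_of K) \<phi> \<and>
    (\<forall>x\<in>constants_of K F. \<phi> x = Some x) \<and>
    unramified_place \<phi> F E \<and> residue_field \<phi> E = K"

text \<open>
  \<open>\<theta> = \<phi>\<^sup>*\<close> on \<open>Gal(K)\<close>.  The last condition determines every \<open>\<theta> \<sigma>\<close> inside the decomposition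
  group, since the inertia group is trivial.
\<close>

definition induced_weak_solution ::
    "'a::alg_closed_field set \<Rightarrow> 'a set \<Rightarrow> 'a set \<Rightarrow> ('a \<Rightarrow> 'a option) \<Rightarrow>
     (('a \<Rightarrow> 'a) \<Rightarrow> ('a \<Rightarrow> 'a)) \<Rightarrow> bool"
  where "induced_weak_solution K E F \<phi> \<theta> \<longleftrightarrow>
    restriction_weak_solution K E F \<theta> \<and>
    \<theta> ` carrier (absolute_galois_group K) = decomposition_group \<phi> F E \<and>
    (\<forall>\<sigma>\<in>carrier (absolute_galois_group K). \<forall>x\<in>F. \<forall>a.
       \<phi> x = Some a \<longrightarrow> \<phi> (\<theta> \<sigma> x) = Some (\<sigma> a))"

text \<open>
  \<open>(\<theta>, \<theta>0) = (\<Phi>\<^sup>*, \<Phi>\<^sub>0\<^sup>*)\<close> is the geometric weak solution attached to the place \<open>\<Phi>\<close> of \<open>F\<close>.  The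
  restriction \<open>\<Phi>\<^sub>0\<close> of \<open>\<Phi>\<close> to \<open>F0\<close> is the same function, considered on \<open>F0\<close> only.
\<close>

definition geometric_weak_solution ::
    "'a::alg_closed_field set \<Rightarrow> 'a set \<Rightarrow> 'a set \<Rightarrow> (nat \<Rightarrow> 'a) \<Rightarrow> nat \<Rightarrow> 'a set \<Rightarrow>
     ('a \<Rightarrow> 'a option) \<Rightarrow> (('a \<Rightarrow> 'a) \<Rightarrow> ('a \<Rightarrow> 'a)) \<Rightarrow> (('a \<Rightarrow> 'a) \<Rightarrow> ('a \<Rightarrow> 'a)) \<Rightarrow> bool"
  where "geometric_weak_solution K0 K E t e F0 \<Phi> \<theta> \<theta>0 \<longleftrightarrow>
    double_weak_solution K0 K E t e F0 \<theta> \<theta>0 \<and>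
    unramified_rational_place K E (compositum F0 K) \<Phi> \<and>
    unramified_rational_place K0 (adjoin K0 t e) F0 \<Phi> \<and>
    induced_weak_solution K E (compositum F0 K) \<Phi> \<theta> \<and>
    induced_weak_solution K0 (adjoin K0 t e) F0 \<Phi> \<theta>0"

end

theory Submission
  imports Defs
begin

text \<open>
  Let \<open>Gal(K)\<close> act on \<open>F K\<^sub>s\<close> through \<open>\<theta>\<close> on \<open>F\<close> and naturally on the separable closure \<open>K\<^sub>s\<close>.  Its fixed
  field \<open>D\<close> contains \<open>E\<close>, is regular over \<open>K\<close> and separable over \<open>K(t)\<close>, and \<open>F\<close> is contained in
  \<open>D K\<^sub>s\<close>; so \<open>\<theta>\<close> becomes the restriction of the action of \<open>Gal(K)\<close> on the constants of \<open>D K\<^sub>s\<close>.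
  The PAC property, applied to a variety with function field inside \<open>D\<close>, yields a \<open>K\<close>-rational point
  above some \<open>a\<close> in \<open>K0\<^sup>e\<close>.  Moving \<open>t\<close> to algebraically independent power series over \<open>K0\<close> with
  constant terms \<open>a\<close>, Newton approximation lifts the point to an embedding \<open>j\<close> of a finitely generated
  part of \<open>D\<close> into the Laurent series over \<open>K\<close>, which extends to \<open>F\<close> with values in the Laurent series
  over \<open>K\<^sub>s\<close>.  The constant term of \<open>j\<close> is the place \<open>\<Phi>\<close>: \<open>j \<circ> \<theta> \<sigma>\<close> is \<open>j\<close> followed by \<open>\<sigma>\<close> on
  coefficients, so \<open>\<Phi>\<close> induces \<open>\<theta>\<close>.  Since \<open>j\<close> maps \<open>F0\<close> into the Laurent series over the separable
  closure of \<open>K0\<close>, the same construction over \<open>K0\<close> gives \<open>\<theta>0\<close>.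
\<close>

section \<open>Subrings and subfields of a field\<close>

text \<open>A \<open>K\<close>-rational point above \<open>a\<close> does not yet give a place:
  extending the specialisation to the function field involves choices, and a residue field larger
  than \<open>K\<close> would spoil rationality. An embedding into Laurent series over
  \<open>K\<close> carries a valuation with residue field \<open>K\<close>. For it to be injective,
  \<open>t\<close> must go to series independent over \<open>K\<close>; for it to send
  \<open>K0(t)\<close> into series over \<open>K0\<close>, those series need coefficients in
  \<open>K0\<close>. The constant terms supplied by the PAC property allow both. Unramifiedness is
  forced in advance: inverses of the differences of the conjugate generators \<open>Z\<close> are
  made integral, so distinct conjugates have distinct residues and inertia is trivial. Inverses of
  numerator and denominator of \<open>r\<close> are made integral likewise, which keeps
  \<open>r(a)\<close> away from 0 and infinity. Absolute irreducibility concerns the algebraic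
  closure of \<open>K\<close>, whereas the Galois action sees only the separable closure. Frobenius
  powers bridge this gap when \<open>K\<close> is imperfect. For \<open>e = 0\<close> the PAC
  property is silent, but then regularity makes \<open>D\<close> equal to \<open>K\<close>.\<close>

definition subring_set :: "'a::comm_ring_1 set \<Rightarrow> bool"
  where "subring_set R \<longleftrightarrow> 0 \<in> R \<and> 1 \<in> R \<and>
    (\<forall>x\<in>R. - x \<in> R \<and> (\<forall>y\<in>R. x + y \<in> R \<and> x * y \<in> R))"

definition subfield_set :: "'a::field set \<Rightarrow> bool"
  where "subfield_set K \<longleftrightarrow> subring_set K \<and> (\<forall>x\<in>K. inverse x \<in> K)"

abbreviation fgen :: "'a::field set \<Rightarrow> 'a set"
  where "fgen S \<equiv> generate_field univ_field S"

text \<open>Values outside \<open>R\<close> are unconstrained, so one HOL function serves as a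
  homomorphism on many subrings and restriction costs only \<open>rhom_mono\<close>. The value at 0
  follows by cancellation.\<close>

definition rhom :: "'a::comm_ring_1 set \<Rightarrow> ('a \<Rightarrow> 'b::comm_ring_1) \<Rightarrow> bool"
  where "rhom R h \<longleftrightarrow> h 1 = 1 \<and> (\<forall>x\<in>R. \<forall>y\<in>R. h (x + y) = h x + h y \<and> h (x * y) = h x * h y)"

abbreviation deg :: "'a::zero poly \<Rightarrow> nat"
  where "deg \<equiv> Polynomial.degree"

lemma subring_setD:
  assumes "subring_set R"
  shows "0 \<in> R" "1 \<in> R" "x \<in> R \<Longrightarrow> - x \<in> R" "x \<in> R \<Longrightarrow> y \<in> R \<Longrightarrow> x + y \<in> R"
    "x \<in> R \<Longrightarrow> y \<in> R \<Longrightarrow> x * y \<in> R" "x \<in> R \<Longrightarrow> y \<in> R \<Longrightarrow> x - y \<in> R"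
proof -
  show m: "\<And>x. x \<in> R \<Longrightarrow> - x \<in> R" and a: "\<And>x y. x \<in> R \<Longrightarrow> y \<in> R \<Longrightarrow> x + y \<in> R"
    using assms unfolding subring_set_def by auto
  show "x \<in> R \<Longrightarrow> y \<in> R \<Longrightarrow> x - y \<in> R" using a[of x "- y"] m[of y] by simp
qed (use assms in \<open>auto simp: subring_set_def\<close>)

lemma subring_set_power: "subring_set R \<Longrightarrow> x \<in> R \<Longrightarrow> x ^ n \<in> R"
  by (induction n) (auto simp: subring_setD)

lemma subring_set_sum: "subring_set R \<Longrightarrow> (\<And>i. i \<in> I \<Longrightarrow> f i \<in> R) \<Longrightarrow> sum f I \<in> R"
  by (induction I rule: infinite_finite_induct) (auto simp: subring_setD)

lemma subring_set_prod: "subring_set R \<Longrightarrow> (\<And>i. i \<in> I \<Longrightarrow> f i \<in> R) \<Longrightarrow> prod f I \<in> R"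
  by (induction I rule: infinite_finite_induct) (auto simp: subring_setD)

lemma subring_setI:
  assumes "0 \<in> R" "1 \<in> R" "\<And>x. x \<in> R \<Longrightarrow> - x \<in> R" "\<And>x y. x \<in> R \<Longrightarrow> y \<in> R \<Longrightarrow> x + y \<in> R"
    "\<And>x y. x \<in> R \<Longrightarrow> y \<in> R \<Longrightarrow> x * y \<in> R"
  shows "subring_set R"
  using assms unfolding subring_set_def by auto

lemma subfield_setD:
  assumes "subfield_set K"
  shows "subring_set K" "0 \<in> K" "1 \<in> K" "x \<in> K \<Longrightarrow> - x \<in> K" "x \<in> K \<Longrightarrow> y \<in> K \<Longrightarrow> x + y \<in> K"
    "x \<in> K \<Longrightarrow> y \<in> K \<Longrightarrow> x * y \<in> K" "x \<in> K \<Longrightarrow> y \<in> K \<Longrightarrow> x - y \<in> K"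
    "x \<in> K \<Longrightarrow> inverse x \<in> K" "x \<in> K \<Longrightarrow> y \<in> K \<Longrightarrow> x / y \<in> K"
proof -
  show *: "subring_set K" using assms by (simp add: subfield_set_def)
  show **: "\<And>x. x \<in> K \<Longrightarrow> inverse x \<in> K" using assms by (simp add: subfield_set_def)
  show "x \<in> K \<Longrightarrow> y \<in> K \<Longrightarrow> x / y \<in> K"
    unfolding divide_inverse by (intro subring_setD(5)[OF *] **)
qed (use assms subring_setD[of K] in \<open>auto simp: subfield_set_def\<close>)

lemma subfield_setI:
  assumes "1 \<in> K" "\<And>x y. x \<in> K \<Longrightarrow> y \<in> K \<Longrightarrow> x - y \<in> K"
    "\<And>x y. x \<in> K \<Longrightarrow> y \<in> K \<Longrightarrow> x * y \<in> K" "\<And>x. x \<in> K \<Longrightarrow> x \<noteq> 0 \<Longrightarrow> inverse x \<in> K"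
  shows "subfield_set K"
proof -
  have 0: "0 \<in> K" using assms(2)[OF assms(1) assms(1)] by simp
  have m: "x \<in> K \<Longrightarrow> - x \<in> K" for x using assms(2)[OF 0, of x] by simp
  have "x \<in> K \<Longrightarrow> y \<in> K \<Longrightarrow> x + y \<in> K" for x y using assms(2)[of x "- y"] m[of y] by simp
  then have "subring_set K" using 0 m assms(1,3) by (intro subring_setI) auto
  moreover have "inverse x \<in> K" if "x \<in> K" for x using 0 assms(4)[of x] that by (cases "x = 0") auto
  ultimately show ?thesis by (simp add: subfield_set_def)
qed

section \<open>Subfields and generated fields inside the field formed by a type\<close>

lemma univ_field_simps:
  "carrier (univ_field :: 'a::field ring) = UNIV"
  "\<zero>\<^bsub>univ_field :: 'a::field ring\<^esub> = 0" "\<one>\<^bsub>univ_field :: 'a::field ring\<^esub> = 1"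
  "x \<oplus>\<^bsub>univ_field\<^esub> y = x + y" "x \<otimes>\<^bsub>univ_field\<^esub> y = x * y"
  for x y :: "'a::field"
  by (auto simp: ring_of_type_algebra_def)

lemma univ_field_uminus: "\<ominus>\<^bsub>univ_field\<^esub> x = - (x::'a::field)"
proof -
  interpret field "univ_field :: 'a ring" by rule
  show ?thesis
    by (rule sum_zero_eq_neg[symmetric]) (auto simp: univ_field_simps)
qed

lemma univ_field_inverse: "x \<noteq> 0 \<Longrightarrow> inv\<^bsub>univ_field\<^esub> x = inverse (x::'a::field)"
proof -
  assume "x \<noteq> 0"
  interpret field "univ_field :: 'a ring" by rule
  show ?thesis
    by (rule comm_inv_char) (auto simp: univ_field_simps \<open>x \<noteq> 0\<close>)
qed

lemma subfield_iff_subfield_set: "subfield K univ_field \<longleftrightarrow> subfield_set K" for K :: "'a::field set"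
proof -
  interpret field "univ_field :: 'a ring" by rule
  show ?thesis
  proof
    assume sf: "subfield K univ_field"
    note sr = subringE[OF subfieldE(1)[OF sf]]
    have inv: "inverse x \<in> K" if "x \<in> K" "x \<noteq> 0" for x
      using subfield_m_inv(1)[OF sf, of x] that univ_field_inverse[of x] by (auto simp: univ_field_simps)
    show "subfield_set K"
    proof (rule subfield_setI)
      show "x - y \<in> K" if "x \<in> K" "y \<in> K" for x y
        using sr(7)[OF that(1) sr(5)[OF that(2)]] by (simp add: univ_field_simps univ_field_uminus)
    qed (use sr inv in \<open>auto simp: univ_field_simps\<close>)
  next
    assume K: "subfield_set K"
    show "subfield K univ_field"
    proof (rule subfieldI')
      show "subring K univ_field"
        by (rule subringI) (use subfield_setD[OF K] in \<open>auto simp: univ_field_simps univ_field_uminus\<close>)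
      show "inv\<^bsub>univ_field\<^esub> k \<in> K" if "k \<in> K - {\<zero>\<^bsub>univ_field\<^esub>}" for k
        using that subfield_setD(8)[OF K, of k] by (auto simp: univ_field_simps univ_field_inverse)
    qed
  qed
qed

lemma subfield_set_fgen [simp, intro]: "subfield_set (fgen S)"
proof -
  interpret field "univ_field :: 'a ring" by rule
  show ?thesis
    using generate_field_is_subfield[of S] by (simp add: subfield_iff_subfield_set univ_field_simps)
qed

lemma fgen_minimal:
  assumes "subfield_set K" "S \<subseteq> K" shows "fgen S \<subseteq> K"
proof -
  interpret field "univ_field :: 'a ring" by rule
  show ?thesis
    using generate_field_min_subfield1[of S K] assms by (simp add: subfield_iff_subfield_set univ_field_simps)
qed

lemma fgen_incl: "S \<subseteq> fgen S"
  by (rule subsetI) (rule generate_field.incl)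

lemma fgen_mono: "S \<subseteq> T \<Longrightarrow> fgen S \<subseteq> fgen T"
  by (rule fgen_minimal[OF subfield_set_fgen]) (use fgen_incl[of T] in blast)

lemma fgen_subfield: "subfield_set K \<Longrightarrow> fgen K = K"
  using fgen_incl[of K] fgen_minimal[of K K] by blast

lemma fgen_fgen_union: "fgen (fgen S \<union> T) = fgen (S \<union> T)"
proof
  show "fgen (fgen S \<union> T) \<subseteq> fgen (S \<union> T)"
    by (intro fgen_minimal subfield_set_fgen Un_least fgen_mono) (use fgen_incl in blast)+
qed (intro fgen_mono; use fgen_incl in blast)

lemma field_extension_iff: "field_extension K N \<longleftrightarrow> subfield_set K \<and> subfield_set N \<and> K \<subseteq> N"
  by (simp add: field_extension_def subfield_iff_subfield_set)

section \<open>Homomorphisms on subrings and subfields\<close>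

lemma rhomD:
  assumes "rhom R h" "subring_set R"
  shows "h 1 = 1" "h 0 = 0" "x \<in> R \<Longrightarrow> y \<in> R \<Longrightarrow> h (x + y) = h x + h y"
    "x \<in> R \<Longrightarrow> y \<in> R \<Longrightarrow> h (x * y) = h x * h y" "x \<in> R \<Longrightarrow> h (- x) = - h x"
    "x \<in> R \<Longrightarrow> y \<in> R \<Longrightarrow> h (x - y) = h x - h y"
proof -
  note R = subring_setD[OF assms(2)]
  have "h (0 + 0) = h 0 + h 0" using assms R(1) unfolding rhom_def by blast
  then show z: "h 0 = 0" by simp
  have add: "x \<in> R \<Longrightarrow> y \<in> R \<Longrightarrow> h (x + y) = h x + h y" for x y using assms(1) unfolding rhom_def by blast
  have m: "h (- x) = - h x" if "x \<in> R" for x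
    using add[OF that R(3)[OF that]] z by (simp add: eq_neg_iff_add_eq_0 add.commute)
  show "x \<in> R \<Longrightarrow> h (- x) = - h x" by (rule m)
  show "x \<in> R \<Longrightarrow> y \<in> R \<Longrightarrow> h (x - y) = h x - h y"
    using add[of x "- y"] m[of y] R(3)[of y] by simp
qed (use assms in \<open>auto simp: rhom_def\<close>)

lemma rhom_sum:
  assumes "rhom R h" "subring_set R" "\<And>i. i \<in> I \<Longrightarrow> f i \<in> R"
  shows "h (sum f I) = (\<Sum>i\<in>I. h (f i))"
  using assms(3)
  by (induction I rule: infinite_finite_induct)
    (auto simp: rhomD[OF assms(1,2)] subring_set_sum[OF assms(2)])

lemma rhom_prod:
  assumes "rhom R h" "subring_set R" "\<And>i. i \<in> I \<Longrightarrow> f i \<in> R"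
  shows "h (prod f I) = (\<Prod>i\<in>I. h (f i))"
  using assms(3)
  by (induction I rule: infinite_finite_induct)
    (auto simp: rhomD[OF assms(1,2)] subring_set_prod[OF assms(2)])

lemma rhom_power: "rhom R h \<Longrightarrow> subring_set R \<Longrightarrow> x \<in> R \<Longrightarrow> h (x ^ n) = h x ^ n"
  by (induction n) (auto simp: rhomD subring_set_power)

lemma rhom_mono: "rhom R h \<Longrightarrow> S \<subseteq> R \<Longrightarrow> rhom S h"
  unfolding rhom_def by blast

lemma rhom_id: "rhom R (\<lambda>x. x)"
  by (simp add: rhom_def)

lemma rhom_cong: "rhom R h \<Longrightarrow> subring_set R \<Longrightarrow> (\<And>x. x \<in> R \<Longrightarrow> g x = h x) \<Longrightarrow> rhom R g"
  unfolding rhom_def subring_set_def by metis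

lemma rhom_comp: "rhom R h \<Longrightarrow> rhom S g \<Longrightarrow> h ` R \<subseteq> S \<Longrightarrow> rhom R (\<lambda>x. g (h x))"
  unfolding rhom_def by (auto simp: image_subset_iff)

lemma rhom_field_inverse:
  fixes h :: "'a::field \<Rightarrow> 'b::field"
  assumes "rhom K h" "subfield_set K" "x \<in> K"
  shows "h (inverse x) = inverse (h x)"
proof (cases "x = 0")
  case False
  have "h (x * inverse x) = h x * h (inverse x)"
    using assms by (intro rhomD) (auto simp: subfield_setD)
  with False have "h x * h (inverse x) = 1"
    using rhomD(1)[OF assms(1) subfield_setD(1)[OF assms(2)]] by simp
  then show ?thesis by (simp add: inverse_unique)
qed (use rhomD(2)[OF assms(1) subfield_setD(1)[OF assms(2)]] in simp)

lemma rhom_field_eq_0_iff: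
  fixes h :: "'a::field \<Rightarrow> 'b::field"
  assumes "rhom K h" "subfield_set K" "x \<in> K"
  shows "h x = 0 \<longleftrightarrow> x = 0"
proof
  assume "h x = 0"
  show "x = 0"
  proof (rule ccontr)
    assume "x \<noteq> 0"
    then have "h (x * inverse x) = 1"
      using rhomD(1)[OF assms(1) subfield_setD(1)[OF assms(2)]] by simp
    moreover have "h (x * inverse x) = h x * h (inverse x)"
      using assms by (intro rhomD) (auto simp: subfield_setD)
    ultimately show False using \<open>h x = 0\<close> by simp
  qed
qed (use rhomD(2)[OF assms(1) subfield_setD(1)[OF assms(2)]] in simp)

lemma rhom_field_inj_on:
  fixes h :: "'a::field \<Rightarrow> 'b::field"
  assumes "rhom K h" "subfield_set K"
  shows "inj_on h K"
proof (rule inj_onI)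
  fix x y assume "x \<in> K" "y \<in> K" "h x = h y"
  then have "h (x - y) = 0" using rhomD(6)[OF assms(1) subfield_setD(1)[OF assms(2)]] by simp
  then show "x = y"
    using rhom_field_eq_0_iff[OF assms, of "x - y"] subfield_setD(7)[OF assms(2)] \<open>x \<in> K\<close> \<open>y \<in> K\<close> by simp
qed

text \<open>The set where two field homomorphisms agree is a subfield, so agreement spreads from the
  generators.\<close>

lemma rhom_fgen_eqI:
  fixes h g :: "'a::field \<Rightarrow> 'b::field"
  assumes h: "rhom (fgen S) h" and g: "rhom (fgen S) g" and eq: "\<And>s. s \<in> S \<Longrightarrow> h s = g s"
    and x: "x \<in> fgen S"
  shows "h x = g x"
proof -
  let ?E = "{x \<in> fgen S. h x = g x}"
  note F = subfield_setD[OF subfield_set_fgen[of S]]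
  have "subfield_set ?E"
    by (rule subfield_setI)
      (auto simp: F rhomD[OF h F(1)] rhomD[OF g F(1)]
        rhom_field_inverse[OF h subfield_set_fgen] rhom_field_inverse[OF g subfield_set_fgen])
  moreover have "S \<subseteq> ?E" using eq fgen_incl by blast
  ultimately show ?thesis using fgen_minimal[of ?E S] x by blast
qed

text \<open>The preimage of a subfield is a subfield, so only the generators need checking.\<close>

lemma rhom_fgen_image_subset:
  fixes h :: "'a::field \<Rightarrow> 'b::field"
  assumes h: "rhom (fgen S) h" and N: "subfield_set N" and S: "h ` S \<subseteq> N"
  shows "h ` fgen S \<subseteq> N"
proof -
  let ?E = "{x \<in> fgen S. h x \<in> N}"
  note F = subfield_setD[OF subfield_set_fgen[of S]]
  have "subfield_set ?E"
    by (rule subfield_setI)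
      (auto simp: F rhomD[OF h F(1)] rhom_field_inverse[OF h subfield_set_fgen] subfield_setD[OF N])
  moreover have "S \<subseteq> ?E" using S fgen_incl by blast
  ultimately show ?thesis using fgen_minimal[of ?E S] by blast
qed

lemma subfield_set_image:
  fixes h :: "'a::field \<Rightarrow> 'b::field"
  assumes h: "rhom K h" and K: "subfield_set K"
  shows "subfield_set (h ` K)"
proof (rule subfield_setI)
  note K' = subfield_setD[OF K]
  note h' = rhomD[OF h K'(1)]
  show "1 \<in> h ` K" using h'(1) K'(3) by (metis image_eqI)
  show "x - y \<in> h ` K" if "x \<in> h ` K" "y \<in> h ` K" for x y
    using that h'(6) K'(7) by (metis (no_types, lifting) imageE image_eqI)
  show "x * y \<in> h ` K" if "x \<in> h ` K" "y \<in> h ` K" for x y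
    using that h'(4) K'(6) by (metis (no_types, lifting) imageE image_eqI)
  show "inverse x \<in> h ` K" if "x \<in> h ` K" for x
    using that rhom_field_inverse[OF h K] K'(8) by (metis (no_types, lifting) imageE image_eqI)
qed

lemma image_fgen:
  fixes h :: "'a::field \<Rightarrow> 'b::field"
  assumes h: "rhom (fgen S) h"
  shows "h ` fgen S = fgen (h ` S)"
proof
  show "h ` fgen S \<subseteq> fgen (h ` S)"
    by (rule rhom_fgen_image_subset[OF h]) (auto intro: fgen_incl[THEN subsetD])
  show "fgen (h ` S) \<subseteq> h ` fgen S"
    by (rule fgen_minimal[OF subfield_set_image[OF h subfield_set_fgen]]) (use fgen_incl in blast)
qed

section \<open>Polynomials over a subfield\<close>

lemma poly_over_0 [simp]: "subring_set R \<Longrightarrow> poly_over R 0"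
  by (simp add: poly_over_def subring_setD)

lemma poly_over_pCons: "poly_over R (pCons a p) \<longleftrightarrow> a \<in> R \<and> poly_over R p"
  unfolding poly_over_def by (metis coeff_pCons_0 coeff_pCons_Suc not0_implies_Suc)

lemma poly_over_add: "subring_set R \<Longrightarrow> poly_over R p \<Longrightarrow> poly_over R q \<Longrightarrow> poly_over R (p + q)"
  by (simp add: poly_over_def subring_setD)

lemma poly_over_diff: "subring_set R \<Longrightarrow> poly_over R p \<Longrightarrow> poly_over R q \<Longrightarrow> poly_over R (p - q)"
  by (simp add: poly_over_def subring_setD)

lemma poly_over_smult: "subring_set R \<Longrightarrow> c \<in> R \<Longrightarrow> poly_over R p \<Longrightarrow> poly_over R (smult c p)"
  by (simp add: poly_over_def subring_setD)

lemma poly_over_mult: "subring_set R \<Longrightarrow> poly_over R p \<Longrightarrow> poly_over R q \<Longrightarrow> poly_over R (p * q)"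
  unfolding poly_over_def coeff_mult by (intro allI subring_set_sum) (auto simp: subring_setD)

lemma poly_over_monom: "subring_set R \<Longrightarrow> c \<in> R \<Longrightarrow> poly_over R (Polynomial.monom c n)"
  by (auto simp: poly_over_def subring_setD)

lemma poly_over_prod:
  "subring_set R \<Longrightarrow> (\<And>i. i \<in> I \<Longrightarrow> poly_over R (f i)) \<Longrightarrow> poly_over R (prod f I)"
proof (induction I rule: infinite_finite_induct)
  case (insert i I)
  then show ?case by (auto simp: poly_over_mult)
qed (auto simp: poly_over_def subring_setD)

lemma poly_over_mono: "poly_over K p \<Longrightarrow> K \<subseteq> N \<Longrightarrow> poly_over N p"
  unfolding poly_over_def by blast

lemma poly_in_subring: "subring_set R \<Longrightarrow> poly_over R p \<Longrightarrow> x \<in> R \<Longrightarrow> poly p x \<in> R"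
  by (induction p) (auto simp: poly_over_pCons subring_setD)

lemma poly_over_pderiv: "subring_set R \<Longrightarrow> poly_over R p \<Longrightarrow> poly_over R (pderiv p)"
  by (induction p) (auto simp: poly_over_pCons pderiv_pCons poly_over_add subring_setD)

lemma map_poly_rhom:
  assumes h: "rhom R h" and R: "subring_set R" and p: "poly_over R p" and q: "poly_over R q"
  shows "map_poly h (p + q) = map_poly h p + map_poly h q"
    and "map_poly h (p * q) = map_poly h p * map_poly h q"
    and "map_poly h (p - q) = map_poly h p - map_poly h q"
proof -
  note h' = rhomD[OF h R]
  have c: "poly.coeff p i \<in> R" "poly.coeff q i \<in> R" for i using p q by (auto simp: poly_over_def)
  show "map_poly h (p + q) = map_poly h p + map_poly h q" "map_poly h (p - q) = map_poly h p - map_poly h q"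
    by (auto intro!: poly_eqI simp: coeff_map_poly h' c)
  show "map_poly h (p * q) = map_poly h p * map_poly h q"
    by (auto intro!: poly_eqI sum.cong
        simp: coeff_map_poly h' c coeff_mult rhom_sum[OF h R] subring_setD[OF R])
qed

lemma map_poly_rhom_pCons:
  assumes h: "rhom R h" and R: "subring_set R"
  shows "map_poly h (pCons a p) = pCons (h a) (map_poly h p)"
  using rhomD(2)[OF h R] by (auto intro!: poly_eqI simp: coeff_map_poly coeff_pCons split: nat.splits)

lemma rhom_poly:
  assumes h: "rhom R h" and R: "subring_set R" and p: "poly_over R p" and x: "x \<in> R"
  shows "h (poly p x) = poly (map_poly h p) (h x)"
  using p
proof (induction p)
  case 0
  then show ?case using rhomD(2)[OF h R] by simp
next
  case (pCons a p)
  then have a: "a \<in> R" and p: "poly_over R p" by (auto simp: poly_over_pCons)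
  have "poly p x \<in> R" by (rule poly_in_subring[OF R p x])
  then show ?case
    using pCons.IH[OF p] a x by (simp add: map_poly_rhom_pCons[OF h R] rhomD[OF h R] subring_setD[OF R])
qed

lemma map_poly_pderiv_rhom:
  assumes h: "rhom R h" and R: "subring_set R" and p: "poly_over R p"
  shows "map_poly h (pderiv p) = pderiv (map_poly h p)"
  using p
proof (induction p)
  case (pCons a p)
  then have p: "a \<in> R" "poly_over R p" by (auto simp: poly_over_pCons)
  then have "poly_over R (pderiv p)" by (intro poly_over_pderiv[OF R])
  then have "poly_over R (pCons 0 (pderiv p))" by (simp add: poly_over_pCons subring_setD[OF R])
  then show ?case
    using pCons.IH p by (simp add: pderiv_pCons map_poly_rhom(1)[OF h R] map_poly_rhom_pCons[OF h R] rhomD[OF h R])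
qed simp

text \<open>Long division by a monic polynomial never inverts a coefficient, so it stays over a
  subring. Each round subtracts the multiple of \<open>p\<close> that cancels the leading term of
  \<open>q\<close>.\<close>

lemma monic_division_over:
  fixes p :: "'a::field poly"
  assumes R: "subring_set R" and p: "poly_over R p" "lead_coeff p = 1" and q: "poly_over R q"
  shows "\<exists>g r. poly_over R g \<and> poly_over R r \<and> q = p * g + r \<and> (r = 0 \<or> deg r < deg p)"
  using q
proof (induction "deg q" arbitrary: q rule: less_induct)
  case less
  show ?case
  proof (cases "q = 0 \<or> deg q < deg p")
    case True
    then show ?thesis using less.prems R by (intro exI[of _ 0] exI[of _ q]) auto
  next
    case False
    then have q0: "q \<noteq> 0" and d: "deg p \<le> deg q" by auto
    have p0: "p \<noteq> 0" using p by auto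
    define m where "m = Polynomial.monom (lead_coeff q) (deg q - deg p)"
    define q' where "q' = q - p * m"
    have m: "poly_over R m"
      unfolding m_def using less.prems by (intro poly_over_monom R) (auto simp: poly_over_def)
    have q': "poly_over R q'" unfolding q'_def by (intro poly_over_diff poly_over_mult R p m less.prems)
    have "m \<noteq> 0" unfolding m_def using q0 by simp
    have dm: "deg (p * m) = deg q"
      using d p0 \<open>m \<noteq> 0\<close> q0 by (simp add: degree_mult_eq m_def degree_monom_eq)
    have "poly.coeff (p * m) (deg q) = lead_coeff p * lead_coeff m"
      using dm lead_coeff_mult[of p m] by simp
    also have "\<dots> = lead_coeff q" using p(2) q0 by (simp add: m_def degree_monom_eq)
    finally have c: "poly.coeff q' (deg q) = 0" unfolding q'_def by simp
    have "deg q' \<le> deg q" unfolding q'_def using dm by (intro degree_diff_le) auto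
    then have "q' = 0 \<or> deg q' < deg q"
      using c by (metis le_neq_implies_less leading_coeff_0_iff)
    then have "\<exists>g r. poly_over R g \<and> poly_over R r \<and> q' = p * g + r \<and> (r = 0 \<or> deg r < deg p)"
    proof
      assume "q' = 0"
      then show ?thesis using R by (intro exI[of _ 0]) auto
    qed (use less.hyps q' in blast)
    then obtain g r where gr: "poly_over R g" "poly_over R r" "q' = p * g + r" "r = 0 \<or> deg r < deg p"
      by blast
    have "q = p * (g + m) + r" using gr(3) unfolding q'_def by (simp add: algebra_simps)
    then show ?thesis using gr m R by (intro exI[of _ "g + m"] exI[of _ r]) (auto simp: poly_over_add)
  qed
qed

lemma is_min_poly_dvd:
  fixes x :: "'a::field"
  assumes K: "subfield_set K" and m: "is_min_poly K x m" and q: "poly_over K q" "poly q x = 0"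
  shows "\<exists>g. poly_over K g \<and> q = m * g"
proof -
  have mK: "poly_over K m" "lead_coeff m = 1" "poly m x = 0"
    and min: "\<And>q. q \<noteq> 0 \<Longrightarrow> poly_over K q \<Longrightarrow> poly q x = 0 \<Longrightarrow> deg m \<le> deg q"
    using m by (auto simp: is_min_poly_def)
  obtain g r where gr: "poly_over K g" "poly_over K r" "q = m * g + r" "r = 0 \<or> deg r < deg m"
    using monic_division_over[OF subfield_setD(1)[OF K] mK(1,2) q(1)] by blast
  have "poly r x = 0" using gr(3) q(2) mK(3) by simp
  then have "r = 0" using min[of r] gr(2,4) by (cases "r = 0") auto
  then show ?thesis using gr by auto
qed

lemma algebraic_over_imp_min_poly:
  fixes x :: "'a::field"
  assumes K: "subfield_set K" and x: "algebraic_over K x"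
  shows "\<exists>m. is_min_poly K x m"
proof -
  let ?P = "\<lambda>p. p \<noteq> 0 \<and> poly_over K p \<and> poly p x = 0"
  define p where "p = arg_min deg ?P"
  obtain p0 where "?P p0" using x by (auto simp: algebraic_over_def)
  then have p: "?P p" and min: "\<And>q. ?P q \<Longrightarrow> deg p \<le> deg q"
    unfolding p_def using arg_min_nat_lemma[of ?P p0 deg] by auto
  define m where "m = smult (inverse (lead_coeff p)) p"
  have "is_min_poly K x m"
    unfolding is_min_poly_def m_def
    using p min by (auto intro!: poly_over_smult subfield_setD[OF K] simp: poly_over_def)
  then show ?thesis ..
qed

lemma is_min_poly_unique:
  fixes x :: "'a::field"
  assumes K: "subfield_set K" and m: "is_min_poly K x m" "is_min_poly K x m'"
  shows "m = m'"
proof (rule ccontr)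
  assume "m \<noteq> m'"
  have d: "deg m = deg m'" using m unfolding is_min_poly_def by (metis le_antisym leading_coeff_0_iff zero_neq_one)
  let ?d = "m - m'"
  have "deg ?d \<le> deg m" using d by (intro degree_diff_le) auto
  moreover have "poly.coeff ?d (deg m) = 0" using m d by (simp add: is_min_poly_def)
  ultimately have "deg ?d < deg m" using \<open>m \<noteq> m'\<close>
    by (metis le_neq_implies_less leading_coeff_0_iff right_minus_eq)
  moreover have "deg m \<le> deg ?d"
    using m \<open>m \<noteq> m'\<close> poly_over_diff[OF subfield_setD(1)[OF K]] unfolding is_min_poly_def by simp
  ultimately show False by simp
qed

lemma algebraic_over_mono: "algebraic_over K x \<Longrightarrow> K \<subseteq> N \<Longrightarrow> algebraic_over N x"
  unfolding algebraic_over_def using poly_over_mono by blast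

lemma algebraic_over_in: "subring_set K \<Longrightarrow> x \<in> K \<Longrightarrow> algebraic_over K x"
  unfolding algebraic_over_def
  by (rule exI[of _ "[:- x, 1:]"]) (auto simp: poly_over_pCons subring_setD)

section \<open>Separable elements and extension of homomorphisms\<close>

abbreviation lin_prod :: "'a::field set \<Rightarrow> 'a poly"
  where "lin_prod S \<equiv> (\<Prod>x\<in>S. [:- x, 1:])"

lemma deg_lin_prod: "finite S \<Longrightarrow> deg (lin_prod S) = card S"
  by (subst degree_prod_eq_sum_degree) auto

lemma lead_coeff_lin_prod: "lead_coeff (lin_prod S) = 1"
  by (induction S rule: infinite_finite_induct) (auto simp del: mult_pCons_left simp: lead_coeff_mult)

lemma poly_lin_prod_eq_0_iff: "finite S \<Longrightarrow> poly (lin_prod S) a = 0 \<longleftrightarrow> a \<in> S"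
  by (auto simp: poly_prod)

lemma rsquarefree_dvd:
  fixes p q :: "'a::field poly"
  assumes "rsquarefree p" "q dvd p" shows "rsquarefree q"
proof -
  have "p \<noteq> 0" "q \<noteq> 0" using assms by (auto simp: rsquarefree_def)
  have "Polynomial.order a q \<le> Polynomial.order a p" for a
    using dvd_imp_order_le[OF \<open>p \<noteq> 0\<close> assms(2)] .
  then show ?thesis using assms(1) \<open>q \<noteq> 0\<close> unfolding rsquarefree_def by (metis le_zero_eq le_antisym less_one linorder_not_le)
qed

lemma order_linear_self: "Polynomial.order a [:- a, 1:] = (1::nat)" for a :: "'a::field"
  using order_power_n_n[of a 1] by simp

lemma order_lin_prod: "finite S \<Longrightarrow> Polynomial.order a (lin_prod S) = (if a \<in> S then 1 else 0)"
proof (induction S rule: finite_induct)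
  case (insert x S)
  have nz: "lin_prod (insert x S) \<noteq> 0" using lead_coeff_lin_prod[of "insert x S"] by (metis leading_coeff_0_iff zero_neq_one)
  have e: "lin_prod (insert x S) = [:- x, 1:] * lin_prod S" using insert by simp
  have "Polynomial.order a (lin_prod (insert x S)) = Polynomial.order a [:- x, 1:] + Polynomial.order a (lin_prod S)"
    using nz unfolding e by (rule order_mult)
  moreover have "Polynomial.order a [:- x, 1:] = (if a = x then 1 else 0)"
    by (auto simp: order_linear_self intro!: order_0I)
  ultimately show ?case using insert by auto
qed auto

lemma rsquarefree_lin_prod: "finite S \<Longrightarrow> rsquarefree (lin_prod S)"
  by (auto simp: rsquarefree_def order_lin_prod)

text \<open>Roots are peeled off one at a time: a nonconstant polynomial has a root in the type, and
  squarefreeness keeps this root from reappearing in the cofactor.\<close>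

lemma rsquarefree_eq_lin_prod:
  fixes p :: "'a::alg_closed_field poly"
  assumes "rsquarefree p"
  shows "p = smult (lead_coeff p) (lin_prod {x. poly p x = 0})"
  using assms
proof (induction "deg p" arbitrary: p rule: less_induct)
  case less
  then have p0: "p \<noteq> 0" by (auto simp: rsquarefree_def)
  show ?case
  proof (cases "deg p = 0")
    case True
    then obtain c where "p = [:c:]" by (auto elim: degree_eq_zeroE)
    then show ?thesis using p0 by auto
  next
    case False
    then obtain a where a: "poly p a = 0" using alg_closed_imp_poly_has_root[of p] by auto
    then obtain q where q: "p = [:- a, 1:] * q" using poly_eq_0_iff_dvd[of p a] by (auto elim: dvdE)
    have q0: "q \<noteq> 0" using q p0 by auto
    have d: "deg q < deg p" using q0 unfolding q by (subst degree_mult_eq) auto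
    have sq: "rsquarefree q" by (rule rsquarefree_dvd[OF less.prems]) (simp only: q dvd_triv_right)
    have "Polynomial.order a p = Suc (Polynomial.order a q)"
      using p0 order_mult[of "[:- a, 1:]" q a] order_linear_self[of a] unfolding q[symmetric] by simp
    then have "Polynomial.order a q = 0" using less.prems unfolding rsquarefree_def by (metis Suc_inject nat.distinct(1) One_nat_def)
    then have qa: "poly q a \<noteq> 0" using q0 order_root[of q a] by auto
    have roots: "{x. poly p x = 0} = insert a {x. poly q x = 0}" unfolding q by auto
    have fin: "finite {x. poly q x = 0}" using q0 by (rule poly_roots_finite)
    have lc: "lead_coeff p = lead_coeff q" unfolding q by (simp only: lead_coeff_mult) simp
    have "lin_prod {x. poly p x = 0} = [:- a, 1:] * lin_prod {x. poly q x = 0}"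
      unfolding roots using fin qa by (subst prod.insert) auto
    then have "smult (lead_coeff p) (lin_prod {x. poly p x = 0})
        = [:- a, 1:] * smult (lead_coeff q) (lin_prod {x. poly q x = 0})"
      unfolding lc by (simp only: mult_smult_right)
    also have "\<dots> = [:- a, 1:] * q" using less.hyps[OF d sq] by simp
    finally show ?thesis unfolding q by simp
  qed
qed

lemma rsquarefree_card_roots:
  fixes p :: "'a::alg_closed_field poly"
  assumes "rsquarefree p"
  shows "card {x. poly p x = 0} = deg p"
proof -
  have p0: "p \<noteq> 0" using assms by (auto simp: rsquarefree_def)
  have "deg p = deg (lin_prod {x. poly p x = 0})"
    using p0 by (subst rsquarefree_eq_lin_prod[OF assms]) simp
  then show ?thesis using deg_lin_prod poly_roots_finite[OF p0] by metis
qed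

lemma separable_over_imp_algebraic: "separable_over K x \<Longrightarrow> algebraic_over K x"
  unfolding separable_over_def is_min_poly_def algebraic_over_def rsquarefree_def by blast

text \<open>The minimal polynomial divides \<open>f\<close>, and divisors of squarefree polynomials
  are squarefree. Separability can thus be witnessed without knowing the minimal polynomial.\<close>

lemma separable_overI:
  assumes K: "subfield_set K" and f: "poly_over K f" "rsquarefree f" "poly f x = 0"
  shows "separable_over K x"
proof -
  have "algebraic_over K x" using f unfolding algebraic_over_def rsquarefree_def by blast
  then obtain m where m: "is_min_poly K x m" using algebraic_over_imp_min_poly[OF K] by blast
  then show ?thesis
    using is_min_poly_dvd[OF K m f(1,3)] rsquarefree_dvd[OF f(2), of m] unfolding separable_over_def by auto
qed

lemma separable_over_mono:
  assumes "separable_over K x" "K \<subseteq> N" "subfield_set N"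
  shows "separable_over N x"
proof -
  obtain p where "is_min_poly K x p" "rsquarefree p" using assms unfolding separable_over_def by blast
  then show ?thesis
    using separable_overI[OF assms(3), of p x] poly_over_mono[OF _ assms(2)] by (auto simp: is_min_poly_def)
qed

lemma separable_over_in: "subfield_set K \<Longrightarrow> x \<in> K \<Longrightarrow> separable_over K x"
  by (rule separable_overI[of _ "[:- x, 1:]"])
    (use rsquarefree_lin_prod[of "{x}"] in \<open>auto simp: poly_over_pCons subfield_setD subring_setD\<close>)

text \<open>Inverses come from a Euclidean descent: dividing the minimal polynomial \<open>m\<close>
  by the monic multiple of \<open>p\<close> leaves a remainder of smaller degree whose value at
  \<open>w\<close> is a multiple of \<open>p(w)\<close>, so an inverse of that value yields an
  inverse of \<open>p(w)\<close>.\<close>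

lemma subfield_set_poly_image:
  fixes w :: "'a::field"
  assumes A: "subfield_set A" and w: "algebraic_over A w"
  shows "subfield_set {poly p w | p. poly_over A p}"
proof -
  note A' = subfield_setD[OF A]
  obtain m where m: "is_min_poly A w m" using algebraic_over_imp_min_poly[OF A w] by blast
  have mA: "poly_over A m" "lead_coeff m = 1" "poly m w = 0"
    and min: "\<And>q. q \<noteq> 0 \<Longrightarrow> poly_over A q \<Longrightarrow> poly q w = 0 \<Longrightarrow> deg m \<le> deg q"
    using m by (auto simp: is_min_poly_def)
  have inv: "\<exists>s. poly_over A s \<and> poly p w * poly s w = 1"
    if "poly_over A p" "p \<noteq> 0" "deg p < deg m" for p
    using that
  proof (induction "deg p" arbitrary: p rule: less_induct)
    case less
    have "lead_coeff p \<in> A" "lead_coeff p \<noteq> 0" using less.prems by (auto simp: poly_over_def)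
    show ?case
    proof (cases "deg p = 0")
      case True
      then obtain c where c: "p = [:c:]" by (auto elim: degree_eq_zeroE)
      then have "c \<in> A" "c \<noteq> 0" using less.prems by (auto simp: poly_over_pCons)
      then show ?thesis using c A' by (intro exI[of _ "[:inverse c:]"]) (auto simp: poly_over_pCons)
    next
      case False
      define c where "c = inverse (lead_coeff p)"
      have c: "c \<in> A" "c \<noteq> 0" unfolding c_def using A' \<open>lead_coeff p \<in> A\<close> \<open>lead_coeff p \<noteq> 0\<close> by auto
      define p' where "p' = smult c p"
      have p': "poly_over A p'" "lead_coeff p' = 1" "deg p' = deg p"
        unfolding p'_def using c less.prems A' by (auto simp: c_def intro!: poly_over_smult)
      obtain g r where gr: "poly_over A g" "poly_over A r" "m = p' * g + r" "r = 0 \<or> deg r < deg p'"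
        using monic_division_over[OF A'(1) p'(1,2) mA(1)] by blast
      \<comment> \<open>Otherwise \<open>m\<close> would be a product of two factors of smaller
        degree, one of which vanishes at \<open>w\<close>, against minimality.\<close>
      have "r \<noteq> 0"
      proof
        assume "r = 0"
        then have mg: "m = p' * g" using gr by simp
        have "m \<noteq> 0" using mA by auto
        then have g0: "g \<noteq> 0" and "p' \<noteq> 0" using mg by auto
        then have dm: "deg m = deg p' + deg g" unfolding mg by (simp add: degree_mult_eq)
        have "poly p' w = 0 \<or> poly g w = 0" using mA(3) mg by auto
        then show False
        proof
          assume "poly p' w = 0"
          then show False using min[of p'] p' \<open>p' \<noteq> 0\<close> less.prems by simp
        next
          assume "poly g w = 0"
          then have "deg m \<le> deg g" using min[of g] gr g0 by simp
          then show False using dm False p'(3) by simp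
        qed
      qed
      then have dr: "deg r < deg p" using gr(4) p'(3) by simp
      obtain s where s: "poly_over A s" "poly r w * poly s w = 1"
        using less.hyps[OF dr gr(2) \<open>r \<noteq> 0\<close>] dr less.prems by auto
      have "poly r w = - (c * poly p w * poly g w)"
        using arg_cong[OF gr(3), of "\<lambda>p. poly p w"] mA(3) unfolding p'_def
        by (simp add: eq_neg_iff_add_eq_0 add.commute mult.assoc)
      then have "poly p w * poly (smult (- c) (g * s)) w = 1" using s(2) by (simp add: algebra_simps)
      moreover have "poly_over A (smult (- c) (g * s))" using A' c gr s by (intro poly_over_smult poly_over_mult) auto
      ultimately show ?thesis by blast
    qed
  qed
  show ?thesis
  proof (rule subfield_setI)
    show "1 \<in> {poly p w | p. poly_over A p}"
      using A' by (auto intro!: exI[of _ "[:1:]"] simp: poly_over_pCons)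
    fix x assume "x \<in> {poly p w | p. poly_over A p}" "x \<noteq> 0"
    then obtain p where p: "poly_over A p" "x = poly p w" by blast
    obtain g r where gr: "poly_over A g" "poly_over A r" "p = m * g + r" "r = 0 \<or> deg r < deg m"
      using monic_division_over[OF A'(1) mA(1,2) p(1)] by blast
    have x: "x = poly r w" using p gr(3) mA(3) by simp
    then have "r \<noteq> 0" using \<open>x \<noteq> 0\<close> by auto
    then obtain s where s: "poly_over A s" "poly r w * poly s w = 1" using inv[of r] gr by auto
    then have "inverse x = poly s w" using x by (simp add: inverse_unique)
    then show "inverse x \<in> {poly p w | p. poly_over A p}" using s by blast
  next
    fix x y assume "x \<in> {poly p w | p. poly_over A p}" "y \<in> {poly p w | p. poly_over A p}"
    then obtain p q where pq: "poly_over A p" "x = poly p w" "poly_over A q" "y = poly q w" by blast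
    show "x - y \<in> {poly p w | p. poly_over A p}"
      using pq poly_over_diff[OF A'(1)] by (auto intro!: exI[of _ "p - q"])
    show "x * y \<in> {poly p w | p. poly_over A p}"
      using pq poly_over_mult[OF A'(1)] by (auto intro!: exI[of _ "p * q"])
  qed
qed

lemma fgen_simple:
  fixes w :: "'a::field"
  assumes A: "subfield_set A" and w: "algebraic_over A w"
  shows "fgen (A \<union> {w}) = {poly p w | p. poly_over A p}"
proof
  show "fgen (A \<union> {w}) \<subseteq> {poly p w | p. poly_over A p}"
  proof (rule fgen_minimal[OF subfield_set_poly_image[OF A w]], rule subsetI)
    fix x assume "x \<in> A \<union> {w}"
    then show "x \<in> {poly p w | p. poly_over A p}"
    proof
      assume "x \<in> A" then show ?thesis
        using subfield_setD[OF A] by (auto intro!: exI[of _ "[:x:]"] simp: poly_over_pCons)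
    next
      assume "x \<in> {w}" then show ?thesis
        using subfield_setD[OF A] by (auto intro!: exI[of _ "[:0, 1:]"] simp: poly_over_pCons)
    qed
  qed
  show "{poly p w | p. poly_over A p} \<subseteq> fgen (A \<union> {w})"
    using fgen_incl[of "A \<union> {w}"]
    by (auto intro!: poly_in_subring subfield_setD(1) poly_over_mono[of A])
qed

lemma rhom_extend_simple:
  fixes h :: "'a::field \<Rightarrow> 'b::field"
  assumes A: "subfield_set A" and m: "is_min_poly A w m"
    and h: "rhom A h" and b: "poly (map_poly h m) b = 0"
  shows "\<exists>h'. rhom (fgen (A \<union> {w})) h' \<and> (\<forall>p. poly_over A p \<longrightarrow> h' (poly p w) = poly (map_poly h p) b)"
proof -
  note A' = subfield_setD[OF A]
  have w: "algebraic_over A w" using m unfolding is_min_poly_def algebraic_over_def by (auto intro!: exI[of _ m])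
  have mA: "poly_over A m" using m by (simp add: is_min_poly_def)
  define h' where "h' y = poly (map_poly h (SOME p. poly_over A p \<and> poly p w = y)) b" for y
  have key: "h' (poly p w) = poly (map_poly h p) b" if p: "poly_over A p" for p
  proof -
    define q where "q = (SOME q. poly_over A q \<and> poly q w = poly p w)"
    have q: "poly_over A q" "poly q w = poly p w"
      unfolding q_def using someI_ex[of "\<lambda>q. poly_over A q \<and> poly q w = poly p w"] p by blast+
    have "poly_over A (q - p)" "poly (q - p) w = 0" using q p A' by (auto simp: poly_over_diff)
    then obtain g where g: "poly_over A g" "q - p = m * g" using is_min_poly_dvd[OF A m] by blast
    have "map_poly h q - map_poly h p = map_poly h m * map_poly h g"
      using map_poly_rhom[OF h A'(1)] q p mA g by metis
    then have "poly (map_poly h q) b - poly (map_poly h p) b = 0"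
      using b by (metis mult_zero_left poly_diff poly_mult)
    then show ?thesis unfolding h'_def q_def by simp
  qed
  have "rhom (fgen (A \<union> {w})) h'"
    unfolding rhom_def fgen_simple[OF A w]
  proof (intro conjI ballI)
    show "h' 1 = 1"
      using key[of "[:1:]"] A' rhomD(1,2)[OF h A'(1)]
      by (simp add: poly_over_pCons map_poly_rhom_pCons[OF h])
  next
    fix x y assume "x \<in> {poly p w | p. poly_over A p}" "y \<in> {poly p w | p. poly_over A p}"
    then obtain p q where pq: "poly_over A p" "x = poly p w" "poly_over A q" "y = poly q w" by blast
    show "h' (x + y) = h' x + h' y"
      using key[of "p + q"] key[of p] key[of q] pq poly_over_add[OF A'(1)] map_poly_rhom(1)[OF h A'(1)] by auto
    show "h' (x * y) = h' x * h' y"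
      using key[of "p * q"] key[of p] key[of q] pq poly_over_mult[OF A'(1)] map_poly_rhom(2)[OF h A'(1)] by auto
  qed
  then show ?thesis using key by blast
qed

lemma map_poly_const_rhom:
  "rhom A h \<Longrightarrow> subring_set A \<Longrightarrow> map_poly h [:a:] = [:h a:]"
  by (simp add: map_poly_rhom_pCons)

lemma deg_map_poly_monic:
  fixes h :: "'a::field \<Rightarrow> 'b::field"
  assumes "rhom A h" "subring_set A" "lead_coeff p = 1"
  shows "deg (map_poly h p) = deg p" "lead_coeff (map_poly h p) = 1"
proof -
  note h = rhomD(1,2)[OF assms(1,2)]
  show d: "deg (map_poly h p) = deg p"
    using assms(3) h by (intro map_poly_degree_eq) auto
  show "lead_coeff (map_poly h p) = 1" using d assms(3) h by (simp add: coeff_map_poly)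
qed

lemma is_min_poly_deg_pos:
  assumes "is_min_poly A w m" shows "deg m > 0"
proof (rule ccontr)
  assume "\<not> deg m > 0"
  then obtain c where "m = [:c:]" by (auto elim: degree_eq_zeroE)
  then show False using assms by (auto simp: is_min_poly_def)
qed

text \<open>Zorn's lemma is applied to graphs, which turn extension of maps into inclusion of sets.
  A maximal graph has every \<open>s\<close> in its domain: the transported minimal polynomial has
  positive degree, hence a root in the algebraically closed target, and
  \<open>rhom_extend_simple\<close> would otherwise enlarge the graph.\<close>

lemma rhom_extend:
  fixes h :: "'a::field \<Rightarrow> 'b::alg_closed_field"
  assumes A: "subfield_set A" and h: "rhom A h" and S: "\<And>s. s \<in> S \<Longrightarrow> algebraic_over A s"
  shows "\<exists>h'. rhom (fgen (A \<union> S)) h' \<and> (\<forall>x\<in>A. h' x = h x)"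
proof -
  define P where "P B g \<longleftrightarrow> subfield_set B \<and> A \<subseteq> B \<and> rhom B g \<and> (\<forall>x\<in>A. g x = h x)" for B g
  define gr where "gr B g = {(x, g x) | x. x \<in> B}" for B :: "'a set" and g :: "'a \<Rightarrow> 'b"
  define \<G> where "\<G> = {G. \<exists>B g. P B g \<and> G = gr B g}"
  have "\<exists>M\<in>\<G>. (\<forall>Q\<in>\<G>. M \<subseteq> Q \<longrightarrow> Q = M)"
  proof (rule subset_Zorn_nonempty)
    have "gr A h \<in> \<G>" using A h unfolding \<G>_def P_def by blast
    then show "\<G> \<noteq> {}" by blast
  next
    fix \<C> assume ne: "\<C> \<noteq> {}" and ch: "subset.chain \<G> \<C>"
    \<comment> \<open>Any two points of the union lie in a common member of the chain. Functionality
      and the ring laws involve at most two arguments, so they are inherited.\<close>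
    define U where "U = \<Union>\<C>"
    have two: "\<exists>G\<in>\<C>. p \<in> G \<and> q \<in> G" if "p \<in> U" "q \<in> U" for p q
    proof -
      obtain G1 G2 where "G1 \<in> \<C>" "p \<in> G1" "G2 \<in> \<C>" "q \<in> G2" using \<open>p \<in> U\<close> \<open>q \<in> U\<close> unfolding U_def by blast
      then show ?thesis using ch unfolding subset_chain_def by blast
    qed
    have inG: "\<exists>B g. P B g \<and> G = gr B g" if "G \<in> \<C>" for G
      using ch that unfolding subset_chain_def \<G>_def by blast
    define B where "B = Domain U"
    define g where "g x = (SOME y. (x, y) \<in> U)" for x
    have fn: "y = y'" if xy: "(x, y) \<in> U" "(x, y') \<in> U" for x y y'
    proof -
      obtain G where "G \<in> \<C>" "(x, y) \<in> G" "(x, y') \<in> G" using two[OF xy] by blast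
      then show ?thesis using inG[of G] unfolding gr_def by auto
    qed
    have g: "g x = y" if "(x, y) \<in> U" for x y
      unfolding g_def by (rule some_equality) (use that fn in auto)
    have loc: "\<exists>B' g'. P B' g' \<and> x \<in> B' \<and> y \<in> B' \<and> B' \<subseteq> B \<and> (\<forall>z\<in>B'. g z = g' z)"
      if "x \<in> B" "y \<in> B" for x y
    proof -
      have "(x, g x) \<in> U" "(y, g y) \<in> U" using that g unfolding B_def by auto
      then obtain G where G: "G \<in> \<C>" "(x, g x) \<in> G" "(y, g y) \<in> G" using two by blast
      then obtain B' g' where B': "P B' g'" "G = gr B' g'" using inG by blast
      have "(z, g' z) \<in> U" if "z \<in> B'" for z using G B' that unfolding U_def gr_def by blast
      then show ?thesis using B' G g unfolding B_def gr_def by (intro exI[of _ B'] exI[of _ g']) auto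
    qed
    have A_B: "A \<subseteq> B \<and> (\<forall>x\<in>A. g x = h x)"
    proof -
      obtain G where "G \<in> \<C>" using ne by blast
      then obtain B' g' where B': "P B' g'" "G = gr B' g'" using inG by blast
      have "(x, h x) \<in> U" if "x \<in> A" for x
      proof -
        have "x \<in> B'" "g' x = h x" using B'(1) that unfolding P_def by auto
        then have "(x, h x) \<in> G" unfolding B'(2) gr_def by force
        then show ?thesis using \<open>G \<in> \<C>\<close> unfolding U_def by blast
      qed
      then show ?thesis using g unfolding B_def by blast
    qed
    have "subfield_set B"
    proof (rule subfield_setI)
      show "1 \<in> B" using A_B subfield_setD[OF A] by auto
      show "x - y \<in> B" "x * y \<in> B" if "x \<in> B" "y \<in> B" for x y
      proof -
        obtain B' g' where B': "P B' g'" "x \<in> B'" "y \<in> B'" "B' \<subseteq> B" using loc \<open>x \<in> B\<close> \<open>y \<in> B\<close> by meson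
        then have "subfield_set B'" unfolding P_def by simp
        from subfield_setD(6,7)[OF this B'(2,3)] show "x - y \<in> B" "x * y \<in> B" using B'(4) by auto
      qed
      show "inverse x \<in> B" if "x \<in> B" for x
      proof -
        obtain B' g' where B': "P B' g'" "x \<in> B'" "B' \<subseteq> B" using loc \<open>x \<in> B\<close> by meson
        then have "subfield_set B'" unfolding P_def by simp
        from subfield_setD(8)[OF this B'(2)] show "inverse x \<in> B" using B'(3) by auto
      qed
    qed
    moreover have "rhom B g"
      unfolding rhom_def
    proof (intro conjI ballI)
      show "g 1 = 1" using A_B rhomD(1)[OF h subfield_setD(1)[OF A]] subfield_setD(3)[OF A] by auto
      fix x y assume "x \<in> B" "y \<in> B"
      then obtain B' g' where B': "P B' g'" "x \<in> B'" "y \<in> B'" "\<forall>z\<in>B'. g z = g' z" using loc by meson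
      then have "subfield_set B'" "rhom B' g'" unfolding P_def by auto
      then show "g (x + y) = g x + g y" "g (x * y) = g x * g y"
        using B' by (simp_all add: rhomD subfield_setD)
    qed
    ultimately have "P B g" using A_B unfolding P_def by blast
    moreover have "U = gr B g" using g unfolding gr_def B_def by auto
    ultimately show "\<Union>\<C> \<in> \<G>" unfolding \<G>_def U_def by blast
  qed
  then obtain M where M: "M \<in> \<G>" and max: "\<And>Q. Q \<in> \<G> \<Longrightarrow> M \<subseteq> Q \<Longrightarrow> Q = M" by blast
  then obtain B g where B: "P B g" "M = gr B g" unfolding \<G>_def by blast
  have Bf: "subfield_set B" and "A \<subseteq> B" and g: "rhom B g" and gA: "\<forall>x\<in>A. g x = h x"
    using B(1) unfolding P_def by auto
  have "S \<subseteq> B"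
  proof
    fix s assume "s \<in> S"
    then have "algebraic_over B s" using S algebraic_over_mono \<open>A \<subseteq> B\<close> by blast
    then obtain m where m: "is_min_poly B s m" using algebraic_over_imp_min_poly[OF Bf] by blast
    have "deg (map_poly g m) > 0"
      using is_min_poly_deg_pos[OF m] deg_map_poly_monic(1)[OF g subfield_setD(1)[OF Bf]] m by (simp add: is_min_poly_def)
    then obtain b where "poly (map_poly g m) b = 0" using alg_closed_imp_poly_has_root by blast
    then obtain h' where h': "rhom (fgen (B \<union> {s})) h'"
      "\<And>p. poly_over B p \<Longrightarrow> h' (poly p s) = poly (map_poly g p) b"
      using rhom_extend_simple[OF Bf m g] by blast
    have h'B: "h' x = g x" if "x \<in> B" for x
      using h'(2)[of "[:x:]"] that subfield_setD[OF Bf] by (simp add: poly_over_pCons map_poly_const_rhom[OF g])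
    have "P (fgen (B \<union> {s})) h'"
      using h'(1) h'B gA \<open>A \<subseteq> B\<close> fgen_incl[of "B \<union> {s}"] unfolding P_def by auto
    then have "gr (fgen (B \<union> {s})) h' \<in> \<G>" unfolding \<G>_def by blast
    moreover have "M \<subseteq> gr (fgen (B \<union> {s})) h'"
      using B(2) h'B fgen_incl[of "B \<union> {s}"] unfolding gr_def by auto
    ultimately have "gr (fgen (B \<union> {s})) h' = gr B g" using max B(2) by blast
    moreover have "s \<in> fgen (B \<union> {s})" using fgen_incl by blast
    ultimately show "s \<in> B" unfolding gr_def by auto
  qed
  \<comment> \<open>The domain of a maximal extension may exceed the generated field, hence the
    final restriction.\<close>
  then have "fgen (A \<union> S) \<subseteq> B" using \<open>A \<subseteq> B\<close> by (intro fgen_minimal Bf) auto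
  then show ?thesis using rhom_mono[OF g] gA by blast
qed

lemma fgen_finite_support:
  assumes "x \<in> fgen T" shows "\<exists>Z. finite Z \<and> Z \<subseteq> T \<and> x \<in> fgen Z"
  using assms
proof (induction rule: generate_field.induct)
  case one
  show ?case using subfield_setD(3)[OF subfield_set_fgen] by (intro exI[of _ "{}"]) (auto simp: univ_field_simps)
next
  case (incl h)
  then show ?case using fgen_incl[of "{h}"] by (intro exI[of _ "{h}"]) auto
next
  case (a_inv h)
  then obtain Z where "finite Z" "Z \<subseteq> T" "h \<in> fgen Z" by blast
  then show ?case unfolding univ_field_uminus using subfield_setD(4)[OF subfield_set_fgen[of Z]] by auto
next
  case (m_inv h)
  then obtain Z where "finite Z" "Z \<subseteq> T" "h \<in> fgen Z" by blast
  moreover have "inv\<^bsub>univ_field\<^esub> h = inverse h" using m_inv by (intro univ_field_inverse) (simp add: univ_field_simps)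
  ultimately show ?case using subfield_setD(8)[OF subfield_set_fgen[of Z]] by auto
next
  case (eng_add h1 h2)
  then obtain Z1 Z2 where Z: "finite Z1" "Z1 \<subseteq> T" "h1 \<in> fgen Z1" "finite Z2" "Z2 \<subseteq> T" "h2 \<in> fgen Z2" by blast
  then have "h1 \<in> fgen (Z1 \<union> Z2)" "h2 \<in> fgen (Z1 \<union> Z2)"
    using fgen_mono[of Z1 "Z1 \<union> Z2"] fgen_mono[of Z2 "Z1 \<union> Z2"] by auto
  then show ?case using Z subfield_setD(5)[OF subfield_set_fgen]
    by (intro exI[of _ "Z1 \<union> Z2"]) (auto simp: univ_field_simps)
next
  case (eng_mult h1 h2)
  then obtain Z1 Z2 where Z: "finite Z1" "Z1 \<subseteq> T" "h1 \<in> fgen Z1" "finite Z2" "Z2 \<subseteq> T" "h2 \<in> fgen Z2" by blast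
  then have "h1 \<in> fgen (Z1 \<union> Z2)" "h2 \<in> fgen (Z1 \<union> Z2)"
    using fgen_mono[of Z1 "Z1 \<union> Z2"] fgen_mono[of Z2 "Z1 \<union> Z2"] by auto
  then show ?case using Z subfield_setD(6)[OF subfield_set_fgen]
    by (intro exI[of _ "Z1 \<union> Z2"]) (auto simp: univ_field_simps)
qed

lemma fgen_finite_support2:
  assumes "x \<in> fgen (A \<union> S)" shows "\<exists>Z. finite Z \<and> Z \<subseteq> S \<and> x \<in> fgen (A \<union> Z)"
proof -
  obtain Z where Z: "finite Z" "Z \<subseteq> A \<union> S" "x \<in> fgen Z" using fgen_finite_support[OF assms] by blast
  then have "x \<in> fgen (A \<union> (Z \<inter> S))" using fgen_mono[of Z "A \<union> (Z \<inter> S)"] by blast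
  then show ?thesis using Z by (intro exI[of _ "Z \<inter> S"]) auto
qed

lemma map_poly_id_on: "subring_set A \<Longrightarrow> poly_over A p \<Longrightarrow> (\<And>a. a \<in> A \<Longrightarrow> h a = a) \<Longrightarrow> map_poly h p = p"
  by (auto intro!: poly_eqI simp: coeff_map_poly subring_setD poly_over_def)

text \<open>The fixed-field statement of Galois theory in a form that works for non-normal
  extensions: embeddings take their values anywhere in the algebraically closed type. Generators are
  removed one at a time; invariance under embeddings of the smaller field is inherited because these
  extend to the larger one.\<close>

lemma fixed_by_homs_finite:
  fixes A :: "'a::alg_closed_field set"
  assumes A: "subfield_set A" and Z: "finite Z" "\<And>z. z \<in> Z \<Longrightarrow> separable_over A z"
    and x: "x \<in> fgen (A \<union> Z)"
    and fix_x: "\<And>h. rhom (fgen (A \<union> Z)) h \<Longrightarrow> (\<And>a. a \<in> A \<Longrightarrow> h a = a) \<Longrightarrow> h x = x"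
  shows "x \<in> A"
  using Z x fix_x
proof (induction Z arbitrary: x rule: finite_induct)
  case empty
  then show ?case using fgen_subfield[OF A] by simp
next
  case (insert z Z)
  define B where "B = fgen (A \<union> Z)"
  have Bf: "subfield_set B" unfolding B_def by simp
  have "A \<subseteq> B" unfolding B_def using fgen_incl by blast
  have N: "fgen (A \<union> insert z Z) = fgen (B \<union> {z})"
    unfolding B_def fgen_fgen_union by (simp add: Un_assoc)
  have sep: "separable_over B z" using separable_over_mono[of A z B] insert.prems(1) \<open>A \<subseteq> B\<close> Bf by blast
  then obtain m where m: "is_min_poly B z m" and sq: "rsquarefree m" unfolding separable_over_def by blast
  then have mB: "poly_over B m" "lead_coeff m = 1" "poly m z = 0" by (auto simp: is_min_poly_def)
  note alg = separable_over_imp_algebraic[OF sep]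
  obtain p where p: "poly_over B p" "x = poly p z"
    using insert.prems(2) unfolding N fgen_simple[OF Bf alg] by blast
  obtain g r where gr: "poly_over B g" "poly_over B r" "p = m * g + r" "r = 0 \<or> deg r < deg m"
    using monic_division_over[OF subfield_setD(1)[OF Bf] mB(1,2) p(1)] by blast
  have xr: "x = poly r z" using p gr mB by simp
  have id: "map_poly (\<lambda>x. x) q = q" for q :: "'a poly" by (simp add: map_poly_idI)
  have root: "poly r z' = x" if z': "poly m z' = 0" for z'
  proof -
    obtain h where h: "rhom (fgen (B \<union> {z})) h" "\<And>p. poly_over B p \<Longrightarrow> h (poly p z) = poly p z'"
      using rhom_extend_simple[OF Bf m rhom_id, of z'] z' unfolding id by blast
    have "h b = b" if "b \<in> B" for b
      using h(2)[of "[:b:]"] that subfield_setD[OF Bf] by (simp add: poly_over_pCons)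
    then have "h x = x" using insert.prems(3)[of h] h(1) \<open>A \<subseteq> B\<close> unfolding N by blast
    then show ?thesis using h(2)[OF gr(2)] xr by simp
  qed
  \<comment> \<open>Each conjugate \<open>z'\<close> of \<open>z\<close> is the image of
    \<open>z\<close> under an embedding, and invariance of \<open>x\<close> makes it a root of
    \<open>r - x\<close>. Separability supplies \<open>deg m\<close> conjugates, too many for a
    nonzero polynomial of smaller degree.\<close>
  have "r - [:x:] = 0"
  proof (rule ccontr)
    assume nz: "r - [:x:] \<noteq> 0"
    have "deg (r - [:x:]) < deg m"
      using gr(4) is_min_poly_deg_pos[OF m] by (auto intro!: degree_diff_less)
    moreover have "card {z'. poly m z' = 0} \<le> card {z'. poly (r - [:x:]) z' = 0}"
      using root by (intro card_mono poly_roots_finite[OF nz]) auto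
    moreover have "card {z'. poly (r - [:x:]) z' = 0} \<le> deg (r - [:x:])" by (rule card_poly_roots_bound[OF nz])
    ultimately show False using rsquarefree_card_roots[OF sq] by simp
  qed
  then have "r = [:x:]" by simp
  then have "x \<in> B" using gr(2) by (simp add: poly_over_pCons)
  show ?case
  proof (rule insert.IH)
    show "x \<in> fgen (A \<union> Z)" using \<open>x \<in> B\<close> unfolding B_def .
    fix h :: "'a \<Rightarrow> 'a" assume h: "rhom (fgen (A \<union> Z)) h" "\<And>a. a \<in> A \<Longrightarrow> h a = a"
    obtain h' where h': "rhom (fgen (B \<union> {z})) h'" "\<forall>x\<in>B. h' x = h x"
      using rhom_extend[OF Bf, of h "{z}"] h(1) alg unfolding B_def by blast
    have "h' a = a" if "a \<in> A" for a using h'(2) h(2)[OF that] \<open>A \<subseteq> B\<close> that by auto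
    then have "h' x = x" using insert.prems(3)[of h'] h'(1) unfolding N by blast
    then show "h x = x" using h'(2) \<open>x \<in> B\<close> by simp
  qed (use insert.prems in auto)
qed

text \<open>Being injective on the finite set \<open>Y\<close> and mapping it into itself,
  \<open>h\<close> merely permutes the linear factors.\<close>

lemma coeff_fixed_lin_prod:
  fixes h :: "'a::field \<Rightarrow> 'a"
  assumes N: "subfield_set N" and h: "rhom N h" and Y: "finite Y" "Y \<subseteq> N" "h ` Y \<subseteq> Y"
  shows "h (poly.coeff (lin_prod Y) i) = poly.coeff (lin_prod Y) i"
proof -
  note N' = subfield_setD[OF N]
  have inj: "inj_on h Y" using rhom_field_inj_on[OF h N] Y(2) by (rule inj_on_subset)
  then have im: "h ` Y = Y" using Y by (simp add: endo_inj_surj)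
  have po: "poly_over N [:- u, 1:]" if "u \<in> N" for u using N' that by (simp add: poly_over_pCons)
  have lin: "map_poly h [:- u, 1:] = [:- h u, 1:]" if "u \<in> N" for u
    using that N' by (simp add: map_poly_rhom_pCons[OF h] rhomD[OF h])
  have "map_poly h (lin_prod Q) = (\<Prod>u\<in>Q. [:- h u, 1:])" if "Q \<subseteq> N" "finite Q" for Q
    using that(2,1)
  proof (induction Q rule: finite_induct)
    case empty
    show ?case using rhomD(1)[OF h N'(1)] by (simp add: map_poly_1' )
  next
    case (insert u Q)
    then have "map_poly h ([:- u, 1:] * lin_prod Q) = map_poly h [:- u, 1:] * map_poly h (lin_prod Q)"
      by (intro map_poly_rhom(2)[OF h N'(1)] poly_over_prod[OF N'(1)] po) auto
    then show ?case using insert lin[of u] by simp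
  qed
  then have "map_poly h (lin_prod Y) = (\<Prod>u\<in>Y. [:- h u, 1:])" using Y by blast
  also have "\<dots> = lin_prod (h ` Y)" using inj by (simp add: prod.reindex)
  finally have "map_poly h (lin_prod Y) = lin_prod Y" using im by simp
  then show ?thesis using rhomD(2)[OF h N'(1)] by (metis coeff_map_poly)
qed

lemma roots_min_poly_subset_closed:
  assumes A: "subfield_set A" and N: "subring_set N" "A \<subseteq> N" and z: "z \<in> N"
    and h: "rhom N h" "\<And>a. a \<in> A \<Longrightarrow> h a = a" and f: "poly_over A f" "poly f z = 0"
  shows "poly f (h z) = 0"
proof -
  have "h (poly f z) = poly (map_poly h f) (h z)"
    using N z f by (intro rhom_poly[OF h(1)] poly_over_mono[OF f(1)]) auto
  then show ?thesis
    using f(2) map_poly_id_on[OF subfield_setD(1)[OF A] f(1) h(2)] rhomD(2)[OF h(1) N(1)] by simp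
qed

text \<open>The orbit polynomial of an element under the embeddings over \<open>A\<close> is separable, and its
  coefficients are fixed by all embeddings.\<close>

lemma separable_fgen_finite:
  fixes A :: "'a::alg_closed_field set"
  assumes A: "subfield_set A" and Z: "finite Z"
    and clo: "\<And>z. z \<in> Z \<Longrightarrow> \<exists>f. poly_over A f \<and> rsquarefree f \<and> poly f z = 0 \<and> {y. poly f y = 0} \<subseteq> Z"
    and y: "y \<in> fgen (A \<union> Z)"
  shows "\<exists>f. poly_over A f \<and> rsquarefree f \<and> poly f y = 0 \<and> {u. poly f u = 0} \<subseteq> fgen (A \<union> Z)"
proof -
  define N where "N = fgen (A \<union> Z)"
  have Nf: "subfield_set N" unfolding N_def by simp
  have AN: "A \<subseteq> N" "Z \<subseteq> N" unfolding N_def using fgen_incl by blast+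
  note N' = subfield_setD[OF Nf]
  define H where "H = {h :: 'a \<Rightarrow> 'a. rhom N h \<and> (\<forall>a\<in>A. h a = a)}"
  have hZ: "h z \<in> Z" if h: "h \<in> H" and z: "z \<in> Z" for h z
  proof -
    obtain f where f: "poly_over A f" "poly f z = 0" "{y. poly f y = 0} \<subseteq> Z" using clo[OF z] by blast
    have "poly f (h z) = 0"
      by (rule roots_min_poly_subset_closed[OF A N'(1) AN(1) _ _ _ f(1,2)])
        (use h z AN in \<open>auto simp: H_def\<close>)
    then show ?thesis using f by blast
  qed
  have hN: "h ` N \<subseteq> N" if h: "h \<in> H" for h
  proof -
    have "h ` (A \<union> Z) \<subseteq> N" using hZ[OF h] AN h by (auto simp: H_def)
    then show ?thesis using rhom_fgen_image_subset[OF _ Nf, of "A \<union> Z" h] h unfolding N_def H_def by blast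
  qed
  have comp: "(\<lambda>x. g (h x)) \<in> H" if "g \<in> H" "h \<in> H" for g h
    using that rhom_comp[of N h N g] hN[OF that(2)] unfolding H_def by auto
  define Y where "Y = (\<lambda>h. h y) ` H"
  \<comment> \<open>An embedding over \<open>A\<close> is determined on \<open>N\<close> by its
    values on the finite set \<open>Z\<close>, which it maps into itself. Passing to restrictions is
    essential, since elements of \<open>H\<close> may differ arbitrarily outside
    \<open>N\<close>.\<close>
  have "finite ((\<lambda>h. restrict h Z) ` H)"
  proof (rule finite_subset)
    show "(\<lambda>h. restrict h Z) ` H \<subseteq> Z \<rightarrow>\<^sub>E Z" using hZ by (intro image_subsetI restrict_PiE_iff[THEN iffD2]) auto
    show "finite (Z \<rightarrow>\<^sub>E Z)" using Z by (intro finite_PiE) auto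
  qed
  moreover have "\<exists>F. Y = F ` ((\<lambda>h. restrict h Z) ` H)"
  proof -
    define F where "F k = (THE v. \<exists>h\<in>H. restrict h Z = k \<and> v = h y)" for k
    have "F (restrict h Z) = h y" if h: "h \<in> H" for h
      unfolding F_def
    proof (rule the_equality)
      show "\<exists>h'\<in>H. restrict h' Z = restrict h Z \<and> h y = h' y" using h by blast
      fix v assume "\<exists>h'\<in>H. restrict h' Z = restrict h Z \<and> v = h' y"
      then obtain h' where h': "h' \<in> H" "restrict h' Z = restrict h Z" "v = h' y" by blast
      have "h' y = h y"
      proof (rule rhom_fgen_eqI[where S = "A \<union> Z" and h = h' and g = h and x = y])
        show "rhom (fgen (A \<union> Z)) h'" "rhom (fgen (A \<union> Z)) h" using h h' unfolding H_def N_def by auto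
        show "h' s = h s" if "s \<in> A \<union> Z" for s
        proof (cases "s \<in> Z")
          case True
          then show ?thesis using fun_cong[OF h'(2), of s] by simp
        next
          case False
          then show ?thesis using that h h'(1) unfolding H_def by auto
        qed
      qed (use y in simp)
      then show "v = h y" using h' by simp
    qed
    then have "Y = F ` ((\<lambda>h. restrict h Z) ` H)"
      unfolding Y_def image_image by (intro image_cong) auto
    then show ?thesis by blast
  qed
  ultimately have fin: "finite Y" by auto
  have YN: "Y \<subseteq> N" using hN y unfolding Y_def N_def by blast
  have "(\<lambda>x. x) \<in> H" unfolding H_def by (simp add: rhom_id)
  then have yY: "y \<in> Y" unfolding Y_def by (rule rev_image_eqI) simp
  have clY: "h ` Y \<subseteq> Y" if "h \<in> H" for h
    unfolding Y_def using comp[OF that] by auto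
  have "poly.coeff (lin_prod Y) i \<in> A" for i
  proof (rule fixed_by_homs_finite[OF A Z])
    show "separable_over A z" if "z \<in> Z" for z using clo[OF that] separable_overI[OF A] by blast
    have "poly_over N (lin_prod Y)"
      by (rule poly_over_prod[OF N'(1)]) (use YN N' in \<open>auto simp: poly_over_pCons\<close>)
    then show "poly.coeff (lin_prod Y) i \<in> fgen (A \<union> Z)" unfolding N_def poly_over_def by blast
    fix h :: "'a \<Rightarrow> 'a" assume "rhom (fgen (A \<union> Z)) h" "\<And>a. a \<in> A \<Longrightarrow> h a = a"
    then have h: "h \<in> H" unfolding H_def N_def by blast
    show "h (poly.coeff (lin_prod Y) i) = poly.coeff (lin_prod Y) i"
      by (rule coeff_fixed_lin_prod[OF Nf _ fin YN clY[OF h]]) (use h in \<open>simp add: H_def\<close>)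
  qed
  then show ?thesis
    using YN yY poly_lin_prod_eq_0_iff[OF fin] rsquarefree_lin_prod[OF fin] unfolding N_def
    by (intro exI[of _ "lin_prod Y"]) (auto simp: poly_over_def)
qed

text \<open>All roots of the minimal polynomials are added. The last clause records that each point
  is a conjugate of an original one, which keeps the enlarged set inside a normal extension.\<close>

lemma finite_root_closure:
  fixes A :: "'a::alg_closed_field set"
  assumes A: "subfield_set A" and Z: "finite Z" "\<And>z. z \<in> Z \<Longrightarrow> separable_over A z"
  shows "\<exists>Z'. finite Z' \<and> Z \<subseteq> Z' \<and>
    (\<forall>z\<in>Z'. \<exists>f. poly_over A f \<and> rsquarefree f \<and> poly f z = 0 \<and> {y. poly f y = 0} \<subseteq> Z') \<and>
    (\<forall>z\<in>Z'. \<exists>y\<in>Z. \<forall>f. is_min_poly A y f \<longrightarrow> poly f z = 0)"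
proof -
  define f where "f z = (SOME p. is_min_poly A z p \<and> rsquarefree p)" for z
  have f: "is_min_poly A z (f z)" "rsquarefree (f z)" if "z \<in> Z" for z
  proof -
    have "\<exists>p. is_min_poly A z p \<and> rsquarefree p" using Z(2)[OF that] unfolding separable_over_def .
    from someI_ex[OF this] show "is_min_poly A z (f z)" "rsquarefree (f z)" unfolding f_def by auto
  qed
  define Z' where "Z' = (\<Union>z\<in>Z. {y. poly (f z) y = 0})"
  have fin: "finite Z'" unfolding Z'_def using Z(1) f(2) by (auto intro!: poly_roots_finite simp: rsquarefree_def)
  moreover have "Z \<subseteq> Z'" unfolding Z'_def using f(1) by (auto simp: is_min_poly_def)
  moreover have "\<exists>f. poly_over A f \<and> rsquarefree f \<and> poly f z = 0 \<and> {y. poly f y = 0} \<subseteq> Z'" if z: "z \<in> Z'" for z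
  proof -
    obtain u where "u \<in> Z" "poly (f u) z = 0" using z unfolding Z'_def by blast
    then show ?thesis using f[of u] unfolding Z'_def is_min_poly_def by (intro exI[of _ "f u"]) auto
  qed
  moreover have "\<exists>y\<in>Z. \<forall>f. is_min_poly A y f \<longrightarrow> poly f z = 0" if z: "z \<in> Z'" for z
  proof -
    obtain u where u: "u \<in> Z" "poly (f u) z = 0" using z unfolding Z'_def by blast
    have "poly p z = 0" if "is_min_poly A u p" for p
      using is_min_poly_unique[OF A that f(1)[OF u(1)]] u(2) by simp
    then show ?thesis using u(1) by blast
  qed
  ultimately show ?thesis by blast
qed

lemma separable_fgen:
  fixes A :: "'a::alg_closed_field set"
  assumes A: "subfield_set A" and S: "\<And>s. s \<in> S \<Longrightarrow> separable_over A s" and y: "y \<in> fgen (A \<union> S)"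
  shows "separable_over A y"
proof -
  obtain Z where Z: "finite Z" "Z \<subseteq> S" "y \<in> fgen (A \<union> Z)" using fgen_finite_support2[OF y] by blast
  obtain Z' where Z': "finite Z'" "Z \<subseteq> Z'"
    "\<forall>z\<in>Z'. \<exists>f. poly_over A f \<and> rsquarefree f \<and> poly f z = 0 \<and> {y. poly f y = 0} \<subseteq> Z'"
    using finite_root_closure[OF A Z(1)] S Z(2) by blast
  have "y \<in> fgen (A \<union> Z')" using Z(3) fgen_mono[of "A \<union> Z" "A \<union> Z'"] Z'(2) by blast
  then obtain f where "poly_over A f" "rsquarefree f" "poly f y = 0"
    using separable_fgen_finite[OF A Z'(1)] Z'(3) by meson
  then show ?thesis by (rule separable_overI[OF A])
qed

section \<open>The separable closure as a field\<close>

lemma separable_closure_of_iff: "x \<in> separable_closure_of K \<longleftrightarrow> separable_over K x"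
  by (simp add: separable_closure_of_def)

lemma subset_separable_closure: "subfield_set K \<Longrightarrow> K \<subseteq> separable_closure_of K"
  by (auto simp: separable_closure_of_iff separable_over_in)

lemma subfield_set_separable_closure:
  fixes K :: "'a::alg_closed_field set"
  assumes K: "subfield_set K"
  shows "subfield_set (separable_closure_of K)"
proof -
  have "fgen (K \<union> separable_closure_of K) \<subseteq> separable_closure_of K"
    using separable_fgen[OF K, of "separable_closure_of K"] by (auto simp: separable_closure_of_iff)
  then have "fgen (K \<union> separable_closure_of K) = separable_closure_of K"
    using fgen_incl[of "K \<union> separable_closure_of K"] by blast
  then show ?thesis using subfield_set_fgen[of "K \<union> separable_closure_of K"] by simp
qed

lemma separable_closure_mono:
  "K0 \<subseteq> K \<Longrightarrow> subfield_set K \<Longrightarrow> separable_closure_of K0 \<subseteq> separable_closure_of K"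
  using separable_over_mono by (auto simp: separable_closure_of_iff)

text \<open>Embeddings of \<open>A(x)\<close> over \<open>A\<close> extend along the algebraic set
  \<open>S\<close>. The lemma serves when invariance of \<open>x\<close> is known only for
  homomorphisms of a composite field.\<close>

lemma fixed_in_separable_closure:
  fixes A :: "'a::alg_closed_field set"
  assumes A: "subfield_set A" and x: "separable_over A x" and S: "\<And>s. s \<in> S \<Longrightarrow> algebraic_over A s"
    and fix_x: "\<And>h. rhom (fgen (A \<union> insert x S)) h \<Longrightarrow> (\<And>a. a \<in> A \<Longrightarrow> h a = a) \<Longrightarrow> h x = x"
  shows "x \<in> A"
proof (rule fixed_by_homs_finite[OF A, of "{x}"])
  show "x \<in> fgen (A \<union> {x})" using fgen_incl by blast
  fix h :: "'a \<Rightarrow> 'a" assume h: "rhom (fgen (A \<union> {x})) h" "\<And>a. a \<in> A \<Longrightarrow> h a = a"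
  have AZ: "A \<subseteq> fgen (A \<union> {x})" using fgen_incl by blast
  obtain h' where h': "rhom (fgen (fgen (A \<union> {x}) \<union> S)) h'" "\<forall>y\<in>fgen (A \<union> {x}). h' y = h y"
    using rhom_extend[OF subfield_set_fgen h(1), of S] S algebraic_over_mono[OF _ AZ] by blast
  have "h' a = a" if "a \<in> A" for a using h'(2) h(2)[OF that] AZ that by auto
  moreover have "fgen (fgen (A \<union> {x}) \<union> S) = fgen (A \<union> insert x S)"
    unfolding fgen_fgen_union by (simp add: Un_assoc)
  ultimately have "h' x = x" using fix_x[of h'] h'(1) by simp
  then show "h x = x" using h' \<open>x \<in> fgen (A \<union> {x})\<close> by simp
qed (use x in auto)

section \<open>Purely inseparable elements\<close>

text \<open>Irreducibility of minimal polynomials: the minimal polynomial \<open>g\<close> of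
  \<open>a\<close> divides \<open>m\<close>, and the cofactor has too small a degree to vanish at
  \<open>x\<close>. Hence \<open>g\<close> vanishes at \<open>x\<close>, has the degree of
  \<open>m\<close>, and both are monic.\<close>

lemma min_poly_of_root:
  fixes x :: "'a::field"
  assumes K: "subfield_set K" and m: "is_min_poly K x m" and a: "poly m a = 0"
  shows "is_min_poly K a m"
proof -
  have m': "poly_over K m" "lead_coeff m = 1" "poly m x = 0" "m \<noteq> 0"
    and min: "\<And>q. q \<noteq> 0 \<Longrightarrow> poly_over K q \<Longrightarrow> poly q x = 0 \<Longrightarrow> deg m \<le> deg q"
    using m by (auto simp: is_min_poly_def)
  have "algebraic_over K a" unfolding algebraic_over_def using m' a by blast
  then obtain g where g: "is_min_poly K a g" using algebraic_over_imp_min_poly[OF K] by blast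
  then have g': "poly_over K g" "lead_coeff g = 1" by (auto simp: is_min_poly_def)
  obtain k where k: "poly_over K k" "m = g * k" using is_min_poly_dvd[OF K g m'(1) a] by blast
  have nz: "g \<noteq> 0" "k \<noteq> 0" using k m'(4) by auto
  then have d: "deg m = deg g + deg k" unfolding k(2) by (rule degree_mult_eq)
  have "poly k x \<noteq> 0"
  proof
    assume "poly k x = 0"
    then have "deg m \<le> deg k" using min nz k by blast
    then show False using d is_min_poly_deg_pos[OF g] by simp
  qed
  then have "poly g x = 0" using m'(3) k(2) by simp
  then have "deg k = 0" using min[OF nz(1) g'(1)] d by simp
  then obtain c where c: "k = [:c:]" by (auto elim: degree_eq_zeroE)
  have "lead_coeff m = lead_coeff g * lead_coeff k" unfolding k(2) by (rule lead_coeff_mult)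
  then have "c = 1" using m'(2) g'(2) c by simp
  then show ?thesis using g k c by (simp add: one_pCons[symmetric])
qed

text \<open>Additivity of the power map is used instead of a power of the characteristic:
  \<open>q = 1\<close> then serves in characteristic 0 and all characteristics are treated
  alike.\<close>

definition frobenius_exponent :: "'a::comm_ring_1 itself \<Rightarrow> nat \<Rightarrow> bool"
  where "frobenius_exponent _ q \<longleftrightarrow> q > 0 \<and> (\<forall>a b::'a. (a + b) ^ q = a ^ q + b ^ q)"

lemma frobenius_exponent_mult:
  "frobenius_exponent TYPE('a::comm_ring_1) q \<Longrightarrow> frobenius_exponent TYPE('a) q' \<Longrightarrow> frobenius_exponent TYPE('a) (q * q')"
  by (simp add: frobenius_exponent_def power_mult)

lemma frobenius_exponent_diff:
  assumes "frobenius_exponent TYPE('a::comm_ring_1) q" shows "(a - b :: 'a) ^ q = a ^ q - b ^ q"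
proof -
  have "((a - b) + b) ^ q = (a - b) ^ q + b ^ q" using assms unfolding frobenius_exponent_def by blast
  then show ?thesis by simp
qed

lemma frobenius_exponent_inj:
  assumes "frobenius_exponent TYPE('a::idom) q" "(a::'a) ^ q = b ^ q" shows "a = b"
proof -
  have "(a - b) ^ q = 0" using frobenius_exponent_diff[OF assms(1), of a b] assms(2) by simp
  then show ?thesis by simp
qed

text \<open>A multiple root \<open>a\<close> of \<open>m\<close> is also a root of the derivative,
  and \<open>m\<close> is the minimal polynomial of \<open>a\<close> as well; a nonzero derivative
  would have too small a degree.\<close>

lemma inseparable_min_poly:
  fixes x :: "'a::alg_closed_field"
  assumes K: "subfield_set K" and m: "is_min_poly K x m" and ns: "\<not> rsquarefree m"
  shows "pderiv m = 0"
proof (rule ccontr)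
  assume nz: "pderiv m \<noteq> 0"
  have m': "poly_over K m" "lead_coeff m = 1" "m \<noteq> 0" using m by (auto simp: is_min_poly_def)
  obtain a where a: "Polynomial.order a m \<noteq> 0" "Polynomial.order a m \<noteq> 1"
    using ns m'(3) unfolding rsquarefree_def by blast
  then have "2 \<le> Polynomial.order a m" by simp
  then have "[:- a, 1:] ^ 2 dvd m" using order_divides[of a 2 m] by blast
  then obtain s where s: "m = [:- a, 1:] ^ 2 * s" by (elim dvdE)
  have "poly m a = 0" unfolding s by simp
  moreover have "poly (pderiv m) a = 0"
    unfolding s power2_eq_square pderiv_mult by simp
  moreover have "poly_over K (pderiv m)" by (rule poly_over_pderiv[OF subfield_setD(1)[OF K] m'(1)])
  ultimately have "deg m \<le> deg (pderiv m)"
    using min_poly_of_root[OF K m] nz unfolding is_min_poly_def by blast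
  moreover have "deg (pderiv m) \<le> deg m - 1" by (rule degree_le) (auto simp: coeff_pderiv coeff_eq_0)
  ultimately show False using is_min_poly_deg_pos[OF m] by simp
qed

text \<open>Induction on the degree of the minimal polynomial. If it is inseparable, its derivative
  is zero, so it is a polynomial in \<open>X^p\<close> and \<open>x^p\<close> has smaller degree
  than \<open>x\<close>; the exponents multiply along the descent.\<close>

lemma algebraic_power_separable:
  fixes x :: "'a::alg_closed_field"
  assumes K: "subfield_set K" and x: "algebraic_over K x"
  shows "\<exists>q. frobenius_exponent TYPE('a) q \<and> separable_over K (x ^ q)"
proof -
  obtain m where "is_min_poly K x m" using algebraic_over_imp_min_poly[OF K x] by blast
  then show ?thesis
  proof (induction "deg m" arbitrary: x m rule: less_induct)
    case less
    show ?case
    proof (cases "rsquarefree m")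
      case True
      then show ?thesis using less.prems by (intro exI[of _ 1]) (auto simp: separable_over_def frobenius_exponent_def)
    next
      case False
      have pd: "pderiv m = 0" by (rule inseparable_min_poly[OF K less.prems False])
      have m': "poly_over K m" "lead_coeff m = 1" "m \<noteq> 0" "poly m x = 0" using less.prems by (auto simp: is_min_poly_def)
      have dp: "deg m > 0" by (rule is_min_poly_deg_pos[OF less.prems])
      define p where "p = CHAR('a)"
      have c: "of_nat i * poly.coeff m i = 0" for i
      proof (cases i)
        case (Suc j)
        then show ?thesis using arg_cong[OF pd, of "\<lambda>f. poly.coeff f j"] by (simp add: coeff_pderiv)
      qed simp
      \<comment> \<open>The coefficient 1 of the leading term forces \<open>deg m\<close> to vanish
        in the field, so the characteristic is positive and divides the degree. In characteristic 0
        this case cannot occur.\<close>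
      have "(of_nat (deg m) :: 'a) = 0" using c[of "deg m"] m'(2) by simp
      then have "p dvd deg m" unfolding p_def by (simp add: of_nat_eq_0_iff_char_dvd)
      then have p0: "p > 0" using dp by (metis dvd_0_left gr0I less_numeral_extra(3))
      have pr: "prime p" using prime_CHAR_semidom p0 unfolding p_def by blast
      then have p1: "p > 1" by (rule prime_gt_1_nat)
      have cz: "poly.coeff m i = 0" if "\<not> p dvd i" for i
        using c[of i] that unfolding p_def by (simp add: of_nat_eq_0_iff_char_dvd)
      obtain n where n: "deg m = p * n" using \<open>p dvd deg m\<close> by (elim dvdE)
      define m2 where "m2 = (\<Sum>i\<le>n. Polynomial.monom (poly.coeff m (p * i)) i)"
      have cm2: "poly.coeff m2 i = (if i \<le> n then poly.coeff m (p * i) else 0)" for i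
        unfolding m2_def by (simp add: coeff_sum when_def)
      have "poly m x = (\<Sum>i\<le>p * n. poly.coeff m i * x ^ i)" by (simp add: poly_altdef n)
      also have "\<dots> = (\<Sum>i\<in>(\<lambda>i. p * i) ` {..n}. poly.coeff m i * x ^ i)"
      proof (rule sum.mono_neutral_right)
        show "\<forall>i\<in>{..p * n} - (\<lambda>i. p * i) ` {..n}. poly.coeff m i * x ^ i = 0"
        proof
          fix i assume i: "i \<in> {..p * n} - (\<lambda>i. p * i) ` {..n}"
          have "\<not> p dvd i"
          proof
            assume "p dvd i"
            then obtain k where "i = p * k" by (elim dvdE)
            then show False using i p0 by auto
          qed
          then show "poly.coeff m i * x ^ i = 0" using cz by simp
        qed
      qed (use p0 in auto)
      also have "\<dots> = (\<Sum>i\<le>n. poly.coeff m (p * i) * x ^ (p * i))"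
        using p0 by (subst sum.reindex) (auto simp: inj_on_def)
      also have "\<dots> = poly m2 (x ^ p)" unfolding m2_def by (simp add: poly_sum poly_monom power_mult)
      finally have r: "poly m2 (x ^ p) = 0" using m'(4) by simp
      have m2K: "poly_over K m2" using m'(1) subfield_setD(2)[OF K] unfolding poly_over_def cm2 by auto
      have "poly.coeff m2 n = 1" using m'(2) unfolding cm2 n[symmetric] by simp
      then have m20: "m2 \<noteq> 0" by auto
      have "algebraic_over K (x ^ p)" unfolding algebraic_over_def using r m2K m20 by blast
      then obtain m3 where m3: "is_min_poly K (x ^ p) m3" using algebraic_over_imp_min_poly[OF K] by blast
      have "deg m3 \<le> deg m2" using m3 r m2K m20 unfolding is_min_poly_def by blast
      also have "deg m2 \<le> n" by (rule degree_le) (simp add: cm2)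
      also have "n < deg m" using n p1 dp by (simp)
      finally obtain q where q: "frobenius_exponent TYPE('a) q" "separable_over K ((x ^ p) ^ q)"
        using less.hyps[OF _ m3] by blast
      have "frobenius_exponent TYPE('a) p"
        using p0 pr freshmans_dream unfolding frobenius_exponent_def p_def by blast
      then show ?thesis using q frobenius_exponent_mult by (metis power_mult)
    qed
  qed
qed

lemma algebraic_over_root:
  assumes K: "subfield_set K" and q: "q > 0" and x: "algebraic_over K (x ^ q)"
  shows "algebraic_over K x"
proof -
  obtain p where p: "p \<noteq> 0" "poly_over K p" "poly p (x ^ q) = 0" using x unfolding algebraic_over_def by blast
  define r where "r = pcompose p (Polynomial.monom 1 q)"
  have "poly_over K (pcompose p (Polynomial.monom 1 q))"
    using p(2)
  proof (induction p)
    case (pCons a p)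
    have K': "subring_set K" "1 \<in> K" using subfield_setD[OF K] by auto
    have "poly_over K [:a:]" using pCons.prems K' by (simp add: poly_over_pCons)
    then show ?case
      unfolding pcompose_pCons using pCons K'
      by (intro poly_over_add poly_over_mult poly_over_monom) (auto simp: poly_over_pCons)
  qed (use subfield_setD(1)[OF K] in simp)
  moreover have "poly r x = 0" unfolding r_def by (simp add: poly_pcompose poly_monom p)
  moreover have "r \<noteq> 0"
  proof
    assume "r = 0"
    moreover have "deg (Polynomial.monom (1::'a) q) > 0" using q by (simp add: degree_monom_eq)
    ultimately have "p = 0" unfolding r_def using pcompose_eq_0[of p] by blast
    then show False using p by simp
  qed
  ultimately show ?thesis unfolding algebraic_over_def r_def by blast
qed

section \<open>The algebraic closure, reached through Frobenius powers\<close>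

lemma subset_algebraic_closure: "subfield_set K \<Longrightarrow> K \<subseteq> algebraic_closure_of K"
  by (auto simp: algebraic_closure_of_def algebraic_over_in subfield_setD)

lemma separable_subset_algebraic_closure: "separable_closure_of K \<subseteq> algebraic_closure_of K"
  by (auto simp: algebraic_closure_of_def separable_closure_of_def separable_over_imp_algebraic)

lemma algebraic_closure_power:
  fixes K :: "'a::alg_closed_field set"
  assumes K: "subfield_set K" and S: "finite S" "S \<subseteq> algebraic_closure_of K"
  shows "\<exists>q. frobenius_exponent TYPE('a) q \<and> (\<forall>x\<in>S. x ^ q \<in> separable_closure_of K)"
  using S
proof (induction S rule: finite_induct)
  case empty
  show ?case by (auto intro!: exI[of _ 1] simp: frobenius_exponent_def)
next
  case (insert x S)
  obtain q where q: "frobenius_exponent TYPE('a) q" "\<forall>x\<in>S. x ^ q \<in> separable_closure_of K" using insert by blast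
  obtain q' where q': "frobenius_exponent TYPE('a) q'" "x ^ q' \<in> separable_closure_of K"
    using algebraic_power_separable[OF K, of x] insert.prems
    by (auto simp: algebraic_closure_of_def separable_closure_of_iff)
  note R = subfield_setD(1)[OF subfield_set_separable_closure[OF K]]
  have "y ^ (q * q') \<in> separable_closure_of K" if "y \<in> insert x S" for y
  proof (cases "y = x")
    case True
    then show ?thesis using subring_set_power[OF R q'(2), of q] by (simp add: power_mult mult.commute[of q])
  next
    case False
    then have "y ^ q \<in> separable_closure_of K" using that q(2) by blast
    then show ?thesis using subring_set_power[OF R, of _ q'] by (simp add: power_mult)
  qed
  then show ?case using frobenius_exponent_mult[OF q(1) q'(1)] by blast
qed

text \<open>A common Frobenius exponent moves given elements into the separable closure, which is
  already known to be a field. The power map respects the operations, and roots of separable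
  elements are algebraic.\<close>

lemma subfield_set_algebraic_closure:
  fixes K :: "'a::alg_closed_field set"
  assumes K: "subfield_set K"
  shows "subfield_set (algebraic_closure_of K)"
proof -
  let ?A = "algebraic_closure_of K" and ?S = "separable_closure_of K"
  note S = subfield_setD[OF subfield_set_separable_closure[OF K]]
  have root: "x \<in> ?A" if "frobenius_exponent TYPE('a) q" "x ^ q \<in> ?S" for x q
    using algebraic_over_root[OF K, of q x] that
    by (auto simp: algebraic_closure_of_def frobenius_exponent_def separable_closure_of_iff separable_over_imp_algebraic)
  show ?thesis
  proof (rule subfield_setI)
    show "1 \<in> ?A" using subset_algebraic_closure[OF K] subfield_setD(3)[OF K] by blast
  next
    fix x y assume xy: "x \<in> ?A" "y \<in> ?A"
    then obtain q where q: "frobenius_exponent TYPE('a) q" "x ^ q \<in> ?S" "y ^ q \<in> ?S"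
      using algebraic_closure_power[OF K, of "{x, y}"] by auto
    show "x - y \<in> ?A" by (rule root[OF q(1)]) (use q S in \<open>simp add: frobenius_exponent_diff\<close>)
    show "x * y \<in> ?A" by (rule root[OF q(1)]) (use q S in \<open>simp add: power_mult_distrib\<close>)
  next
    fix x assume "x \<in> ?A"
    then obtain q where q: "frobenius_exponent TYPE('a) q" "x ^ q \<in> ?S"
      using algebraic_closure_power[OF K, of "{x}"] by auto
    show "inverse x \<in> ?A" by (rule root[OF q(1)]) (use q S in \<open>simp add: power_inverse\<close>)
  qed
qed

section \<open>Linear disjointness\<close>

text \<open>Coefficients are indexed by the vectors themselves. Since \<open>sum\<close> is 0 on
  infinite sets, the notion is meaningful for finite \<open>B\<close>, as in
  \<open>lin_disj\<close>.\<close>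

definition indep :: "'a::field set \<Rightarrow> 'a set \<Rightarrow> bool"
  where "indep K B \<longleftrightarrow> (\<forall>l. (\<forall>b\<in>B. l b \<in> K) \<and> (\<Sum>b\<in>B. l b * b) = 0 \<longrightarrow> (\<forall>b\<in>B. l b = 0))"

definition lin_disj :: "'a::field set \<Rightarrow> 'a set \<Rightarrow> 'a set \<Rightarrow> bool"
  where "lin_disj L M N \<longleftrightarrow> (\<forall>B. finite B \<and> B \<subseteq> N \<and> indep L B \<longrightarrow> indep M B)"

lemma indepD: "indep K B \<Longrightarrow> (\<And>b. b \<in> B \<Longrightarrow> l b \<in> K) \<Longrightarrow> (\<Sum>b\<in>B. l b * b) = 0 \<Longrightarrow> b \<in> B \<Longrightarrow> l b = 0"
  unfolding indep_def by blast

lemma span_basis: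
  assumes K: "subfield_set K" and S: "finite S"
  shows "\<exists>B\<subseteq>S. indep K B \<and> (\<forall>s\<in>S. \<exists>l. (\<forall>b\<in>B. l b \<in> K) \<and> s = (\<Sum>b\<in>B. l b * b))"
  using S
proof (induction S rule: finite_induct)
  case empty
  show ?case by (auto simp: indep_def)
next
  case (insert x S)
  note K' = subfield_setD[OF K]
  obtain B where B: "B \<subseteq> S" "indep K B" "\<forall>s\<in>S. \<exists>l. (\<forall>b\<in>B. l b \<in> K) \<and> s = (\<Sum>b\<in>B. l b * b)"
    using insert by blast
  have fB: "finite B" using B(1) insert(1) by (rule finite_subset)
  show ?case
  proof (cases "\<exists>l. (\<forall>b\<in>B. l b \<in> K) \<and> x = (\<Sum>b\<in>B. l b * b)")
    case True
    then show ?thesis using B by (intro exI[of _ B] conjI ballI) auto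
  next
    case False
    have xB: "x \<notin> B" using B(1) insert(2) by blast
    have "indep K (insert x B)"
      unfolding indep_def
    proof (intro allI impI)
      fix l assume l: "(\<forall>b\<in>insert x B. l b \<in> K) \<and> (\<Sum>b\<in>insert x B. l b * b) = 0"
      have sum: "l x * x + (\<Sum>b\<in>B. l b * b) = 0" using l fB xB by simp
      have lx: "l x = 0"
      proof (rule ccontr)
        assume "l x \<noteq> 0"
        have "x = (\<Sum>b\<in>B. (- (l b / l x)) * b)"
        proof -
          have "(\<Sum>b\<in>B. (- (l b / l x)) * b) = - (\<Sum>b\<in>B. l b * b) / l x"
            by (simp add: sum_divide_distrib sum_negf)
          also have "(\<Sum>b\<in>B. l b * b) = - (l x * x)" using sum by (simp add: eq_neg_iff_add_eq_0 add.commute)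
          also have "- (- (l x * x)) / l x = x" using \<open>l x \<noteq> 0\<close> by simp
          finally show ?thesis by simp
        qed
        moreover have "\<forall>b\<in>B. - (l b / l x) \<in> K" using l K' by simp
        ultimately have "\<exists>l. (\<forall>b\<in>B. l b \<in> K) \<and> x = (\<Sum>b\<in>B. l b * b)"
          by (intro exI[of _ "\<lambda>b. - (l b / l x)"] conjI)
        then show False using False by blast
      qed
      then have "\<forall>b\<in>B. l b = 0" using l sum B(2) unfolding indep_def by auto
      then show "\<forall>b\<in>insert x B. l b = 0" using lx by simp
    qed
    moreover have "\<exists>l. (\<forall>b\<in>insert x B. l b \<in> K) \<and> s = (\<Sum>b\<in>insert x B. l b * b)" if "s \<in> insert x S" for s
    proof (cases "s = x")
      case True
      have "(\<Sum>b\<in>insert x B. (if b = x then 1 else 0) * b) = x"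
        using fB xB by (subst sum.insert) (auto intro!: sum.neutral)
      then show ?thesis using True K' by (intro exI[of _ "\<lambda>b. if b = x then 1 else 0"]) auto
    next
      case False
      then have "s \<in> S" using that by simp
      from B(3)[rule_format, OF this] obtain l where l: "\<forall>b\<in>B. l b \<in> K" "s = (\<Sum>b\<in>B. l b * b)" by (elim exE conjE)
      have "(\<Sum>b\<in>insert x B. (if b = x then 0 else l b) * b) = (\<Sum>b\<in>B. l b * b)"
        using fB xB by (subst sum.insert) (auto intro!: sum.cong)
      then have "s = (\<Sum>b\<in>insert x B. (if b = x then 0 else l b) * b)" using l(2) by simp
      moreover have "\<forall>b\<in>insert x B. (if b = x then 0 else l b) \<in> K" using l(1) K'(2) by simp
      ultimately show ?thesis by (intro exI[of _ "\<lambda>b. if b = x then 0 else l b"] conjI)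
    qed
    moreover have "insert x B \<subseteq> insert x S" using B(1) by blast
    ultimately show ?thesis by (intro exI[of _ "insert x B"] conjI ballI)
  qed
qed

lemma span_basis_choice:
  assumes K: "subfield_set K" and S: "finite S"
  shows "\<exists>B m. B \<subseteq> S \<and> finite B \<and> indep K B \<and> (\<forall>s\<in>S. \<forall>b\<in>B. m s b \<in> K) \<and> (\<forall>s\<in>S. s = (\<Sum>b\<in>B. m s b * b))"
proof -
  obtain B where B: "B \<subseteq> S" "indep K B" "\<forall>s\<in>S. \<exists>l. (\<forall>b\<in>B. l b \<in> K) \<and> s = (\<Sum>b\<in>B. l b * b)"
    using span_basis[OF K S] by (elim exE conjE)
  have "\<exists>m. \<forall>s\<in>S. (\<forall>b\<in>B. m s b \<in> K) \<and> s = (\<Sum>b\<in>B. m s b * b)" by (rule bchoice[OF B(3)])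
  then obtain m where m: "\<forall>s\<in>S. (\<forall>b\<in>B. m s b \<in> K) \<and> s = (\<Sum>b\<in>B. m s b * b)" by (elim exE)
  then have "\<forall>s\<in>S. \<forall>b\<in>B. m s b \<in> K" "\<forall>s\<in>S. s = (\<Sum>b\<in>B. m s b * b)" by auto
  then show ?thesis using B finite_subset[OF B(1) S] by (intro exI[of _ B] exI[of _ m] conjI) assumption+
qed

text \<open>The coefficients from \<open>N\<close> are expanded along an \<open>L\<close>-basis
  \<open>C\<close> of their span. Disjointness makes \<open>C\<close> independent over
  \<open>M\<close>; after exchanging the sums, the coefficient of each \<open>c\<close> is a
  relation of \<open>B\<close> over \<open>L\<close> and therefore trivial.\<close>

lemma lin_disj_sym:
  assumes L: "subfield_set L" and M: "subfield_set M" "L \<subseteq> M" and N: "L \<subseteq> N" and ld: "lin_disj L M N"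
  shows "lin_disj L N M"
  unfolding lin_disj_def indep_def[of N]
proof (intro allI impI ballI, elim conjE)
  fix B l b assume B: "finite B" "B \<subseteq> M" "indep L B" and l: "\<forall>b\<in>B. l b \<in> N" "(\<Sum>b\<in>B. l b * b) = 0" and b: "b \<in> B"
  note M' = subfield_setD[OF M(1)]
  obtain C m where C: "C \<subseteq> l ` B" "finite C" "indep L C" "\<forall>s\<in>l ` B. \<forall>c\<in>C. m s c \<in> L"
    "\<forall>s\<in>l ` B. s = (\<Sum>c\<in>C. m s c * c)"
    using span_basis_choice[OF L finite_imageI[OF B(1), of l]] by (elim exE conjE)
  have "C \<subseteq> N" using C(1) l(1) by blast
  then have iM: "indep M C" using ld C unfolding lin_disj_def by blast
  have "(\<Sum>b\<in>B. l b * b) = (\<Sum>b\<in>B. (\<Sum>c\<in>C. m (l b) c * c) * b)"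
  proof (rule sum.cong)
    fix b assume "b \<in> B"
    then have "l b = (\<Sum>c\<in>C. m (l b) c * c)" by (intro C(5)[rule_format]) simp
    then show "l b * b = (\<Sum>c\<in>C. m (l b) c * c) * b" by (rule arg_cong)
  qed simp
  also have "\<dots> = (\<Sum>b\<in>B. \<Sum>c\<in>C. m (l b) c * b * c)"
    by (simp add: sum_distrib_right sum_distrib_left mult_ac)
  also have "\<dots> = (\<Sum>c\<in>C. \<Sum>b\<in>B. m (l b) c * b * c)" by (rule sum.swap)
  also have "\<dots> = (\<Sum>c\<in>C. (\<Sum>b\<in>B. m (l b) c * b) * c)" by (simp add: sum_distrib_right)
  finally have z: "(\<Sum>c\<in>C. (\<Sum>b\<in>B. m (l b) c * b) * c) = 0" using l(2) by simp
  have zr: "(\<Sum>b\<in>B. m (l b) c * b) = 0" if "c \<in> C" for c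
  proof (rule indepD[OF iM _ z that])
    fix c assume "c \<in> C"
    have "m (l b) c * b \<in> M" if "b \<in> B" for b
      by (rule M'(6)) (use C(4) \<open>c \<in> C\<close> that B(2) M(2) in auto)
    then show "(\<Sum>b\<in>B. m (l b) c * b) \<in> M" by (intro subring_set_sum M'(1))
  qed
  have "m (l b) c = 0" if "c \<in> C" for c
    by (rule indepD[OF B(3) _ zr b]) (use C(4) that in auto)
  then have "(\<Sum>c\<in>C. m (l b) c * c) = 0" by simp
  moreover have "l b = (\<Sum>c\<in>C. m (l b) c * c)" by (intro C(5)[rule_format] imageI b)
  ultimately show "l b = 0" by simp
qed

text \<open>Artin's argument: a shortest linear relation has its coefficients in the fixed field.\<close>

lemma artin_indep:
  assumes M: "subfield_set M" and fin: "finite B" and iL: "indep L B"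
    and H: "\<And>h. h \<in> H \<Longrightarrow> rhom M h \<and> h ` M \<subseteq> M"
    and rel: "\<And>h l. h \<in> H \<Longrightarrow> (\<And>b. b \<in> B \<Longrightarrow> l b \<in> M) \<Longrightarrow> (\<Sum>b\<in>B. l b * b) = 0 \<Longrightarrow> (\<Sum>b\<in>B. h (l b) * b) = 0"
    and fixed: "\<And>x. x \<in> M \<Longrightarrow> (\<And>h. h \<in> H \<Longrightarrow> h x = x) \<Longrightarrow> x \<in> L"
  shows "indep M B"
proof -
  note M' = subfield_setD[OF M]
  have "\<forall>b\<in>B. l b = 0" if "\<And>b. b \<in> B \<Longrightarrow> l b \<in> M" "(\<Sum>b\<in>B. l b * b) = 0" for l
    using that
  proof (induction "card {b \<in> B. l b \<noteq> 0}" arbitrary: l rule: less_induct)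
    case less
    show ?case
    proof (rule ccontr)
      assume "\<not> (\<forall>b\<in>B. l b = 0)"
      then obtain a where a: "a \<in> B" "l a \<noteq> 0" by blast
      define k where "k b = l b / l a" for b
      have kM: "k b \<in> M" if "b \<in> B" for b unfolding k_def by (rule M'(9)[OF less.prems(1)[OF that] less.prems(1)[OF a(1)]])
      have k0: "(\<Sum>b\<in>B. k b * b) = 0"
        using less.prems(2) unfolding k_def by (simp add: sum_divide_distrib[symmetric])
      have ka: "k a = 1" unfolding k_def using a by simp
      have kfix: "h (k b) = k b" if h: "h \<in> H" and b: "b \<in> B" for h b
      proof -
        have hM: "rhom M h" "h ` M \<subseteq> M" using H[OF h] by auto
        \<comment> \<open>One coefficient of \<open>k\<close> is normalised to 1, so
          \<open>d\<close> vanishes there as well as wherever \<open>k\<close> vanishes: it is a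
          relation of strictly smaller support and is zero by induction.\<close>
        define d where "d b = h (k b) - k b" for b
        have sub: "{b \<in> B. d b \<noteq> 0} \<subset> {b \<in> B. l b \<noteq> 0}"
        proof
          show "{b \<in> B. d b \<noteq> 0} \<subseteq> {b \<in> B. l b \<noteq> 0}"
            unfolding d_def k_def using rhomD(2)[OF hM(1) M'(1)] by auto
          have "d a = 0" unfolding d_def ka using rhomD(1)[OF hM(1) M'(1)] by simp
          then show "{b \<in> B. d b \<noteq> 0} \<noteq> {b \<in> B. l b \<noteq> 0}" using a by blast
        qed
        have "card {b \<in> B. d b \<noteq> 0} < card {b \<in> B. l b \<noteq> 0}"
          by (rule psubset_card_mono[OF _ sub]) (use fin in simp)
        moreover have "d b \<in> M" if "b \<in> B" for b unfolding d_def by (rule M'(7)) (use kM[OF that] hM(2) in auto)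
        moreover have "(\<Sum>b\<in>B. d b * b) = 0"
          unfolding d_def using rel[OF h kM k0] k0 by (simp add: left_diff_distrib sum_subtractf)
        ultimately have "\<forall>b\<in>B. d b = 0" by (rule less.hyps)
        then show ?thesis using b unfolding d_def by simp
      qed
      have "k b \<in> L" if "b \<in> B" for b by (rule fixed[OF kM[OF that]]) (rule kfix[OF _ that])
      then have "k a = 0" by (rule indepD[OF iL _ k0 a(1)])
      then show False using ka by simp
    qed
  qed
  then show ?thesis unfolding indep_def by blast
qed

text \<open>The image of the tensor product of \<open>M\<close> and \<open>N\<close> under
  multiplication. Lists allow repeated pairs, and appending them gives addition.\<close>

definition span_ring :: "'a::field set \<Rightarrow> 'a set \<Rightarrow> 'a set"
  where "span_ring M N = {\<Sum>(x, y)\<leftarrow>ps. x * y | ps. set ps \<subseteq> M \<times> N}"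

lemma sum_list_prod_pairs:
  fixes F G :: "'b \<Rightarrow> 'a::comm_semiring_0"
  shows "sum_list (map F ps) * sum_list (map G qs) = sum_list (concat (map (\<lambda>p. map (\<lambda>q. F p * G q) qs) ps))"
  by (induction ps) (auto simp: distrib_right sum_list_const_mult)

lemma set_prod_pairs:
  assumes "subfield_set M" "subfield_set N" "set ps \<subseteq> M \<times> N" "set qs \<subseteq> M \<times> N"
  shows "set (concat (map (\<lambda>p. map (\<lambda>q. (fst p * fst q, snd p * snd q)) qs) ps)) \<subseteq> M \<times> N"
proof
  fix r assume "r \<in> set (concat (map (\<lambda>p. map (\<lambda>q. (fst p * fst q, snd p * snd q)) qs) ps))"
  then obtain p q where pq: "p \<in> set ps" "q \<in> set qs" "r = (fst p * fst q, snd p * snd q)" by auto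
  have "fst p \<in> M" "snd p \<in> N" "fst q \<in> M" "snd q \<in> N" using pq(1,2) assms(3,4) by auto
  then show "r \<in> M \<times> N" unfolding pq(3) using assms(1,2) by (simp add: subfield_setD(6))
qed

lemma span_ringI: "x \<in> M \<Longrightarrow> y \<in> N \<Longrightarrow> x * y \<in> span_ring M N"
  unfolding span_ring_def by (rule CollectI, rule exI[of _ "[(x, y)]"]) auto

lemma span_ring_sum:
  assumes "finite I" "\<And>i. i \<in> I \<Longrightarrow> x i \<in> M" "\<And>i. i \<in> I \<Longrightarrow> y i \<in> N"
  shows "(\<Sum>i\<in>I. x i * y i) \<in> span_ring M N"
proof -
  obtain js where "set js = I" "distinct js" using finite_distinct_list[OF assms(1)] by blast
  then have "(\<Sum>i\<in>I. x i * y i) = (\<Sum>(x, y)\<leftarrow>map (\<lambda>i. (x i, y i)) js. x * y)"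
    by (simp add: sum_list_distinct_conv_sum_set o_def)
  moreover have "set (map (\<lambda>i. (x i, y i)) js) \<subseteq> M \<times> N" using assms \<open>set js = I\<close> by auto
  ultimately show ?thesis unfolding span_ring_def by blast
qed

lemma span_ring_rep:
  assumes "z \<in> span_ring M N"
  shows "\<exists>(n::nat) x y. (\<forall>i<n. x i \<in> M) \<and> (\<forall>i<n. y i \<in> N) \<and> z = (\<Sum>i<n. x i * y i)"
proof -
  obtain ps where ps: "z = (\<Sum>(x, y)\<leftarrow>ps. x * y)" "set ps \<subseteq> M \<times> N" using assms unfolding span_ring_def by blast
  have "z = (\<Sum>i<length ps. fst (ps ! i) * snd (ps ! i))"
    unfolding ps(1) by (simp add: sum_list_sum_nth case_prod_unfold lessThan_atLeast0)
  moreover have "ps ! i \<in> M \<times> N" if "i < length ps" for i using ps(2) nth_mem[OF that] by blast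
  then have "\<forall>i<length ps. fst (ps ! i) \<in> M" "\<forall>i<length ps. snd (ps ! i) \<in> N" by (auto simp: mem_Times_iff)
  ultimately show ?thesis by (intro exI conjI)
qed

lemma span_ring_left: "1 \<in> N \<Longrightarrow> x \<in> M \<Longrightarrow> x \<in> span_ring M N"
  using span_ringI[of x M 1 N] by simp

lemma span_ring_right: "1 \<in> M \<Longrightarrow> y \<in> N \<Longrightarrow> y \<in> span_ring M N"
  using span_ringI[of 1 M y N] by simp

lemma subring_set_span_ring:
  assumes M: "subfield_set M" and N: "subfield_set N"
  shows "subring_set (span_ring M N)"
proof (rule subring_setI)
  note M' = subfield_setD[OF M] and N' = subfield_setD[OF N]
  show "0 \<in> span_ring M N" "1 \<in> span_ring M N" using span_ring_left[of N] M' N' by auto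
  fix z w assume "z \<in> span_ring M N" "w \<in> span_ring M N"
  then obtain ps qs where ps: "z = (\<Sum>(x, y)\<leftarrow>ps. x * y)" "set ps \<subseteq> M \<times> N"
    and qs: "w = (\<Sum>(x, y)\<leftarrow>qs. x * y)" "set qs \<subseteq> M \<times> N" unfolding span_ring_def by blast
  show "z + w \<in> span_ring M N"
    unfolding span_ring_def using ps qs by (intro CollectI exI[of _ "ps @ qs"]) auto
  define rs where "rs = concat (map (\<lambda>p. map (\<lambda>q. (fst p * fst q, snd p * snd q)) qs) ps)"
  have "z * w = (\<Sum>(x, y)\<leftarrow>rs. x * y)"
    unfolding ps qs sum_list_prod_pairs rs_def by (simp add: map_concat o_def case_prod_unfold mult_ac)
  moreover have "set rs \<subseteq> M \<times> N" unfolding rs_def by (rule set_prod_pairs[OF M N ps(2) qs(2)])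
  ultimately show "z * w \<in> span_ring M N" unfolding span_ring_def by blast
next
  note M' = subfield_setD[OF M] and N' = subfield_setD[OF N]
  fix z assume "z \<in> span_ring M N"
  from span_ring_rep[OF this] obtain n :: nat and x y
    where z: "\<forall>i<n. x i \<in> M" "\<forall>i<n. y i \<in> N" "z = (\<Sum>i<n. x i * y i)" by (elim exE conjE)
  have "- z = (\<Sum>i<n. (- x i) * y i)" unfolding z(3) by (simp add: sum_negf)
  moreover have "(\<Sum>i<n. (- x i) * y i) \<in> span_ring M N" by (rule span_ring_sum) (use z(1,2) M' in auto)
  ultimately show "- z \<in> span_ring M N" by simp
qed

lemma span_ring_subset: "subring_set R \<Longrightarrow> M \<subseteq> R \<Longrightarrow> N \<subseteq> R \<Longrightarrow> span_ring M N \<subseteq> R"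
proof
  fix z assume R: "subring_set R" "M \<subseteq> R" "N \<subseteq> R" and zs: "z \<in> span_ring M N"
  from span_ring_rep[OF zs] obtain n :: nat and x y
    where z: "\<forall>i<n. x i \<in> M" "\<forall>i<n. y i \<in> N" "z = (\<Sum>i<n. x i * y i)" by (elim exE conjE)
  then show "z \<in> R" unfolding z(3) using R by (intro subring_set_sum subring_setD(5)) auto
qed

text \<open>By linear disjointness every relation between products is a consequence of relations
  over \<open>L\<close>: expanding the \<open>y i\<close> along an \<open>L\<close>-basis makes each
  coefficient vanish in \<open>M\<close>. Applying \<open>f\<close> to these coefficients and
  reassembling gives the claim.\<close>

lemma span_ring_hom_well_defined:
  fixes f g :: "'a::field \<Rightarrow> 'b::comm_ring_1"
  assumes L: "subfield_set L" and M: "subfield_set M" "L \<subseteq> M" and N: "subfield_set N" "L \<subseteq> N"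
    and ld: "lin_disj L M N" and f: "rhom M f" and g: "rhom N g" and fg: "\<And>x. x \<in> L \<Longrightarrow> f x = g x"
    and xy: "\<And>i. i < n \<Longrightarrow> x i \<in> M" "\<And>i. i < n \<Longrightarrow> y i \<in> N" and z: "(\<Sum>i<(n::nat). x i * y i) = 0"
  shows "(\<Sum>i<n. f (x i) * g (y i)) = 0"
proof -
  note M' = subfield_setD[OF M(1)] and N' = subfield_setD[OF N(1)]
  note f' = rhomD[OF f M'(1)] and g' = rhomD[OF g N'(1)]
  obtain C m where C: "C \<subseteq> y ` {..<n}" "finite C" "indep L C"
    "\<forall>s\<in>y ` {..<n}. \<forall>c\<in>C. m s c \<in> L" "\<forall>s\<in>y ` {..<n}. s = (\<Sum>c\<in>C. m s c * c)"
    using span_basis_choice[OF L finite_imageI[OF finite_lessThan[of n], of y]] by (elim exE conjE)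
  have CN: "C \<subseteq> N" using C(1) xy(2) by blast
  then have iM: "indep M C" using ld C unfolding lin_disj_def by blast
  have mL: "m (y i) c \<in> L" if "i < n" "c \<in> C" for i c using C(4) that by blast
  have yi: "y i = (\<Sum>c\<in>C. m (y i) c * c)" if "i < n" for i by (rule C(5)[rule_format]) (use that in auto)
  have "(\<Sum>i<n. x i * y i) = (\<Sum>i<n. x i * (\<Sum>c\<in>C. m (y i) c * c))"
  proof (rule sum.cong)
    fix i assume "i \<in> {..<n}"
    then have "y i = (\<Sum>c\<in>C. m (y i) c * c)" by (intro yi) simp
    then show "x i * y i = x i * (\<Sum>c\<in>C. m (y i) c * c)" by (rule arg_cong)
  qed simp
  also have "\<dots> = (\<Sum>i<n. \<Sum>c\<in>C. x i * m (y i) c * c)" by (simp add: sum_distrib_left mult.assoc)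
  also have "\<dots> = (\<Sum>c\<in>C. \<Sum>i<n. x i * m (y i) c * c)" by (rule sum.swap)
  also have "\<dots> = (\<Sum>c\<in>C. (\<Sum>i<n. x i * m (y i) c) * c)" by (simp add: sum_distrib_right)
  finally have z': "(\<Sum>c\<in>C. (\<Sum>i<n. x i * m (y i) c) * c) = 0" using z by simp
  have xm: "x i * m (y i) c \<in> M" if "i < n" "c \<in> C" for i c by (rule M'(6)) (use xy(1) mL that M(2) in auto)
  have zero: "(\<Sum>i<n. x i * m (y i) c) = 0" if "c \<in> C" for c
    by (rule indepD[OF iM _ z' that]) (use xm in \<open>auto intro!: subring_set_sum M'(1)\<close>)
  have "(\<Sum>i<n. f (x i) * g (y i)) = (\<Sum>i<n. f (x i) * (\<Sum>c\<in>C. f (m (y i) c) * g c))"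
  proof (rule sum.cong)
    fix i assume "i \<in> {..<n}"
    then have i: "i < n" by simp
    have "g (y i) = g (\<Sum>c\<in>C. m (y i) c * c)" using yi[OF i] by simp
    also have "\<dots> = (\<Sum>c\<in>C. g (m (y i) c * c))"
      by (rule rhom_sum[OF g N'(1)]) (rule N'(6); use mL[OF i] CN N(2) in auto)
    also have "\<dots> = (\<Sum>c\<in>C. f (m (y i) c) * g c)"
    proof (rule sum.cong)
      fix c assume c: "c \<in> C"
      have "m (y i) c \<in> N" "c \<in> N" using mL[OF i c] N(2) CN c by auto
      then show "g (m (y i) c * c) = f (m (y i) c) * g c" using g'(4) fg[OF mL[OF i c]] by simp
    qed simp
    finally show "f (x i) * g (y i) = f (x i) * (\<Sum>c\<in>C. f (m (y i) c) * g c)" by simp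
  qed simp
  also have "\<dots> = (\<Sum>i<n. \<Sum>c\<in>C. f (x i) * f (m (y i) c) * g c)" by (simp add: sum_distrib_left mult.assoc)
  also have "\<dots> = (\<Sum>c\<in>C. \<Sum>i<n. f (x i) * f (m (y i) c) * g c)" by (rule sum.swap)
  also have "\<dots> = (\<Sum>c\<in>C. (\<Sum>i<n. f (x i) * f (m (y i) c)) * g c)" by (simp add: sum_distrib_right)
  also have "\<dots> = (\<Sum>c\<in>C. f (\<Sum>i<n. x i * m (y i) c) * g c)"
  proof (rule sum.cong)
    fix c assume c: "c \<in> C"
    have "f (\<Sum>i<n. x i * m (y i) c) = (\<Sum>i<n. f (x i * m (y i) c))"
      by (rule rhom_sum[OF f M'(1)]) (use xm c in simp)
    also have "\<dots> = (\<Sum>i<n. f (x i) * f (m (y i) c))"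
    proof (rule sum.cong)
      fix i assume "i \<in> {..<n}"
      then have "x i \<in> M" "m (y i) c \<in> M" using xy(1) mL[OF _ c] M(2) by auto
      then show "f (x i * m (y i) c) = f (x i) * f (m (y i) c)" by (rule f'(4))
    qed simp
    finally show "(\<Sum>i<n. f (x i) * f (m (y i) c)) * g c = f (\<Sum>i<n. x i * m (y i) c) * g c" by simp
  qed simp
  also have "\<dots> = 0" using zero f'(2) by simp
  finally show ?thesis .
qed

text \<open>Universal property of the tensor product over \<open>L\<close>, with which
  \<open>span_ring M N\<close> may be identified under linear disjointness. Here \<open>v\<close>
  evaluates a list of pairs in the source and \<open>w\<close> in the target.\<close>

lemma span_ring_hom:
  fixes f g :: "'a::field \<Rightarrow> 'b::comm_ring_1"
  assumes L: "subfield_set L" and M: "subfield_set M" "L \<subseteq> M" and N: "subfield_set N" "L \<subseteq> N"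
    and ld: "lin_disj L M N" and f: "rhom M f" and g: "rhom N g" and fg: "\<And>x. x \<in> L \<Longrightarrow> f x = g x"
  shows "\<exists>h. rhom (span_ring M N) h \<and> (\<forall>x\<in>M. h x = f x) \<and> (\<forall>y\<in>N. h y = g y)"
proof -
  note M' = subfield_setD[OF M(1)] and N' = subfield_setD[OF N(1)]
  note f' = rhomD[OF f M'(1)] and g' = rhomD[OF g N'(1)]
  define v where "v ps = (\<Sum>(x, y)\<leftarrow>ps. x * y)" for ps :: "('a \<times> 'a) list"
  define w where "w ps = (\<Sum>(x, y)\<leftarrow>ps. f x * g y)" for ps
  have wd0: "w ps = 0" if "set ps \<subseteq> M \<times> N" "v ps = 0" for ps
  proof -
    have "ps ! i \<in> M \<times> N" if "i < length ps" for i using \<open>set ps \<subseteq> M \<times> N\<close> nth_mem[OF that] by blast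
    then have "(\<Sum>i<length ps. f (fst (ps ! i)) * g (snd (ps ! i))) = 0"
      using that(2) unfolding v_def
      by (intro span_ring_hom_well_defined[OF L M N ld f g fg])
        (auto simp: mem_Times_iff sum_list_sum_nth case_prod_unfold lessThan_atLeast0)
    then show ?thesis unfolding w_def by (simp add: sum_list_sum_nth case_prod_unfold lessThan_atLeast0)
  qed
  have v_app: "v (ps @ qs) = v ps + v qs" "w (ps @ qs) = w ps + w qs" for ps qs unfolding v_def w_def by auto
  \<comment> \<open>Negating the left entries reduces equality of two values to the case of a
    vanishing sum.\<close>
  define neg where "neg ps = map (\<lambda>(x, y). (- x, y)) ps" for ps :: "('a \<times> 'a) list"
  have neg: "set (neg ps) \<subseteq> M \<times> N \<and> v (neg ps) = - v ps \<and> w (neg ps) = - w ps" if "set ps \<subseteq> M \<times> N" for ps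
    using that unfolding neg_def by (induction ps) (auto simp: v_def w_def f' M')
  have wd: "w ps = w qs" if "set ps \<subseteq> M \<times> N" "set qs \<subseteq> M \<times> N" "v ps = v qs" for ps qs
    using wd0[of "ps @ neg qs"] neg[OF that(2)] that v_app by simp
  define pr where "pr ps qs = concat (map (\<lambda>p. map (\<lambda>q. (fst p * fst q, snd p * snd q)) qs) ps)"
    for ps qs :: "('a \<times> 'a) list"
  have pr: "set (pr ps qs) \<subseteq> M \<times> N" "v (pr ps qs) = v ps * v qs" "w (pr ps qs) = w ps * w qs"
    if "set ps \<subseteq> M \<times> N" "set qs \<subseteq> M \<times> N" for ps qs
  proof -
    show "set (pr ps qs) \<subseteq> M \<times> N" unfolding pr_def by (rule set_prod_pairs[OF M(1) N(1) that])
    show "v (pr ps qs) = v ps * v qs"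
      unfolding v_def sum_list_prod_pairs pr_def by (simp add: map_concat o_def case_prod_unfold mult_ac)
    have "w (pr ps qs) = sum_list (concat (map (\<lambda>p. map (\<lambda>q. f (fst p * fst q) * g (snd p * snd q)) qs) ps))"
      unfolding w_def pr_def by (simp add: map_concat o_def case_prod_unfold)
    also have "\<dots> = sum_list (concat (map (\<lambda>p. map (\<lambda>q. (f (fst p) * g (snd p)) * (f (fst q) * g (snd q))) qs) ps))"
    proof (intro arg_cong[where f = sum_list] arg_cong[where f = concat] map_cong refl)
      fix p q assume "p \<in> set ps" "q \<in> set qs"
      then have "fst p \<in> M" "snd p \<in> N" "fst q \<in> M" "snd q \<in> N" using that by auto
      then show "f (fst p * fst q) * g (snd p * snd q) = (f (fst p) * g (snd p)) * (f (fst q) * g (snd q))"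
        using f' g' by (simp add: mult_ac)
    qed
    also have "\<dots> = w ps * w qs" unfolding w_def sum_list_prod_pairs case_prod_unfold ..
    finally show "w (pr ps qs) = w ps * w qs" .
  qed
  define h where "h z = w (SOME ps. set ps \<subseteq> M \<times> N \<and> v ps = z)" for z
  have h: "h (v ps) = w ps" if "set ps \<subseteq> M \<times> N" for ps
  proof -
    have "\<exists>qs. set qs \<subseteq> M \<times> N \<and> v qs = v ps" using that by blast
    from someI_ex[OF this] show ?thesis unfolding h_def using wd that by blast
  qed
  have rep: "\<exists>ps. set ps \<subseteq> M \<times> N \<and> z = v ps" if "z \<in> span_ring M N" for z
    using that unfolding span_ring_def v_def by blast
  have hM: "h x = f x" if "x \<in> M" for x
    using h[of "[(x, 1)]"] that N' g' by (simp add: v_def w_def)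
  have hN: "h y = g y" if "y \<in> N" for y
    using h[of "[(1, y)]"] that M' f' by (simp add: v_def w_def)
  have "rhom (span_ring M N) h"
    unfolding rhom_def
  proof (intro conjI ballI)
    show "h 1 = 1" using hM M' f' by simp
    fix x y assume "x \<in> span_ring M N" "y \<in> span_ring M N"
    then obtain ps qs where ps: "set ps \<subseteq> M \<times> N" "x = v ps" and qs: "set qs \<subseteq> M \<times> N" "y = v qs"
      using rep by meson
    show "h (x + y) = h x + h y" using h[OF ps(1)] h[OF qs(1)] h[of "ps @ qs"] ps qs v_app by simp
    show "h (x * y) = h x * h y" using h[OF ps(1)] h[OF qs(1)] h[OF pr(1)[OF ps(1) qs(1)]] pr[OF ps(1) qs(1)] ps(2) qs(2) by simp
  qed
  then show ?thesis using hM hN by blast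
qed

text \<open>The inverse of an algebraic element is a polynomial in it, so it already lies in the
  ring.\<close>

lemma subfield_set_of_algebraic:
  assumes A: "subfield_set A" and R: "subring_set R" "A \<subseteq> R" and alg: "\<And>x. x \<in> R \<Longrightarrow> algebraic_over A x"
  shows "subfield_set R"
  unfolding subfield_set_def
proof (intro conjI ballI R(1))
  fix x assume x: "x \<in> R"
  have "inverse x \<in> fgen (A \<union> {x})"
    using subfield_setD(8)[OF subfield_set_fgen] fgen_incl[of "A \<union> {x}"] by blast
  then obtain p where "poly_over A p" "inverse x = poly p x" unfolding fgen_simple[OF A alg[OF x]] by blast
  then show "inverse x \<in> R" using poly_in_subring[OF R(1) poly_over_mono[OF _ R(2)] x] by auto
qed

section \<open>Galois groups\<close>

lemma galois_group_carrier_iff: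
  assumes "subring_set N"
  shows "\<sigma> \<in> carrier (galois_group N M) \<longleftrightarrow>
    \<sigma> \<in> extensional N \<and> bij_betw \<sigma> N N \<and> rhom N \<sigma> \<and> (\<forall>x\<in>M. \<sigma> x = x)"
  using subring_setD(2)[OF assms] bij_betw_imp_funcset[of \<sigma> N N]
  unfolding galois_group_def Bij_def rhom_def ring_hom_def
  by (auto simp: univ_field_simps)

lemma galois_group_mult:
  assumes "\<sigma> \<in> carrier (galois_group N M)" "\<tau> \<in> carrier (galois_group N M)"
  shows "\<sigma> \<otimes>\<^bsub>galois_group N M\<^esub> \<tau> = compose N \<sigma> \<tau>"
  using assms unfolding galois_group_def BijGroup_def by simp

lemma galois_group_one: "\<one>\<^bsub>galois_group N M\<^esub> = (\<lambda>x\<in>N. x)"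
  unfolding galois_group_def BijGroup_def by simp

lemma galois_groupD:
  assumes "subring_set N" "\<sigma> \<in> carrier (galois_group N M)"
  shows "\<sigma> \<in> extensional N" "bij_betw \<sigma> N N" "rhom N \<sigma>" "x \<in> M \<Longrightarrow> \<sigma> x = x" "x \<in> N \<Longrightarrow> \<sigma> x \<in> N"
  using assms(2) bij_betwE[of \<sigma> N N] unfolding galois_group_carrier_iff[OF assms(1)] by auto

lemma galois_group_compose:
  assumes N: "subring_set N" and M: "M \<subseteq> N"
    and s: "\<sigma> \<in> carrier (galois_group N M)" and t: "\<tau> \<in> carrier (galois_group N M)"
  shows "compose N \<sigma> \<tau> \<in> carrier (galois_group N M)"
  unfolding galois_group_carrier_iff[OF N]
proof (intro conjI ballI)
  note s' = galois_groupD[OF N s] and t' = galois_groupD[OF N t]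
  show "compose N \<sigma> \<tau> \<in> extensional N" by (simp add: compose_def)
  show "bij_betw (compose N \<sigma> \<tau>) N N" by (rule bij_betw_compose[OF t'(2) s'(2)])
  have "rhom N (\<lambda>x. \<sigma> (\<tau> x))" by (rule rhom_comp[OF t'(3) s'(3)]) (use t'(5) in auto)
  then show "rhom N (compose N \<sigma> \<tau>)" by (rule rhom_cong[OF _ N]) (simp add: compose_def)
  show "compose N \<sigma> \<tau> x = x" if "x \<in> M" for x
    using that M t'(4)[OF that] s'(4)[OF that] by (auto simp: compose_def)
qed

lemma galois_group_one_mem:
  assumes "subring_set N" "M \<subseteq> N" shows "(\<lambda>x\<in>N. x) \<in> carrier (galois_group N M)"
  unfolding galois_group_carrier_iff[OF assms(1)]
proof (intro conjI ballI)
  show "bij_betw (\<lambda>x\<in>N. x) N N" by (simp add: bij_betw_def inj_on_def)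
  show "rhom N (\<lambda>x\<in>N. x)" by (rule rhom_cong[OF rhom_id assms(1)]) simp
qed (use assms in auto)

lemma galois_group_inverse:
  assumes N: "subfield_set N" and M: "M \<subseteq> N" and s: "\<sigma> \<in> carrier (galois_group N M)"
  obtains \<tau> where "\<tau> \<in> carrier (galois_group N M)" "\<And>x. x \<in> N \<Longrightarrow> \<sigma> (\<tau> x) = x" "\<And>x. x \<in> N \<Longrightarrow> \<tau> (\<sigma> x) = x"
proof -
  note R = subfield_setD(1)[OF N]
  note N' = subfield_setD[OF N]
  note s' = galois_groupD[OF R s]
  note r = rhomD[OF s'(3) R]
  define \<tau> where "\<tau> = restrict (inv_into N \<sigma>) N"
  have bij: "bij_betw \<tau> N N" unfolding \<tau>_def using bij_betw_inv_into[OF s'(2)] by (simp add: bij_betw_def inj_on_def)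
  have st: "\<sigma> (\<tau> x) = x" if "x \<in> N" for x
    using that bij_betw_inv_into_right[OF s'(2)] unfolding \<tau>_def by simp
  have ts: "\<tau> (\<sigma> x) = x" if "x \<in> N" for x
    using that bij_betw_inv_into_left[OF s'(2)] s'(5) unfolding \<tau>_def by simp
  have tN: "\<tau> x \<in> N" if "x \<in> N" for x using bij_betwE[OF bij] that by blast
  have "rhom N \<tau>"
    unfolding rhom_def
  proof (intro conjI ballI)
    show "\<tau> 1 = 1" using ts[of 1] r(1) N' by simp
    fix x y assume xy: "x \<in> N" "y \<in> N"
    show "\<tau> (x + y) = \<tau> x + \<tau> y"
      using ts[of "\<tau> x + \<tau> y"] r(3)[OF tN[OF xy(1)] tN[OF xy(2)]] st xy tN N' by simp
    show "\<tau> (x * y) = \<tau> x * \<tau> y"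
      using ts[of "\<tau> x * \<tau> y"] r(4)[OF tN[OF xy(1)] tN[OF xy(2)]] st xy tN N' by simp
  qed
  moreover have "\<tau> x = x" if "x \<in> M" for x using ts[of x] s'(4)[OF that] that M by auto
  ultimately have "\<tau> \<in> carrier (galois_group N M)"
    unfolding galois_group_carrier_iff[OF R] using bij by (auto simp: \<tau>_def)
  then show ?thesis using that st ts by blast
qed

text \<open>A homomorphism over \<open>K\<close> permutes the finitely many roots of every minimal polynomial.\<close>

lemma hom_separable_closure_bij:
  fixes K :: "'a::alg_closed_field set"
  assumes K: "subfield_set K" and h: "rhom (separable_closure_of K) h" and fix_K: "\<And>a. a \<in> K \<Longrightarrow> h a = a"
  shows "bij_betw h (separable_closure_of K) (separable_closure_of K)"
proof -
  let ?S = "separable_closure_of K"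
  note Sf = subfield_set_separable_closure[OF K]
  note KS = subset_separable_closure[OF K]
  have inj: "inj_on h ?S" by (rule rhom_field_inj_on[OF h Sf])
  have root: "poly f (h y) = 0" if "y \<in> ?S" "poly_over K f" "poly f y = 0" for y f
    by (rule roots_min_poly_subset_closed[OF K subfield_setD(1)[OF Sf] KS that(1) h fix_K that(2,3)])
  have sub: "h ` ?S \<subseteq> ?S"
  proof
    fix z assume "z \<in> h ` ?S"
    then obtain y where y: "y \<in> ?S" "z = h y" by blast
    then obtain f where f: "is_min_poly K y f" "rsquarefree f" unfolding separable_closure_of_iff separable_over_def by blast
    then have "separable_over K z" unfolding y(2)
      using root[OF y(1)] by (intro separable_overI[OF K, of f]) (auto simp: is_min_poly_def)
    then show "z \<in> ?S" by (simp add: separable_closure_of_iff)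
  qed
  have "?S \<subseteq> h ` ?S"
  proof
    fix y assume y: "y \<in> ?S"
    then obtain f where f: "is_min_poly K y f" "rsquarefree f" unfolding separable_closure_of_iff separable_over_def by blast
    then have f': "poly_over K f" "poly f y = 0" "f \<noteq> 0" by (auto simp: is_min_poly_def)
    let ?R = "{u. poly f u = 0}"
    have "?R \<subseteq> ?S" using separable_overI[OF K f'(1) f(2)] by (auto simp: separable_closure_of_iff)
    moreover have "finite ?R" by (rule poly_roots_finite[OF f'(3)])
    moreover have "h ` ?R \<subseteq> ?R" using root[OF _ f'(1)] \<open>?R \<subseteq> ?S\<close> by blast
    ultimately have "h ` ?R = ?R" using inj_on_subset[OF inj] by (intro endo_inj_surj) auto
    then have "y \<in> h ` ?R" using f'(2) by simp
    then show "y \<in> h ` ?S" using \<open>?R \<subseteq> ?S\<close> by blast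
  qed
  then show ?thesis using inj sub by (auto simp: bij_betw_def)
qed

text \<open>The homomorphism extends to the composite of \<open>B\<close> with the separable
  closure, and its restriction to that closure is automatically bijective. In the study of
  decomposition groups \<open>B\<close> is a residue field.\<close>

lemma galois_group_extend:
  fixes K :: "'a::alg_closed_field set"
  assumes K: "subfield_set K" and B: "subfield_set B" "K \<subseteq> B"
    and g: "rhom B g" and fix_K: "\<And>a. a \<in> K \<Longrightarrow> g a = a"
  shows "\<exists>\<sigma>\<in>carrier (absolute_galois_group K). \<forall>x\<in>B \<inter> separable_closure_of K. \<sigma> x = g x"
proof -
  let ?S = "separable_closure_of K"
  note Sr = subfield_setD(1)[OF subfield_set_separable_closure[OF K]]
  have alg: "algebraic_over B s" if s: "s \<in> ?S" for s
    by (rule algebraic_over_mono[OF separable_over_imp_algebraic B(2)]) (use s in \<open>simp add: separable_closure_of_iff\<close>)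
  have "\<exists>h. rhom (fgen (B \<union> ?S)) h \<and> (\<forall>x\<in>B. h x = g x)" by (rule rhom_extend[OF B(1) g alg])
  then obtain h where h: "rhom (fgen (B \<union> ?S)) h" "\<forall>x\<in>B. h x = g x" by (elim exE conjE)
  have SB: "?S \<subseteq> fgen (B \<union> ?S)" using fgen_incl[of "B \<union> ?S"] by simp
  have hS: "rhom ?S h" by (rule rhom_mono[OF h(1) SB])
  have hK: "h a = a" if "a \<in> K" for a using h(2) fix_K[OF that] that B(2) by auto
  have bij: "bij_betw h ?S ?S" by (rule hom_separable_closure_bij[OF K hS hK])
  have "restrict h ?S \<in> carrier (absolute_galois_group K)"
    unfolding galois_group_carrier_iff[OF Sr]
  proof (intro conjI ballI)
    show "bij_betw (restrict h ?S) ?S ?S" using bij by (simp add: bij_betw_def inj_on_def)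
    show "rhom ?S (restrict h ?S)" by (rule rhom_cong[OF hS Sr]) simp
    show "restrict h ?S x = x" if "x \<in> K" for x using that hK subset_separable_closure[OF K] by auto
  qed simp
  moreover have "restrict h ?S x = g x" if "x \<in> B \<inter> ?S" for x using h(2) that by simp
  ultimately show ?thesis by (intro bexI[of _ "restrict h ?S"] ballI)
qed

text \<open>Every embedding of \<open>K(x)\<close> over \<open>K\<close> is induced by an
  automorphism of the separable closure, so invariance under the group is invariance under all
  embeddings.\<close>

lemma absolute_galois_fixed:
  fixes K :: "'a::alg_closed_field set"
  assumes K: "subfield_set K" and x: "x \<in> separable_closure_of K"
    and fix_x: "\<And>\<sigma>. \<sigma> \<in> carrier (absolute_galois_group K) \<Longrightarrow> \<sigma> x = x"
  shows "x \<in> K"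
proof (rule fixed_by_homs_finite[OF K, of "{x}"])
  show xB: "x \<in> fgen (K \<union> {x})" using fgen_incl[of "K \<union> {x}"] by simp
  fix h :: "'a \<Rightarrow> 'a" assume h: "rhom (fgen (K \<union> {x})) h" "\<And>a. a \<in> K \<Longrightarrow> h a = a"
  have "K \<subseteq> fgen (K \<union> {x})" using fgen_incl[of "K \<union> {x}"] by simp
  from galois_group_extend[OF K subfield_set_fgen this h]
  obtain \<sigma> where s: "\<sigma> \<in> carrier (absolute_galois_group K)" "\<sigma> x = h x" using x xB by blast
  then show "h x = x" using fix_x[OF s(1)] by simp
qed (use x in \<open>auto simp: separable_closure_of_iff\<close>)

section \<open>Twisting by a weak solution\<close>

text \<open>All right-hand factors occurring in representations of the finitely many elements are
  expanded along one \<open>K\<close>-basis of their span. This replaces finitely many elements of a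
  composite by finitely many elements of one of its factors.\<close>

lemma span_ring_common_basis:
  assumes K: "subfield_set K" "K \<subseteq> M" and M: "subfield_set M" and V: "finite V" "V \<subseteq> span_ring M N"
  shows "\<exists>C m. C \<subseteq> N \<and> finite C \<and> indep K C \<and> (\<forall>v\<in>V. \<forall>c\<in>C. m v c \<in> M) \<and> (\<forall>v\<in>V. v = (\<Sum>c\<in>C. m v c * c))"
proof -
  have "\<forall>v\<in>V. \<exists>r :: nat \<times> (nat \<Rightarrow> 'a) \<times> (nat \<Rightarrow> 'a). (\<forall>i<fst r. fst (snd r) i \<in> M) \<and> (\<forall>i<fst r. snd (snd r) i \<in> N) \<and>
      v = (\<Sum>i<fst r. fst (snd r) i * snd (snd r) i)"
  proof
    fix v assume "v \<in> V"
    then have "v \<in> span_ring M N" using V(2) by blast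
    from span_ring_rep[OF this] obtain n :: nat and x y
      where "\<forall>i<n. x i \<in> M" "\<forall>i<n. y i \<in> N" "v = (\<Sum>i<n. x i * y i)" by (elim exE conjE)
    then show "\<exists>r :: nat \<times> (nat \<Rightarrow> 'a) \<times> (nat \<Rightarrow> 'a). (\<forall>i<fst r. fst (snd r) i \<in> M) \<and> (\<forall>i<fst r. snd (snd r) i \<in> N) \<and>
      v = (\<Sum>i<fst r. fst (snd r) i * snd (snd r) i)"
      by (intro exI[of _ "(n, x, y)"]) simp
  qed
  from bchoice[OF this] obtain r :: "'a \<Rightarrow> nat \<times> (nat \<Rightarrow> 'a) \<times> (nat \<Rightarrow> 'a)" where r: "\<forall>v\<in>V. (\<forall>i<fst (r v). fst (snd (r v)) i \<in> M) \<and>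
      (\<forall>i<fst (r v). snd (snd (r v)) i \<in> N) \<and> v = (\<Sum>i<fst (r v). fst (snd (r v)) i * snd (snd (r v)) i)"
    by (elim exE)
  define n where "n v = (fst (r v) :: nat)" for v
  define x where "x v = fst (snd (r v))" for v
  define y where "y v = snd (snd (r v))" for v
  have xy: "x v i \<in> M" "y v i \<in> N" if "v \<in> V" "i < n v" for v i
    using r[rule_format, OF that(1)] that(2) unfolding n_def x_def y_def by auto
  have v: "v = (\<Sum>i<n v. x v i * y v i)" if "v \<in> V" for v
    using r[rule_format, OF that] unfolding n_def x_def y_def by blast
  define S where "S = (\<Union>v\<in>V. y v ` {..<n v})"
  have "finite S" unfolding S_def using V(1) by blast
  from span_basis_choice[OF K(1) this] obtain C k where C: "C \<subseteq> S" "finite C" "indep K C"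
    "\<forall>s\<in>S. \<forall>b\<in>C. k s b \<in> K" "\<forall>s\<in>S. s = (\<Sum>b\<in>C. k s b * b)" by (elim exE conjE)
  have yS: "y v i \<in> S" if "v \<in> V" "i < n v" for v i unfolding S_def using that by blast
  define m where "m v c = (\<Sum>i<n v. x v i * k (y v i) c)" for v c
  have "C \<subseteq> N" using C(1) xy(2) unfolding S_def by blast
  moreover have "m v c \<in> M" if "v \<in> V" "c \<in> C" for v c
    unfolding m_def
  proof (rule subring_set_sum[OF subfield_setD(1)[OF M]])
    fix i assume "i \<in> {..<n v}"
    then have i: "i < n v" by simp
    have "k (y v i) c \<in> M" using C(4) yS[OF that(1) i] that(2) K(2) by blast
    then show "x v i * k (y v i) c \<in> M" by (rule subfield_setD(6)[OF M xy(1)[OF that(1) i]])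
  qed
  moreover have "v = (\<Sum>c\<in>C. m v c * c)" if "v \<in> V" for v
  proof -
    have "v = (\<Sum>i<n v. x v i * y v i)" by (rule v[OF that])
    also have "\<dots> = (\<Sum>i<n v. x v i * (\<Sum>c\<in>C. k (y v i) c * c))"
    proof (rule sum.cong)
      fix i assume "i \<in> {..<n v}"
      then have "y v i = (\<Sum>c\<in>C. k (y v i) c * c)" by (intro C(5)[rule_format] yS that) simp
      then show "x v i * y v i = x v i * (\<Sum>c\<in>C. k (y v i) c * c)" by (rule arg_cong)
    qed simp
    also have "\<dots> = (\<Sum>i<n v. \<Sum>c\<in>C. x v i * k (y v i) c * c)" by (simp add: sum_distrib_left mult.assoc)
    also have "\<dots> = (\<Sum>c\<in>C. \<Sum>i<n v. x v i * k (y v i) c * c)" by (rule sum.swap)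
    also have "\<dots> = (\<Sum>c\<in>C. m v c * c)" unfolding m_def by (simp add: sum_distrib_right)
    finally show ?thesis .
  qed
  ultimately show ?thesis using C(2,3) by (intro exI[of _ C] exI[of _ m] conjI ballI)
qed

text \<open>\<open>A\<close> stands for \<open>K(t)\<close> and \<open>Z\<close> for a finite
  generating set of \<open>F\<close> that is closed under conjugation, so \<open>F\<close> is finite
  Galois over \<open>A\<close>. The finite set \<open>W\<close> is the form in which continuity of
  \<open>\<theta>\<close> enters.\<close>

locale twist =
  fixes K A E F Z W :: "'a::alg_closed_field set" and \<theta> :: "('a \<Rightarrow> 'a) \<Rightarrow> ('a \<Rightarrow> 'a)"
  assumes K: "subfield_set K" and A: "subfield_set A" "K \<subseteq> A" and E: "subfield_set E" "A \<subseteq> E" "E \<subseteq> F"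
    and Z: "finite Z" and F: "F = fgen (A \<union> Z)"
    and Z_closed: "\<And>z. z \<in> Z \<Longrightarrow> \<exists>f. poly_over A f \<and> rsquarefree f \<and> poly f z = 0 \<and> {y. poly f y = 0} \<subseteq> Z"
    and regular: "lin_disj K (algebraic_closure_of K) E"
    and \<theta>: "\<And>\<sigma>. \<sigma> \<in> carrier (absolute_galois_group K) \<Longrightarrow> \<theta> \<sigma> \<in> carrier (galois_group F E)"
    and \<theta>_compose: "\<And>\<sigma> \<tau>. \<sigma> \<in> carrier (absolute_galois_group K) \<Longrightarrow> \<tau> \<in> carrier (absolute_galois_group K) \<Longrightarrow>
      \<theta> (compose (separable_closure_of K) \<sigma> \<tau>) = compose F (\<theta> \<sigma>) (\<theta> \<tau>)"
    and \<theta>_one: "\<theta> (\<lambda>x\<in>separable_closure_of K. x) = (\<lambda>x\<in>F. x)"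
    and \<theta>_const: "\<And>\<sigma> x. \<sigma> \<in> carrier (absolute_galois_group K) \<Longrightarrow> x \<in> F \<Longrightarrow> x \<in> separable_closure_of K \<Longrightarrow> \<theta> \<sigma> x = \<sigma> x"
    and W: "finite W" "W \<subseteq> separable_closure_of K"
    and \<theta>_W: "\<And>\<sigma> \<tau>. \<sigma> \<in> carrier (absolute_galois_group K) \<Longrightarrow> \<tau> \<in> carrier (absolute_galois_group K) \<Longrightarrow>
      (\<And>w. w \<in> W \<Longrightarrow> \<sigma> w = \<tau> w) \<Longrightarrow> \<theta> \<sigma> = \<theta> \<tau>"
begin

abbreviation "Ks \<equiv> separable_closure_of K"
abbreviation "Kb \<equiv> algebraic_closure_of K"
abbreviation "G \<equiv> carrier (absolute_galois_group K)"
abbreviation "T \<equiv> span_ring Ks F"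

lemma subfield_F: "subfield_set F" unfolding F by simp
lemma subfield_Ks: "subfield_set Ks" by (rule subfield_set_separable_closure[OF K])
lemma subfield_Kb: "subfield_set Kb" by (rule subfield_set_algebraic_closure[OF K])
lemma K_Ks: "K \<subseteq> Ks" by (rule subset_separable_closure[OF K])
lemma A_F: "A \<subseteq> F" using E by blast
lemma K_F: "K \<subseteq> F" using A A_F by blast
lemma Z_F: "Z \<subseteq> F" unfolding F using fgen_incl[of "A \<union> Z"] by simp

lemmas G_D = galois_groupD[OF subfield_setD(1)[OF subfield_Ks]]
lemmas \<theta>_D = galois_groupD[OF subfield_setD(1)[OF subfield_F] \<theta>]

lemma Ks_sep: "x \<in> Ks \<Longrightarrow> K \<subseteq> B \<Longrightarrow> subfield_set B \<Longrightarrow> separable_over B x"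
  using separable_over_mono by (auto simp: separable_closure_of_iff)

lemma hom_Ks:
  assumes h: "rhom R h" "subring_set R" "Ks \<subseteq> R" and fix_K: "\<And>a. a \<in> K \<Longrightarrow> h a = a" shows "h ` Ks \<subseteq> Ks"
  using hom_separable_closure_bij[OF K rhom_mono[OF h(1,3)] fix_K] by (simp add: bij_betw_def)

text \<open>Artin's argument with the homomorphisms of \<open>F Ks\<close> over \<open>F\<close>.
  They map \<open>Ks\<close> into itself since conjugates over \<open>K\<close> stay there, and an
  element of \<open>Ks\<close> fixed by all of them lies in \<open>F\<close> by
  separability.\<close>

lemma lin_disj_constants: "lin_disj (F \<inter> Ks) Ks F"
  unfolding lin_disj_def
proof (intro allI impI, elim conjE)
  fix B assume B: "finite B" "B \<subseteq> F" "indep (F \<inter> Ks) B"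
  let ?N = "fgen (F \<union> Ks)"
  define H where "H = {h :: 'a \<Rightarrow> 'a. rhom ?N h \<and> (\<forall>a\<in>F. h a = a)}"
  have N: "subring_set ?N" by (rule subfield_setD(1)) simp
  have FN: "F \<subseteq> ?N" "Ks \<subseteq> ?N" using fgen_incl[of "F \<union> Ks"] by auto
  show "indep Ks B"
  proof (rule artin_indep[OF subfield_Ks B(1,3), of H])
    show "rhom Ks h \<and> h ` Ks \<subseteq> Ks" if "h \<in> H" for h
      using that hom_Ks[OF _ N FN(2), of h] rhom_mono[OF _ FN(2), of h] K_F unfolding H_def by auto
  next
    fix h l assume h: "h \<in> H" and l: "\<And>b. b \<in> B \<Longrightarrow> l b \<in> Ks" "(\<Sum>b\<in>B. l b * b) = 0"
    have hN: "rhom ?N h" and hF: "\<And>a. a \<in> F \<Longrightarrow> h a = a" using h unfolding H_def by auto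
    have m: "l b \<in> ?N" "b \<in> ?N" if "b \<in> B" for b using l(1)[OF that] that B(2) FN by auto
    have "h (\<Sum>b\<in>B. l b * b) = (\<Sum>b\<in>B. h (l b * b))"
      by (rule rhom_sum[OF hN N]) (use m subring_setD(5)[OF N] in blast)
    also have "\<dots> = (\<Sum>b\<in>B. h (l b) * b)"
    proof (rule sum.cong)
      fix b assume b: "b \<in> B"
      have "h b = b" using hF b B(2) by blast
      then show "h (l b * b) = h (l b) * b" using rhomD(4)[OF hN N m[OF b]] by simp
    qed simp
    finally show "(\<Sum>b\<in>B. h (l b) * b) = 0" using l(2) rhomD(2)[OF hN N] by simp
  next
    fix x assume x: "x \<in> Ks" "\<And>h. h \<in> H \<Longrightarrow> h x = x"
    have ins: "insert x Ks = Ks" using x(1) by blast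
    have "x \<in> F"
    proof (rule fixed_in_separable_closure[OF subfield_F, of x Ks])
      show "separable_over F x" by (rule Ks_sep[OF x(1) K_F subfield_F])
      show "algebraic_over F s" if "s \<in> Ks" for s
        by (rule separable_over_imp_algebraic[OF Ks_sep[OF that K_F subfield_F]])
      show "h x = x" if "rhom (fgen (F \<union> insert x Ks)) h" "\<And>a. a \<in> F \<Longrightarrow> h a = a" for h
        using x(2)[of h] that unfolding H_def ins by blast
    qed
    then show "x \<in> F \<inter> Ks" using x(1) by blast
  qed
qed

text \<open>The tensor product of \<open>\<sigma>\<close> on \<open>Ks\<close> and
  \<open>\<theta> \<sigma>\<close> on \<open>F\<close>. Both agree on the common constants
  \<open>F \<inter> Ks\<close>, over which the two fields are linearly disjoint; its values on
  \<open>T\<close> are thereby determined.\<close>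

definition \<delta> :: "('a \<Rightarrow> 'a) \<Rightarrow> 'a \<Rightarrow> 'a"
  where "\<delta> \<sigma> = (SOME h. rhom T h \<and> (\<forall>x\<in>Ks. h x = \<sigma> x) \<and> (\<forall>x\<in>F. h x = \<theta> \<sigma> x))"

lemma \<delta>:
  assumes s: "\<sigma> \<in> G"
  shows "rhom T (\<delta> \<sigma>)" "x \<in> Ks \<Longrightarrow> \<delta> \<sigma> x = \<sigma> x" "x \<in> F \<Longrightarrow> \<delta> \<sigma> x = \<theta> \<sigma> x"
proof -
  have L: "subfield_set (F \<inter> Ks)"
    using subfield_setD[OF subfield_F] subfield_setD[OF subfield_Ks] by (intro subfield_setI) auto
  have "\<exists>h. rhom T h \<and> (\<forall>x\<in>Ks. h x = \<sigma> x) \<and> (\<forall>x\<in>F. h x = \<theta> \<sigma> x)"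
    by (rule span_ring_hom[OF L subfield_Ks _ subfield_F _ lin_disj_constants G_D(3)[OF s] \<theta>_D(3)[OF s]])
      (use \<theta>_const[OF s] in auto)
  from someI_ex[OF this] show "rhom T (\<delta> \<sigma>)" "x \<in> Ks \<Longrightarrow> \<delta> \<sigma> x = \<sigma> x" "x \<in> F \<Longrightarrow> \<delta> \<sigma> x = \<theta> \<sigma> x"
    unfolding \<delta>_def by auto
qed

lemma Ks_T: "Ks \<subseteq> T" using span_ring_left[OF subfield_setD(3)[OF subfield_F]] by blast
lemma F_T: "F \<subseteq> T" using span_ring_right[OF subfield_setD(3)[OF subfield_Ks]] by blast
lemma subring_T: "subring_set T" by (rule subring_set_span_ring[OF subfield_Ks subfield_F])

lemma Z_sep: "z \<in> Z \<Longrightarrow> separable_over A z"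
  using Z_closed[of z] separable_overI[OF A(1)] by blast

lemma generators_sep:
  assumes "x \<in> fgen (A \<union> (Z \<union> Ks))" shows "separable_over A x"
proof (rule separable_fgen[OF A(1) _ assms])
  show "separable_over A s" if "s \<in> Z \<union> Ks" for s using that Z_sep Ks_sep[OF _ A(2) A(1)] by blast
qed

lemma F_generators: "F \<subseteq> fgen (A \<union> (Z \<union> Ks))" unfolding F by (rule fgen_mono) blast

lemma T_subset: "T \<subseteq> fgen (A \<union> (Z \<union> Ks))"
  by (rule span_ring_subset[OF subfield_setD(1)[OF subfield_set_fgen] _ F_generators])
    (use fgen_incl[of "A \<union> (Z \<union> Ks)"] in simp)

lemma T_sep: "x \<in> T \<Longrightarrow> separable_over A x"
  using T_subset generators_sep by blast

lemma A_T: "A \<subseteq> T" using A_F F_T by blast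

lemma subfield_T: "subfield_set T"
  by (rule subfield_set_of_algebraic[OF A(1) subring_T A_T separable_over_imp_algebraic[OF T_sep]])

lemma T_eq: "T = fgen (A \<union> (Z \<union> Ks))"
proof
  show "fgen (A \<union> (Z \<union> Ks)) \<subseteq> T"
    by (rule fgen_minimal[OF subfield_T]) (use A_T Z_F F_T Ks_T in blast)
qed (rule T_subset)

definition D :: "'a set" where "D = {y \<in> T. \<forall>\<sigma>\<in>G. \<delta> \<sigma> y = y}"

lemma D_T: "D \<subseteq> T" unfolding D_def by blast

lemma subfield_D: "subfield_set D"
proof (rule subfield_setI)
  note T' = subfield_setD[OF subfield_T]
  note d = rhomD[OF \<delta>(1) subring_T]
  show "1 \<in> D" unfolding D_def using T'(3) d(1) by blast
  fix x assume x: "x \<in> D"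
  show "inverse x \<in> D"
    using x T'(8) rhom_field_inverse[OF \<delta>(1) subfield_T] unfolding D_def by auto
  fix y assume y: "y \<in> D"
  show "x - y \<in> D" using x y T'(7) d(6) unfolding D_def by auto
  show "x * y \<in> D" using x y T'(6) d(4) unfolding D_def by auto
qed

lemma E_D: "E \<subseteq> D"
proof
  fix x assume x: "x \<in> E"
  then have "x \<in> F" using E by blast
  then show "x \<in> D" unfolding D_def using F_T \<delta>(3) \<theta>_D(4)[OF _ x] by auto
qed

text \<open>Artin's argument for the group acting on \<open>Ks\<close>:
  \<open>\<delta> \<sigma>\<close> fixes the vectors in \<open>D\<close> and moves only the
  coefficients, so relations go to relations, and the fixed field of the group in \<open>Ks\<close>
  is \<open>K\<close>.\<close>

lemma lin_disj_D_Ks: "lin_disj K Ks D"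
  unfolding lin_disj_def
proof (intro allI impI, elim conjE)
  fix B assume B: "finite B" "B \<subseteq> D" "indep K B"
  show "indep Ks B"
  proof (rule artin_indep[OF subfield_Ks B(1,3), of G])
    show "rhom Ks h \<and> h ` Ks \<subseteq> Ks" if "h \<in> G" for h using G_D[OF that] by blast
  next
    fix \<sigma> l assume s: "\<sigma> \<in> G" and l: "\<And>b. b \<in> B \<Longrightarrow> l b \<in> Ks" "(\<Sum>b\<in>B. l b * b) = 0"
    have m: "l b \<in> T" "b \<in> T" if "b \<in> B" for b using l(1)[OF that] that B(2) D_T Ks_T by auto
    have "\<delta> \<sigma> (\<Sum>b\<in>B. l b * b) = (\<Sum>b\<in>B. \<delta> \<sigma> (l b * b))"
      by (rule rhom_sum[OF \<delta>(1)[OF s] subring_T]) (use m subring_setD(5)[OF subring_T] in blast)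
    also have "\<dots> = (\<Sum>b\<in>B. \<sigma> (l b) * b)"
    proof (rule sum.cong)
      fix b assume b: "b \<in> B"
      have "\<delta> \<sigma> b = b" using b B(2) s unfolding D_def by blast
      then show "\<delta> \<sigma> (l b * b) = \<sigma> (l b) * b"
        using rhomD(4)[OF \<delta>(1)[OF s] subring_T m[OF b]] \<delta>(2)[OF s l(1)[OF b]] by simp
    qed simp
    finally show "(\<Sum>b\<in>B. \<sigma> (l b) * b) = 0" using l(2) rhomD(2)[OF \<delta>(1)[OF s] subring_T] by simp
  qed (rule absolute_galois_fixed[OF K])
qed

text \<open>Regularity of \<open>E\<close> passes to \<open>E Ks\<close>: expand the coefficients along a basis inside \<open>E\<close>.\<close>

lemma indep_EKs:
  assumes B: "finite B" "B \<subseteq> Kb" "indep Ks B" shows "indep (fgen (E \<union> Ks)) B"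
proof -
  have KsKb: "Ks \<subseteq> Kb" by (rule separable_subset_algebraic_closure)
  have ET: "E \<subseteq> T" using E_D D_T by blast
  have sub: "span_ring Ks E \<subseteq> T" by (rule span_ring_subset[OF subring_T Ks_T ET])
  have EE: "E \<subseteq> span_ring Ks E" using span_ring_right[OF subfield_setD(3)[OF subfield_Ks]] by blast
  have KE: "Ks \<subseteq> span_ring Ks E" using span_ring_left[OF subfield_setD(3)[OF E(1)]] by blast
  have AE: "A \<subseteq> span_ring Ks E" using E EE by blast
  have sf: "subfield_set (span_ring Ks E)"
    by (rule subfield_set_of_algebraic[OF A(1) subring_set_span_ring[OF subfield_Ks E(1)] AE])
      (use separable_over_imp_algebraic[OF T_sep] sub in blast)
  have eq: "fgen (E \<union> Ks) \<subseteq> span_ring Ks E" by (rule fgen_minimal[OF sf]) (use EE KE in blast)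
  show ?thesis
    unfolding indep_def
  proof (intro allI impI ballI, elim conjE)
    fix l b assume l: "\<forall>b\<in>B. l b \<in> fgen (E \<union> Ks)" "(\<Sum>b\<in>B. l b * b) = 0" and b: "b \<in> B"
    have "l ` B \<subseteq> span_ring Ks E" using l(1) eq by blast
    from span_ring_common_basis[OF K K_Ks subfield_Ks finite_imageI[OF B(1)] this]
    obtain C m where C: "C \<subseteq> E" "finite C" "indep K C" "\<forall>v\<in>l ` B. \<forall>c\<in>C. m v c \<in> Ks"
      "\<forall>v\<in>l ` B. v = (\<Sum>c\<in>C. m v c * c)" by (elim exE conjE)
    have iC: "indep Kb C" using regular C(1-3) unfolding lin_disj_def by blast
    have "(\<Sum>b\<in>B. l b * b) = (\<Sum>b\<in>B. (\<Sum>c\<in>C. m (l b) c * c) * b)"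
    proof (rule sum.cong)
      fix b assume "b \<in> B"
      then have "l b = (\<Sum>c\<in>C. m (l b) c * c)" by (intro C(5)[rule_format]) simp
      then show "l b * b = (\<Sum>c\<in>C. m (l b) c * c) * b" by (rule arg_cong)
    qed simp
    also have "\<dots> = (\<Sum>b\<in>B. \<Sum>c\<in>C. m (l b) c * b * c)"
      by (simp add: sum_distrib_right sum_distrib_left mult_ac)
    also have "\<dots> = (\<Sum>c\<in>C. \<Sum>b\<in>B. m (l b) c * b * c)" by (rule sum.swap)
    also have "\<dots> = (\<Sum>c\<in>C. (\<Sum>b\<in>B. m (l b) c * b) * c)" by (simp add: sum_distrib_right)
    finally have z: "(\<Sum>c\<in>C. (\<Sum>b\<in>B. m (l b) c * b) * c) = 0" using l(2) by simp
    have zr: "(\<Sum>b\<in>B. m (l b) c * b) = 0" if "c \<in> C" for c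
    proof (rule indepD[OF iC _ z that])
      fix c assume c: "c \<in> C"
      show "(\<Sum>b\<in>B. m (l b) c * b) \<in> Kb"
      proof (rule subring_set_sum[OF subfield_setD(1)[OF subfield_Kb]])
        fix b assume "b \<in> B"
        then show "m (l b) c * b \<in> Kb"
          by (intro subfield_setD(6)[OF subfield_Kb]) (use C(4) c KsKb B(2) in auto)
      qed
    qed
    have "m (l b) c = 0" if "c \<in> C" for c
      by (rule indepD[OF B(3) _ zr b]) (use C(4) that in auto)
    then have "(\<Sum>c\<in>C. m (l b) c * c) = 0" by simp
    moreover have "l b = (\<Sum>c\<in>C. m (l b) c * c)" by (intro C(5)[rule_format] imageI b)
    ultimately show "l b = 0" by simp
  qed
qed

text \<open>An element that is both separable and purely inseparable over \<open>E Ks\<close> lies in \<open>E Ks\<close>.\<close>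

lemma T_EKb: assumes x: "x \<in> T" "x \<in> fgen (E \<union> Kb)" shows "x \<in> fgen (E \<union> Ks)"
proof (rule fixed_in_separable_closure[of _ x Kb])
  let ?N = "fgen (E \<union> Ks)"
  have EN: "E \<subseteq> ?N" "Ks \<subseteq> ?N" using fgen_incl[of "E \<union> Ks"] by auto
  show "separable_over ?N x"
    by (rule separable_over_mono[OF T_sep[OF x(1)]]) (use E EN in auto)
  show "algebraic_over ?N s" if "s \<in> Kb" for s
    by (rule algebraic_over_mono[of K]) (use that K_Ks EN in \<open>auto simp: algebraic_closure_of_def\<close>)
  fix h :: "'a \<Rightarrow> 'a" assume h: "rhom (fgen (?N \<union> insert x Kb)) h" "\<And>a. a \<in> ?N \<Longrightarrow> h a = a"
  let ?R = "fgen (?N \<union> insert x Kb)"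
  have R: "subring_set ?R" by (rule subfield_setD(1)) simp
  have NR: "?N \<subseteq> ?R" "Kb \<subseteq> ?R" using fgen_incl[of "?N \<union> insert x Kb"] by auto
  \<comment> \<open>Some Frobenius power of \<open>c\<close> lies in \<open>Ks\<close> and is fixed
    by \<open>h\<close>; injectivity of the power map then fixes \<open>c\<close> itself.\<close>
  have hKb: "h c = c" if c: "c \<in> Kb" for c
  proof -
    obtain q where q: "frobenius_exponent TYPE('a) q" "c ^ q \<in> Ks"
      using algebraic_closure_power[OF K, of "{c}"] c by auto
    have "c \<in> ?R" using c NR by blast
    then have "h (c ^ q) = h c ^ q" by (rule rhom_power[OF h(1) R])
    moreover have "h (c ^ q) = c ^ q" using h(2) q(2) EN by blast
    ultimately show ?thesis using frobenius_exponent_inj[OF q(1)] by metis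
  qed
  have sub: "fgen (E \<union> Kb) \<subseteq> ?R" by (rule fgen_minimal[OF subfield_set_fgen]) (use EN NR in blast)
  show "h x = x"
    by (rule rhom_fgen_eqI[OF rhom_mono[OF h(1) sub] rhom_id _ x(2)]) (use h(2) hKb EN in blast)
qed simp

text \<open>\<open>T\<close> is generated by \<open>A\<close>, \<open>Ks\<close> and the root-closed
  set \<open>Z\<close>, so homomorphisms over \<open>E Kb\<close> map it into itself. An element of
  \<open>T\<close> fixed by all of them lies in \<open>E Kb\<close> by separability, hence in
  \<open>E Ks\<close>, over which \<open>B\<close> is already independent.\<close>

lemma lin_disj_T_Kb: "lin_disj Ks T Kb"
  unfolding lin_disj_def
proof (intro allI impI, elim conjE)
  fix B assume B: "finite B" "B \<subseteq> Kb" "indep Ks B"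
  let ?M = "fgen (E \<union> Kb)"
  let ?N = "fgen (?M \<union> Z)"
  define H where "H = {h :: 'a \<Rightarrow> 'a. rhom ?N h \<and> (\<forall>a\<in>?M. h a = a)}"
  have N: "subring_set ?N" by (rule subfield_setD(1)) simp
  have M: "E \<subseteq> ?M" "Kb \<subseteq> ?M" using fgen_incl[of "E \<union> Kb"] by auto
  have MN: "?M \<subseteq> ?N" "Z \<subseteq> ?N" using fgen_incl[of "?M \<union> Z"] by auto
  have KsM: "Ks \<subseteq> ?M" using separable_subset_algebraic_closure[of K] M by blast
  have AM: "A \<subseteq> ?M" using E M by blast
  have TN: "T \<subseteq> ?N" unfolding T_eq by (rule fgen_minimal[OF subfield_set_fgen]) (use AM KsM MN in blast)
  show "indep T B"
  proof (rule artin_indep[OF subfield_T B(1) indep_EKs[OF B], of H])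
    fix h assume "h \<in> H"
    then have hN: "rhom ?N h" and hM: "\<And>a. a \<in> ?M \<Longrightarrow> h a = a" unfolding H_def by auto
    have hT: "rhom T h" by (rule rhom_mono[OF hN TN])
    have "h z \<in> Z" if z: "z \<in> Z" for z
    proof -
      obtain f where f: "poly_over A f" "poly f z = 0" "{y. poly f y = 0} \<subseteq> Z" using Z_closed[OF z] by blast
      have "A \<subseteq> ?N" "z \<in> ?N" "\<And>a. a \<in> A \<Longrightarrow> h a = a" using AM MN z hM by auto
      then have "poly f (h z) = 0"
        by (rule roots_min_poly_subset_closed[OF A(1) N _ _ hN _ f(1,2)])
      then show ?thesis using f(3) by blast
    qed
    then have "h x \<in> T" if "x \<in> A \<union> (Z \<union> Ks)" for x
    proof (cases "x \<in> Z")
      case True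
      then have "h x \<in> Z" using \<open>\<And>z. z \<in> Z \<Longrightarrow> h z \<in> Z\<close> by blast
      then show ?thesis using Z_F F_T by blast
    next
      case False
      then have "x \<in> ?M" "x \<in> T" using that AM KsM A_T Ks_T by auto
      then show ?thesis using hM by simp
    qed
    then have "h ` (A \<union> (Z \<union> Ks)) \<subseteq> T" by blast
    from rhom_fgen_image_subset[OF _ subfield_T this] hT show "rhom T h \<and> h ` T \<subseteq> T" unfolding T_eq by blast
  next
    fix h l assume h: "h \<in> H" and l: "\<And>b. b \<in> B \<Longrightarrow> l b \<in> T" "(\<Sum>b\<in>B. l b * b) = 0"
    have hN: "rhom ?N h" and hM: "\<And>a. a \<in> ?M \<Longrightarrow> h a = a" using h unfolding H_def by auto
    have m: "l b \<in> ?N" "b \<in> ?N" if "b \<in> B" for b using l(1)[OF that] that B(2) TN M MN by auto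
    have "h (\<Sum>b\<in>B. l b * b) = (\<Sum>b\<in>B. h (l b * b))"
      by (rule rhom_sum[OF hN N]) (use m subring_setD(5)[OF N] in blast)
    also have "\<dots> = (\<Sum>b\<in>B. h (l b) * b)"
    proof (rule sum.cong)
      fix b assume b: "b \<in> B"
      have "h b = b" using hM b B(2) M by blast
      then show "h (l b * b) = h (l b) * b" using rhomD(4)[OF hN N m[OF b]] by simp
    qed simp
    finally show "(\<Sum>b\<in>B. h (l b) * b) = 0" using l(2) rhomD(2)[OF hN N] by simp
  next
    fix x assume x: "x \<in> T" "\<And>h. h \<in> H \<Longrightarrow> h x = x"
    have "x \<in> ?M"
    proof (rule fixed_by_homs_finite[OF subfield_set_fgen Z])
      show "separable_over ?M z" if "z \<in> Z" for z by (rule separable_over_mono[OF Z_sep[OF that] AM]) simp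
      show "x \<in> ?N" using x(1) TN by blast
      show "h x = x" if "rhom ?N h" "\<And>a. a \<in> ?M \<Longrightarrow> h a = a" for h
        using x(2)[of h] that unfolding H_def by blast
    qed
    then show "x \<in> fgen (E \<union> Ks)" by (rule T_EKb[OF x(1)])
  qed
qed

text \<open>Two stages: vectors of \<open>D\<close> stay independent from \<open>K\<close> to
  \<open>Ks\<close> by descent, and from \<open>Ks\<close> to \<open>Kb\<close> inside the larger
  field \<open>T\<close>. The second stage deals with inseparability.\<close>

lemma lin_disj_D_Kb: "lin_disj K Kb D"
proof -
  have "lin_disj Ks Kb T"
    by (rule lin_disj_sym[OF subfield_Ks subfield_T Ks_T separable_subset_algebraic_closure lin_disj_T_Kb])
  then show ?thesis using lin_disj_D_Ks D_T unfolding lin_disj_def by blast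
qed

end

section \<open>Galois descent: \<open>F\<close> lies in the span of \<open>Ks\<close> and
  \<open>D\<close>\<close>

context twist begin

text \<open>A product of Lagrange factors: an element of the span of the characters \<open>\<sigma> \<mapsto> \<sigma> m\<close> that is the
  indicator function of the automorphisms acting trivially on \<open>V\<close>.\<close>

lemma indicator_combination:
  assumes V: "finite V" "V \<subseteq> Ks" and P: "finite P"
  shows "\<exists>ps. set ps \<subseteq> Ks \<times> fgen (K \<union> V) \<and>
    (\<forall>\<sigma>\<in>G. (\<forall>w\<in>V. \<sigma> w = w) \<longrightarrow> (\<Sum>(c, m)\<leftarrow>ps. c * \<sigma> m) = 1) \<and>
    (\<forall>\<sigma>\<in>G. restrict \<sigma> V \<in> P \<and> (\<exists>w\<in>V. \<sigma> w \<noteq> w) \<longrightarrow> (\<Sum>(c, m)\<leftarrow>ps. c * \<sigma> m) = 0)"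
  using P
proof (induction P rule: finite_induct)
  case empty
  show ?case
    using subfield_setD(3)[OF subfield_Ks] subfield_setD(3)[OF subfield_set_fgen[of "K \<union> V"]]
      rhomD(1)[OF G_D(3) subfield_setD(1)[OF subfield_Ks]]
    by (intro exI[of _ "[(1, 1)]"]) auto
next
  case (insert \<rho> P)
  let ?N = "fgen (K \<union> V)"
  note S = subfield_setD[OF subfield_Ks]
  have NK: "?N \<subseteq> Ks" by (rule fgen_minimal[OF subfield_Ks]) (use K_Ks V in blast)
  have VN: "V \<subseteq> ?N" using fgen_incl[of "K \<union> V"] by simp
  from insert.IH obtain ps where ps: "set ps \<subseteq> Ks \<times> ?N"
    "\<forall>\<sigma>\<in>G. (\<forall>w\<in>V. \<sigma> w = w) \<longrightarrow> (\<Sum>(c, m)\<leftarrow>ps. c * \<sigma> m) = 1"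
    "\<forall>\<sigma>\<in>G. restrict \<sigma> V \<in> P \<and> (\<exists>w\<in>V. \<sigma> w \<noteq> w) \<longrightarrow> (\<Sum>(c, m)\<leftarrow>ps. c * \<sigma> m) = 0" by (elim exE conjE)
  show ?case
  proof (cases "\<exists>\<sigma>\<in>G. restrict \<sigma> V = \<rho> \<and> (\<exists>w\<in>V. \<sigma> w \<noteq> w)")
    case False
    then show ?thesis using ps by (intro exI[of _ ps]) blast
  next
    case True
    then obtain \<tau> u where t: "\<tau> \<in> G" "restrict \<tau> V = \<rho>" and u: "u \<in> V" "\<tau> u \<noteq> u" by blast
    have uK: "u \<in> Ks" "u \<in> ?N" "\<tau> u \<in> Ks" using u V VN G_D(5)[OF t(1)] by auto
    \<comment> \<open>\<open>a * (\<sigma> u - \<tau> u)\<close> is the Lagrange factor: 1 if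
      \<open>\<sigma>\<close> fixes \<open>u\<close>, and 0 if \<open>\<sigma>\<close> agrees with
      \<open>\<tau>\<close> at \<open>u\<close>. Since \<open>\<sigma>\<close> is multiplicative,
      multiplying the old combination by it amounts to replacing each pair \<open>(c, m)\<close> by
      the two pairs in \<open>qs\<close>.\<close>
    define a where "a = inverse (u - \<tau> u)"
    have a: "a \<in> Ks" "a * (u - \<tau> u) = 1" unfolding a_def using uK u S by auto
    define qs where "qs = map (\<lambda>(c, m). (a * c, u * m)) ps @ map (\<lambda>(c, m). (- (a * \<tau> u) * c, m)) ps"
    have mem: "c \<in> Ks" "m \<in> ?N" "m \<in> Ks" if "(c, m) \<in> set ps" for c m using ps(1) that NK by auto
    have "set qs \<subseteq> Ks \<times> ?N"
    proof
      fix q assume "q \<in> set qs"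
      then obtain c m where cm: "(c, m) \<in> set ps" "q = (a * c, u * m) \<or> q = (- (a * \<tau> u) * c, m)"
        unfolding qs_def by auto
      have "a * c \<in> Ks" "u * m \<in> ?N" "- (a * \<tau> u) * c \<in> Ks"
        using mem[OF cm(1)] a(1) uK S(4,6) subfield_setD(6)[OF subfield_set_fgen] by auto
      then show "q \<in> Ks \<times> ?N" using cm(2) mem[OF cm(1)] by blast
    qed
    moreover have ev: "(\<Sum>(c, m)\<leftarrow>qs. c * \<sigma> m) = a * (\<sigma> u - \<tau> u) * (\<Sum>(c, m)\<leftarrow>ps. c * \<sigma> m)" if s: "\<sigma> \<in> G" for \<sigma>
    proof -
      note sm = rhomD(4)[OF G_D(3)[OF s] S(1)]
      have "(\<Sum>(c, m)\<leftarrow>map (\<lambda>(c, m). (a * c, u * m)) rs. c * \<sigma> m) = a * \<sigma> u * (\<Sum>(c, m)\<leftarrow>rs. c * \<sigma> m)"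
        if "set rs \<subseteq> set ps" for rs
        using that
      proof (induction rs)
        case (Cons r rs)
        obtain c m where r: "r = (c, m)" by (cases r)
        then have "\<sigma> (u * m) = \<sigma> u * \<sigma> m" using Cons.prems mem[of c m] uK by (intro sm) auto
        then show ?case using Cons r by (simp add: algebra_simps)
      qed simp
      moreover have "(\<Sum>(c, m)\<leftarrow>map (\<lambda>(c, m). (- (a * \<tau> u) * c, m)) rs. c * \<sigma> m) = - (a * \<tau> u) * (\<Sum>(c, m)\<leftarrow>rs. c * \<sigma> m)" for rs
        by (induction rs) (auto simp: algebra_simps)
      ultimately show ?thesis unfolding qs_def by (simp add: algebra_simps)
    qed
    moreover have "(\<Sum>(c, m)\<leftarrow>qs. c * \<sigma> m) = 1" if s: "\<sigma> \<in> G" "\<forall>w\<in>V. \<sigma> w = w" for \<sigma>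
      using ev[OF s(1)] ps(2) s u(1) a(2) by simp
    moreover have "(\<Sum>(c, m)\<leftarrow>qs. c * \<sigma> m) = 0"
      if s: "\<sigma> \<in> G" "restrict \<sigma> V \<in> insert \<rho> P" "\<exists>w\<in>V. \<sigma> w \<noteq> w" for \<sigma>
    proof (cases "restrict \<sigma> V = \<rho>")
      case True
      then have "\<sigma> u = \<tau> u" using t(2) u(1) by (metis restrict_apply')
      then show ?thesis using ev[OF s(1)] by simp
    next
      case False
      then show ?thesis using ev[OF s(1)] ps(3) s by simp
    qed
    ultimately show ?thesis by (intro exI[of _ qs]) blast
  qed
qed

text \<open>The sum \<open>y m\<close> over a finite quotient of the group is a trace of
  \<open>m * z\<close> for the twisted action, hence invariant. Weighting such traces with an
  indicator combination isolates the summand of the identity, which is \<open>z\<close>.\<close>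

lemma F_span_D: "F \<subseteq> span_ring Ks D"
proof
  fix z assume zF: "z \<in> F"
  have "\<And>w. w \<in> W \<Longrightarrow> separable_over K w" using W(2) by (auto simp: separable_closure_of_iff)
  \<comment> \<open>With \<open>W\<close> enlarged to a root-closed set, restriction to
    \<open>V\<close> takes only finitely many values, while \<open>\<theta> \<sigma>\<close> and the
    action of \<open>\<sigma>\<close> on \<open>K(V)\<close> depend on that restriction
    alone.\<close>
  from finite_root_closure[OF K W(1) this] obtain V where V: "finite V" "W \<subseteq> V"
    "\<forall>z\<in>V. \<exists>f. poly_over K f \<and> rsquarefree f \<and> poly f z = 0 \<and> {y. poly f y = 0} \<subseteq> V" by blast
  have VK: "V \<subseteq> Ks" using V(3) separable_overI[OF K] by (auto simp: separable_closure_of_iff)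
  note S = subfield_setD[OF subfield_Ks]
  have sV: "\<sigma> w \<in> V" if s: "\<sigma> \<in> G" and w: "w \<in> V" for \<sigma> w
  proof -
    obtain f where f: "poly_over K f" "poly f w = 0" "{y. poly f y = 0} \<subseteq> V" using V(3) w by blast
    have "poly f (\<sigma> w) = 0"
      by (rule roots_min_poly_subset_closed[OF K S(1) K_Ks _ G_D(3)[OF s] G_D(4)[OF s] f(1,2)]) (use w VK in auto)
    then show ?thesis using f(3) by blast
  qed
  define Q where "Q = (\<lambda>\<sigma>. restrict \<sigma> V) ` G"
  have fQ: "finite Q"
  proof (rule finite_subset)
    show "Q \<subseteq> V \<rightarrow>\<^sub>E V" unfolding Q_def using sV by (intro image_subsetI restrict_PiE_iff[THEN iffD2]) auto
    show "finite (V \<rightarrow>\<^sub>E V)" using V by (intro finite_PiE) auto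
  qed
  define r where "r \<rho> = (SOME \<sigma>. \<sigma> \<in> G \<and> restrict \<sigma> V = \<rho>)" for \<rho>
  have r: "r \<rho> \<in> G" "restrict (r \<rho>) V = \<rho>" if "\<rho> \<in> Q" for \<rho>
  proof -
    have "\<exists>\<sigma>. \<sigma> \<in> G \<and> restrict \<sigma> V = \<rho>" using that unfolding Q_def by blast
    from someI_ex[OF this] show "r \<rho> \<in> G" "restrict (r \<rho>) V = \<rho>" unfolding r_def by auto
  qed
  let ?N = "fgen (K \<union> V)"
  have NK: "?N \<subseteq> Ks" by (rule fgen_minimal[OF subfield_Ks]) (use K_Ks VK in blast)
  have agree: "\<sigma> m = \<tau> m \<and> \<theta> \<sigma> = \<theta> \<tau>"
    if s: "\<sigma> \<in> G" "\<tau> \<in> G" "restrict \<sigma> V = restrict \<tau> V" and m: "m \<in> ?N" for \<sigma> \<tau> m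
  proof -
    have e: "\<sigma> w = \<tau> w" if "w \<in> V" for w using s(3) that by (metis restrict_apply')
    have "\<sigma> m = \<tau> m"
      by (rule rhom_fgen_eqI[OF rhom_mono[OF G_D(3)[OF s(1)] NK] rhom_mono[OF G_D(3)[OF s(2)] NK] _ m])
        (use e G_D(4)[OF s(1)] G_D(4)[OF s(2)] in auto)
    moreover have "\<theta> \<sigma> = \<theta> \<tau>" by (rule \<theta>_W[OF s(1,2)]) (use e V(2) in blast)
    ultimately show ?thesis by simp
  qed
  define y where "y m = (\<Sum>\<rho>\<in>Q. r \<rho> m * \<theta> (r \<rho>) z)" for m
  have yT: "y m \<in> T" if m: "m \<in> ?N" for m
    unfolding y_def
  proof (rule span_ring_sum[OF fQ])
    fix \<rho> assume q: "\<rho> \<in> Q"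
    show "r \<rho> m \<in> Ks" by (rule G_D(5)[OF r(1)[OF q]]) (use m NK in blast)
    show "\<theta> (r \<rho>) z \<in> F" by (rule \<theta>_D(5)[OF r(1)[OF q] zF])
  qed
  have yD: "y m \<in> D" if m: "m \<in> ?N" for m
  proof -
    have mK: "m \<in> Ks" using m NK by blast
    have "\<delta> \<tau> (y m) = y m" if t: "\<tau> \<in> G" for \<tau>
    proof -
      \<comment> \<open>Left translation by \<open>\<tau>\<close> on the finite set of restrictions.
        It is injective, hence a permutation, and only reindexes the sum.\<close>
      define b where "b \<rho> = restrict (compose Ks \<tau> (r \<rho>)) V" for \<rho>
      have cG: "compose Ks \<tau> (r \<rho>) \<in> G" if "\<rho> \<in> Q" for \<rho>
        by (rule galois_group_compose[OF S(1) K_Ks t r(1)[OF that]])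
      have bQ: "b \<rho> \<in> Q" if "\<rho> \<in> Q" for \<rho> unfolding b_def Q_def using cG[OF that] by blast
      have "inj_on b Q"
      proof (rule inj_onI)
        fix \<rho> \<rho>' assume q: "\<rho> \<in> Q" "\<rho>' \<in> Q" "b \<rho> = b \<rho>'"
        have "r \<rho> w = r \<rho>' w" if w: "w \<in> V" for w
        proof -
          have wK: "w \<in> Ks" using w VK by blast
          have "compose Ks \<tau> (r \<rho>) w = compose Ks \<tau> (r \<rho>') w"
            using q(3) w unfolding b_def by (metis restrict_apply')
          then have "\<tau> (r \<rho> w) = \<tau> (r \<rho>' w)" using wK by (simp add: compose_eq)
          then show ?thesis
            using G_D(2)[OF t] G_D(5)[OF r(1)[OF q(1)] wK] G_D(5)[OF r(1)[OF q(2)] wK]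
            by (simp add: bij_betw_def inj_on_def)
        qed
        then have "restrict (r \<rho>) V = restrict (r \<rho>') V" by (auto simp: restrict_def)
        then show "\<rho> = \<rho>'" using r(2) q by simp
      qed
      moreover have "b ` Q \<subseteq> Q" using bQ by blast
      ultimately have bij: "bij_betw b Q Q" using endo_inj_surj[OF fQ] by (simp add: bij_betw_def)
      have trm: "r \<rho> m \<in> T" "\<theta> (r \<rho>) z \<in> T" "r \<rho> m \<in> Ks" "\<theta> (r \<rho>) z \<in> F" if "\<rho> \<in> Q" for \<rho>
        using G_D(5)[OF r(1)[OF that] mK] \<theta>_D(5)[OF r(1)[OF that] zF] Ks_T F_T by auto
      have "\<delta> \<tau> (y m) = (\<Sum>\<rho>\<in>Q. \<delta> \<tau> (r \<rho> m * \<theta> (r \<rho>) z))"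
        unfolding y_def by (rule rhom_sum[OF \<delta>(1)[OF t] subring_T]) (use trm subring_setD(5)[OF subring_T] in blast)
      also have "\<dots> = (\<Sum>\<rho>\<in>Q. r (b \<rho>) m * \<theta> (r (b \<rho>)) z)"
      proof (rule sum.cong)
        fix \<rho> assume q: "\<rho> \<in> Q"
        have "\<delta> \<tau> (r \<rho> m * \<theta> (r \<rho>) z) = \<tau> (r \<rho> m) * \<theta> \<tau> (\<theta> (r \<rho>) z)"
          using rhomD(4)[OF \<delta>(1)[OF t] subring_T trm(1,2)[OF q]] \<delta>(2)[OF t trm(3)[OF q]] \<delta>(3)[OF t trm(4)[OF q]]
          by simp
        also have "\<dots> = compose Ks \<tau> (r \<rho>) m * \<theta> (compose Ks \<tau> (r \<rho>)) z"
          unfolding \<theta>_compose[OF t r(1)[OF q]] using mK zF by (simp add: compose_eq)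
        also have "\<dots> = r (b \<rho>) m * \<theta> (r (b \<rho>)) z"
          using agree[OF cG[OF q] r(1)[OF bQ[OF q]] _ m] r(2)[OF bQ[OF q]] unfolding b_def by simp
        finally show "\<delta> \<tau> (r \<rho> m * \<theta> (r \<rho>) z) = r (b \<rho>) m * \<theta> (r (b \<rho>)) z" .
      qed simp
      also have "\<dots> = y m" unfolding y_def by (rule sum.reindex_bij_betw[OF bij])
      finally show ?thesis .
    qed
    then show ?thesis unfolding D_def using yT[OF m] by blast
  qed
  obtain ps where ps: "set ps \<subseteq> Ks \<times> ?N"
    "\<forall>\<sigma>\<in>G. (\<forall>w\<in>V. \<sigma> w = w) \<longrightarrow> (\<Sum>(c, m)\<leftarrow>ps. c * \<sigma> m) = 1"
    "\<forall>\<sigma>\<in>G. restrict \<sigma> V \<in> Q \<and> (\<exists>w\<in>V. \<sigma> w \<noteq> w) \<longrightarrow> (\<Sum>(c, m)\<leftarrow>ps. c * \<sigma> m) = 0"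
    using indicator_combination[OF V(1) VK fQ] by (elim exE conjE)
  define \<rho>0 where "\<rho>0 = restrict (\<lambda>x\<in>Ks. x) V"
  have idG: "(\<lambda>x\<in>Ks. x) \<in> G" by (rule galois_group_one_mem[OF S(1) K_Ks])
  have r0: "\<rho>0 \<in> Q" unfolding \<rho>0_def Q_def using idG by blast
  have "\<theta> (r \<rho>0) = \<theta> (\<lambda>x\<in>Ks. x)"
    using agree[OF r(1)[OF r0] idG _ subfield_setD(3)[OF subfield_set_fgen]] r(2)[OF r0] unfolding \<rho>0_def by blast
  then have \<theta>0: "\<theta> (r \<rho>0) z = z" using \<theta>_one zF by simp
  have ev: "(\<Sum>(c, m)\<leftarrow>ps. c * r \<rho> m) = (if \<rho> = \<rho>0 then 1 else 0)" if q: "\<rho> \<in> Q" for \<rho>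
  proof (cases "\<rho> = \<rho>0")
    case True
    have "r \<rho> w = w" if "w \<in> V" for w
    proof -
      have "restrict (r \<rho>) V w = \<rho>0 w" using r(2)[OF q] True by simp
      then show ?thesis using that VK by (auto simp: \<rho>0_def)
    qed
    then show ?thesis using ps(2) r(1)[OF q] True by simp
  next
    case False
    have "\<exists>w\<in>V. r \<rho> w \<noteq> w"
    proof (rule ccontr)
      assume "\<not> (\<exists>w\<in>V. r \<rho> w \<noteq> w)"
      then have "restrict (r \<rho>) V = \<rho>0" unfolding \<rho>0_def using VK by (auto simp: restrict_def fun_eq_iff)
      then show False using r(2)[OF q] False by simp
    qed
    moreover have "restrict (r \<rho>) V \<in> Q" using r(2)[OF q] q by simp
    ultimately show ?thesis using ps(3) r(1)[OF q] False by simp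
  qed
  \<comment> \<open>After exchanging the sums, the weight of each summand is the indicator evaluated
    at \<open>r \<rho>\<close>.\<close>
  have "(\<Sum>(c, m)\<leftarrow>qs. c * y m) = (\<Sum>\<rho>\<in>Q. (\<Sum>(c, m)\<leftarrow>qs. c * r \<rho> m) * \<theta> (r \<rho>) z)" for qs
    by (induction qs) (auto simp: y_def sum.distrib sum_distrib_left distrib_right mult.assoc)
  then have "(\<Sum>(c, m)\<leftarrow>ps. c * y m) = (\<Sum>\<rho>\<in>Q. (if \<rho> = \<rho>0 then 1 else 0) * \<theta> (r \<rho>) z)"
    using ev by simp
  also have "\<dots> = z" using fQ r0 \<theta>0 by (simp add: if_distrib[of "\<lambda>x. x * _"] sum.delta cong: if_cong)
  finally have "z = (\<Sum>(c, d)\<leftarrow>map (\<lambda>(c, m). (c, y m)) ps. c * d)" by (simp add: o_def case_prod_unfold)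
  moreover have "set (map (\<lambda>(c, m). (c, y m)) ps) \<subseteq> Ks \<times> D" using ps(1) yD by auto
  ultimately show "z \<in> span_ring Ks D" unfolding span_ring_def by blast
qed

lemma D_sep: "x \<in> D \<Longrightarrow> separable_over A x"
  using T_sep D_T by blast

end

section \<open>Evaluation of polynomials in several variables\<close>

definition mon_eval :: "(nat \<Rightarrow> 'b::field) \<Rightarrow> (nat \<Rightarrow>\<^sub>0 nat) \<Rightarrow> 'b"
  where "mon_eval x m = (\<Prod>i\<in>Poly_Mapping.keys m. x i ^ Poly_Mapping.lookup m i)"

lemma mon_eval_superset:
  "finite I \<Longrightarrow> Poly_Mapping.keys m \<subseteq> I \<Longrightarrow> mon_eval x m = (\<Prod>i\<in>I. x i ^ Poly_Mapping.lookup m i)"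
  unfolding mon_eval_def by (rule prod.mono_neutral_left) (auto simp: in_keys_iff)

lemma mon_eval_add: "mon_eval x (m + m') = mon_eval x m * mon_eval x m'"
proof -
  let ?I = "Poly_Mapping.keys m \<union> Poly_Mapping.keys m'"
  have "Poly_Mapping.keys (m + m') \<subseteq> ?I" by (rule Poly_Mapping.keys_add)
  then show ?thesis
    using mon_eval_superset[of ?I "m + m'" x] mon_eval_superset[of ?I m x] mon_eval_superset[of ?I m' x]
    by (simp add: lookup_add power_add prod.distrib)
qed

lemma mon_eval_single: "mon_eval x (Poly_Mapping.single i k) = x i ^ k"
  by (subst mon_eval_superset[of "{i}"]) auto

lemma mon_eval_zero: "mon_eval x 0 = 1"
  by (simp add: mon_eval_def)

lemma mpoly_eval_superset:
  assumes "rhom UNIV h" "finite M" "Poly_Mapping.keys p \<subseteq> M"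
  shows "mpoly_eval h x p = (\<Sum>m\<in>M. h (Poly_Mapping.lookup p m) * mon_eval x m)"
proof -
  have "h 0 = 0" by (rule rhomD(2)[OF assms(1)]) (auto simp: subring_set_def)
  then show ?thesis
    unfolding mpoly_eval_def mon_eval_def[symmetric]
    using assms by (intro sum.mono_neutral_left) (auto simp: in_keys_iff)
qed

lemma subring_set_UNIV: "subring_set (UNIV :: 'a::comm_ring_1 set)"
  by (auto simp: subring_set_def)

lemma mpoly_eval_add:
  assumes h: "rhom UNIV h" shows "mpoly_eval h x (p + q) = mpoly_eval h x p + mpoly_eval h x q"
proof -
  let ?M = "Poly_Mapping.keys p \<union> Poly_Mapping.keys q"
  have "Poly_Mapping.keys (p + q) \<subseteq> ?M" by (rule Poly_Mapping.keys_add)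
  then show ?thesis
    using mpoly_eval_superset[OF h, of ?M "p + q" x] mpoly_eval_superset[OF h, of ?M p x]
      mpoly_eval_superset[OF h, of ?M q x]
    by (simp add: lookup_add rhomD(3)[OF h subring_set_UNIV] distrib_right sum.distrib)
qed

lemma mpoly_eval_single:
  assumes h: "rhom UNIV h" shows "mpoly_eval h x (Poly_Mapping.single m c) = h c * mon_eval x m"
  by (subst mpoly_eval_superset[OF h, of "{m}"]) auto

lemma mpoly_eval_zero: "mpoly_eval h x 0 = 0"
  by (simp add: mpoly_eval_def)

lemma mpoly_eval_sum:
  assumes h: "rhom UNIV h" shows "mpoly_eval h x (\<Sum>i\<in>I. f i) = (\<Sum>i\<in>I. mpoly_eval h x (f i))"
  by (induction I rule: infinite_finite_induct) (auto simp: mpoly_eval_zero mpoly_eval_add[OF h])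

lemma mpoly_sum_single: "p = (\<Sum>m\<in>Poly_Mapping.keys p. Poly_Mapping.single m (Poly_Mapping.lookup p m))"
proof (rule poly_mapping_eqI)
  fix k
  have "(\<Sum>m\<in>Poly_Mapping.keys p. Poly_Mapping.lookup (Poly_Mapping.single m (Poly_Mapping.lookup p m)) k)
      = (\<Sum>m\<in>Poly_Mapping.keys p. if m = k then Poly_Mapping.lookup p m else 0)"
    by (intro sum.cong) (auto simp: lookup_single when_def)
  also have "\<dots> = Poly_Mapping.lookup p k" by (auto simp: sum.delta in_keys_iff)
  finally show "Poly_Mapping.lookup p k =
      Poly_Mapping.lookup (\<Sum>m\<in>Poly_Mapping.keys p. Poly_Mapping.single m (Poly_Mapping.lookup p m)) k"
    by (simp add: lookup_sum)
qed

lemma mpoly_mult_sum: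
  "p * q = (\<Sum>m\<in>Poly_Mapping.keys p. \<Sum>m'\<in>Poly_Mapping.keys q.
     Poly_Mapping.single (m + m') (Poly_Mapping.lookup p m * Poly_Mapping.lookup q m'))"
  for p q :: "'a::comm_semiring_1 mpoly"
proof -
  have "p * q = (\<Sum>m\<in>Poly_Mapping.keys p. Poly_Mapping.single m (Poly_Mapping.lookup p m)) *
      (\<Sum>m\<in>Poly_Mapping.keys q. Poly_Mapping.single m (Poly_Mapping.lookup q m))"
    using mpoly_sum_single[of p] mpoly_sum_single[of q] by simp
  then show ?thesis by (simp add: sum_product mult_single)
qed

lemma mpoly_eval_mult:
  fixes h :: "'a::field \<Rightarrow> 'b::field"
  assumes h: "rhom UNIV h" shows "mpoly_eval h x (p * q) = mpoly_eval h x p * mpoly_eval h x q"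
proof -
  have "mpoly_eval h x (p * q) = (\<Sum>m\<in>Poly_Mapping.keys p. \<Sum>m'\<in>Poly_Mapping.keys q.
      (h (Poly_Mapping.lookup p m) * mon_eval x m) * (h (Poly_Mapping.lookup q m') * mon_eval x m'))"
    unfolding mpoly_mult_sum mpoly_eval_sum[OF h] mpoly_eval_single[OF h]
    by (simp add: rhomD(4)[OF h subring_set_UNIV] mon_eval_add mult_ac)
  also have "\<dots> = mpoly_eval h x p * mpoly_eval h x q"
    using mpoly_eval_superset[OF h, of "Poly_Mapping.keys p" p x] mpoly_eval_superset[OF h, of "Poly_Mapping.keys q" q x]
    by (simp add: sum_product)
  finally show ?thesis .
qed

lemma mpoly_eval_const:
  assumes h: "rhom UNIV h" shows "mpoly_eval h x (Poly_Mapping.single 0 c) = h c"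
  by (simp add: mpoly_eval_single[OF h] mon_eval_zero)

abbreviation mvar :: "nat \<Rightarrow> 'a::field mpoly" where "mvar i \<equiv> Poly_Mapping.single (Poly_Mapping.single i (Suc 0)) 1"

lemma mpoly_eval_mvar:
  assumes h: "rhom UNIV h" shows "mpoly_eval h x (mvar i) = x i"
  using rhomD(1)[OF h subring_set_UNIV] by (simp add: mpoly_eval_single[OF h] mon_eval_single)

lemma rhom_mpoly_eval:
  fixes h :: "'a::field \<Rightarrow> 'b::field"
  assumes h: "rhom UNIV h" shows "rhom UNIV (mpoly_eval h x)"
  unfolding rhom_def
  using mpoly_eval_add[OF h] mpoly_eval_mult[OF h] mpoly_eval_const[OF h, of x 1] rhomD(1)[OF h subring_set_UNIV]
  by (simp)

lemma rhom_mpoly_eval_id: "rhom UNIV (mpoly_eval id x)"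
  by (rule rhom_mpoly_eval) (simp add: rhom_def)

lemma rhom_UNIV_id: "rhom UNIV id" by (simp add: rhom_def)

lemma mpoly_eval_comp:
  fixes g :: "'b::field \<Rightarrow> 'c::field" and h :: "'a::field \<Rightarrow> 'b"
  assumes g: "rhom R g" and R: "subring_set R" and hR: "\<And>m. h (Poly_Mapping.lookup p m) \<in> R"
    and xR: "\<And>m i. m \<in> Poly_Mapping.keys p \<Longrightarrow> i \<in> Poly_Mapping.keys m \<Longrightarrow> x i \<in> R"
  shows "g (mpoly_eval h x p) = mpoly_eval (\<lambda>c. g (h c)) (\<lambda>i. g (x i)) p"
proof -
  have mR: "(\<Prod>i\<in>Poly_Mapping.keys m. x i ^ Poly_Mapping.lookup m i) \<in> R" if "m \<in> Poly_Mapping.keys p" for m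
    by (rule subring_set_prod[OF R], rule subring_set_power[OF R], rule xR[OF that])
  show ?thesis
    unfolding mpoly_eval_def
    by (subst rhom_sum[OF g R])
      (auto intro!: sum.cong subring_setD(5)[OF R] hR mR
        simp: rhomD(4)[OF g R hR mR] rhom_prod[OF g R] subring_set_power[OF R] xR rhom_power[OF g R])
qed

lemma mpoly_ring_carrier:
  "p \<in> carrier (mpoly_ring K n) \<longleftrightarrow>
    (\<forall>m. Poly_Mapping.lookup p m \<in> K) \<and> (\<forall>m\<in>Poly_Mapping.keys p. Poly_Mapping.keys m \<subseteq> {..<n})"
  by (simp add: mpoly_ring_def)

lemma single_in_mpoly_ring:
  "0 \<in> K \<Longrightarrow> c \<in> K \<Longrightarrow> Poly_Mapping.keys m \<subseteq> {..<n} \<Longrightarrow> Poly_Mapping.single m c \<in> carrier (mpoly_ring K n)"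
  by (auto simp: mpoly_ring_carrier lookup_single when_def)

lemma subring_set_mpoly_ring:
  assumes K: "subring_set K" shows "subring_set (carrier (mpoly_ring K n))"
proof (rule subring_setI)
  note K' = subring_setD[OF K]
  let ?C = "carrier (mpoly_ring K n)"
  show z: "0 \<in> ?C" by (simp add: mpoly_ring_carrier K')
  show "1 \<in> ?C" unfolding single_one[symmetric] by (rule single_in_mpoly_ring) (use K' in auto)
  show "- p \<in> ?C" if "p \<in> ?C" for p
    using that K' by (auto simp: mpoly_ring_carrier in_keys_iff)
  show add: "p + q \<in> ?C" if "p \<in> ?C" "q \<in> ?C" for p q
    unfolding mpoly_ring_carrier
  proof (intro conjI allI ballI)
    show "Poly_Mapping.lookup (p + q) m \<in> K" for m
      using that K'(4) unfolding mpoly_ring_carrier lookup_add by blast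
    show "Poly_Mapping.keys m \<subseteq> {..<n}" if m: "m \<in> Poly_Mapping.keys (p + q)" for m
    proof -
      have "m \<in> Poly_Mapping.keys p \<or> m \<in> Poly_Mapping.keys q" using m Poly_Mapping.keys_add[of p q] by blast
      then show ?thesis using \<open>p \<in> ?C\<close> \<open>q \<in> ?C\<close> unfolding mpoly_ring_carrier by blast
    qed
  qed
  have sum: "(\<Sum>i\<in>I. f i) \<in> ?C" if "\<And>i. i \<in> I \<Longrightarrow> f i \<in> ?C" for I :: "(nat \<Rightarrow>\<^sub>0 nat) set" and f
    using that by (induction I rule: infinite_finite_induct) (auto simp: z add)
  show "p * q \<in> ?C" if pq: "p \<in> ?C" "q \<in> ?C" for p q
    unfolding mpoly_mult_sum
  proof (intro sum single_in_mpoly_ring)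
    fix m m' assume m: "m \<in> Poly_Mapping.keys p" "m' \<in> Poly_Mapping.keys q"
    show "Poly_Mapping.lookup p m * Poly_Mapping.lookup q m' \<in> K" using pq K' unfolding mpoly_ring_carrier by blast
    have "Poly_Mapping.keys m \<subseteq> {..<n}" "Poly_Mapping.keys m' \<subseteq> {..<n}" using pq m unfolding mpoly_ring_carrier by blast+
    then show "Poly_Mapping.keys (m + m') \<subseteq> {..<n}" using Poly_Mapping.keys_add[of m m'] by blast
  qed (use K' in simp)
qed

lemma const_in_mpoly_ring: "subring_set K \<Longrightarrow> c \<in> K \<Longrightarrow> Poly_Mapping.single 0 c \<in> carrier (mpoly_ring K n)"
  by (rule single_in_mpoly_ring) (auto simp: subring_setD)

lemma mvar_in_mpoly_ring: "subring_set K \<Longrightarrow> i < n \<Longrightarrow> mvar i \<in> carrier (mpoly_ring K n)"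
  by (rule single_in_mpoly_ring) (auto simp: subring_setD)

lemma mpoly_ring_mono: "K \<subseteq> N \<Longrightarrow> n \<le> n' \<Longrightarrow> carrier (mpoly_ring K n) \<subseteq> carrier (mpoly_ring N n')"
  unfolding mpoly_ring_carrier subset_iff by fastforce

lemma mpoly_eval_in:
  assumes R: "subring_set R" and p: "p \<in> carrier (mpoly_ring K n)"
    and h: "\<And>c. c \<in> K \<Longrightarrow> h c \<in> R" and x: "\<And>i. i < n \<Longrightarrow> x i \<in> R"
  shows "mpoly_eval h x p \<in> R"
proof -
  have "Poly_Mapping.keys m \<subseteq> {..<n}" if "m \<in> Poly_Mapping.keys p" for m using p that unfolding mpoly_ring_carrier by blast
  moreover have "Poly_Mapping.lookup p m \<in> K" for m using p unfolding mpoly_ring_carrier by blast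
  ultimately show ?thesis
    unfolding mpoly_eval_def
    by (intro subring_set_sum[OF R] subring_setD(5)[OF R] h subring_set_prod[OF R] subring_set_power[OF R] x) auto
qed

text \<open>The coefficients are expanded along a \<open>K\<close>-basis of their span. This reduces
  statements about polynomials with larger coefficients to polynomials over \<open>K\<close>, for
  base change of ideals and for independence of series.\<close>

lemma mpoly_basis_decomposition:
  assumes K: "subfield_set K" and p: "p \<in> carrier (mpoly_ring N n)"
  shows "\<exists>B P. finite B \<and> B \<subseteq> N \<and> indep K B \<and> (\<forall>b\<in>B. P b \<in> carrier (mpoly_ring K n)) \<and>
    p = (\<Sum>b\<in>B. Poly_Mapping.single 0 b * P b)"
proof -
  note K' = subfield_setD[OF K]
  let ?M = "Poly_Mapping.keys p"
  let ?S = "Poly_Mapping.lookup p ` ?M"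
  have "finite ?S" by simp
  from span_basis_choice[OF K this] obtain B k where B: "B \<subseteq> ?S" "finite B" "indep K B"
    "\<forall>s\<in>?S. \<forall>b\<in>B. k s b \<in> K" "\<forall>s\<in>?S. s = (\<Sum>b\<in>B. k s b * b)" by (elim exE conjE)
  define P where "P b = (\<Sum>m\<in>?M. Poly_Mapping.single m (k (Poly_Mapping.lookup p m) b))" for b
  have "B \<subseteq> N" using B(1) p unfolding mpoly_ring_carrier by blast
  moreover have "P b \<in> carrier (mpoly_ring K n)" if "b \<in> B" for b
    unfolding P_def
  proof (rule subring_set_sum[OF subring_set_mpoly_ring[OF K'(1)]], rule single_in_mpoly_ring)
    fix m assume m: "m \<in> ?M"
    show "k (Poly_Mapping.lookup p m) b \<in> K" using B(4) m that by blast
    show "Poly_Mapping.keys m \<subseteq> {..<n}" using p m unfolding mpoly_ring_carrier by blast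
  qed (rule K'(2))
  moreover have "p = (\<Sum>b\<in>B. Poly_Mapping.single 0 b * P b)"
  proof -
    have "p = (\<Sum>m\<in>?M. Poly_Mapping.single m (Poly_Mapping.lookup p m))" by (rule mpoly_sum_single)
    also have "\<dots> = (\<Sum>m\<in>?M. \<Sum>b\<in>B. Poly_Mapping.single m (b * k (Poly_Mapping.lookup p m) b))"
    proof (rule sum.cong)
      fix m assume "m \<in> ?M"
      then have "Poly_Mapping.lookup p m = (\<Sum>b\<in>B. k (Poly_Mapping.lookup p m) b * b)" by (intro B(5)[rule_format]) simp
      then have "Poly_Mapping.single m (Poly_Mapping.lookup p m) = Poly_Mapping.single m (\<Sum>b\<in>B. k (Poly_Mapping.lookup p m) b * b)"
        by (rule arg_cong)
      also have "\<dots> = (\<Sum>b\<in>B. Poly_Mapping.single m (k (Poly_Mapping.lookup p m) b * b))"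
        using B(2) by (induction B rule: finite_induct) (auto simp: single_add)
      finally show "Poly_Mapping.single m (Poly_Mapping.lookup p m) =
          (\<Sum>b\<in>B. Poly_Mapping.single m (b * k (Poly_Mapping.lookup p m) b))" by (simp add: mult.commute)
    qed simp
    also have "\<dots> = (\<Sum>b\<in>B. \<Sum>m\<in>?M. Poly_Mapping.single m (b * k (Poly_Mapping.lookup p m) b))" by (rule sum.swap)
    also have "\<dots> = (\<Sum>b\<in>B. Poly_Mapping.single 0 b * P b)"
      unfolding P_def by (simp add: sum_distrib_left mult_single)
    finally show ?thesis .
  qed
  ultimately show ?thesis using B(2,3) by (intro exI[of _ B] exI[of _ P]) simp
qed

lemma rhom_factor:
  fixes f :: "'c::comm_ring_1 \<Rightarrow> 'a::comm_ring_1" and g :: "'c \<Rightarrow> 'b::comm_ring_1"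
  assumes C: "subring_set C" and f: "rhom C f" and g: "rhom C g" and ker: "\<And>p. p \<in> C \<Longrightarrow> f p = 0 \<Longrightarrow> g p = 0"
  shows "\<exists>\<phi>. rhom (f ` C) \<phi> \<and> (\<forall>p\<in>C. \<phi> (f p) = g p)"
proof -
  note C' = subring_setD[OF C] and f' = rhomD[OF f C] and g' = rhomD[OF g C]
  define \<phi> where "\<phi> z = g (SOME p. p \<in> C \<and> f p = z)" for z
  have \<phi>: "\<phi> (f p) = g p" if p: "p \<in> C" for p
  proof -
    define q where "q = (SOME q. q \<in> C \<and> f q = f p)"
    have "\<exists>q. q \<in> C \<and> f q = f p" using p by blast
    from someI_ex[OF this] have q: "q \<in> C" "f q = f p" unfolding q_def by auto
    then have "g (q - p) = 0" using p f'(6) C'(6) by (intro ker) auto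
    then show ?thesis using g'(6)[OF q(1) p] unfolding \<phi>_def q_def by simp
  qed
  have "rhom (f ` C) \<phi>"
    unfolding rhom_def
  proof (intro conjI ballI)
    show "\<phi> 1 = 1" using \<phi>[OF C'(2)] f'(1) g'(1) by simp
    fix x y assume "x \<in> f ` C" "y \<in> f ` C"
    then obtain p q where pq: "p \<in> C" "x = f p" "q \<in> C" "y = f q" by blast
    show "\<phi> (x + y) = \<phi> x + \<phi> y" using \<phi>[OF C'(4)[OF pq(1,3)]] \<phi> pq f'(3) g'(3) by simp
    show "\<phi> (x * y) = \<phi> x * \<phi> y" using \<phi>[OF C'(5)[OF pq(1,3)]] \<phi> pq f'(4) g'(4) by simp
  qed
  then show ?thesis using \<phi> by blast
qed

lemma subring_set_image:
  assumes C: "subring_set C" and f: "rhom C f" shows "subring_set (f ` C)"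
proof (rule subring_setI)
  note C' = subring_setD[OF C] and f' = rhomD[OF f C]
  show "0 \<in> f ` C" by (rule image_eqI[where f = f and x = 0]) (use f' C' in auto)
  show "1 \<in> f ` C" by (rule image_eqI[where f = f and x = 1]) (use f' C' in auto)
  fix x assume "x \<in> f ` C"
  then obtain p where p: "p \<in> C" "x = f p" by blast
  show "- x \<in> f ` C" by (rule image_eqI[where f = f and x = "- p"]) (use f' C' p in auto)
  fix y assume "y \<in> f ` C"
  then obtain q where q: "q \<in> C" "y = f q" by blast
  show "x + y \<in> f ` C" by (rule image_eqI[where f = f and x = "p + q"]) (use f' C' p q in auto)
  show "x * y \<in> f ` C" by (rule image_eqI[where f = f and x = "p * q"]) (use f' C' p q in auto)
qed

lemma subfield_set_fractions:
  fixes f :: "'c::comm_ring_1 \<Rightarrow> 'a::field"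
  assumes C: "subring_set C" and f: "rhom C f"
  shows "subfield_set {f p / f q | p q. p \<in> C \<and> q \<in> C \<and> f q \<noteq> 0}" (is "subfield_set ?Q")
proof (rule subfield_setI)
  note C' = subring_setD[OF C] and f' = rhomD[OF f C]
  show "1 \<in> ?Q" using C'(2) f'(1) by (auto intro!: exI[of _ 1])
  fix x assume x: "x \<in> ?Q"
  then obtain p q where pq: "p \<in> C" "q \<in> C" "f q \<noteq> 0" "x = f p / f q" by blast
  show "inverse x \<in> ?Q" if "x \<noteq> 0" using that pq by (intro CollectI exI[of _ q] exI[of _ p]) auto
  fix y assume "y \<in> ?Q"
  then obtain r s where rs: "r \<in> C" "s \<in> C" "f s \<noteq> 0" "y = f r / f s" by blast
  have "f (p * s - r * q) = f p * f s - f r * f q" "f (q * s) = f q * f s" using pq rs C' f' by simp_all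
  moreover have "x - y = (f p * f s - f r * f q) / (f q * f s)"
    unfolding pq(4) rs(4) by (rule diff_frac_eq[OF pq(3) rs(3)])
  ultimately have "x - y = f (p * s - r * q) / f (q * s)" by simp
  moreover have "p * s - r * q \<in> C" "q * s \<in> C" "f (q * s) \<noteq> 0" using pq rs C' f' by auto
  ultimately show "x - y \<in> ?Q" by blast
  have "x * y = f (p * r) / f (q * s)" using pq rs f' by simp
  moreover have "p * r \<in> C" using pq rs C' by auto
  ultimately show "x * y \<in> ?Q" using \<open>q * s \<in> C\<close> \<open>f (q * s) \<noteq> 0\<close> by blast
qed

text \<open>Equal kernels make the two images isomorphic domains, and the isomorphism passes to
  fractions. Nonvanishing of the denominator transfers from \<open>f\<close> to \<open>g\<close>,
  which needs the equivalence and not just one inclusion of kernels.\<close>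

lemma rhom_fractions:
  fixes f :: "'c::comm_ring_1 \<Rightarrow> 'a::field" and g :: "'c \<Rightarrow> 'b::field"
  assumes C: "subring_set C" and f: "rhom C f" and g: "rhom C g" and ker: "\<And>p. p \<in> C \<Longrightarrow> f p = 0 \<longleftrightarrow> g p = 0"
  shows "\<exists>\<phi>. rhom {f p / f q | p q. p \<in> C \<and> q \<in> C \<and> f q \<noteq> 0} \<phi> \<and>
    (\<forall>p\<in>C. \<forall>q\<in>C. f q \<noteq> 0 \<longrightarrow> \<phi> (f p / f q) = g p / g q)"
proof -
  note C' = subring_setD[OF C] and f' = rhomD[OF f C] and g' = rhomD[OF g C]
  let ?P = "\<lambda>z r. fst r \<in> C \<and> snd r \<in> C \<and> f (snd r) \<noteq> 0 \<and> z = f (fst r) / f (snd r)"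
  define \<phi> where "\<phi> z = (let r = (SOME r. ?P z r) in g (fst r) / g (snd r))" for z
  have \<phi>: "\<phi> (f p / f q) = g p / g q" if p: "p \<in> C" "q \<in> C" "f q \<noteq> 0" for p q
  proof -
    define r where "r = (SOME r. ?P (f p / f q) r)"
    have "\<exists>r. ?P (f p / f q) r" using p by (intro exI[of _ "(p, q)"]) simp
    from someI_ex[OF this] have r: "fst r \<in> C" "snd r \<in> C" "f (snd r) \<noteq> 0" "f p / f q = f (fst r) / f (snd r)"
      unfolding r_def by auto
    have "f (p * snd r - fst r * q) = f p * f (snd r) - f (fst r) * f q" using r p C' f' by simp
    also have "\<dots> = 0" using r(3,4) p(3) by (simp add: field_simps)
    finally have "f (p * snd r - fst r * q) = 0" .
    then have "g (p * snd r - fst r * q) = 0" using ker[of "p * snd r - fst r * q"] r p C' by simp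
    then have "g p * g (snd r) = g (fst r) * g q" using r p C' g' by simp
    moreover have "g q \<noteq> 0" "g (snd r) \<noteq> 0" using ker p r by auto
    ultimately have "g (fst r) / g (snd r) = g p / g q" by (simp add: field_simps)
    then show ?thesis unfolding \<phi>_def r_def Let_def by simp
  qed
  have "rhom {f p / f q | p q. p \<in> C \<and> q \<in> C \<and> f q \<noteq> 0} \<phi>"
    unfolding rhom_def
  proof (intro conjI ballI)
    show "\<phi> 1 = 1" using \<phi>[of 1 1] f'(1) g'(1) C' by simp
    fix x y assume "x \<in> {f p / f q | p q. p \<in> C \<and> q \<in> C \<and> f q \<noteq> 0}" "y \<in> {f p / f q | p q. p \<in> C \<and> q \<in> C \<and> f q \<noteq> 0}"
    then obtain p q r s where pq: "p \<in> C" "q \<in> C" "f q \<noteq> 0" "x = f p / f q" and rs: "r \<in> C" "s \<in> C" "f s \<noteq> 0" "y = f r / f s" by blast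
    have nz: "g q \<noteq> 0" "g s \<noteq> 0" using ker pq rs by auto
    have m: "p * s + r * q \<in> C" "q * s \<in> C" "f (q * s) \<noteq> 0" "p * r \<in> C" using pq rs C' f' by auto
    have "f (p * s + r * q) = f p * f s + f r * f q" "f (q * s) = f q * f s" using pq rs C' f' by simp_all
    moreover have "x + y = (f p * f s + f r * f q) / (f q * f s)"
      unfolding pq(4) rs(4) by (rule add_frac_eq[OF pq(3) rs(3)])
    ultimately have "x + y = f (p * s + r * q) / f (q * s)" by simp
    then have "\<phi> (x + y) = g (p * s + r * q) / g (q * s)" using \<phi>[OF m(1-3)] by simp
    also have "\<dots> = (g p * g s + g r * g q) / (g q * g s)" using pq rs C' g' by simp
    also have "\<dots> = g p / g q + g r / g s" by (rule add_frac_eq[OF nz, symmetric])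
    finally show "\<phi> (x + y) = \<phi> x + \<phi> y" using \<phi> pq rs by simp
    have "x * y = f (p * r) / f (q * s)" using pq rs f' by simp
    then have "\<phi> (x * y) = g (p * r) / g (q * s)" using \<phi>[OF m(4,2,3)] by simp
    also have "\<dots> = (g p / g q) * (g r / g s)" using pq rs g' by simp
    finally show "\<phi> (x * y) = \<phi> x * \<phi> y" using \<phi> pq rs by simp
  qed
  then show ?thesis using \<phi> by blast
qed

lemma adjoin_eq_fractions:
  fixes K :: "'a::field set"
  assumes K: "subfield_set K"
  shows "adjoin K y n = {mpoly_eval id y p / mpoly_eval id y q | p q.
    p \<in> carrier (mpoly_ring K n) \<and> q \<in> carrier (mpoly_ring K n) \<and> mpoly_eval id y q \<noteq> 0}" (is "_ = ?Q")
proof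
  note K' = subfield_setD[OF K]
  let ?C = "carrier (mpoly_ring K n)"
  have C: "subring_set ?C" by (rule subring_set_mpoly_ring[OF K'(1)])
  have Q: "subfield_set ?Q" by (rule subfield_set_fractions[OF C rhom_mono[OF rhom_mpoly_eval_id subset_UNIV]])
  have in_Q: "mpoly_eval id y p \<in> ?Q" if "p \<in> ?C" for p
    using that subring_setD(2)[OF C] rhomD(1)[OF rhom_mpoly_eval_id subring_set_UNIV, of y]
    by (intro CollectI exI[of _ p] exI[of _ 1]) simp
  have "c \<in> ?Q" if "c \<in> K" for c
    using in_Q[OF const_in_mpoly_ring[OF K'(1) that]] by (simp add: mpoly_eval_const[OF rhom_UNIV_id])
  moreover have "y i \<in> ?Q" if "i < n" for i
    using in_Q[OF mvar_in_mpoly_ring[OF K'(1) that]] by (simp add: mpoly_eval_mvar[OF rhom_UNIV_id])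
  ultimately show "adjoin K y n \<subseteq> ?Q" unfolding adjoin_def by (intro fgen_minimal[OF Q]) blast
  have S: "subfield_set (adjoin K y n)" unfolding adjoin_def by simp
  have KA: "K \<subseteq> adjoin K y n" and yA: "\<And>i. i < n \<Longrightarrow> y i \<in> adjoin K y n"
    unfolding adjoin_def using fgen_incl[of "K \<union> y ` {..<n}"] by auto
  have "mpoly_eval id y p \<in> adjoin K y n" if "p \<in> ?C" for p
    by (rule mpoly_eval_in[OF subfield_setD(1)[OF S] that]) (use KA yA in auto)
  then show "?Q \<subseteq> adjoin K y n" using subfield_setD(9)[OF S] by blast
qed

section \<open>Points of varieties over a PAC extension\<close>

lemma embed_rhom: "rhom UNIV (embed :: 'a::field \<Rightarrow> 'a universal_domain)"
  unfolding rhom_def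
proof (intro conjI ballI)
  show "(embed 1 :: 'a universal_domain) = 1"
    unfolding embed_def by (simp add: One_fract_def[symmetric])
  fix x y :: 'a
  have "Fract (Poly_Mapping.single 0 (x + y)) 1 = Fract (Poly_Mapping.single 0 x) 1 + Fract (Poly_Mapping.single (0 :: nat \<Rightarrow>\<^sub>0 nat) y) 1"
    by (simp add: single_add)
  then show "embed (x + y) = embed x + embed y" unfolding embed_def by (simp only: to_ac_add)
  have "Fract (Poly_Mapping.single 0 (x * y)) 1 = Fract (Poly_Mapping.single 0 x) 1 * Fract (Poly_Mapping.single (0 :: nat \<Rightarrow>\<^sub>0 nat) y) 1"
    by (simp add: mult_single)
  then show "embed (x * y) = embed x * embed y" unfolding embed_def by (simp only: to_ac_mult)
qed

lemma subfield_set_UNIV: "subfield_set UNIV"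
  by (auto simp: subfield_set_def subring_set_UNIV)

lemma embed_inj: "embed c = embed d \<longleftrightarrow> c = d"
  using rhom_field_inj_on[OF embed_rhom subfield_set_UNIV] by (auto dest: injD)

lemma embed_eq_0_iff:
  fixes c :: "'a::field"
  shows "embed c = 0 \<longleftrightarrow> c = 0"
  using embed_inj[of c 0] rhomD(2)[OF embed_rhom[where 'a = 'a] subring_set_UNIV] by simp

lemma embed_adjoin: "embed ` adjoin K y n = adjoin (embed ` K) (\<lambda>i. embed (y i)) n"
  unfolding adjoin_def
  using image_fgen[OF rhom_mono[OF embed_rhom subset_UNIV], of "K \<union> y ` {..<n}"] by (simp add: image_Un image_image)

lemma mpoly_eval_embed: "mpoly_eval embed (\<lambda>i. embed (y i)) p = embed (mpoly_eval id y p)"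
  using mpoly_eval_comp[OF embed_rhom subring_set_UNIV, of id p y] by simp

lemma embed_algebraically_independent:
  assumes "algebraically_independent K t n"
  shows "algebraically_independent (embed ` K) (\<lambda>i. embed (t i)) n"
  unfolding algebraically_independent_def
proof (intro ballI impI)
  fix p :: "'a universal_domain mpoly"
  assume p: "p \<in> carrier (mpoly_ring (embed ` K) n)" "mpoly_eval id (\<lambda>i. embed (t i)) p = 0"
  note e = rhomD[OF embed_rhom subring_set_UNIV]
  define g where "g c = (if c = 0 then 0 else inv_into UNIV embed c)" for c :: "'a universal_domain"
  define q where "q = Poly_Mapping.map g p"
  have inv: "embed (inv_into UNIV embed c) = c" if "c \<in> embed ` K" for c
    using that f_inv_into_f[of c embed UNIV] by auto
  have lq: "embed (Poly_Mapping.lookup q m) = Poly_Mapping.lookup p m" for m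
    using p(1) inv unfolding q_def mpoly_ring_carrier by (auto simp: Poly_Mapping.map.rep_eq when_def g_def e(2))
  have keys: "Poly_Mapping.keys q = Poly_Mapping.keys p"
  proof -
    have "Poly_Mapping.lookup q m = 0 \<longleftrightarrow> Poly_Mapping.lookup p m = 0" for m
      using embed_eq_0_iff[of "Poly_Mapping.lookup q m"] unfolding lq by blast
    then show ?thesis unfolding set_eq_iff in_keys_iff by blast
  qed
  have "Poly_Mapping.lookup q m \<in> K" for m
  proof -
    have "embed (Poly_Mapping.lookup q m) \<in> embed ` K" using lq p(1) unfolding mpoly_ring_carrier by simp
    then obtain k where "k \<in> K" "embed (Poly_Mapping.lookup q m) = embed k" by (rule imageE)
    then show ?thesis by (simp only: embed_inj)
  qed
  then have "q \<in> carrier (mpoly_ring K n)" using p(1) keys unfolding mpoly_ring_carrier by simp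
  moreover have "embed (mpoly_eval id t q) = mpoly_eval embed (\<lambda>i. embed (t i)) q" by (rule mpoly_eval_embed[symmetric])
  then have "embed (mpoly_eval id t q) = mpoly_eval id (\<lambda>i. embed (t i)) p"
    unfolding mpoly_eval_def[of embed] mpoly_eval_def[of id _ p] keys by (simp add: lq)
  then have "mpoly_eval id t q = 0" using p(2) embed_eq_0_iff by metis
  ultimately have "q = 0" using assms unfolding algebraically_independent_def by blast
  then show "p = 0" using keys by (metis keys_eq_empty keys_zero)
qed

text \<open>A squarefree monic polynomial is a product of distinct linear factors;
  \<open>embed\<close> is injective and keeps these factors distinct.\<close>

lemma embed_separable:
  fixes x :: "'a::alg_closed_field"
  assumes K: "subfield_set K" and x: "separable_over K x"
  shows "separable_over (embed ` K) (embed x)"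
proof -
  let ?e = "embed :: 'a \<Rightarrow> 'a universal_domain"
  obtain m where m: "is_min_poly K x m" "rsquarefree m" using x unfolding separable_over_def by blast
  let ?R = "{y. poly m y = 0}"
  have m': "poly_over K m" "lead_coeff m = 1" "poly m x = 0" "m \<noteq> 0" using m(1) by (auto simp: is_min_poly_def)
  have fin: "finite ?R" by (rule poly_roots_finite[OF m'(4)])
  have ml: "m = lin_prod ?R" using rsquarefree_eq_lin_prod[OF m(2)] m'(2) by simp
  note e = rhomD[OF embed_rhom subring_set_UNIV]
  have "map_poly ?e (lin_prod R) = lin_prod (?e ` R)" if "finite R" for R
    using that
  proof (induction R rule: finite_induct)
    case empty
    show ?case by (simp add: map_poly_1' e(1))
  next
    case (insert u R)
    have "map_poly ?e ([:- u, 1:] * lin_prod R) = map_poly ?e [:- u, 1:] * map_poly ?e (lin_prod R)"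
      by (rule map_poly_rhom(2)[OF embed_rhom subring_set_UNIV]) (auto simp: poly_over_def)
    moreover have "map_poly ?e [:- u, 1:] = [:- ?e u, 1:]"
      by (simp add: map_poly_rhom_pCons[OF embed_rhom subring_set_UNIV] e(1,5))
    moreover have "?e u \<notin> ?e ` R" using insert(2) by (simp add: image_iff embed_inj)
    ultimately show ?case using insert by simp
  qed
  then have mm: "map_poly ?e m = lin_prod (?e ` ?R)" using ml fin by metis
  show ?thesis
  proof (rule separable_overI)
    show "subfield_set (?e ` K)" by (rule subfield_set_image[OF rhom_mono[OF embed_rhom subset_UNIV] K])
    show "poly_over (?e ` K) (map_poly ?e m)"
      using m'(1) unfolding poly_over_def by (auto simp: coeff_map_poly e(2))
    show "rsquarefree (map_poly ?e m)" unfolding mm by (rule rsquarefree_lin_prod) (use fin in simp)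
    show "poly (map_poly ?e m) (?e x) = 0"
      unfolding mm using fin m'(3) by (subst poly_lin_prod_eq_0_iff) auto
  qed
qed

section \<open>Ideals of polynomial rings and absolutely irreducible loci\<close>

lemma subring_structure_simps:
  "carrier (ring_of_type_algebra\<lparr>carrier := C\<rparr> :: 'c::comm_ring_1 ring) = C"
  "\<zero>\<^bsub>(ring_of_type_algebra\<lparr>carrier := C\<rparr> :: 'c ring)\<^esub> = 0"
  "\<one>\<^bsub>(ring_of_type_algebra\<lparr>carrier := C\<rparr> :: 'c ring)\<^esub> = 1"
  "x \<oplus>\<^bsub>ring_of_type_algebra\<lparr>carrier := C\<rparr>\<^esub> y = x + y"
  "x \<otimes>\<^bsub>ring_of_type_algebra\<lparr>carrier := C\<rparr>\<^esub> y = x * y"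
  "x \<oplus>\<^bsub>ring_of_type_algebra\<^esub> y = x + y" "x \<otimes>\<^bsub>ring_of_type_algebra\<^esub> y = x * y"
  "\<zero>\<^bsub>(ring_of_type_algebra :: 'c ring)\<^esub> = 0" "\<one>\<^bsub>(ring_of_type_algebra :: 'c ring)\<^esub> = 1"
  for x y :: "'c::comm_ring_1"
  by (auto simp: ring_of_type_algebra_def)

lemma cring_subring_set:
  fixes C :: "'c::comm_ring_1 set"
  assumes C: "subring_set C"
  shows "cring (ring_of_type_algebra\<lparr>carrier := C\<rparr>)"
proof (rule cringI)
  note C' = subring_setD[OF C]
  show "abelian_group (ring_of_type_algebra\<lparr>carrier := C\<rparr>)"
  proof (rule abelian_groupI, unfold subring_structure_simps)
    fix x assume "x \<in> C"
    then show "\<exists>y\<in>C. y + x = 0" using C'(3) by (intro bexI[of _ "- x"]) auto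
  qed (use C' in \<open>auto simp: algebra_simps\<close>)
  show "Group.comm_monoid (ring_of_type_algebra\<lparr>carrier := C\<rparr>)"
    by (rule comm_monoidI, unfold subring_structure_simps) (use C' in \<open>auto simp: algebra_simps\<close>)
qed (auto simp: subring_structure_simps algebra_simps)

lemma mpoly_ring_structure: "mpoly_ring K n = ring_of_type_algebra\<lparr>carrier := carrier (mpoly_ring K n)\<rparr>"
  by (simp add: mpoly_ring_def)

lemma kernel_ideal:
  fixes C :: "'c::comm_ring_1 set" and f :: "'c \<Rightarrow> 'b::comm_ring_1"
  assumes C: "subring_set C" and f: "rhom C f"
  shows "ideal {p \<in> C. f p = 0} (ring_of_type_algebra\<lparr>carrier := C\<rparr>)"
proof -
  let ?R = "ring_of_type_algebra\<lparr>carrier := C\<rparr> :: 'c ring"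
  note C' = subring_setD[OF C] and f' = rhomD[OF f C]
  interpret cring ?R by (rule cring_subring_set[OF C])
  show ?thesis
  proof (rule idealI)
    show "Ring.ring ?R" by (rule ring_axioms)
    have neg: "\<ominus>\<^bsub>?R\<^esub> x = - x" if "x \<in> C" for x
      by (rule minus_equality) (use that C'(3) in \<open>auto simp: subring_structure_simps\<close>)
    show "subgroup {p \<in> C. f p = 0} (add_monoid ?R)"
    proof (rule add.subgroupI)
      show "{p \<in> C. f p = 0} \<subseteq> carrier ?R" by (auto simp: subring_structure_simps)
      show "{p \<in> C. f p = 0} \<noteq> {}" using C'(1) f'(2) by blast
      show "\<ominus>\<^bsub>?R\<^esub> a \<in> {p \<in> C. f p = 0}" if "a \<in> {p \<in> C. f p = 0}" for a
        using that neg[of a] C'(3) f'(5) by simp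
      show "a \<oplus>\<^bsub>?R\<^esub> b \<in> {p \<in> C. f p = 0}" if "a \<in> {p \<in> C. f p = 0}" "b \<in> {p \<in> C. f p = 0}" for a b
        using that C'(4) f'(3) by (simp add: subring_structure_simps)
    qed
    show "x \<otimes>\<^bsub>?R\<^esub> a \<in> {p \<in> C. f p = 0}" "a \<otimes>\<^bsub>?R\<^esub> x \<in> {p \<in> C. f p = 0}"
      if "a \<in> {p \<in> C. f p = 0}" "x \<in> carrier ?R" for a x
      using that C'(5) f'(4) by (simp_all add: subring_structure_simps)
  qed
qed

lemma kernel_primeideal:
  fixes C :: "'c::comm_ring_1 set" and f :: "'c \<Rightarrow> 'b::idom"
  assumes C: "subring_set C" and f: "rhom C f"
  shows "primeideal {p \<in> C. f p = 0} (ring_of_type_algebra\<lparr>carrier := C\<rparr>)"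
proof (rule primeidealI[OF kernel_ideal[OF C f] cring_subring_set[OF C]], unfold subring_structure_simps)
  note C' = subring_setD[OF C] and f' = rhomD[OF f C]
  show "C \<noteq> {p \<in> C. f p = 0}" using C'(2) f'(1) by (metis (mono_tags, lifting) mem_Collect_eq zero_neq_one)
  fix a b assume "a \<in> C" "b \<in> C" "a * b \<in> {p \<in> C. f p = 0}"
  then show "a \<in> {p \<in> C. f p = 0} \<or> b \<in> {p \<in> C. f p = 0}" using f'(4) by auto
qed

lemma ideal_combination:
  fixes C :: "'c::comm_ring_1 set"
  assumes J: "ideal J (ring_of_type_algebra\<lparr>carrier := C\<rparr>)"
    and x: "\<And>b. b \<in> B \<Longrightarrow> x b \<in> C" and y: "\<And>b. b \<in> B \<Longrightarrow> y b \<in> J"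
  shows "(\<Sum>b\<in>B. x b * y b) \<in> J"
proof -
  interpret ideal J "ring_of_type_algebra\<lparr>carrier := C\<rparr>" by (rule J)
  have add: "a + b \<in> J" if "a \<in> J" "b \<in> J" for a b using additive_subgroup.a_closed[OF ideal.axioms(1)[OF J] that] by (simp add: subring_structure_simps)
  have zero: "0 \<in> J" using additive_subgroup.zero_closed[OF ideal.axioms(1)[OF J]] by (simp add: subring_structure_simps)
  have mult: "x b * y b \<in> J" if "b \<in> B" for b
    using I_l_closed[OF y[OF that]] x[OF that] by (simp add: subring_structure_simps)
  show ?thesis using mult by (induction B rule: infinite_finite_induct) (auto simp: add zero)
qed

text \<open>Over the algebraic closure the polynomials vanishing at \<open>y\<close> form the kernel
  of a map to a field, a prime ideal. It is generated by its elements over \<open>K\<close>: in the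
  decomposition of \<open>f\<close> along independent constants, the values of the parts lie in
  \<open>D\<close> and vanish by linear disjointness.\<close>

lemma absolutely_irreducible_locus:
  fixes K :: "'a::alg_closed_field set"
  assumes K: "subfield_set K" and D: "subfield_set D" "K \<subseteq> D" "lin_disj K (algebraic_closure_of K) D"
    and y: "\<And>i. i < n \<Longrightarrow> y i \<in> D"
  shows "absolutely_irreducible_variety K n {f \<in> carrier (mpoly_ring K n). mpoly_eval id y f = 0}"
proof -
  let ?Kb = "algebraic_closure_of K"
  let ?I = "{f \<in> carrier (mpoly_ring K n). mpoly_eval id y f = 0}"
  let ?J = "{f \<in> carrier (mpoly_ring ?Kb n). mpoly_eval id y f = 0}"
  note K' = subfield_setD[OF K]
  have Kb: "subfield_set ?Kb" "K \<subseteq> ?Kb" using subfield_set_algebraic_closure[OF K] subset_algebraic_closure[OF K] .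
  have C: "subring_set (carrier (mpoly_ring K n))" "subring_set (carrier (mpoly_ring ?Kb n))"
    using subring_set_mpoly_ring subfield_setD(1)[OF K] subfield_setD(1)[OF Kb(1)] by auto
  note ev = rhom_mpoly_eval_id[of y]
  note ev' = rhomD[OF ev subring_set_UNIV]
  have I: "ideal ?I (mpoly_ring K n)"
    using kernel_ideal[OF C(1) rhom_mono[OF ev subset_UNIV]] mpoly_ring_structure[of K n] by simp
  have J: "primeideal ?J (mpoly_ring ?Kb n)"
    using kernel_primeideal[OF C(2) rhom_mono[OF ev subset_UNIV]] mpoly_ring_structure[of ?Kb n] by simp
  have ld: "lin_disj K D ?Kb" by (rule lin_disj_sym[OF K Kb(1) Kb(2) D(2) D(3)])
  have IJ: "?I \<subseteq> ?J" using mpoly_ring_mono[OF Kb(2) order_refl, of n] by blast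
  have "Idl\<^bsub>mpoly_ring ?Kb n\<^esub> ?I = ?J"
  proof
    show "Idl\<^bsub>mpoly_ring ?Kb n\<^esub> ?I \<subseteq> ?J"
      unfolding genideal_def using primeideal.axioms(1)[OF J] IJ by blast
    show "?J \<subseteq> Idl\<^bsub>mpoly_ring ?Kb n\<^esub> ?I"
      unfolding genideal_def
    proof (intro subsetI InterI, elim CollectE conjE)
      fix f M assume f: "f \<in> carrier (mpoly_ring ?Kb n)" "mpoly_eval id y f = 0"
        and M: "ideal M (mpoly_ring ?Kb n)" "?I \<subseteq> M"
      from mpoly_basis_decomposition[OF K f(1)] obtain B P where B: "finite B" "B \<subseteq> ?Kb" "indep K B"
        "\<forall>b\<in>B. P b \<in> carrier (mpoly_ring K n)" "f = (\<Sum>b\<in>B. Poly_Mapping.single 0 b * P b)" by (elim exE conjE)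
      have iD: "indep D B" using ld B(1-3) unfolding lin_disj_def by blast
      have "mpoly_eval id y f = (\<Sum>b\<in>B. mpoly_eval id y (P b) * b)"
        unfolding B(5) mpoly_eval_sum[OF rhom_UNIV_id] mpoly_eval_mult[OF rhom_UNIV_id] mpoly_eval_const[OF rhom_UNIV_id]
        by (simp add: mult.commute)
      then have z: "(\<Sum>b\<in>B. mpoly_eval id y (P b) * b) = 0" using f(2) by simp
      have "mpoly_eval id y (P b) = 0" if b: "b \<in> B" for b
      proof (rule indepD[OF iD _ z b])
        fix b assume "b \<in> B"
        then show "mpoly_eval id y (P b) \<in> D"
          using B(4) D(2) y by (intro mpoly_eval_in[OF subfield_setD(1)[OF D(1)], of _ K n]) auto
      qed
      then have "P b \<in> M" if "b \<in> B" for b using M(2) B(4) that by blast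
      moreover have "ideal M (ring_of_type_algebra\<lparr>carrier := carrier (mpoly_ring ?Kb n)\<rparr>)"
        using M(1) mpoly_ring_structure[of ?Kb n] by simp
      moreover have "Poly_Mapping.single 0 b \<in> carrier (mpoly_ring ?Kb n)" if "b \<in> B" for b
        using const_in_mpoly_ring[OF subfield_setD(1)[OF Kb(1)]] B(2) that by blast
      ultimately show "f \<in> M" unfolding B(5) by (intro ideal_combination) auto
    qed
  qed
  then show ?thesis unfolding absolutely_irreducible_variety_def using I J by simp
qed

text \<open>The locus of \<open>t\<close> together with \<open>Y\<close> is an absolutely
  irreducible variety with separable projection to \<open>t\<close>. Its coordinate ring is realised
  as the subring \<open>R\<close> of \<open>D\<close>, and a rational point becomes the
  specialisation \<open>\<phi>\<close> of \<open>R\<close> over \<open>K\<close>.\<close>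

lemma pac_point:
  fixes K0 K :: "'a::alg_closed_field set"
  assumes pac: "pac_extension K0 K"
    and D: "subfield_set D" "K \<subseteq> D" "lin_disj K (algebraic_closure_of K) D"
    and t: "\<And>i. i < e \<Longrightarrow> t i \<in> D" "algebraically_independent K t e" "e \<ge> 1"
    and sep: "\<And>x. x \<in> D \<Longrightarrow> separable_over (adjoin K t e) x"
    and Y: "finite Y" "Y \<subseteq> D"
  shows "\<exists>R \<phi>. subring_set R \<and> K \<subseteq> R \<and> Y \<subseteq> R \<and> (\<forall>i<e. t i \<in> R) \<and> R \<subseteq> D \<and>
    rhom R \<phi> \<and> \<phi> ` R \<subseteq> K \<and> (\<forall>c\<in>K. \<phi> c = c) \<and> (\<forall>i<e. \<phi> (t i) \<in> K0)"
proof -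
  have K: "subfield_set K" using pac unfolding pac_extension_def field_extension_iff by simp
  note K' = subfield_setD[OF K]
  obtain ys where ys: "set ys = Y" using finite_list[OF Y(1)] by blast
  define n where "n = e + length ys"
  \<comment> \<open>Listing \<open>t\<close> first makes the rational map the projection to the
    first \<open>e\<close> coordinates.\<close>
  define y where "y i = (if i < e then t i else ys ! (i - e))" for i
  define x where "x i = embed (y i)" for i
  define I where "I = {f \<in> carrier (mpoly_ring K n). mpoly_eval id y f = 0}"
  have yD: "y i \<in> D" if "i < n" for i
  proof (cases "i < e")
    case False
    then have "i - e < length ys" using that unfolding n_def by simp
    then have "ys ! (i - e) \<in> Y" using ys nth_mem by blast
    then show ?thesis using False Y(2) unfolding y_def by auto
  qed (use t(1) in \<open>simp add: y_def\<close>)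
  have yt: "y i = t i" "i < n" if "i < e" for i using that unfolding y_def n_def by auto
  have adjD: "adjoin K y n \<subseteq> D" unfolding adjoin_def by (rule fgen_minimal[OF D(1)]) (use D(2) yD in auto)
  have ty: "t i \<in> adjoin K y n" if "i < e" for i
    unfolding adjoin_def yt(1)[OF that, symmetric] using yt(2)[OF that] fgen_incl[of "K \<union> y ` {..<n}"] by blast
  have KA: "K \<subseteq> adjoin K y n" "K \<subseteq> adjoin K t e"
    unfolding adjoin_def using fgen_incl[of "K \<union> y ` {..<n}"] fgen_incl[of "K \<union> t ` {..<e}"] by auto
  have tA: "t i \<in> adjoin K t e" if "i < e" for i
    unfolding adjoin_def using that fgen_incl[of "K \<union> t ` {..<e}"] by blast
  have sf: "subfield_set (adjoin K y n)" "subfield_set (adjoin K t e)" unfolding adjoin_def by auto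
  have AA: "adjoin K t e \<subseteq> adjoin K y n"
    unfolding adjoin_def[of K t] by (rule fgen_minimal[OF sf(1)]) (use KA ty in auto)
  let ?et = "\<lambda>i. embed (t i)"
  have emb_sub: "subfield_set (embed ` N)" if "subfield_set N" for N :: "'a set"
    by (rule subfield_set_image[OF rhom_mono[OF embed_rhom subset_UNIV] that])
  have adj: "adjoin (embed ` K) x n = embed ` adjoin K y n" "adjoin (embed ` K) ?et e = embed ` adjoin K t e"
    unfolding x_def using embed_adjoin[of K y n] embed_adjoin[of K t e] by auto
  have e_sep: "separable_over (adjoin (embed ` K) ?et e) z" if z: "z \<in> adjoin (embed ` K) x n" for z
  proof -
    from z obtain u where u: "u \<in> adjoin K y n" "z = embed u" unfolding adj by (elim imageE)
    then show ?thesis unfolding adj using embed_separable[OF sf(2) sep] adjD by blast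
  qed
  have etn: "embed (t i) \<in> adjoin (embed ` K) x n" if "i < e" for i unfolding adj using ty[OF that] by blast
  have alg_t: "algebraically_independent (embed ` K) ?et e" by (rule embed_algebraically_independent[OF t(2)])
  have tb: "transcendence_basis (embed ` K) (adjoin (embed ` K) x n) ?et e"
    unfolding transcendence_basis_def using etn alg_t separable_over_imp_algebraic[OF e_sep] by blast
  have sd: "separable_dominating_rational_map K n x e ?et"
    unfolding separable_dominating_rational_map_def separable_algebraic_extension_def field_extension_iff
    using etn alg_t e_sep emb_sub[OF sf(1)] emb_sub[OF sf(2)] AA unfolding adj by blast
  have irr: "absolutely_irreducible_variety K n I"
    unfolding I_def by (rule absolutely_irreducible_locus[OF K D yD])
  have gen: "generic_point K n I x"
    unfolding generic_point_def x_def mpoly_eval_embed embed_eq_0_iff I_def by blast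
  have "r \<ge> 1 \<and> absolutely_irreducible_variety K n I \<and> generic_point K n I x \<and>
       (\<exists>s. transcendence_basis (embed ` K) (adjoin (embed ` K) x n) s r) \<and>
       separable_dominating_rational_map K n x r \<nu> \<longrightarrow>
       (\<exists>a\<in>rational_points K n I. \<forall>i<r. \<exists>b\<in>K0. has_value_at embed K n x (\<nu> i) a b)" for r \<nu>
    using pac unfolding pac_extension_def by blast
  from this[of e ?et] obtain a where a: "a \<in> rational_points K n I"
    "\<forall>i<e. \<exists>b\<in>K0. has_value_at embed K n x (embed (t i)) a b"
    using t(3) irr gen tb sd by blast
  have aK: "a i \<in> K" if "i < n" for i using a(1) that unfolding rational_points_def by blast
  have aI: "mpoly_eval id a f = 0" if "f \<in> carrier (mpoly_ring K n)" "mpoly_eval id y f = 0" for f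
    using a(1) that unfolding rational_points_def I_def by blast
  let ?C = "carrier (mpoly_ring K n)"
  have C: "subring_set ?C" by (rule subring_set_mpoly_ring[OF K'(1)])
  note C' = subring_setD[OF C]
  have evy: "rhom ?C (mpoly_eval id y)" and eva: "rhom ?C (mpoly_eval id a)"
    by (rule rhom_mono[OF rhom_mpoly_eval_id subset_UNIV])+
  note evy' = rhomD[OF rhom_mpoly_eval_id[of y] subring_set_UNIV]
  note eva' = rhomD[OF rhom_mpoly_eval_id[of a] subring_set_UNIV]
  from rhom_factor[OF C evy eva aI] obtain \<phi>
    where \<phi>: "rhom (mpoly_eval id y ` ?C) \<phi>" "\<forall>p\<in>?C. \<phi> (mpoly_eval id y p) = mpoly_eval id a p" by blast
  let ?R = "mpoly_eval id y ` ?C"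
  \<comment> \<open>Values of rational functions are given through an unspecified fraction
    \<open>p/q\<close>. As \<open>t i\<close> is itself a coordinate, the polynomial
    \<open>mvar i * q - p\<close> vanishes at the generic point, hence at \<open>a\<close>, which
    identifies that value with \<open>a i\<close>.\<close>
  have aK0: "a i \<in> K0" if i: "i < e" for i
  proof -
    obtain b p q where b: "b \<in> K0" and pq: "p \<in> ?C" "q \<in> ?C" "mpoly_eval embed x q \<noteq> 0"
      "embed (t i) = mpoly_eval embed x p / mpoly_eval embed x q" "mpoly_eval id a q \<noteq> 0"
      "b = mpoly_eval id a p / mpoly_eval id a q"
      using a(2) i unfolding has_value_at_def by blast
    have mi: "mvar i \<in> ?C" by (rule mvar_in_mpoly_ring[OF K'(1) yt(2)[OF i]])
    have "embed (t i) * embed (mpoly_eval id y q) = embed (mpoly_eval id y p)"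
      using pq(3,4) unfolding x_def mpoly_eval_embed by simp
    then have "embed (t i * mpoly_eval id y q) = embed (mpoly_eval id y p)"
      by (simp add: rhomD(4)[OF embed_rhom subring_set_UNIV])
    then have "t i * mpoly_eval id y q = mpoly_eval id y p" by (simp only: embed_inj)
    then have "mpoly_eval id y (mvar i * q - p) = 0"
      using yt(1)[OF i] by (simp add: evy' mpoly_eval_mvar[OF rhom_UNIV_id])
    then have "mpoly_eval id a (mvar i * q - p) = 0" using C' mi pq by (intro aI) auto
    then have "a i * mpoly_eval id a q = mpoly_eval id a p"
      by (simp add: eva' mpoly_eval_mvar[OF rhom_UNIV_id])
    then have "a i = b" unfolding pq(6) using pq(5) by (simp add: eq_divide_eq)
    then show ?thesis using b by simp
  qed
  have cR: "c \<in> ?R \<and> \<phi> c = c" if "c \<in> K" for c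
  proof -
    have m: "Poly_Mapping.single 0 c \<in> ?C" by (rule const_in_mpoly_ring[OF K'(1) that])
    have "mpoly_eval id y (Poly_Mapping.single 0 c) = c" "mpoly_eval id a (Poly_Mapping.single 0 c) = c"
      by (simp_all add: mpoly_eval_const[OF rhom_UNIV_id])
    then show ?thesis using \<phi>(2) m by (metis image_eqI)
  qed
  have yR: "y i \<in> ?R \<and> \<phi> (y i) = a i" if "i < n" for i
  proof -
    have m: "mvar i \<in> ?C" by (rule mvar_in_mpoly_ring[OF K'(1) that])
    have "mpoly_eval id y (mvar i) = y i" "mpoly_eval id a (mvar i) = a i"
      by (simp_all add: mpoly_eval_mvar[OF rhom_UNIV_id])
    then show ?thesis using \<phi>(2) m by (metis image_eqI)
  qed
  have YR: "Y \<subseteq> ?R"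
  proof
    fix u assume "u \<in> Y"
    then obtain j where j: "j < length ys" "u = ys ! j" using ys by (metis in_set_conv_nth)
    then have "y (e + j) = u" "e + j < n" unfolding y_def n_def by auto
    then show "u \<in> ?R" using yR by blast
  qed
  have "\<phi> ` ?R \<subseteq> K"
  proof
    fix z assume "z \<in> \<phi> ` ?R"
    then obtain p where "p \<in> ?C" "z = mpoly_eval id a p" using \<phi>(2) by auto
    then show "z \<in> K" using mpoly_eval_in[OF K'(1), of p K n id a] aK by simp
  qed
  moreover have "?R \<subseteq> D"
    using mpoly_eval_in[OF subfield_setD(1)[OF D(1)], of _ K n id y] D(2) yD by auto
  moreover have "subring_set ?R" by (rule subring_set_image[OF C evy])
  moreover have "\<forall>i<e. t i \<in> ?R \<and> \<phi> (t i) \<in> K0" using yR yt aK0 by metis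
  ultimately show ?thesis using cR YR \<phi>(1) by (intro exI[of _ ?R] exI[of _ \<phi>]) blast
qed

section \<open>Laurent series over a subfield\<close>

definition fls_over :: "'a::field set \<Rightarrow> 'a fls set"
  where "fls_over K = {f. \<forall>n. fls_nth f n \<in> K}"

definition fps_over :: "'a::field set \<Rightarrow> 'a fps set"
  where "fps_over K = {f. \<forall>n. fps_nth f n \<in> K}"

lemma fps_over_to_fls: "0 \<in> K \<Longrightarrow> fps_to_fls f \<in> fls_over K \<longleftrightarrow> f \<in> fps_over K"
proof
  assume "fps_to_fls f \<in> fls_over K"
  then have "fls_nth (fps_to_fls f) (int n) \<in> K" for n unfolding fls_over_def by blast
  then show "f \<in> fps_over K" by (simp add: fps_over_def)
qed (auto simp: fls_over_def fps_over_def)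

lemma fls_const_over: "0 \<in> K \<Longrightarrow> c \<in> K \<Longrightarrow> fls_const c \<in> fls_over K"
  by (simp add: fls_over_def)

lemma subring_set_fps_over:
  assumes K: "subring_set K" shows "subring_set (fps_over K)"
  by (rule subring_setI)
    (auto simp: fps_over_def subring_setD[OF K] fps_mult_nth intro!: subring_set_sum[OF K])

text \<open>The recursion for the coefficients of the inverse divides by the constant term
  only.\<close>

lemma fps_inverse_over:
  assumes K: "subfield_set K" and u: "u \<in> fps_over K" "fps_nth u 0 \<noteq> 0"
  shows "inverse u \<in> fps_over K"
proof -
  note K' = subfield_setD[OF K]
  let ?v = "inverse u"
  have uv: "u * ?v = 1" using inverse_mult_eq_1[OF u(2)] by (simp add: mult.commute)
  have "fps_nth ?v n \<in> K" for n
  proof (induction n rule: less_induct)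
    case (less n)
    have "(\<Sum>i=0..n. fps_nth u i * fps_nth ?v (n - i)) = (if n = 0 then 1 else 0)"
      using arg_cong[OF uv, of "\<lambda>f. fps_nth f n"] by (simp add: fps_mult_nth)
    moreover have "(\<Sum>i=0..n. fps_nth u i * fps_nth ?v (n - i))
        = fps_nth u 0 * fps_nth ?v n + (\<Sum>i=1..n. fps_nth u i * fps_nth ?v (n - i))"
      by (simp add: sum.atLeast_Suc_atMost)
    ultimately have e: "fps_nth ?v n = ((if n = 0 then 1 else 0) - (\<Sum>i=1..n. fps_nth u i * fps_nth ?v (n - i))) / fps_nth u 0"
      using u(2) by (simp add: field_simps)
    have s: "(\<Sum>i=1..n. fps_nth u i * fps_nth ?v (n - i)) \<in> K"
    proof (rule subring_set_sum[OF K'(1)])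
      fix i assume "i \<in> {1..n}"
      then have "n - i < n" by auto
      then show "fps_nth u i * fps_nth ?v (n - i) \<in> K" using less.IH u(1) K'(6) unfolding fps_over_def by blast
    qed
    have "fps_nth u 0 \<in> K" using u(1) unfolding fps_over_def by blast
    then show ?case unfolding e by (intro K'(9) K'(7) s) (use K'(2,3) in auto)
  qed
  then show ?thesis unfolding fps_over_def by blast
qed

lemma subfield_set_fls_over:
  assumes K: "subfield_set K" shows "subfield_set (fls_over K)"
proof (rule subfield_setI)
  note K' = subfield_setD[OF K]
  show "1 \<in> fls_over K" using fls_const_over[of K 1] K'(2,3) by simp
  fix f assume f: "f \<in> fls_over K"
  fix g assume g: "g \<in> fls_over K"
  show "f - g \<in> fls_over K" using f g K'(7) by (simp add: fls_over_def)
  show "f * g \<in> fls_over K"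
    unfolding fls_over_def
  proof (intro CollectI allI)
    fix n
    show "fls_nth (f * g) n \<in> K"
      unfolding fls_times_nth(2)[of f g]
      by (rule subring_set_sum[OF K'(1)], rule K'(6)) (use f g in \<open>simp_all add: fls_over_def\<close>)
  qed
next
  note K' = subfield_setD[OF K]
  fix f assume f: "f \<in> fls_over K" "f \<noteq> 0"
  define u where "u = fls_base_factor_to_fps f"
  define n where "n = fls_subdegree f"
  have "fps_nth u m = fls_nth f (fls_subdegree f + int m)" for m unfolding u_def by (rule fls_base_factor_to_fps_nth)
  then have u: "u \<in> fps_over K" using f(1) unfolding fps_over_def fls_over_def by simp
  have u0: "fps_nth u 0 \<noteq> 0" unfolding u_def using f(2) by (rule fls_base_factor_to_fps_base)
  then have "subdegree u = 0" by (simp add: subdegree_eq_0_iff)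
  have "f = fls_shift (- n) (fps_to_fls u)" unfolding n_def u_def by (rule fls_conv_base_factor_to_fps_shift_subdegree)
  then have "inverse f = fls_shift n (inverse (fps_to_fls u))" using fls_inverse_shift[of "- n" "fps_to_fls u"] by simp
  also have "\<dots> = fls_shift n (fps_to_fls (inverse u))" using fls_inverse_fps_to_fls[OF \<open>subdegree u = 0\<close>] by simp
  finally have e: "inverse f = fls_shift n (fps_to_fls (inverse u))" .
  have "fps_to_fls (inverse u) \<in> fls_over K" using fps_over_to_fls[OF K'(2)] fps_inverse_over[OF K u u0] by blast
  then show "inverse f \<in> fls_over K" unfolding e by (simp add: fls_over_def)
qed

section \<open>The valuation ring of the Laurent series and its residue map\<close>

abbreviation fls_int :: "'a::field fls set" where "fls_int \<equiv> range fps_to_fls"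
abbreviation fls_res :: "'a::field fls \<Rightarrow> 'a" where "fls_res f \<equiv> fls_nth f 0"

lemma rhom_fps_to_fls: "rhom UNIV (fps_to_fls :: 'a::field fps \<Rightarrow> 'a fls)"
  by (simp add: rhom_def fls_times_fps_to_fls)

lemma rhom_fps_nth_0: "rhom UNIV (\<lambda>f :: 'a::field fps. fps_nth f 0)"
  by (simp add: rhom_def)

lemma rhom_fls_const: "rhom UNIV (fls_const :: 'a::field \<Rightarrow> 'a fls)"
  by (auto simp: rhom_def fls_plus_const intro!: fls_eqI)

lemma subring_fls_int: "subring_set (fls_int :: 'a::field fls set)"
  by (rule subring_set_image[OF subring_set_UNIV rhom_fps_to_fls])

lemma rhom_fls_res: "rhom fls_int (fls_res :: 'a::field fls \<Rightarrow> 'a)"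
  unfolding rhom_def by (auto simp: fls_times_fps_to_fls[symmetric])

lemma fls_int_iff: "f \<in> fls_int \<longleftrightarrow> (\<forall>n<0. fls_nth f n = 0)"
proof
  assume "\<forall>n<0. fls_nth f n = 0"
  then have "f = fps_to_fls (fls_regpart f)" by (intro fls_eqI) auto
  then show "f \<in> fls_int" by blast
qed auto

lemma fls_int_inverse:
  fixes f :: "'a::field fls"
  assumes "f \<in> fls_int" "fls_res f \<noteq> 0" shows "inverse f \<in> fls_int"
proof -
  obtain u where u: "f = fps_to_fls u" using assms(1) by blast
  then have "fps_nth u 0 \<noteq> 0" using assms(2) by simp
  then have "subdegree u = 0" by (simp add: subdegree_eq_0_iff)
  from fls_inverse_fps_to_fls[OF this] show ?thesis unfolding u by simp
qed

lemma fls_int_or_inverse: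
  fixes f :: "'a::field fls"
  assumes "f \<notin> fls_int" shows "inverse f \<in> fls_int \<and> fls_res (inverse f) = 0"
proof -
  have "f \<noteq> 0" using assms fps_zero_to_fls by (metis rangeI)
  have "fls_subdegree f < 0"
  proof (rule ccontr)
    assume "\<not> fls_subdegree f < 0"
    then have "fps_to_fls (fls_regpart f) = f" by simp
    then show False using assms by (metis rangeI)
  qed
  then have s: "fls_subdegree (inverse f) > 0" using \<open>f \<noteq> 0\<close> by simp
  then have "fls_nth (inverse f) n = 0" if "n \<le> 0" for n
    using that by (intro fls_eq0_below_subdegree) simp
  then show ?thesis unfolding fls_int_iff by simp
qed

section \<open>Newton approximation\<close>

text \<open>The second-order remainder is left unspecified, so no division by 2 occurs and every
  characteristic is covered.\<close>

lemma poly_taylor: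
  fixes f :: "'a::idom poly"
  shows "\<exists>r. poly f (y + d) = poly f y + poly (pderiv f) y * d + r * d ^ 2"
proof (induction f)
  case 0
  show ?case by (intro exI[of _ 0]) simp
next
  case (pCons a f)
  then obtain r where r: "poly f (y + d) = poly f y + poly (pderiv f) y * d + r * d ^ 2" by blast
  show ?case
    unfolding poly_pCons r pderiv_pCons poly_add
    by (intro exI[of _ "poly (pderiv f) y + r * (y + d)"]) (simp add: algebra_simps power2_eq_square)
qed

lemma fps_poly_cong:
  fixes f :: "'a::field fps poly"
  assumes "\<And>i. i < n \<Longrightarrow> fps_nth y i = fps_nth z i" and "i < n"
  shows "fps_nth (poly f y) i = fps_nth (poly f z) i"
  using assms(2)
proof (induction f arbitrary: i)
  case (pCons a f)
  have "fps_nth (y * poly f y) i = fps_nth (z * poly f z) i"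
    unfolding fps_mult_nth using pCons assms(1) by (intro sum.cong) auto
  then show ?case by simp
qed simp

lemma poly_coeffs_in_subring:
  fixes p :: "'a::comm_ring_1 poly"
  assumes R: "subring_set R" and p: "\<And>i. poly.coeff p i \<in> R" and x: "x \<in> R"
  shows "poly p x \<in> R"
  unfolding poly_altdef
  by (intro subring_set_sum[OF R] subring_setD(5)[OF R] subring_set_power[OF R] p x)

lemma pderiv_coeffs_in_subring:
  fixes p :: "'a::idom poly"
  assumes R: "subring_set R" and p: "\<And>i. poly.coeff p i \<in> R"
  shows "poly.coeff (pderiv p) i \<in> R"
proof -
  have "of_nat n \<in> R" for n by (induction n) (auto simp: subring_setD[OF R])
  then show ?thesis unfolding coeff_pderiv by (intro subring_setD(5)[OF R] p)
qed

text \<open>One coefficient is corrected per step, always dividing by the constant \<open>u\<close>,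
  the constant term of the derivative. This linear form of Newton's method keeps all coefficients in
  \<open>k\<close>.\<close>

lemma fps_newton_exists:
  fixes f :: "'a::field fps poly"
  assumes k: "subfield_set k" and f: "\<And>i. poly.coeff f i \<in> fps_over k" and c: "c \<in> k"
    and root: "fps_nth (poly f (fps_const c)) 0 = 0" and der: "fps_nth (poly (pderiv f) (fps_const c)) 0 \<noteq> 0"
  shows "\<exists>y \<in> fps_over k. fps_nth y 0 = c \<and> poly f y = 0"
proof -
  note k' = subfield_setD[OF k]
  have R: "subring_set (fps_over k)" by (rule subring_set_fps_over[OF k'(1)])
  define u where "u = fps_nth (poly (pderiv f) (fps_const c)) 0"
  have cR: "fps_const c \<in> fps_over k" using c k'(2) by (simp add: fps_over_def)
  have uk: "u \<in> k" "u \<noteq> 0"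
    using poly_coeffs_in_subring[OF R pderiv_coeffs_in_subring[OF R f] cR] der unfolding u_def fps_over_def by auto
  \<comment> \<open>The new term has order \<open>Suc n\<close>: it leaves the lower coefficients of
    the value alone and changes the one at \<open>Suc n\<close> by exactly its negative.\<close>
  define Y where "Y = rec_nat (fps_const c) (\<lambda>n y. y - fps_const (fps_nth (poly f y) (Suc n) / u) * fps_X ^ Suc n)"
  have Y0: "Y 0 = fps_const c"
    and YS: "Y (Suc n) = Y n - fps_const (fps_nth (poly f (Y n)) (Suc n) / u) * fps_X ^ Suc n" for n
    unfolding Y_def by auto
  have Xn: "fps_nth (fps_const a * fps_X ^ Suc n) i = (if i = Suc n then a else 0)" for a :: 'a and n i
    by (simp only: fps_mult_left_const_nth fps_X_power_nth) simp
  have YSn: "fps_nth (Y (Suc n)) i = fps_nth (Y n) i - (if i = Suc n then fps_nth (poly f (Y n)) (Suc n) / u else 0)" for n i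
    unfolding YS fps_sub_nth Xn ..
  have Yk: "Y n \<in> fps_over k" for n
  proof (induction n)
    case (Suc n)
    have "poly f (Y n) \<in> fps_over k" by (rule poly_coeffs_in_subring[OF R f Suc])
    then have "fps_nth (poly f (Y n)) (Suc n) / u \<in> k" using k'(9) uk(1) unfolding fps_over_def by blast
    moreover have "fps_nth (Y n) i \<in> k" for i using Suc unfolding fps_over_def by blast
    ultimately have "fps_nth (Y (Suc n)) i \<in> k" for i unfolding YSn using k'(7) k'(2) by simp
    then show ?case unfolding fps_over_def by blast
  qed (simp add: Y0 cR)
  have Y00: "fps_nth (Y n) 0 = c" for n by (induction n) (auto simp: Y0 YSn)
  have inv: "\<forall>i\<le>n. fps_nth (poly f (Y n)) i = 0" for n
  proof (induction n)
    case 0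
    show ?case using root by (simp add: Y0)
  next
    case (Suc n)
    define a where "a = fps_nth (poly f (Y n)) (Suc n) / u"
    define d where "d = - (fps_const a * fps_X ^ Suc n)"
    have dn: "fps_nth d i = (if i = Suc n then - a else 0)" for i unfolding d_def fps_neg_nth Xn by simp
    obtain r where "poly f (Y n + d) = poly f (Y n) + poly (pderiv f) (Y n) * d + r * d ^ 2" using poly_taylor by blast
    moreover have "Y (Suc n) = Y n + d" unfolding YS d_def a_def by simp
    ultimately have e: "poly f (Y (Suc n)) = poly f (Y n) + poly (pderiv f) (Y n) * d + r * d ^ 2" by simp
    have d1: "fps_nth (g * d) i = (if i = Suc n then - fps_nth g 0 * a else 0)" if "i \<le> Suc n" for g i
    proof -
      have "fps_nth (g * d) i = (\<Sum>j=0..i. if i - j = Suc n then - fps_nth g j * a else 0)"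
        unfolding fps_mult_nth dn by (intro sum.cong) auto
      also have "\<dots> = (if i = Suc n then - fps_nth g 0 * a else 0)"
      proof (cases "i = Suc n")
        case True
        then have "(\<Sum>j=0..i. if i - j = Suc n then - fps_nth g j * a else 0) = (\<Sum>j=0..i. if j = 0 then - fps_nth g j * a else 0)"
          by (intro sum.cong) auto
        then show ?thesis using True by simp
      next
        case False
        then show ?thesis using that by (intro trans[OF sum.neutral]) auto
      qed
      finally show ?thesis .
    qed
    \<comment> \<open>The square of \<open>d\<close> has order beyond \<open>Suc n\<close>, so the
      Taylor remainder does not interfere.\<close>
    have d2: "fps_nth (r * d ^ 2) i = 0" if "i \<le> Suc n" for i
    proof -
      have "fps_nth d 0 = 0" using dn[of 0] by simp
      then have z: "fps_nth (r * d) 0 = 0" by simp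
      have "fps_nth (r * d ^ 2) i = fps_nth ((r * d) * d) i" by (simp only: power2_eq_square mult.assoc)
      also have "\<dots> = 0" unfolding d1[OF that] z by simp
      finally show ?thesis .
    qed
    have pd: "fps_nth (poly (pderiv f) (Y n)) 0 = u"
      unfolding u_def by (rule fps_poly_cong[where n = 1]) (auto simp: Y00)
    show ?case
    proof (intro allI impI)
      fix i assume i: "i \<le> Suc n"
      have "fps_nth (poly f (Y (Suc n))) i = fps_nth (poly f (Y n)) i + (if i = Suc n then - u * a else 0)"
        unfolding e fps_add_nth d1[OF i] d2[OF i] pd by simp
      also have "\<dots> = 0"
      proof (cases "i = Suc n")
        case True
        then show ?thesis unfolding a_def using uk by simp
      next
        case False
        then show ?thesis using Suc i by simp
      qed
      finally show "fps_nth (poly f (Y (Suc n))) i = 0" .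
    qed
  qed
  \<comment> \<open>Coefficient \<open>i\<close> is final from step \<open>i\<close> on, so the
    diagonal gives the limit.\<close>
  have stab: "fps_nth (Y m) i = fps_nth (Y i) i" if "i \<le> m" for i m
    using that by (induction m rule: dec_induct) (auto simp: YSn)
  define y where "y = Abs_fps (\<lambda>n. fps_nth (Y n) n)"
  have "fps_nth (poly f y) i = 0" for i
  proof -
    have "fps_nth (poly f y) i = fps_nth (poly f (Y i)) i"
    proof (rule fps_poly_cong[where n = "Suc i"])
      fix j assume "j < Suc i"
      then show "fps_nth y j = fps_nth (Y i) j" using stab[of j i] by (simp add: y_def)
    qed simp
    then show ?thesis using inv by simp
  qed
  then have "poly f y = 0" by (intro fps_ext) simp
  moreover have "fps_nth y 0 = c" unfolding y_def using Y00 by simp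
  moreover have "y \<in> fps_over k" using Yk unfolding y_def fps_over_def by simp
  ultimately show ?thesis by blast
qed

section \<open>Algebraically independent power series\<close>

lemma countable_fgen:
  fixes S :: "'a::field set"
  assumes "countable S" shows "countable (fgen S)"
proof -
  define step where "step U = U \<union> (\<lambda>(x, y). x - y) ` (U \<times> U) \<union> (\<lambda>(x, y). x * y) ` (U \<times> U) \<union> inverse ` U" for U :: "'a set"
  define V where "V n = (step ^^ n) (insert 1 S)" for n
  have VS: "V (Suc n) = step (V n)" for n by (simp add: V_def)
  have c: "countable (V n)" for n
  proof (induction n)
    case (Suc n)
    then show ?case unfolding VS step_def by (intro countable_Un countable_image countable_SIGMA) auto
  qed (use assms in \<open>simp add: V_def\<close>)
  have "V n \<subseteq> V (Suc n)" for n unfolding VS step_def by blast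
  then have mono: "V m \<subseteq> V n" if "m \<le> n" for m n using lift_Suc_mono_le[of V m n] that by blast
  have "subfield_set (\<Union>n. V n)"
  proof (rule subfield_setI)
    show "1 \<in> (\<Union>n. V n)" using V_def[of 0] by auto
    fix x assume "x \<in> (\<Union>n. V n)"
    then obtain m where m: "x \<in> V m" by blast
    have "inverse x \<in> V (Suc m)" unfolding VS step_def using m by blast
    then show "inverse x \<in> (\<Union>n. V n)" by blast
    fix y assume "y \<in> (\<Union>n. V n)"
    then obtain n where n: "y \<in> V n" by blast
    have xy: "x \<in> V (max m n)" "y \<in> V (max m n)" using m n mono[of m "max m n"] mono[of n "max m n"] by auto
    then have "(x, y) \<in> V (max m n) \<times> V (max m n)" by blast
    then have "x - y \<in> V (Suc (max m n))" "x * y \<in> V (Suc (max m n))" unfolding VS step_def by force+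
    then show "x - y \<in> (\<Union>n. V n)" "x * y \<in> (\<Union>n. V n)" by blast+
  qed
  moreover have "S \<subseteq> (\<Union>n. V n)" using V_def[of 0] by auto
  ultimately have "fgen S \<subseteq> (\<Union>n. V n)" by (rule fgen_minimal)
  then show ?thesis by (rule countable_subset) (use c in auto)
qed

lemma countable_poly_mapping:
  assumes K: "countable K" and M: "countable M"
  shows "countable {p :: 'k \<Rightarrow>\<^sub>0 'v::zero. Poly_Mapping.keys p \<subseteq> M \<and> (\<forall>m. Poly_Mapping.lookup p m \<in> K)}" (is "countable ?P")
proof -
  define g where "g p = (\<lambda>m. (m, Poly_Mapping.lookup p m)) ` Poly_Mapping.keys p" for p :: "'k \<Rightarrow>\<^sub>0 'v"
  have "inj g"
  proof (rule injI)
    fix p q assume e: "g p = g q"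
    have k: "Poly_Mapping.keys p = fst ` g p" for p unfolding g_def by (simp add: image_image)
    have lk: "Poly_Mapping.lookup p m = v" if "(m, v) \<in> g p" for p m v using that unfolding g_def by auto
    show "p = q"
    proof (rule poly_mapping_eqI)
      fix m show "Poly_Mapping.lookup p m = Poly_Mapping.lookup q m"
      proof (cases "m \<in> Poly_Mapping.keys p")
        case True
        then have "(m, Poly_Mapping.lookup p m) \<in> g p" unfolding g_def by (rule imageI)
        then have "(m, Poly_Mapping.lookup p m) \<in> g q" by (simp only: e)
        from lk[OF this] show ?thesis by (rule sym)
      next
        case False
        then have "m \<notin> Poly_Mapping.keys q" by (simp only: k[of p] k[of q] e not_False_eq_True)
        then have "Poly_Mapping.lookup q m = 0" by (simp only: not_in_keys_iff_lookup_eq_zero)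
        moreover have "Poly_Mapping.lookup p m = 0" using False by (simp only: not_in_keys_iff_lookup_eq_zero)
        ultimately show ?thesis by (simp only:)
      qed
    qed
  qed
  moreover have "g p \<in> {A. finite A \<and> A \<subseteq> M \<times> K}" if "p \<in> ?P" for p using that unfolding g_def by auto
  then have "g ` ?P \<subseteq> {A. finite A \<and> A \<subseteq> M \<times> K}" by (rule image_subsetI)
  then have "countable (g ` ?P)" using countable_Collect_finite_subset[OF countable_SIGMA[OF M K]] by (rule countable_subset)
  ultimately show ?thesis using countable_image_inj_on[of g ?P] inj_on_subset[of g UNIV ?P] by blast
qed

lemma countable_mpoly_ring: "countable K \<Longrightarrow> countable (carrier (mpoly_ring K n))"
proof -
  assume K: "countable K"
  have "countable (UNIV :: (nat \<Rightarrow>\<^sub>0 nat) set)"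
    using countable_poly_mapping[of "UNIV :: nat set" "UNIV :: nat set"] by simp
  then have "countable {p :: 'a mpoly. Poly_Mapping.keys p \<subseteq> UNIV \<and> (\<forall>m. Poly_Mapping.lookup p m \<in> K)}"
    by (rule countable_poly_mapping[OF K])
  then show ?thesis by (rule countable_subset[rotated]) (auto simp: mpoly_ring_carrier)
qed

text \<open>Cantor's theorem on subsets of the natural numbers. Taking 0 and 1 as coefficients keeps
  these series over every subfield containing \<open>a\<close>.\<close>

lemma uncountable_series:
  "uncountable {f :: 'a::field fps. fps_nth f 0 = a \<and> (\<forall>n>0. fps_nth f n \<in> {0, 1})}" (is "uncountable ?U")
proof
  assume c: "countable ?U"
  define F where "F S = Abs_fps (\<lambda>n. if n = 0 then a else if n - 1 \<in> S then 1 else 0)" for S :: "nat set"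
  have "inj F"
  proof (rule injI)
    fix S T assume "F S = F T"
    then have e: "fps_nth (F S) (Suc n) = fps_nth (F T) (Suc n)" for n by simp
    have "(n \<in> S) = (n \<in> T)" for n using e[of n] by (cases "n \<in> S"; cases "n \<in> T") (simp_all add: F_def)
    then show "S = T" by blast
  qed
  moreover have "range F \<subseteq> ?U" unfolding F_def by auto
  then have "countable (range F)" using c by (rule countable_subset)
  ultimately have "countable (UNIV :: nat set set)" by (rule countable_image_inj_on[rotated])
  then obtain f :: "nat \<Rightarrow> nat set" where "range f = UNIV" using uncountable_def by (metis UNIV_not_empty)
  then show False using Cantors_theorem[of "UNIV :: nat set"] by auto
qed

text \<open>The polynomials that can be read as polynomials in the last variable are closed under
  sums and contain all monomials, from which that variable splits off.\<close>

lemma mpoly_split_last: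
  assumes K: "subring_set K" and P: "P \<in> carrier (mpoly_ring K (Suc i))"
  shows "\<exists>Q :: 'a::field mpoly poly. (\<forall>l. poly.coeff Q l \<in> carrier (mpoly_ring K i)) \<and> P = poly Q (mvar i)"
proof -
  note C = subring_setD[OF subring_set_mpoly_ring[OF K, of i]]
  define S where "S = {p :: 'a mpoly. \<exists>Q. (\<forall>l. poly.coeff Q l \<in> carrier (mpoly_ring K i)) \<and> p = poly Q (mvar i)}"
  have zero: "0 \<in> S" unfolding S_def using C(1) by (intro CollectI exI[of _ 0]) simp
  have add: "p + q \<in> S" if p: "p \<in> S" and q: "q \<in> S" for p q
  proof -
    obtain Q where "\<forall>l. poly.coeff Q l \<in> carrier (mpoly_ring K i)" "p = poly Q (mvar i)" using p unfolding S_def by blast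
    moreover obtain Q' where "\<forall>l. poly.coeff Q' l \<in> carrier (mpoly_ring K i)" "q = poly Q' (mvar i)" using q unfolding S_def by blast
    ultimately show ?thesis unfolding S_def using C(4) by (intro CollectI exI[of _ "Q + Q'"]) simp
  qed
  have mpow: "(mvar i :: 'a mpoly) ^ l = Poly_Mapping.single (Poly_Mapping.single i l) 1" for l
    by (induction l) (auto simp: mult_single single_add[symmetric] single_one)
  have mono: "Poly_Mapping.single m c \<in> S" if c: "c \<in> K" and m: "Poly_Mapping.keys m \<subseteq> {..<Suc i}" for m c
  proof -
    define l where "l = Poly_Mapping.lookup m i"
    define m' where "m' = Poly_Mapping.update i 0 m"
    have mm: "m = m' + Poly_Mapping.single i l"
      by (rule poly_mapping_eqI) (auto simp: m'_def l_def lookup_add lookup_update lookup_single when_def)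
    have "Poly_Mapping.keys m' \<subseteq> {..<i}"
    proof
      fix j assume "j \<in> Poly_Mapping.keys m'"
      then have "j \<noteq> i" "j \<in> Poly_Mapping.keys m" unfolding m'_def in_keys_iff lookup_update by (auto split: if_splits)
      then show "j \<in> {..<i}" using m by (auto simp: less_Suc_eq)
    qed
    then have "Poly_Mapping.single m' c \<in> carrier (mpoly_ring K i)"
      using c subring_setD(1)[OF K] by (intro single_in_mpoly_ring)
    then have "\<forall>j. poly.coeff (Polynomial.monom (Poly_Mapping.single m' c) l) j \<in> carrier (mpoly_ring K i)"
      using C(1) by simp
    moreover have "Poly_Mapping.single m c = poly (Polynomial.monom (Poly_Mapping.single m' c) l) (mvar i)"
      unfolding poly_monom mpow by (subst mm) (simp add: mult_single)
    ultimately show ?thesis unfolding S_def by blast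
  qed
  have sum: "(\<Sum>m\<in>M. f m) \<in> S" if "\<And>m. m \<in> M \<Longrightarrow> f m \<in> S" for M :: "(nat \<Rightarrow>\<^sub>0 nat) set" and f
    using that by (induction M rule: infinite_finite_induct) (auto simp: zero add)
  have "(\<Sum>m\<in>Poly_Mapping.keys P. Poly_Mapping.single m (Poly_Mapping.lookup P m)) \<in> S"
    using P unfolding mpoly_ring_carrier by (intro sum mono) auto
  then have "P \<in> S" using mpoly_sum_single[of P] by simp
  then show ?thesis unfolding S_def by blast
qed

lemma mpoly_eval_cong:
  assumes "p \<in> carrier (mpoly_ring K n)" "\<And>i. i < n \<Longrightarrow> x i = y i"
  shows "mpoly_eval h x p = mpoly_eval h y p"
  unfolding mpoly_eval_def
proof (intro sum.cong refl arg_cong2[where f = times] prod.cong)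
  fix m i assume "m \<in> Poly_Mapping.keys p" "i \<in> Poly_Mapping.keys m"
  then have "i < n" using assms(1) unfolding mpoly_ring_carrier by blast
  then show "x i ^ Poly_Mapping.lookup m i = y i ^ Poly_Mapping.lookup m i" using assms(2) by simp
qed

lemma rhom_poly_UNIV:
  assumes h: "rhom UNIV h" shows "h (poly p x) = poly (map_poly h p) (h x)"
proof (induction p)
  case 0
  show ?case using rhomD(2)[OF h subring_set_UNIV] by simp
next
  case (pCons a p)
  then show ?case by (simp add: map_poly_rhom_pCons[OF h subring_set_UNIV] rhomD[OF h subring_set_UNIV])
qed

text \<open>Over a countable field only countably many series are excluded in each step.\<close>

lemma independent_series_countable:
  fixes K :: "'a::field set" and a :: "nat \<Rightarrow> 'a"
  assumes K: "subfield_set K" "countable K" and a: "\<And>i. i < n \<Longrightarrow> a i \<in> K"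
  shows "\<exists>g. (\<forall>i<n. g i \<in> fps_over K \<and> fps_nth (g i) 0 = a i) \<and>
    (\<forall>P\<in>carrier (mpoly_ring K n). P \<noteq> 0 \<longrightarrow> mpoly_eval fls_const (\<lambda>i. fps_to_fls (g i)) P \<noteq> 0)"
  using a
proof (induction n)
  case 0
  have z: "mpoly_eval fls_const (\<lambda>i. fps_to_fls (g i)) P \<noteq> 0" if P: "P \<in> carrier (mpoly_ring K 0)" "P \<noteq> 0" for P :: "'a mpoly" and g
  proof -
    have "Poly_Mapping.keys P \<subseteq> {0}"
    proof
      fix m assume "m \<in> Poly_Mapping.keys P"
      then have "Poly_Mapping.keys m \<subseteq> {..<0}" using P(1) unfolding mpoly_ring_carrier by blast
      then have "Poly_Mapping.keys m = {}" by simp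
      then show "m \<in> {0}" by simp
    qed
    then have "mpoly_eval fls_const (\<lambda>i. fps_to_fls (g i)) P = fls_const (Poly_Mapping.lookup P 0)"
      by (subst mpoly_eval_superset[OF rhom_fls_const, of "{0}"]) (auto simp: mon_eval_zero)
    moreover have "Poly_Mapping.lookup P 0 \<noteq> 0"
    proof
      assume "Poly_Mapping.lookup P 0 = 0"
      then have "0 \<notin> Poly_Mapping.keys P" by (simp add: in_keys_iff)
      then have "Poly_Mapping.keys P = {}" using \<open>Poly_Mapping.keys P \<subseteq> {0}\<close> by blast
      then show False using P(2) by simp
    qed
    ultimately show ?thesis by simp
  qed
  show ?case by (rule exI[of _ "\<lambda>_. 0"], intro conjI allI impI ballI z) simp_all
next
  case (Suc n)
  note K' = subfield_setD[OF K(1)]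
  from Suc obtain g where g: "\<forall>i<n. g i \<in> fps_over K \<and> fps_nth (g i) 0 = a i"
    and gi: "\<forall>P\<in>carrier (mpoly_ring K n). P \<noteq> 0 \<longrightarrow> mpoly_eval fls_const (\<lambda>i. fps_to_fls (g i)) P \<noteq> 0" by auto
  define ev where "ev = mpoly_eval fls_const (\<lambda>i. fps_to_fls (g i))"
  have evh: "rhom UNIV ev" unfolding ev_def by (rule rhom_mpoly_eval[OF rhom_fls_const])
  note ev' = rhomD[OF evh subring_set_UNIV]
  let ?C = "carrier (mpoly_ring K (Suc n))"
  define Q where "Q P = (SOME Q. (\<forall>l. poly.coeff Q l \<in> carrier (mpoly_ring K n)) \<and> P = poly Q (mvar n))" for P :: "'a mpoly"
  have Q: "\<forall>l. poly.coeff (Q P) l \<in> carrier (mpoly_ring K n)" "P = poly (Q P) (mvar n)" if "P \<in> ?C" for P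
    using someI_ex[OF mpoly_split_last[OF K'(1) that]] unfolding Q_def by auto
  \<comment> \<open>These series would satisfy the relation \<open>P\<close>. By the induction
    hypothesis some coefficient of \<open>Q P\<close> stays nonzero after the earlier series are
    substituted, so each set is finite.\<close>
  define bad where "bad P = {f. poly (map_poly ev (Q P)) (fps_to_fls f) = 0}" for P
  have fin: "finite (bad P)" if P: "P \<in> ?C" "P \<noteq> 0" for P
  proof -
    have "Q P \<noteq> 0" using Q(2)[OF P(1)] P(2) by auto
    then obtain l where l: "poly.coeff (Q P) l \<noteq> 0" by (metis leading_coeff_neq_0)
    then have "ev (poly.coeff (Q P) l) \<noteq> 0" using gi Q(1)[OF P(1)] unfolding ev_def by blast
    then have "poly.coeff (map_poly ev (Q P)) l \<noteq> 0" by (simp add: coeff_map_poly ev'(2))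
    then have "map_poly ev (Q P) \<noteq> 0" by auto
    then have fr: "finite {x. poly (map_poly ev (Q P)) x = 0}" by (rule poly_roots_finite)
    have eq: "bad P = fps_to_fls -` {x. poly (map_poly ev (Q P)) x = 0}" unfolding bad_def by auto
    have inj: "inj (fps_to_fls :: 'a fps \<Rightarrow> 'a fls)" by (rule injI) simp
    show ?thesis unfolding eq by (rule finite_vimageI[OF fr inj])
  qed
  have "countable (\<Union>P\<in>?C - {0}. bad P)"
    using fin by (intro countable_UN countable_finite countable_Diff countable_mpoly_ring K(2)) auto
  then have "\<not> {f. fps_nth f 0 = a n \<and> (\<forall>n>0. fps_nth f n \<in> {0, 1})} \<subseteq> (\<Union>P\<in>?C - {0}. bad P)"
    using uncountable_series countable_subset by blast
  then obtain f where f: "fps_nth f 0 = a n" "\<forall>n>0. fps_nth f n \<in> {0, 1}" "f \<notin> (\<Union>P\<in>?C - {0}. bad P)" by blast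
  have fK: "f \<in> fps_over K"
    unfolding fps_over_def
  proof (intro CollectI allI)
    fix m show "fps_nth f m \<in> K"
    proof (cases "m = 0")
      case False
      then have "fps_nth f m \<in> {0, 1}" using f(2) by blast
      then show ?thesis using K'(2,3) by auto
    qed (use f(1) Suc.prems in simp)
  qed
  let ?g = "g(n := f)"
  have "mpoly_eval fls_const (\<lambda>i. fps_to_fls (?g i)) P \<noteq> 0" if P: "P \<in> ?C" "P \<noteq> 0" for P
  proof
    assume z: "mpoly_eval fls_const (\<lambda>i. fps_to_fls (?g i)) P = 0"
    let ?e = "mpoly_eval fls_const (\<lambda>i. fps_to_fls (?g i))"
    have eh: "rhom UNIV ?e" by (rule rhom_mpoly_eval[OF rhom_fls_const])
    have "?e (poly (Q P) (mvar n)) = poly (map_poly ?e (Q P)) (?e (mvar n))"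
      by (rule rhom_poly_UNIV[OF eh])
    moreover have "?e (mvar n) = fps_to_fls f" by (simp add: mpoly_eval_mvar[OF rhom_fls_const])
    moreover have "map_poly ?e (Q P) = map_poly ev (Q P)"
    proof (rule poly_eqI)
      fix l
      have "?e (poly.coeff (Q P) l) = ev (poly.coeff (Q P) l)"
        unfolding ev_def using Q(1)[OF P(1)] by (intro mpoly_eval_cong[of _ K n]) auto
      then show "poly.coeff (map_poly ?e (Q P)) l = poly.coeff (map_poly ev (Q P)) l"
        by (simp add: coeff_map_poly ev'(2) mpoly_eval_zero)
    qed
    ultimately have "poly (map_poly ev (Q P)) (fps_to_fls f) = 0" using z Q(2)[OF P(1)] by simp
    then have "f \<in> bad P" unfolding bad_def by simp
    then show False using f(3) P by blast
  qed
  moreover have "\<forall>i<Suc n. ?g i \<in> fps_over K \<and> fps_nth (?g i) 0 = a i"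
    using g fK f(1) by (auto simp: less_Suc_eq)
  ultimately show ?case by (intro exI[of _ ?g]) blast
qed

text \<open>The prescribed constant terms generate a countable field \<open>F\<close>, over which
  counting works. Independence then passes to an arbitrary \<open>K\<close>: a relation is expanded
  along constants independent over \<open>F\<close>, and comparing Laurent coefficients, which lie
  in \<open>F\<close>, kills each part.\<close>

lemma independent_series:
  fixes K K0 :: "'a::field set" and a :: "nat \<Rightarrow> 'a"
  assumes K: "subfield_set K" and K0: "subfield_set K0" "K0 \<subseteq> K" and a: "\<And>i. i < n \<Longrightarrow> a i \<in> K0"
  shows "\<exists>g. (\<forall>i<n. g i \<in> fps_over K0 \<and> fps_nth (g i) 0 = a i) \<and>
    (\<forall>P\<in>carrier (mpoly_ring K n). P \<noteq> 0 \<longrightarrow> mpoly_eval fls_const (\<lambda>i. fps_to_fls (g i)) P \<noteq> 0)"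
proof -
  define F where "F = fgen (a ` {..<n})"
  have aK0: "a ` {..<n} \<subseteq> K0" using a by auto
  have F: "subfield_set F" unfolding F_def by (rule subfield_set_fgen)
  have Fc: "countable F" unfolding F_def by (intro countable_fgen countable_finite finite_imageI finite_lessThan)
  have FK0: "F \<subseteq> K0" unfolding F_def by (rule fgen_minimal[OF K0(1) aK0])
  have aF: "a i \<in> F" if "i < n" for i unfolding F_def using fgen_incl[of "a ` {..<n}"] that by blast
  note F' = subfield_setD[OF F]
  have "\<exists>g. (\<forall>i<n. g i \<in> fps_over F \<and> fps_nth (g i) 0 = a i) \<and>
    (\<forall>P\<in>carrier (mpoly_ring F n). P \<noteq> 0 \<longrightarrow> mpoly_eval fls_const (\<lambda>i. fps_to_fls (g i)) P \<noteq> 0)"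
    by (rule independent_series_countable[OF F Fc aF])
  then obtain g
    where g: "\<forall>i<n. g i \<in> fps_over F \<and> fps_nth (g i) 0 = a i"
    and gi: "\<forall>P\<in>carrier (mpoly_ring F n). P \<noteq> 0 \<longrightarrow> mpoly_eval fls_const (\<lambda>i. fps_to_fls (g i)) P \<noteq> 0" by (elim exE conjE)
  let ?e = "mpoly_eval fls_const (\<lambda>i. fps_to_fls (g i))"
  have "P = 0" if P: "P \<in> carrier (mpoly_ring K n)" "?e P = 0" for P
  proof -
    from mpoly_basis_decomposition[OF F P(1)] obtain B p where B: "finite B" "B \<subseteq> K" "indep F B"
      "\<forall>b\<in>B. p b \<in> carrier (mpoly_ring F n)" "P = (\<Sum>b\<in>B. Poly_Mapping.single 0 b * p b)" by (elim exE conjE)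
    have eF: "?e (p b) \<in> fls_over F" if "b \<in> B" for b
    proof (rule mpoly_eval_in[OF subfield_setD(1)[OF subfield_set_fls_over[OF F]] B(4)[rule_format, OF that]])
      show "fls_const c \<in> fls_over F" if "c \<in> F" for c using fls_const_over[OF F'(2) that] .
      show "fps_to_fls (g i) \<in> fls_over F" if "i < n" for i
        using g that by (simp only: fps_over_to_fls[OF F'(2)])
    qed
    have "?e P = (\<Sum>b\<in>B. fls_const b * ?e (p b))"
      unfolding B(5) mpoly_eval_sum[OF rhom_fls_const] mpoly_eval_mult[OF rhom_fls_const] mpoly_eval_const[OF rhom_fls_const] ..
    then have z: "(\<Sum>b\<in>B. fls_const b * ?e (p b)) = 0" using P(2) by simp
    have "?e (p b) = 0" if b: "b \<in> B" for b
    proof (rule fls_eqI)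
      fix k
      have "fls_nth (\<Sum>b\<in>S. fls_const b * ?e (p b)) k = (\<Sum>b\<in>S. fls_nth (?e (p b)) k * b)" for S
        by (induction S rule: infinite_finite_induct) (auto simp: mult.commute)
      from this[of B] have s0: "(\<Sum>b\<in>B. fls_nth (?e (p b)) k * b) = 0" unfolding z by simp
      have "fls_nth (?e (p c)) k \<in> F" if "c \<in> B" for c using eF[OF that] unfolding fls_over_def by blast
      from indepD[OF B(3) this s0 b] show "fls_nth (?e (p b)) k = fls_nth 0 k" by simp
    qed
    have "p b = 0" if b: "b \<in> B" for b
    proof (rule ccontr)
      assume "p b \<noteq> 0"
      then have "?e (p b) \<noteq> 0" using gi B(4) b by simp
      then show False using \<open>\<And>b. b \<in> B \<Longrightarrow> ?e (p b) = 0\<close> b by simp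
    qed
    then show "P = 0" unfolding B(5) by simp
  qed
  moreover have "\<forall>i<n. g i \<in> fps_over K0 \<and> fps_nth (g i) 0 = a i"
    using g FK0 unfolding fps_over_def by blast
  ultimately show ?thesis by (intro exI[of _ g] conjI ballI impI notI) auto
qed

section \<open>Laurent series points over a PAC extension\<close>

text \<open>The generators are combined as the value of a polynomial at a suitable
  \<open>\<tau>\<close>. If \<open>\<tau>\<close> avoids finitely many roots, an embedding that
  fixes \<open>w\<close> must fix every generator, so the generators lie in
  \<open>A(w)\<close>.\<close>

lemma primitive_element:
  fixes A :: "'a::alg_closed_field set"
  assumes A: "subfield_set A" "infinite A" and Z: "finite Z" "\<And>z. z \<in> Z \<Longrightarrow> separable_over A z"
  shows "\<exists>w\<in>fgen (A \<union> Z). fgen (A \<union> {w}) = fgen (A \<union> Z)"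
proof -
  let ?N = "fgen (A \<union> Z)"
  have N: "subfield_set ?N" by simp
  note N' = subfield_setD[OF N]
  have AN: "A \<subseteq> ?N" "Z \<subseteq> ?N" using fgen_incl[of "A \<union> Z"] by auto
  have "\<exists>Z'. finite Z' \<and> Z \<subseteq> Z' \<and>
    (\<forall>z\<in>Z'. \<exists>f. poly_over A f \<and> rsquarefree f \<and> poly f z = 0 \<and> {y. poly f y = 0} \<subseteq> Z') \<and>
    (\<forall>z\<in>Z'. \<exists>y\<in>Z. \<forall>f. is_min_poly A y f \<longrightarrow> poly f z = 0)"
    by (rule finite_root_closure[OF A(1) Z])
  then obtain Z' where Z': "finite Z'" "Z \<subseteq> Z'"
    "\<forall>z\<in>Z'. \<exists>f. poly_over A f \<and> rsquarefree f \<and> poly f z = 0 \<and> {y. poly f y = 0} \<subseteq> Z'" by (elim exE conjE)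
  obtain zs where zs: "set zs = Z" using finite_list[OF Z(1)] by (elim exE)
  define H where "H = {h :: 'a \<Rightarrow> 'a. rhom ?N h \<and> (\<forall>a\<in>A. h a = a)}"
  have hZ: "h z \<in> Z'" if h: "h \<in> H" and z: "z \<in> Z" for h z
  proof -
    have "z \<in> Z'" using z Z'(2) by blast
    from Z'(3)[rule_format, OF this] obtain f where f: "poly_over A f" "poly f z = 0" "{y. poly f y = 0} \<subseteq> Z'"
      by (elim exE conjE)
    have "poly f (h z) = 0"
      by (rule roots_min_poly_subset_closed[OF A(1) N'(1) AN(1) _ _ _ f(1,2)]) (use h z AN(2) in \<open>auto simp: H_def\<close>)
    then show ?thesis using f(3) by blast
  qed
  define V where "V = (\<lambda>h. map h zs) ` H"
  have "V \<subseteq> {xs. set xs \<subseteq> Z' \<and> length xs = length zs}" unfolding V_def using hZ zs by auto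
  then have fV: "finite V" using finite_lists_length_eq[OF Z'(1)] by (rule finite_subset)
  \<comment> \<open>\<open>q v\<close> has the differences between a conjugate tuple
    \<open>v\<close> and the tuple of generators as coefficients; its value at \<open>\<tau>\<close>
    is the displacement of \<open>w\<close> under the corresponding embedding.\<close>
  define q where "q v = (\<Sum>k<length zs. Polynomial.monom (v ! k - zs ! k) k)" for v
  have cq: "poly.coeff (q v) k = (if k < length zs then v ! k - zs ! k else 0)" for v k
    unfolding q_def by (simp add: coeff_sum)
  define bad where "bad = (\<Union>v\<in>V - {zs}. {\<tau>. poly (q v) \<tau> = 0})"
  have "finite {\<tau>. poly (q v) \<tau> = 0}" if v: "v \<in> V - {zs}" for v
  proof -
    have "length v = length zs" using v unfolding V_def by auto
    then obtain k where k: "k < length zs" "v ! k \<noteq> zs ! k" using v by (auto simp: list_eq_iff_nth_eq)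
    then have "poly.coeff (q v) k \<noteq> 0" unfolding cq by simp
    then have "q v \<noteq> 0" by auto
    then show ?thesis by (rule poly_roots_finite)
  qed
  then have "finite bad" unfolding bad_def using fV by blast
  then have "infinite (A - bad)" using A(2) by simp
  then obtain \<tau> where t: "\<tau> \<in> A" "\<tau> \<notin> bad" by (metis Diff_iff finite.emptyI ex_in_conv)
  define w where "w = (\<Sum>k<length zs. zs ! k * \<tau> ^ k)"
  have zN: "zs ! k \<in> ?N" "\<tau> ^ k \<in> ?N" if "k < length zs" for k
    using nth_mem[OF that] zs AN t(1) subring_set_power[OF N'(1)] by auto
  have wN: "w \<in> ?N" unfolding w_def by (rule subring_set_sum[OF N'(1)]) (use zN N'(6) in simp)
  have key: "h z = z" if h: "h \<in> H" "h w = w" and z: "z \<in> Z" for h z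
  proof -
    have hN: "rhom ?N h" and hA: "\<And>a. a \<in> A \<Longrightarrow> h a = a" using h(1) unfolding H_def by auto
    have "h w = (\<Sum>k<length zs. h (zs ! k * \<tau> ^ k))"
      unfolding w_def by (rule rhom_sum[OF hN N'(1)]) (use zN N'(6) in simp)
    also have "\<dots> = (\<Sum>k<length zs. h (zs ! k) * \<tau> ^ k)"
    proof (rule sum.cong)
      fix k assume "k \<in> {..<length zs}"
      then have k: "k < length zs" by simp
      have "h (\<tau> ^ k) = \<tau> ^ k" using rhom_power[OF hN N'(1), of \<tau> k] AN(1) t(1) hA[OF t(1)] by auto
      then show "h (zs ! k * \<tau> ^ k) = h (zs ! k) * \<tau> ^ k" using rhomD(4)[OF hN N'(1) zN[OF k]] by simp
    qed simp
    finally have "poly (q (map h zs)) \<tau> = h w - w"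
      unfolding q_def w_def by (simp add: poly_sum poly_monom left_diff_distrib sum_subtractf)
    then have "poly (q (map h zs)) \<tau> = 0" using h(2) by simp
    moreover have "map h zs \<in> V" unfolding V_def using h(1) by blast
    ultimately have "map h zs = zs" using t(2) unfolding bad_def by blast
    then have "map h zs = map id zs" by simp
    then have "\<forall>z\<in>set zs. h z = id z" by (simp only: map_eq_conv)
    then show ?thesis using z zs by simp
  qed
  let ?B = "fgen (A \<union> {w})"
  have AB: "A \<subseteq> ?B" "w \<in> ?B" using fgen_incl[of "A \<union> {w}"] by auto
  have "z \<in> ?B" if z: "z \<in> Z" for z
  proof (rule fixed_by_homs_finite[OF subfield_set_fgen Z(1)])
    show "separable_over ?B y" if "y \<in> Z" for y by (rule separable_over_mono[OF Z(2)[OF that] AB(1) subfield_set_fgen])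
    show "z \<in> fgen (?B \<union> Z)" using z fgen_incl[of "?B \<union> Z"] by blast
    fix h :: "'a \<Rightarrow> 'a" assume h: "rhom (fgen (?B \<union> Z)) h" "\<And>a. a \<in> ?B \<Longrightarrow> h a = a"
    have "?N \<subseteq> fgen (?B \<union> Z)" by (rule fgen_mono) (use AB in blast)
    then have "rhom ?N h" by (rule rhom_mono[OF h(1)])
    then have "h \<in> H" unfolding H_def using h(2) AB(1) by blast
    then show "h z = z" by (rule key[of h z, OF _ h(2)[OF AB(2)] z])
  qed
  then have "?N \<subseteq> ?B" by (intro fgen_minimal[OF subfield_set_fgen]) (use AB in blast)
  moreover have "?B \<subseteq> ?N" by (rule fgen_minimal[OF N]) (use AN wN in blast)
  ultimately show ?thesis using wN by blast
qed

text \<open>The powers of \<open>t 0\<close> are distinct. This supplies the infinite base field for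
  the primitive element whatever the size of \<open>K\<close>.\<close>

lemma infinite_adjoin:
  assumes K: "subfield_set K" and t: "algebraically_independent K t e" "e \<ge> 1"
  shows "infinite (adjoin K t e)"
proof
  assume fin: "finite (adjoin K t e)"
  note K' = subfield_setD[OF K]
  have S: "subfield_set (adjoin K t e)" unfolding adjoin_def by simp
  have t0: "t 0 \<in> adjoin K t e"
    unfolding adjoin_def using fgen_incl[of "K \<union> t ` {..<e}"] t(2) by (auto simp: image_subset_iff)
  have inj: "inj (\<lambda>i::nat. t 0 ^ i)"
  proof (rule injI)
    fix i j :: nat assume e: "t 0 ^ i = t 0 ^ j"
    let ?M = "\<lambda>i. Poly_Mapping.single (Poly_Mapping.single (0::nat) i) 1 :: 'a mpoly"
    have M: "?M i \<in> carrier (mpoly_ring K e)" for i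
      by (rule single_in_mpoly_ring) (use K' t(2) in auto)
    have ev: "mpoly_eval id t (?M i) = t 0 ^ i" for i
      by (simp add: mpoly_eval_single[OF rhom_UNIV_id] mon_eval_single)
    have "?M i - ?M j \<in> carrier (mpoly_ring K e)" by (rule subring_setD(6)[OF subring_set_mpoly_ring[OF K'(1)] M M])
    moreover have "mpoly_eval id t (?M i - ?M j) = 0"
      using rhomD(6)[OF rhom_mpoly_eval_id[of t] subring_set_UNIV, of "?M i" "?M j"] ev e by simp
    ultimately have "?M i = ?M j" using t(1) unfolding algebraically_independent_def by (metis right_minus_eq)
    then have "Poly_Mapping.lookup (?M i) (Poly_Mapping.single 0 j) = 1" by (simp only: lookup_single_eq)
    then have "Poly_Mapping.single (0::nat) i = Poly_Mapping.single 0 j" by (simp add: lookup_single when_def split: if_splits)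
    then have "Poly_Mapping.lookup (Poly_Mapping.single (0::nat) i) 0 = Poly_Mapping.lookup (Poly_Mapping.single 0 j) 0" by simp
    then show "i = j" by simp
  qed
  have "range (\<lambda>i. t 0 ^ i) \<subseteq> adjoin K t e" using subring_set_power[OF subfield_setD(1)[OF S] t0] by blast
  then have "finite (range (\<lambda>i::nat. t 0 ^ i))" using fin by (rule finite_subset)
  then show False using finite_imageD[OF _ inj] infinite_UNIV_nat by blast
qed

text \<open>If \<open>x\<close> were outside \<open>K\<close>, then 1 and \<open>x\<close> would be
  independent over \<open>K\<close>, hence over the algebraic closure. But there the coefficients
  \<open>x\<close> and \<open>- 1\<close> give a nontrivial relation.\<close>

lemma algebraic_regular_trivial:
  fixes K :: "'a::alg_closed_field set"
  assumes K: "subfield_set K" and ld: "lin_disj K (algebraic_closure_of K) D" and D: "1 \<in> D"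
    and x: "x \<in> D" "algebraic_over K x"
  shows "x \<in> K"
proof (rule ccontr)
  assume xK: "x \<notin> K"
  note K' = subfield_setD[OF K]
  have x1: "x \<noteq> 1" using xK K'(3) by blast
  have sum: "(\<Sum>b\<in>{1, x}. l b * b) = l 1 + l x * x" for l using x1 by simp
  have "indep K {1, x}"
    unfolding indep_def sum
  proof (intro allI impI)
    fix l assume l: "(\<forall>b\<in>{1, x}. l b \<in> K) \<and> l 1 + l x * x = 0"
    have "l x = 0"
    proof (rule ccontr)
      assume "l x \<noteq> 0"
      moreover from l have "x * l x = - l 1" by (simp add: eq_neg_iff_add_eq_0 add.commute mult.commute)
      ultimately have "x = - l 1 / l x" by (simp only: nonzero_eq_divide_eq simp_thms)
      moreover have "- l 1 / l x \<in> K" using l K' by simp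
      ultimately show False using xK by simp
    qed
    then show "\<forall>b\<in>{1, x}. l b = 0" using l by simp
  qed
  moreover have "{1, x} \<subseteq> D" using x(1) D by simp
  ultimately have "indep (algebraic_closure_of K) {1, x}" using ld unfolding lin_disj_def by simp
  moreover have "x \<in> algebraic_closure_of K" "- 1 \<in> algebraic_closure_of K"
    using x(2) subfield_setD(3,4)[OF subfield_set_algebraic_closure[OF K]] by (auto simp: algebraic_closure_of_def)
  ultimately have c: "indep (algebraic_closure_of K) {1, x}" "x \<in> algebraic_closure_of K" "- 1 \<in> algebraic_closure_of K" .
  have "(\<Sum>b\<in>{1, x}. (if b = x then - 1 else x) * b) = 0" unfolding sum using x1 by simp
  then have "(if x = x then - 1 else x) = (0::'a)"
    using c(2,3) by (intro indepD[OF c(1), where l = "\<lambda>b. if b = x then - 1 else x"]) auto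
  then show False by simp
qed

lemma map_poly_pderiv_UNIV:
  fixes h :: "'a::idom \<Rightarrow> 'b::idom"
  assumes h: "rhom UNIV h" shows "map_poly h (pderiv p) = pderiv (map_poly h p)"
proof -
  note h' = rhomD[OF h subring_set_UNIV]
  have n: "h (of_nat n) = of_nat n" for n by (induction n) (auto simp: h')
  show ?thesis by (rule poly_eqI) (simp add: coeff_map_poly h'(2) coeff_pderiv h'(4) n del: of_nat_Suc)
qed

text \<open>With a primitive element \<open>x\<close> over \<open>K(t)\<close>, only one equation
  has to be solved in series. The PAC point solves it for the constant terms, the independent series
  replace \<open>t\<close>, and Newton's method lifts the simple root. Enlarging the coordinate ring
  beforehand ensures that the root is simple and that \<open>S\<close> becomes integral.\<close>

lemma series_point:
  fixes K0 K D :: "'a::alg_closed_field set"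
  assumes pac: "pac_extension K0 K" and D: "subfield_set D" "lin_disj K (algebraic_closure_of K) D"
    and AD: "adjoin K t e \<subseteq> D" and alg: "algebraically_independent K t e"
    and sep: "\<And>x. x \<in> D \<Longrightarrow> separable_over (adjoin K t e) x" and S: "finite S" "S \<subseteq> D"
  shows "\<exists>a j. (\<forall>i<e. a i \<in> K0) \<and> rhom (fgen (adjoin K t e \<union> S)) j \<and> (\<forall>c\<in>K. j c = fls_const c) \<and>
    (\<forall>x\<in>fgen (adjoin K t e \<union> S). j x \<in> fls_over K) \<and> (\<forall>x\<in>adjoin K0 t e. j x \<in> fls_over K0) \<and>
    (\<forall>i<e. j (t i) \<in> fls_int \<and> fls_res (j (t i)) = a i) \<and> (\<forall>x\<in>S. j x \<in> fls_int)"
proof -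
  have K: "subfield_set K" and K0: "subfield_set K0" "K0 \<subseteq> K"
    using pac unfolding pac_extension_def field_extension_iff by auto
  note K' = subfield_setD[OF K]
  define A where "A = adjoin K t e"
  have A: "subfield_set A" unfolding A_def adjoin_def by simp
  have KA: "K \<subseteq> A" and tA: "\<And>i. i < e \<Longrightarrow> t i \<in> A"
    unfolding A_def adjoin_def using fgen_incl[of "K \<union> t ` {..<e}"] by auto
  note A' = subfield_setD[OF A]
  have AD': "A \<subseteq> D" using AD unfolding A_def .
  show ?thesis
  proof (cases "e = 0")
    \<comment> \<open>The PAC property concerns maps to spaces of positive dimension. Here
      \<open>D\<close> is algebraic over \<open>K\<close>, so regularity puts \<open>S\<close> into
      \<open>K\<close> and constant series suffice.\<close>
    case True
    then have AK: "adjoin K t e = K" "adjoin K0 t e = K0"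
      unfolding adjoin_def using fgen_subfield[OF K] fgen_subfield[OF K0(1)] by auto
    have "S \<subseteq> K"
    proof
      fix x assume "x \<in> S"
      then have "x \<in> D" using S by blast
      then show "x \<in> K"
        using algebraic_regular_trivial[OF K D(2) subfield_setD(3)[OF D(1)]] separable_over_imp_algebraic sep unfolding AK by blast
    qed
    then have "fgen (adjoin K t e \<union> S) = K" unfolding AK using fgen_subfield[OF K] by (simp add: Un_absorb2)
    moreover have "fls_const c \<in> fls_int" for c :: 'a using fps_const_to_fls[of c] by (metis rangeI)
    ultimately show ?thesis
      using True rhom_mono[OF rhom_fls_const subset_UNIV, of K] fls_const_over[OF K'(2)] fls_const_over[OF subfield_setD(2)[OF K0(1)]]
      unfolding AK by (intro exI[of _ "\<lambda>_. 0"] exI[of _ fls_const]) auto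
  next
    case False
    then have e1: "e \<ge> 1" by simp
    let ?C = "carrier (mpoly_ring K e)"
    let ?evt = "mpoly_eval id t"
    have C: "subring_set ?C" by (rule subring_set_mpoly_ring[OF K'(1)])
    have sepA: "separable_over A s" if "s \<in> D" for s using sep[OF that] unfolding A_def .
    have "separable_over A s" if "s \<in> S" for s using sepA S(2) that by blast
    from primitive_element[OF A _ S(1) this] infinite_adjoin[OF K alg e1]
    obtain x where x: "x \<in> fgen (A \<union> S)" "fgen (A \<union> {x}) = fgen (A \<union> S)" unfolding A_def by blast
    define E where "E = fgen (A \<union> S)"
    have Ef: "subfield_set E" unfolding E_def by simp
    have ED: "E \<subseteq> D" unfolding E_def by (rule fgen_minimal[OF D(1)]) (use AD' S in blast)
    have AE: "A \<subseteq> E" "S \<subseteq> E" unfolding E_def using fgen_incl[of "A \<union> S"] by auto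
    have xE: "x \<in> E" using x(1) unfolding E_def .
    have sx: "separable_over A x" using sepA ED xE by blast
    have Ex: "E = {poly p x | p. poly_over A p}"
      unfolding E_def x(2)[symmetric] by (rule fgen_simple[OF A separable_over_imp_algebraic[OF sx]])
    obtain m where m: "is_min_poly A x m" "rsquarefree m" using sx unfolding separable_over_def by (elim exE conjE)
    then have mA: "poly_over A m" "lead_coeff m = 1" "poly m x = 0" by (auto simp: is_min_poly_def)
    have "\<forall>d\<in>S. \<exists>p. poly_over A p \<and> d = poly p x" using AE(2) Ex by blast
    from bchoice[OF this] obtain gd where gd: "\<forall>d\<in>S. poly_over A (gd d) \<and> d = poly (gd d) x" by (elim exE)
    \<comment> \<open>Coefficients of \<open>m\<close> and of the polynomials expressing
      \<open>S\<close> through \<open>x\<close>: the finitely many elements of \<open>A\<close>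
      whose series must be integral.\<close>
    define Cf where "Cf = (\<Union>p\<in>insert m (gd ` S). range (poly.coeff p))"
    have fCf: "finite Cf" unfolding Cf_def using S(1) by (auto simp: range_coeff)
    have CfA: "Cf \<subseteq> A" unfolding Cf_def using mA(1) gd by (auto simp: poly_over_def)
    have "\<forall>c\<in>A. \<exists>r. fst r \<in> ?C \<and> snd r \<in> ?C \<and> ?evt (snd r) \<noteq> 0 \<and> c = ?evt (fst r) / ?evt (snd r)"
    proof
      fix c assume "c \<in> A"
      then obtain p q where "p \<in> ?C" "q \<in> ?C" "?evt q \<noteq> 0" "c = ?evt p / ?evt q"
        unfolding A_def adjoin_eq_fractions[OF K] by blast
      then show "\<exists>r. fst r \<in> ?C \<and> snd r \<in> ?C \<and> ?evt (snd r) \<noteq> 0 \<and> c = ?evt (fst r) / ?evt (snd r)"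
        by (intro exI[of _ "(p, q)"]) simp
    qed
    from bchoice[OF this] obtain r where r: "\<forall>c\<in>A. fst (r c) \<in> ?C \<and> snd (r c) \<in> ?C \<and> ?evt (snd (r c)) \<noteq> 0 \<and> c = ?evt (fst (r c)) / ?evt (snd (r c))"
      by (elim exE)
    define pc where "pc c = fst (r c)" for c
    define qc where "qc c = snd (r c)" for c
    have pq: "pc c \<in> ?C" "qc c \<in> ?C" "?evt (qc c) \<noteq> 0" "c = ?evt (pc c) / ?evt (qc c)" if "c \<in> A" for c
      using r[rule_format, OF that] unfolding pc_def qc_def by blast+
    have evtA: "?evt p \<in> A" if "p \<in> ?C" for p
      by (rule mpoly_eval_in[OF A'(1) that]) (use KA tA in auto)
    define dm where "dm = poly (pderiv m) x"
    \<comment> \<open>These elements are forced into the domain of the specialisation. The inverse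
      of \<open>dm\<close> keeps the root simple, and the inverses of the denominators keep
      \<open>Cf\<close> finite at the point.\<close>
    define Y where "Y = {x, inverse dm} \<union> (\<lambda>c. inverse (?evt (qc c))) ` Cf"
    have dmE: "dm \<in> E"
      unfolding dm_def
      by (rule poly_in_subring[OF subfield_setD(1)[OF Ef] poly_over_mono[OF poly_over_pderiv[OF A'(1) mA(1)] AE(1)] xE])
    have dm0: "dm \<noteq> 0"
    proof
      assume "dm = 0"
      then have "pderiv m = 0 \<or> deg m \<le> deg (pderiv m)"
        using m(1) poly_over_pderiv[OF A'(1) mA(1)] unfolding is_min_poly_def dm_def by blast
      moreover have "deg (pderiv m) \<le> deg m - 1" by (rule degree_le) (auto simp: coeff_pderiv coeff_eq_0)
      ultimately have pd: "pderiv m = 0" using is_min_poly_deg_pos[OF m(1)] by auto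
      obtain u where u: "m = [:- x, 1:] * u" using mA(3) poly_eq_0_iff_dvd[of m x] by (elim iffE) (blast elim: dvdE)
      have "m \<noteq> 0" using mA(2) by auto
      have "poly u x = poly (pderiv m) x" unfolding u pderiv_mult by (simp add: pderiv_pCons)
      then have "poly u x = 0" unfolding pd by simp
      then have "Polynomial.order x u \<noteq> 0" using \<open>m \<noteq> 0\<close> u order_root[of u x] by auto
      moreover have "Polynomial.order x m = Polynomial.order x [:- x, 1:] + Polynomial.order x u"
        using \<open>m \<noteq> 0\<close> unfolding u by (rule order_mult)
      ultimately have "Polynomial.order x m \<ge> 2" using order_linear_self[of x] by simp
      then show False using m(2) unfolding rsquarefree_def by (metis not_numeral_le_zero numeral_le_one_iff semiring_norm(69))
    qed
    have YE: "Y \<subseteq> E"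
      unfolding Y_def using xE dmE evtA[OF pq(2)] CfA AE(1) subfield_setD(8)[OF Ef] by blast
    have fY: "finite Y" unfolding Y_def using fCf by simp
    have ldE: "lin_disj K (algebraic_closure_of K) E" using D(2) ED unfolding lin_disj_def by blast
    have KE: "K \<subseteq> E" using KA AE by blast
    have tE: "t i \<in> E" if "i < e" for i using tA[OF that] AE by blast
    have sepE: "separable_over (adjoin K t e) s" if "s \<in> E" for s using sep ED that by blast
    have "\<exists>R \<phi>. subring_set R \<and> K \<subseteq> R \<and> Y \<subseteq> R \<and> (\<forall>i<e. t i \<in> R) \<and> R \<subseteq> E \<and>
      rhom R \<phi> \<and> \<phi> ` R \<subseteq> K \<and> (\<forall>c\<in>K. \<phi> c = c) \<and> (\<forall>i<e. \<phi> (t i) \<in> K0)"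
      by (rule pac_point[OF pac Ef KE ldE tE alg e1 sepE fY YE])
    then obtain R \<phi> where R: "subring_set R" "K \<subseteq> R" "Y \<subseteq> R" "\<forall>i<e. t i \<in> R"
      and \<phi>: "rhom R \<phi>" "\<phi> ` R \<subseteq> K" "\<forall>c\<in>K. \<phi> c = c" "\<forall>i<e. \<phi> (t i) \<in> K0" by (elim exE conjE)
    note R' = subring_setD[OF R(1)] and \<phi>' = rhomD[OF \<phi>(1) R(1)]
    define a where "a i = \<phi> (t i)" for i
    have aK0: "a i \<in> K0" if "i < e" for i using \<phi>(4) that unfolding a_def by blast
    have evtR: "?evt p \<in> R" "\<phi> (?evt p) = mpoly_eval id a p" if p: "p \<in> ?C" for p
    proof -
      show "?evt p \<in> R" by (rule mpoly_eval_in[OF R(1) p]) (use R in auto)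
      have pk: "Poly_Mapping.lookup p k \<in> K" "k \<in> Poly_Mapping.keys p \<Longrightarrow> Poly_Mapping.keys k \<subseteq> {..<e}" for k
        using p unfolding mpoly_ring_carrier by blast+
      have "\<phi> (?evt p) = mpoly_eval (\<lambda>c. \<phi> (id c)) (\<lambda>i. \<phi> (t i)) p"
      proof (rule mpoly_eval_comp[OF \<phi>(1) R(1)])
        show "id (Poly_Mapping.lookup p k) \<in> R" for k using pk(1) R(2) by auto
        show "t i \<in> R" if "k \<in> Poly_Mapping.keys p" "i \<in> Poly_Mapping.keys k" for k i
          using pk(2)[OF that(1)] that(2) R(4) by blast
      qed
      also have "\<dots> = mpoly_eval id a p"
        unfolding mpoly_eval_def a_def using \<phi>(3) pk(1) by simp
      finally show "\<phi> (?evt p) = mpoly_eval id a p" .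
    qed
    have "\<exists>g. (\<forall>i<e. g i \<in> fps_over K0 \<and> fps_nth (g i) 0 = a i) \<and>
      (\<forall>P\<in>carrier (mpoly_ring K e). P \<noteq> 0 \<longrightarrow> mpoly_eval fls_const (\<lambda>i. fps_to_fls (g i)) P \<noteq> 0)"
      by (rule independent_series[OF K K0 aK0])
    then obtain g where g: "\<forall>i<e. g i \<in> fps_over K0 \<and> fps_nth (g i) 0 = a i"
      and gi: "\<forall>P\<in>?C. P \<noteq> 0 \<longrightarrow> mpoly_eval fls_const (\<lambda>i. fps_to_fls (g i)) P \<noteq> 0" by (elim exE conjE)
    let ?evg = "mpoly_eval fls_const (\<lambda>i. fps_to_fls (g i))"
    have ci: "fls_const c \<in> fls_int" for c :: 'a using fps_const_to_fls[of c] by (metis rangeI)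
    have evg: "?evg p \<in> fls_int" "fls_res (?evg p) = mpoly_eval id a p" if p: "p \<in> ?C" for p
    proof -
      show "?evg p \<in> fls_int" by (rule mpoly_eval_in[OF subring_fls_int p]) (use ci in auto)
      have "fls_res (?evg p) = mpoly_eval (\<lambda>c. fls_res (fls_const c)) (\<lambda>i. fls_res (fps_to_fls (g i))) p"
        by (rule mpoly_eval_comp[OF rhom_fls_res subring_fls_int]) (use ci in auto)
      also have "\<dots> = mpoly_eval id (\<lambda>i. fps_nth (g i) 0) p" by (simp add: mpoly_eval_def)
      also have "\<dots> = mpoly_eval id a p" by (rule mpoly_eval_cong[OF p]) (use g in simp)
      finally show "fls_res (?evg p) = mpoly_eval id a p" .
    qed
    have ker: "?evt p = 0 \<longleftrightarrow> ?evg p = 0" if p: "p \<in> ?C" for p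
    proof -
      have "?evt p = 0 \<longleftrightarrow> p = 0" using alg p mpoly_eval_zero unfolding algebraically_independent_def by blast
      moreover have "?evg p = 0 \<longleftrightarrow> p = 0" using gi p mpoly_eval_zero by blast
      ultimately show ?thesis by simp
    qed
    have "\<exists>\<psi>. rhom {?evt p / ?evt q | p q. p \<in> ?C \<and> q \<in> ?C \<and> ?evt q \<noteq> 0} \<psi> \<and>
      (\<forall>p\<in>?C. \<forall>q\<in>?C. ?evt q \<noteq> 0 \<longrightarrow> \<psi> (?evt p / ?evt q) = ?evg p / ?evg q)"
      by (rule rhom_fractions[OF C rhom_mono[OF rhom_mpoly_eval_id subset_UNIV] rhom_mono[OF rhom_mpoly_eval[OF rhom_fls_const] subset_UNIV] ker])
    \<comment> \<open>Algebraic independence of both \<open>t\<close> and the series gives the two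
      evaluations the same kernel, so the substitution extends to all of
      \<open>K(t)\<close>.\<close>
    then obtain \<psi> where \<psi>: "rhom A \<psi>"
      "\<forall>p\<in>?C. \<forall>q\<in>?C. ?evt q \<noteq> 0 \<longrightarrow> \<psi> (?evt p / ?evt q) = ?evg p / ?evg q"
      unfolding A_def adjoin_eq_fractions[OF K] by (elim exE conjE)
    note \<psi>' = rhomD[OF \<psi>(1) A'(1)]
    have e1': "?evt 1 = 1" "?evg 1 = 1"
      using rhomD(1)[OF rhom_mpoly_eval_id subring_set_UNIV] rhomD(1)[OF rhom_mpoly_eval[OF rhom_fls_const] subring_set_UNIV] by auto
    have \<psi>p: "\<psi> (?evt p) = ?evg p" if "p \<in> ?C" for p
      using \<psi>(2)[rule_format, OF that subring_setD(2)[OF C]] e1' by simp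
    have \<psi>K: "\<psi> c = fls_const c" if "c \<in> K" for c
      using \<psi>p[OF const_in_mpoly_ring[OF K'(1) that]] by (simp add: mpoly_eval_const[OF rhom_UNIV_id] mpoly_eval_const[OF rhom_fls_const])
    have \<psi>t: "\<psi> (t i) = fps_to_fls (g i)" if "i < e" for i
      using \<psi>p[OF mvar_in_mpoly_ring[OF K'(1) that]] by (simp add: mpoly_eval_mvar[OF rhom_UNIV_id] mpoly_eval_mvar[OF rhom_fls_const])
    \<comment> \<open>On \<open>Cf\<close> the constant term of the series is the specialised value:
      both come from numerator and denominator evaluated at \<open>a\<close>, and the denominator
      does not vanish there.\<close>
    have good: "c \<in> R \<and> \<psi> c \<in> fls_int \<and> fls_res (\<psi> c) = \<phi> c" if c: "c \<in> Cf" for c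
    proof -
      have cA: "c \<in> A" using c CfA by blast
      note q = pq[OF cA]
      define u where "u = ?evt (qc c)"
      have iR: "inverse u \<in> R" using R(3) c unfolding Y_def u_def by blast
      have uR: "u \<in> R" "\<phi> u = mpoly_eval id a (qc c)" using evtR[OF q(2)] unfolding u_def by auto
      have "\<phi> (u * inverse u) = 1" using q(3) \<phi>'(1) unfolding u_def by simp
      then have inv: "\<phi> u * \<phi> (inverse u) = 1" using \<phi>'(4)[OF uR(1) iR] by simp
      then have u0: "\<phi> u \<noteq> 0" by auto
      have cc: "c = ?evt (pc c) * inverse u" using q(4) unfolding u_def by (simp add: divide_inverse)
      have cR: "c \<in> R" using R'(5)[OF evtR(1)[OF q(1)] iR] cc by simp
      have "\<phi> c = \<phi> (?evt (pc c)) * \<phi> (inverse u)" using \<phi>'(4)[OF evtR(1)[OF q(1)] iR] cc by simp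
      moreover have "\<phi> (inverse u) = inverse (\<phi> u)" using inv by (simp add: inverse_unique[symmetric])
      ultimately have \<phi>c: "\<phi> c = mpoly_eval id a (pc c) * inverse (\<phi> u)" using evtR(2)[OF q(1)] by simp
      have \<psi>c: "\<psi> c = ?evg (pc c) * inverse (?evg (qc c))"
        using \<psi>(2)[rule_format, OF q(1,2,3)] q(4) by (simp add: divide_inverse)
      have ru: "fls_res (?evg (qc c)) = \<phi> u" using evg(2)[OF q(2)] uR(2) by simp
      then have ii: "inverse (?evg (qc c)) \<in> fls_int" using fls_int_inverse[OF evg(1)[OF q(2)]] u0 by simp
      have n0: "?evg (qc c) \<noteq> 0" using ker[OF q(2)] q(3) by simp
      have "fls_res (?evg (qc c)) * fls_res (inverse (?evg (qc c))) = 1"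
        using rhomD(4)[OF rhom_fls_res subring_fls_int evg(1)[OF q(2)] ii] n0 by simp
      then have "fls_res (inverse (?evg (qc c))) = inverse (\<phi> u)" using ru by (simp add: inverse_unique[symmetric])
      then have "fls_res (\<psi> c) = \<phi> c"
        using rhomD(4)[OF rhom_fls_res subring_fls_int evg(1)[OF q(1)] ii] evg(2)[OF q(1)] unfolding \<psi>c \<phi>c by simp
      moreover have "\<psi> c \<in> fls_int" unfolding \<psi>c by (rule subring_setD(5)[OF subring_fls_int evg(1)[OF q(1)] ii])
      ultimately show ?thesis using cR by blast
    qed
    have \<psi>A: "\<psi> ` A \<subseteq> fls_over K"
      unfolding A_def adjoin_def
    proof (rule rhom_fgen_image_subset[OF _ subfield_set_fls_over[OF K]])
      show "rhom (fgen (K \<union> t ` {..<e})) \<psi>" using \<psi>(1) unfolding A_def adjoin_def .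
      have "fps_to_fls (g i) \<in> fls_over K" if "i < e" for i
        using g that K0(2) by (subst fps_over_to_fls[OF K'(2)]) (auto simp: fps_over_def)
      then show "\<psi> ` (K \<union> t ` {..<e}) \<subseteq> fls_over K" using \<psi>K \<psi>t fls_const_over[OF K'(2)] by auto
    qed
    have cm: "poly.coeff m i \<in> Cf" for i unfolding Cf_def by blast
    define M where "M = map_poly \<psi> m"
    define Mf where "Mf = map_poly fls_regpart M"
    have cM: "poly.coeff M i = \<psi> (poly.coeff m i)" for i unfolding M_def by (simp add: coeff_map_poly \<psi>'(2))
    have cMf: "fps_to_fls (poly.coeff Mf i) = \<psi> (poly.coeff m i)" for i
    proof -
      obtain u where "\<psi> (poly.coeff m i) = fps_to_fls u" using good[OF cm] by blast
      then show ?thesis unfolding Mf_def by (simp add: coeff_map_poly cM)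
    qed
    have MMf: "map_poly fps_to_fls Mf = M" by (rule poly_eqI) (simp add: coeff_map_poly cMf cM)
    have Mf0: "map_poly (\<lambda>f. fps_nth f 0) Mf = map_poly \<phi> m"
    proof (rule poly_eqI)
      fix i
      have "fps_nth (poly.coeff Mf i) 0 = fls_res (fps_to_fls (poly.coeff Mf i))" by simp
      then have "fps_nth (poly.coeff Mf i) 0 = \<phi> (poly.coeff m i)" unfolding cMf using good[OF cm[of i]] by simp
      then show "poly.coeff (map_poly (\<lambda>f. fps_nth f 0) Mf) i = poly.coeff (map_poly \<phi> m) i"
        by (simp add: coeff_map_poly \<phi>'(2))
    qed
    have mR: "poly_over R m" unfolding poly_over_def using good[OF cm] by blast
    have xR: "x \<in> R" using R(3) unfolding Y_def by blast
    have xK: "\<phi> x \<in> K" using \<phi>(2) xR by blast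
    have res_poly: "fps_nth (poly f (fps_const c)) 0 = poly (map_poly (\<lambda>f. fps_nth f 0) f) c" for f :: "'a fps poly" and c
      using rhom_poly_UNIV[OF rhom_fps_nth_0, of f "fps_const c"] by simp
    \<comment> \<open>Reduced to constant terms, \<open>Mf\<close> is the specialised minimal
      polynomial, which vanishes at \<open>\<phi> x\<close>.\<close>
    have root: "fps_nth (poly Mf (fps_const (\<phi> x))) 0 = 0"
      unfolding res_poly Mf0 rhom_poly[OF \<phi>(1) R(1) mR xR, symmetric] mA(3) \<phi>'(2) ..
    have dmR: "dm \<in> R" unfolding dm_def by (rule poly_in_subring[OF R(1) poly_over_pderiv[OF R(1) mR] xR])
    have idm: "inverse dm \<in> R" using R(3) unfolding Y_def by blast
    have "\<phi> dm * \<phi> (inverse dm) = 1" using \<phi>'(4)[OF dmR idm] dm0 \<phi>'(1) by simp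
    then have "\<phi> dm \<noteq> 0" by auto
    moreover have "\<phi> dm = poly (pderiv (map_poly \<phi> m)) (\<phi> x)"
      unfolding dm_def map_poly_pderiv_rhom[OF \<phi>(1) R(1) mR, symmetric]
      by (rule rhom_poly[OF \<phi>(1) R(1) poly_over_pderiv[OF R(1) mR] xR])
    ultimately have der: "fps_nth (poly (pderiv Mf) (fps_const (\<phi> x))) 0 \<noteq> 0"
      unfolding res_poly map_poly_pderiv_UNIV[OF rhom_fps_nth_0] Mf0 by simp
    have cMfK: "poly.coeff Mf i \<in> fps_over K" for i
      using \<psi>A CfA cm[of i] unfolding fps_over_to_fls[OF K'(2), symmetric] cMf by blast
    have "\<exists>y \<in> fps_over K. fps_nth y 0 = \<phi> x \<and> poly Mf y = 0" by (rule fps_newton_exists[OF K cMfK xK root der])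
    then obtain y where y: "y \<in> fps_over K" "poly Mf y = 0" by blast
    have "poly M (fps_to_fls y) = fps_to_fls (poly Mf y)"
      unfolding MMf[symmetric] by (rule rhom_poly_UNIV[OF rhom_fps_to_fls, symmetric])
    then have "poly (map_poly \<psi> m) (fps_to_fls y) = 0" using y(2) unfolding M_def by simp
    from rhom_extend_simple[OF A m(1) \<psi>(1) this] obtain j
      where j: "rhom (fgen (A \<union> {x})) j" "\<forall>p. poly_over A p \<longrightarrow> j (poly p x) = poly (map_poly \<psi> p) (fps_to_fls y)"
      by (elim exE conjE)
    have jE: "rhom E j" using j(1) unfolding x(2) E_def .
    have jA: "j c = \<psi> c" if "c \<in> A" for c
      using j(2)[rule_format, of "[:c:]"] that A' by (simp add: poly_over_pCons map_poly_const_rhom[OF \<psi>(1)])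
    have jx: "j x = fps_to_fls y"
      using j(2)[rule_format, of "[:0, 1:]"] A' by (simp add: poly_over_pCons map_poly_rhom_pCons[OF \<psi>(1)] \<psi>')
    have jK: "\<forall>c\<in>K. j c = fls_const c" using jA \<psi>K KA by auto
    have jt: "j (t i) = fps_to_fls (g i)" if "i < e" for i using jA[OF tA[OF that]] \<psi>t[OF that] by simp
    have jEK: "\<forall>z\<in>E. j z \<in> fls_over K"
    proof -
      have "j ` fgen (A \<union> {x}) \<subseteq> fls_over K"
      proof (rule rhom_fgen_image_subset[OF j(1) subfield_set_fls_over[OF K]])
        have "j x \<in> fls_over K" unfolding jx fps_over_to_fls[OF K'(2)] by (rule y(1))
        moreover have "j c \<in> fls_over K" if "c \<in> A" for c using \<psi>A that jA by auto
        ultimately show "j ` (A \<union> {x}) \<subseteq> fls_over K" by blast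
      qed
      then show ?thesis unfolding x(2) E_def by blast
    qed
    have jK0: "\<forall>z\<in>adjoin K0 t e. j z \<in> fls_over K0"
    proof -
      have sub: "fgen (K0 \<union> t ` {..<e}) \<subseteq> E" by (rule fgen_minimal[OF Ef]) (use K0(2) KE tE in auto)
      have "j ` fgen (K0 \<union> t ` {..<e}) \<subseteq> fls_over K0"
      proof (rule rhom_fgen_image_subset[OF rhom_mono[OF jE sub] subfield_set_fls_over[OF K0(1)]])
        have "j c \<in> fls_over K0" if "c \<in> K0" for c
          using jK that K0(2) fls_const_over[OF subfield_setD(2)[OF K0(1)] that] by auto
        moreover have "j (t i) \<in> fls_over K0" if "i < e" for i
          unfolding jt[OF that] fps_over_to_fls[OF subfield_setD(2)[OF K0(1)]] using g that by blast
        ultimately show "j ` (K0 \<union> t ` {..<e}) \<subseteq> fls_over K0" by blast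
      qed
      then show ?thesis unfolding adjoin_def by blast
    qed
    have jS: "\<forall>d\<in>S. j d \<in> fls_int"
    proof
      fix d assume d: "d \<in> S"
      have gdA: "poly_over A (gd d)" and dd: "d = poly (gd d) x" using gd d by blast+
      have "j d = poly (map_poly \<psi> (gd d)) (fps_to_fls y)" using j(2)[rule_format, OF gdA] dd by simp
      also have "\<dots> \<in> fls_int"
      proof (rule poly_coeffs_in_subring[OF subring_fls_int])
        fix i
        have "poly.coeff (gd d) i \<in> Cf" unfolding Cf_def using d by blast
        then show "poly.coeff (map_poly \<psi> (gd d)) i \<in> fls_int" using good by (simp add: coeff_map_poly \<psi>'(2))
      qed simp
      finally show "j d \<in> fls_int" .
    qed
    have "\<forall>i<e. j (t i) \<in> fls_int \<and> fls_res (j (t i)) = a i" using jt g by simp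
    then show ?thesis
      unfolding A_def[symmetric] E_def[symmetric]
      using aK0 jE jK jEK jK0 jS by (intro exI[of _ a] exI[of _ j] conjI allI impI) auto
  qed
qed

section \<open>Linear independence and dimension over lists\<close>

text \<open>Bridges list-based spans and coefficient functions; distinctness allows a coefficient to
  be attached to a vector instead of a position.\<close>

lemma Span_iff:
  fixes K :: "'a::field set"
  assumes K: "subfield_set K" and us: "distinct us"
  shows "u \<in> ring.Span univ_field K us \<longleftrightarrow> (\<exists>l. (\<forall>v\<in>set us. l v \<in> K) \<and> u = (\<Sum>v\<in>set us. l v * v))"
proof -
  interpret R: ring "univ_field :: 'a ring" by (rule ring_from_type_algebra)
  have Kf: "subfield K univ_field" using K unfolding subfield_iff_subfield_set .
  note K' = subfield_setD[OF K]
  have rep: "\<exists>l. (\<forall>v\<in>set us. l v \<in> K) \<and> R.combine ks us = (\<Sum>v\<in>set us. l v * v)" if "set ks \<subseteq> K" for ks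
    using us that
  proof (induction us arbitrary: ks)
    case Nil
    show ?case by (cases ks) (simp_all add: univ_field_simps)
  next
    case (Cons w us)
    show ?case
    proof (cases ks)
      case Nil
      then show ?thesis using K'(2) by (intro exI[of _ "\<lambda>_. 0"]) (simp add: univ_field_simps)
    next
      case (Cons k ks')
      have "distinct us" "set ks' \<subseteq> K" using Cons.prems \<open>ks = k # ks'\<close> by auto
      from Cons.IH[OF this] obtain l where l: "\<forall>v\<in>set us. l v \<in> K" "R.combine ks' us = (\<Sum>v\<in>set us. l v * v)"
        by (elim exE conjE)
      have w: "w \<notin> set us" using Cons.prems by simp
      have "(\<Sum>v\<in>set us. (l(w := k)) v * v) = (\<Sum>v\<in>set us. l v * v)" by (rule sum.cong) (use w in auto)
      then have "R.combine ks (w # us) = (\<Sum>v\<in>set (w # us). (l(w := k)) v * v)"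
        using l(2) w \<open>ks = k # ks'\<close> by (simp add: univ_field_simps)
      moreover have "\<forall>v\<in>set (w # us). (l(w := k)) v \<in> K" using l(1) Cons.prems(2) \<open>ks = k # ks'\<close> by simp
      ultimately show ?thesis by (intro exI[of _ "l(w := k)"] conjI)
    qed
  qed
  have "R.combine (map l us) us = (\<Sum>v\<in>set us. l v * v)" for l
    using us by (induction us) (simp_all add: univ_field_simps)
  then have conv: "(\<Sum>v\<in>set us. l v * v) \<in> R.Span K us" if "\<forall>v\<in>set us. l v \<in> K" for l
    unfolding R.Span_eq_combine_set[OF Kf, of us, unfolded univ_field_simps, OF subset_UNIV]
    using that by (intro CollectI exI[of _ "map l us"] conjI) auto
  show ?thesis
  proof
    assume "u \<in> R.Span K us"
    then obtain ks where ks: "set ks \<subseteq> K" "u = R.combine ks us"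
      unfolding R.Span_eq_combine_set[OF Kf, of us, unfolded univ_field_simps, OF subset_UNIV] by blast
    show "\<exists>l. (\<forall>v\<in>set us. l v \<in> K) \<and> u = (\<Sum>v\<in>set us. l v * v)" unfolding ks(2) by (rule rep[OF ks(1)])
  next
    assume "\<exists>l. (\<forall>v\<in>set us. l v \<in> K) \<and> u = (\<Sum>v\<in>set us. l v * v)"
    then obtain l where l: "\<forall>v\<in>set us. l v \<in> K" "u = (\<Sum>v\<in>set us. l v * v)" by (elim exE conjE)
    show "u \<in> R.Span K us" unfolding l(2) by (rule conv[OF l(1)])
  qed
qed

lemma indep_insert:
  fixes K :: "'a::field set"
  assumes K: "subfield_set K" and B: "finite B" "u \<notin> B"
  shows "indep K (insert u B) \<longleftrightarrow> indep K B \<and> (\<nexists>l. (\<forall>v\<in>B. l v \<in> K) \<and> u = (\<Sum>v\<in>B. l v * v))"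
proof (intro iffI conjI notI)
  note K' = subfield_setD[OF K]
  assume i: "indep K (insert u B)"
  show "indep K B"
    unfolding indep_def
  proof (intro allI impI)
    fix l assume l: "(\<forall>b\<in>B. l b \<in> K) \<and> (\<Sum>b\<in>B. l b * b) = 0"
    have "(\<Sum>b\<in>B. (l(u := 0)) b * b) = (\<Sum>b\<in>B. l b * b)" by (rule sum.cong) (use B in auto)
    then have s: "(\<Sum>b\<in>insert u B. (l(u := 0)) b * b) = 0" using l B by simp
    have "(l(u := 0)) b \<in> K" if "b \<in> insert u B" for b using that l K'(2) by auto
    from indepD[OF i this s] show "\<forall>b\<in>B. l b = 0" using B(2) by (metis fun_upd_other insertI2)
  qed
  assume "\<exists>l. (\<forall>v\<in>B. l v \<in> K) \<and> u = (\<Sum>v\<in>B. l v * v)"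
  then obtain l where l: "\<forall>v\<in>B. l v \<in> K" "u = (\<Sum>v\<in>B. l v * v)" by (elim exE conjE)
  have "(\<Sum>b\<in>B. (l(u := - 1)) b * b) = (\<Sum>b\<in>B. l b * b)" by (rule sum.cong) (use B in auto)
  then have s: "(\<Sum>b\<in>insert u B. (l(u := - 1)) b * b) = 0" using l(2) B by simp
  have "(l(u := - 1)) b \<in> K" if "b \<in> insert u B" for b using that l(1) K'(3,4) by auto
  from indepD[OF i this s, of u] show False by simp
next
  note K' = subfield_setD[OF K]
  assume i: "indep K B \<and> (\<nexists>l. (\<forall>v\<in>B. l v \<in> K) \<and> u = (\<Sum>v\<in>B. l v * v))"
  then have iB: "indep K B" and no: "\<nexists>l. (\<forall>v\<in>B. l v \<in> K) \<and> u = (\<Sum>v\<in>B. l v * v)" by blast+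
  show "indep K (insert u B)"
    unfolding indep_def
  proof (intro allI impI)
    fix l assume l: "(\<forall>b\<in>insert u B. l b \<in> K) \<and> (\<Sum>b\<in>insert u B. l b * b) = 0"
    then have s: "l u * u + (\<Sum>b\<in>B. l b * b) = 0" using B by simp
    have u0: "l u = 0"
    proof (rule ccontr)
      assume n: "l u \<noteq> 0"
      have "l u * u = - (\<Sum>b\<in>B. l b * b)" using s by (simp add: eq_neg_iff_add_eq_0)
      then have "inverse (l u) * (l u * u) = inverse (l u) * (- (\<Sum>b\<in>B. l b * b))" by (rule arg_cong)
      then have "u = inverse (l u) * (- (\<Sum>b\<in>B. l b * b))" using n by (simp add: mult.assoc[symmetric])
      also have "\<dots> = (\<Sum>b\<in>B. (- (inverse (l u) * l b)) * b)" by (simp add: sum_distrib_left sum_negf mult.assoc)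
      finally have "u = (\<Sum>b\<in>B. (- (inverse (l u) * l b)) * b)" .
      moreover have "\<forall>b\<in>B. - (inverse (l u) * l b) \<in> K" using l K' by simp
      ultimately have "\<exists>l. (\<forall>v\<in>B. l v \<in> K) \<and> u = (\<Sum>v\<in>B. l v * v)"
        by (intro exI[of _ "\<lambda>b. - (inverse (l u) * l b)"] conjI)
      with no show False by (rule notE)
    qed
    have "l b = 0" if "b \<in> B" for b
      by (rule indepD[OF iB, of l]) (use l s u0 that in auto)
    then show "\<forall>b\<in>insert u B. l b = 0" using u0 by simp
  qed
qed

lemma independent_iff_indep:
  fixes K :: "'a::field set"
  assumes K: "subfield_set K" and us: "distinct us"
  shows "ring.independent univ_field K us \<longleftrightarrow> indep K (set us)"
proof -
  interpret R: ring "univ_field :: 'a ring" by (rule ring_from_type_algebra)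
  have Kf: "subfield K univ_field" using K unfolding subfield_iff_subfield_set .
  have cons: "R.independent K (u # us) \<longleftrightarrow> u \<notin> R.Span K us \<and> R.independent K us" for u us
    using R.independent_backwards[of K u us] R.li_Cons[of u K us] by (auto simp: univ_field_simps)
  show ?thesis
    using us
  proof (induction us)
    case Nil
    then show ?case by (simp add: indep_def)
  next
    case (Cons u us)
    then have d: "distinct us" "u \<notin> set us" by auto
    show ?case
      unfolding cons Cons.IH[OF d(1)] Span_iff[OF K d(1)] list.set indep_insert[OF K finite_set d(2)] by (rule conj_commute)
  qed
qed

lemma regular_extension_lin_disj:
  fixes K :: "'a::alg_closed_field set"
  assumes "regular_extension K E"
  shows "lin_disj K (algebraic_closure_of K) E"
  unfolding lin_disj_def
proof (intro allI impI)
  fix B assume B: "finite B \<and> B \<subseteq> E \<and> indep K B"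
  have K: "subfield_set K" using assms unfolding regular_extension_def field_extension_iff by simp
  from finite_distinct_list[OF conjunct1[OF B]] obtain us where us: "set us = B" "distinct us" by (elim exE conjE)
  have "ring.independent univ_field K us" using B us(1) unfolding independent_iff_indep[OF K us(2)] by simp
  then have "ring.independent univ_field (algebraic_closure_of K) us"
    using assms B us(1) unfolding regular_extension_def by simp
  then show "indep (algebraic_closure_of K) B"
    unfolding independent_iff_indep[OF subfield_set_algebraic_closure[OF K] us(2)] us(1) .
qed

lemma finite_dimension_generators:
  fixes A N :: "'a::field set"
  assumes A: "subfield_set A" and N: "subfield_set N" "A \<subseteq> N" and fin: "ring.finite_dimension univ_field A N"
  shows "\<exists>S. finite S \<and> S \<subseteq> N \<and> N = fgen (A \<union> S)"
proof -
  interpret R: ring "univ_field :: 'a ring" by (rule ring_from_type_algebra)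
  have Af: "subfield A univ_field" using A unfolding subfield_iff_subfield_set .
  obtain n where n: "R.dimension n A N" using fin unfolding R.finite_dimension_def by (elim exE)
  from R.exists_base[OF Af n] obtain vs where vs: "R.independent A vs" "R.Span A vs = N" by (elim exE conjE)
  have d: "distinct vs" by (rule R.independent_distinct[OF Af vs(1)])
  have vN: "set vs \<subseteq> N" using R.Span_base_incl[OF Af, of vs] vs(2) by (simp add: univ_field_simps)
  let ?B = "fgen (A \<union> set vs)"
  note B' = subfield_setD[OF subfield_set_fgen[of "A \<union> set vs"]]
  have "N \<subseteq> ?B"
  proof
    fix u assume "u \<in> N"
    then obtain l where l: "\<forall>v\<in>set vs. l v \<in> A" "u = (\<Sum>v\<in>set vs. l v * v)"
      unfolding vs(2)[symmetric] Span_iff[OF A d] by (elim exE conjE)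
    show "u \<in> ?B" unfolding l(2)
    proof (rule subring_set_sum[OF B'(1)])
      fix v assume v: "v \<in> set vs"
      have "l v \<in> ?B" "v \<in> ?B" using l(1) v fgen_incl[of "A \<union> set vs"] by auto
      then show "l v * v \<in> ?B" by (rule B'(6))
    qed
  qed
  moreover have "?B \<subseteq> N" by (rule fgen_minimal[OF N(1)]) (use N vN in simp)
  ultimately have "N = ?B" by (rule equalityI)
  then show ?thesis using vN by (intro exI[of _ "set vs"] conjI) simp_all
qed

section \<open>The Krull topology\<close>

lemma topspace_krull:
  assumes "subring_set N"
  shows "topspace (krull_topology N M) = carrier (galois_group N M)"
proof -
  have "carrier (galois_group N M) \<subseteq> (\<Pi>\<^sub>E i\<in>N. N)"
  proof
    fix \<tau> assume t: "\<tau> \<in> carrier (galois_group N M)"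
    show "\<tau> \<in> (\<Pi>\<^sub>E i\<in>N. N)"
      unfolding PiE_iff using galois_groupD(1,5)[OF assms t] by (intro conjI ballI)
  qed
  then show ?thesis
    unfolding krull_topology_def topspace_subtopology topspace_product_topology topspace_discrete_topology by (rule Int_absorb1)
qed

lemma openin_krull:
  assumes N: "subring_set N" and R: "finite R" "R \<subseteq> N" and s: "\<sigma> \<in> carrier (galois_group N M)"
  shows "openin (krull_topology N M) {\<tau> \<in> carrier (galois_group N M). \<forall>r\<in>R. \<tau> r = \<sigma> r}"
proof -
  let ?U = "\<lambda>i. if i \<in> R then {\<sigma> i} else N"
  have "openin (product_topology (\<lambda>_. discrete_topology N) N) (\<Pi>\<^sub>E i\<in>N. ?U i)"
  proof (rule product_topology_basis)
    show "openin (discrete_topology N) (?U i)" for i using galois_groupD(5)[OF N s, of i] R by auto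
    have "{i. ?U i \<noteq> topspace (discrete_topology N)} \<subseteq> R" by auto
    then show "finite {i. ?U i \<noteq> topspace (discrete_topology N)}" using R(1) by (rule finite_subset)
  qed
  moreover have "{\<tau> \<in> carrier (galois_group N M). \<forall>r\<in>R. \<tau> r = \<sigma> r} = (\<Pi>\<^sub>E i\<in>N. ?U i) \<inter> carrier (galois_group N M)"
  proof (intro equalityI subsetI)
    fix \<tau> assume "\<tau> \<in> {\<tau> \<in> carrier (galois_group N M). \<forall>r\<in>R. \<tau> r = \<sigma> r}"
    then have t: "\<tau> \<in> carrier (galois_group N M)" "\<And>r. r \<in> R \<Longrightarrow> \<tau> r = \<sigma> r" by auto
    have "\<tau> \<in> (\<Pi>\<^sub>E i\<in>N. ?U i)"
      unfolding PiE_iff using galois_groupD(1,5)[OF N t(1)] t(2) by (intro conjI ballI) simp_all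
    then show "\<tau> \<in> (\<Pi>\<^sub>E i\<in>N. ?U i) \<inter> carrier (galois_group N M)" using t(1) by simp
  next
    fix \<tau> assume "\<tau> \<in> (\<Pi>\<^sub>E i\<in>N. ?U i) \<inter> carrier (galois_group N M)"
    then have t: "\<tau> \<in> carrier (galois_group N M)" "\<And>i. i \<in> N \<Longrightarrow> \<tau> i \<in> ?U i" unfolding PiE_iff by blast+
    have "\<tau> r = \<sigma> r" if "r \<in> R" for r using t(2)[of r] R(2) that by auto
    then show "\<tau> \<in> {\<tau> \<in> carrier (galois_group N M). \<forall>r\<in>R. \<tau> r = \<sigma> r}" using t(1) by simp
  qed
  ultimately show ?thesis unfolding krull_topology_def openin_subtopology by (intro exI conjI)
qed

lemma krull_neighbourhood:
  assumes N: "subring_set N" and S: "openin (krull_topology N M) S" and s: "\<sigma> \<in> S"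
  shows "\<exists>R. finite R \<and> R \<subseteq> N \<and> (\<forall>\<tau>\<in>carrier (galois_group N M). (\<forall>r\<in>R. \<tau> r = \<sigma> r) \<longrightarrow> \<tau> \<in> S)"
proof -
  obtain T where T: "openin (product_topology (\<lambda>_. discrete_topology N) N) T" "S = T \<inter> carrier (galois_group N M)"
    using S unfolding krull_topology_def openin_subtopology by (elim exE conjE)
  have sT: "\<sigma> \<in> T" using s T(2) by simp
  have "\<exists>U. finite {i \<in> N. U i \<noteq> topspace (discrete_topology N)} \<and> (\<forall>i\<in>N. openin (discrete_topology N) (U i)) \<and>
    \<sigma> \<in> PiE N U \<and> PiE N U \<subseteq> T"
    by (rule T(1)[unfolded openin_product_topology_alt, rule_format, OF sT])
  then obtain U where U: "finite {i \<in> N. U i \<noteq> topspace (discrete_topology N)}" "\<sigma> \<in> PiE N U" "PiE N U \<subseteq> T"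
    by (elim exE conjE)
  let ?R = "{i \<in> N. U i \<noteq> N}"
  have "\<tau> \<in> S" if t: "\<tau> \<in> carrier (galois_group N M)" and agree: "\<forall>r\<in>?R. \<tau> r = \<sigma> r" for \<tau>
  proof -
    have "\<tau> i \<in> U i" if i: "i \<in> N" for i
    proof (cases "U i = N")
      case True
      then show ?thesis using galois_groupD(5)[OF N t i] by simp
    next
      case False
      then have "\<tau> i = \<sigma> i" using agree i by simp
      then show ?thesis using U(2) i by (simp add: PiE_iff)
    qed
    then have "\<tau> \<in> PiE N U" using galois_groupD(1)[OF N t] by (simp add: PiE_iff)
    then show ?thesis using U(3) T(2) t by blast
  qed
  moreover have "finite ?R" using U(1) by simp
  ultimately show ?thesis by (intro exI[of _ ?R] conjI ballI impI) auto
qed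

text \<open>A map depending only on the values at finitely many points is locally constant, so the
  preimage of every set is open.\<close>

lemma krull_continuous:
  assumes N: "subring_set N" and N': "subring_set N'" and R: "finite R" "R \<subseteq> N"
    and \<theta>: "\<And>\<sigma>. \<sigma> \<in> carrier (galois_group N M) \<Longrightarrow> \<theta> \<sigma> \<in> carrier (galois_group N' M')"
    and agree: "\<And>\<sigma> \<tau>. \<sigma> \<in> carrier (galois_group N M) \<Longrightarrow> \<tau> \<in> carrier (galois_group N M) \<Longrightarrow>
      (\<And>r. r \<in> R \<Longrightarrow> \<sigma> r = \<tau> r) \<Longrightarrow> \<theta> \<sigma> = \<theta> \<tau>"
  shows "continuous_map (krull_topology N M) (krull_topology N' M') \<theta>"
  unfolding continuous_map_def topspace_krull[OF N] topspace_krull[OF N']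
proof (intro conjI allI impI)
  show "\<theta> \<in> carrier (galois_group N M) \<rightarrow> carrier (galois_group N' M')" using \<theta> by (rule Pi_I)
  fix U
  let ?S = "{\<sigma> \<in> carrier (galois_group N M). \<theta> \<sigma> \<in> U}"
  have "\<exists>T. openin (krull_topology N M) T \<and> \<sigma> \<in> T \<and> T \<subseteq> ?S" if s: "\<sigma> \<in> ?S" for \<sigma>
  proof -
    have sG: "\<sigma> \<in> carrier (galois_group N M)" "\<theta> \<sigma> \<in> U" using s by auto
    let ?T = "{\<tau> \<in> carrier (galois_group N M). \<forall>r\<in>R. \<tau> r = \<sigma> r}"
    have "openin (krull_topology N M) ?T" by (rule openin_krull[OF N R sG(1)])
    moreover have "\<sigma> \<in> ?T" using sG by simp
    moreover have "?T \<subseteq> ?S"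
    proof
      fix \<tau> assume t: "\<tau> \<in> ?T"
      have "\<theta> \<tau> = \<theta> \<sigma>" by (rule agree[OF _ sG(1)]) (use t in auto)
      then show "\<tau> \<in> ?S" using t sG by simp
    qed
    ultimately show ?thesis by (intro exI[of _ ?T] conjI)
  qed
  then show "openin (krull_topology N M) ?S" by (subst openin_subopen) (rule ballI)
qed

section \<open>Places from Laurent series\<close>

text \<open>Coefficients of such a product are polynomial expressions in the \<open>u y\<close>. The
  map \<open>h\<close> need not be injective, so the lemma also covers reduction to constant
  terms.\<close>

lemma coeff_lin_prod_hom:
  assumes R: "subring_set R" and h: "rhom R h" and Y: "finite Y" and u: "\<And>y. y \<in> Y \<Longrightarrow> u y \<in> R"
  shows "poly.coeff (\<Prod>y\<in>Y. [:- u y, 1:]) i \<in> R \<and>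
    h (poly.coeff (\<Prod>y\<in>Y. [:- u y, 1:]) i) = poly.coeff (\<Prod>y\<in>Y. [:- h (u y), 1:]) i"
  using Y u
proof (induction Y arbitrary: i)
  case empty
  note R' = subring_setD[OF R] and h' = rhomD[OF h R]
  show ?case using R' h' by (simp add: one_pCons coeff_pCons split: nat.split)
next
  case (insert y Y)
  note R' = subring_setD[OF R] and h' = rhomD[OF h R]
  let ?P = "\<Prod>y\<in>Y. [:- u y, 1:]" and ?Q = "\<Prod>y\<in>Y. [:- h (u y), 1:]"
  have IH: "poly.coeff ?P i \<in> R" "h (poly.coeff ?P i) = poly.coeff ?Q i" for i
    using insert.IH[of i] insert.prems by auto
  have c: "poly.coeff ([:- a, 1:] * p) i = - (a * poly.coeff p i) + (case i of 0 \<Rightarrow> 0 | Suc k \<Rightarrow> poly.coeff p k)"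
    for a :: "'r::comm_ring_1" and p i by (simp add: mult_pCons_left coeff_pCons)
  have uy: "u y \<in> R" using insert.prems by simp
  show ?case
    unfolding prod.insert[OF insert.hyps] c using IH uy R' h' by (auto split: nat.split)
qed

lemma fls_const_int: "fls_const c \<in> fls_int"
  using fps_const_to_fls[of c] by (metis rangeI)

text \<open>The common setting of both embedding problems: over \<open>K\<close> with the given
  \<open>\<theta>\<close>, and over \<open>K0\<close> with a map read off from \<open>j\<close>. The
  homomorphism law and continuity of \<open>\<theta>\<close> are derived here from the coefficient
  formula \<open>j_\<theta>\<close>.\<close>

locale series_place =
  fixes k E F Z :: "'a::alg_closed_field set" and j :: "'a \<Rightarrow> 'a fls" and \<theta> :: "('a \<Rightarrow> 'a) \<Rightarrow> ('a \<Rightarrow> 'a)"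
  assumes k: "subfield_set k" and E: "k \<subseteq> E" and Z: "finite Z" and F: "F = fgen (E \<union> Z)"
    and j: "rhom F j" and j_const: "\<And>c. c \<in> F \<Longrightarrow> c \<in> separable_closure_of k \<Longrightarrow> j c = fls_const c"
    and j_E: "\<And>x. x \<in> E \<Longrightarrow> j x \<in> fls_over k"
    and j_F: "\<And>x. x \<in> F \<Longrightarrow> j x \<in> fls_over (separable_closure_of k)"
    and j_Z: "\<And>z. z \<in> Z \<Longrightarrow> j z \<in> fls_int" and res_inj: "inj_on (\<lambda>z. fls_res (j z)) Z"
    and \<theta>: "\<And>\<sigma>. \<sigma> \<in> carrier (absolute_galois_group k) \<Longrightarrow> \<theta> \<sigma> \<in> carrier (galois_group F E)"
    and j_\<theta>: "\<And>\<sigma> x n. \<sigma> \<in> carrier (absolute_galois_group k) \<Longrightarrow> x \<in> F \<Longrightarrow>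
      fls_nth (j (\<theta> \<sigma> x)) n = \<sigma> (fls_nth (j x) n)"
    and Z_stable: "\<And>\<gamma> z. \<gamma> \<in> carrier (galois_group F E) \<Longrightarrow> z \<in> Z \<Longrightarrow> \<gamma> z \<in> Z"
begin

abbreviation "ks \<equiv> separable_closure_of k"
abbreviation "G \<equiv> carrier (absolute_galois_group k)"

definition \<Phi> :: "'a \<Rightarrow> 'a option"
  where "\<Phi> x = (if j x \<in> fls_int then Some (fls_res (j x)) else None)"

lemma subfield_F: "subfield_set F" unfolding F by simp
lemma subfield_ks: "subfield_set ks" by (rule subfield_set_separable_closure[OF k])
lemma E_F: "E \<subseteq> F" unfolding F using fgen_incl[of "E \<union> Z"] by simp
lemma Z_F: "Z \<subseteq> F" unfolding F using fgen_incl[of "E \<union> Z"] by simp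
lemma k_ks: "k \<subseteq> ks" by (rule subset_separable_closure[OF k])
lemmas F' = subfield_setD[OF subfield_F]
lemmas j' = rhomD[OF j subfield_setD(1)[OF subfield_F]]
lemmas int' = subring_setD[OF subring_fls_int]
lemmas res' = rhomD[OF rhom_fls_res subring_fls_int]
lemmas gal_F = galois_groupD[OF subfield_setD(1)[OF subfield_F]]
lemmas gal_k = galois_groupD[OF subfield_setD(1)[OF subfield_ks]]

lemma j_eq: "x \<in> F \<Longrightarrow> y \<in> F \<Longrightarrow> j x = j y \<Longrightarrow> x = y"
  by (rule inj_onD[OF rhom_field_inj_on[OF j subfield_F]])

lemma gal_F_eqI:
  assumes "\<gamma> \<in> carrier (galois_group F E)" "\<gamma>' \<in> carrier (galois_group F E)" "\<And>x. x \<in> F \<Longrightarrow> \<gamma> x = \<gamma>' x"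
  shows "\<gamma> = \<gamma>'"
  by (rule extensionalityI[OF gal_F(1)[OF assms(1)] gal_F(1)[OF assms(2)] assms(3)])

text \<open>Automorphisms over \<open>E\<close> permute \<open>Z\<close> and residues separate the
  points of \<open>Z\<close>, so residues determine the automorphism on generators. Unramifiedness,
  continuity and the lifting from the decomposition group all rest on this.\<close>

lemma gal_F_eqI_res:
  assumes g: "\<gamma> \<in> carrier (galois_group F E)" "\<gamma>' \<in> carrier (galois_group F E)"
    and res: "\<And>z. z \<in> Z \<Longrightarrow> fls_res (j (\<gamma> z)) = fls_res (j (\<gamma>' z))"
  shows "\<gamma> = \<gamma>'"
proof (rule gal_F_eqI[OF g])
  fix x assume x: "x \<in> F"
  show "\<gamma> x = \<gamma>' x"
  proof (rule rhom_fgen_eqI[of "E \<union> Z" \<gamma> \<gamma>' x])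
    show "rhom (fgen (E \<union> Z)) \<gamma>" using gal_F(3)[OF g(1)] unfolding F .
    show "rhom (fgen (E \<union> Z)) \<gamma>'" using gal_F(3)[OF g(2)] unfolding F .
    show "x \<in> fgen (E \<union> Z)" using x unfolding F .
    fix s assume "s \<in> E \<union> Z"
    then show "\<gamma> s = \<gamma>' s"
    proof
      assume "s \<in> E"
      then show ?thesis using gal_F(4)[OF g(1)] gal_F(4)[OF g(2)] by simp
    next
      assume s: "s \<in> Z"
      show ?thesis
        by (rule inj_onD[OF res_inj res[OF s] Z_stable[OF g(1) s] Z_stable[OF g(2) s]])
    qed
  qed
qed

lemma \<Phi>_Some: "\<Phi> x = Some a \<longleftrightarrow> j x \<in> fls_int \<and> fls_res (j x) = a"
  by (simp add: \<Phi>_def)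

lemma \<Phi>_None: "\<Phi> x = None \<longleftrightarrow> j x \<notin> fls_int"
  by (simp add: \<Phi>_def)

lemma res_in: "x \<in> F \<Longrightarrow> fls_nth (j x) n \<in> ks"
  using j_F unfolding fls_over_def by blast

text \<open>Outside the maximal ideal of the valuation ring every series has an integral inverse,
  which can be multiplied in.\<close>

lemma fls_int_cancel:
  fixes f g :: "'a fls"
  assumes fg: "f * g \<in> fls_int" and g: "\<not> (g \<in> fls_int \<and> fls_res g = 0)"
  shows "f \<in> fls_int"
proof -
  have g0: "g \<noteq> 0" using g int'(1) by auto
  have "inverse g \<in> fls_int"
  proof (cases "g \<in> fls_int")
    case True
    then show ?thesis using g fls_int_inverse[of g] by simp
  next
    case False
    then show ?thesis using fls_int_or_inverse[of g] by simp
  qed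
  then have "f * g * inverse g \<in> fls_int" by (rule int'(5)[OF fg])
  then show ?thesis using g0 by (simp add: mult.assoc)
qed

lemma is_place_\<Phi>: "is_place F (algebraic_closure_of k) \<Phi>"
  unfolding is_place_def
proof (intro conjI ballI allI impI)
  show "a \<in> algebraic_closure_of k" if "x \<in> F" "\<Phi> x = Some a" for x a
    using res_in[OF that(1), of 0] that(2) unfolding \<Phi>_Some
    by (elim conjE) (simp, rule subsetD[OF separable_subset_algebraic_closure])
  show "\<Phi> 1 = Some 1" unfolding \<Phi>_Some using j'(1) int'(2) by simp
next
  fix x y a b assume xy: "x \<in> F" "y \<in> F" and "\<Phi> x = Some a \<and> \<Phi> y = Some b"
  then have ab: "j x \<in> fls_int" "fls_res (j x) = a" "j y \<in> fls_int" "fls_res (j y) = b" unfolding \<Phi>_Some by auto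
  show "\<Phi> (x + y) = Some (a + b)"
    unfolding \<Phi>_Some j'(3)[OF xy] using int'(4)[OF ab(1,3)] res'(3)[OF ab(1,3)] ab(2,4) by simp
  show "\<Phi> (x * y) = Some (a * b)"
    unfolding \<Phi>_Some j'(4)[OF xy] using int'(5)[OF ab(1,3)] res'(4)[OF ab(1,3)] ab(2,4) by simp
next
  fix x y assume xy: "x \<in> F" "y \<in> F" and "\<Phi> x = None \<and> \<Phi> y \<noteq> None"
  then have ab: "j x \<notin> fls_int" "j y \<in> fls_int" unfolding \<Phi>_None by auto
  show "\<Phi> (x + y) = None" unfolding \<Phi>_None j'(3)[OF xy]
  proof
    assume "j x + j y \<in> fls_int"
    then have "j x + j y - j y \<in> fls_int" using ab(2) by (rule int'(6))
    then show False using ab(1) by simp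
  qed
next
  fix x y assume xy: "x \<in> F" "y \<in> F" and "\<Phi> x = None \<and> \<Phi> y \<noteq> Some 0"
  then have ab: "j x \<notin> fls_int" "\<not> (j y \<in> fls_int \<and> fls_res (j y) = 0)" unfolding \<Phi>_None \<Phi>_Some by auto
  show "\<Phi> (x * y) = None" unfolding \<Phi>_None j'(4)[OF xy]
  proof
    assume "j x * j y \<in> fls_int"
    then have "j x \<in> fls_int" using ab(2) by (rule fls_int_cancel)
    with ab(1) show False by (rule notE)
  qed
qed

lemma \<Phi>_const: "c \<in> F \<Longrightarrow> c \<in> ks \<Longrightarrow> \<Phi> c = Some c"
  unfolding \<Phi>_Some j_const using fls_const_int[of c] by simp

text \<open>The residue field of \<open>E\<close> is \<open>k\<close> because \<open>j\<close> maps
  \<open>E\<close> to series over \<open>k\<close> and constants to themselves. An inertia element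
  does not change the residues of \<open>Z\<close>, so it is the identity.\<close>

lemma unramified_rational: "unramified_rational_place k E F \<Phi>"
  unfolding unramified_rational_place_def
proof (intro conjI ballI)
  show "is_place F (algebraic_closure_of k) \<Phi>" by (rule is_place_\<Phi>)
  show "\<Phi> x = Some x" if "x \<in> constants_of k F" for x using that \<Phi>_const unfolding constants_of_def by simp
  show "residue_field \<Phi> E = k"
  proof
    show "residue_field \<Phi> E \<subseteq> k"
      using j_E unfolding residue_field_def \<Phi>_Some fls_over_def by auto
    show "k \<subseteq> residue_field \<Phi> E"
    proof
      fix c assume c: "c \<in> k"
      then have "\<Phi> c = Some c" using E E_F k_ks by (intro \<Phi>_const) auto
      then show "c \<in> residue_field \<Phi> E" using c E unfolding residue_field_def by (intro CollectI bexI[of _ c]) auto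
    qed
  qed
  have one: "(\<lambda>x\<in>F. x) \<in> carrier (galois_group F E)" by (rule galois_group_one_mem[OF F'(1) E_F])
  show "unramified_place \<Phi> F E"
    unfolding unramified_place_def galois_group_one
  proof
    show "inertia_group \<Phi> F E \<subseteq> {\<lambda>x\<in>F. x}"
    proof
      fix \<gamma> assume "\<gamma> \<in> inertia_group \<Phi> F E"
      then have g: "\<gamma> \<in> carrier (galois_group F E)" "\<And>x. x \<in> F \<Longrightarrow> \<Phi> x \<noteq> None \<Longrightarrow> \<Phi> (\<gamma> x) = \<Phi> x"
        unfolding inertia_group_def decomposition_group_def by auto
      have "\<gamma> = (\<lambda>x\<in>F. x)"
      proof (rule gal_F_eqI_res[OF g(1) one])
        fix z assume z: "z \<in> Z"
        have zF: "z \<in> F" using Z_F z by blast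
        have pz: "\<Phi> z = Some (fls_res (j z))" unfolding \<Phi>_Some using j_Z[OF z] by simp
        have "\<Phi> (\<gamma> z) = Some (fls_res (j z))" using g(2)[OF zF] pz by simp
        then show "fls_res (j (\<gamma> z)) = fls_res (j ((\<lambda>x\<in>F. x) z))" using zF unfolding \<Phi>_Some by simp
      qed
      then show "\<gamma> \<in> {\<lambda>x\<in>F. x}" by simp
    qed
    show "{\<lambda>x\<in>F. x} \<subseteq> inertia_group \<Phi> F E"
      using one unfolding inertia_group_def decomposition_group_def by simp
  qed
qed

lemma \<Phi>_\<theta>: "\<sigma> \<in> G \<Longrightarrow> x \<in> F \<Longrightarrow> j (\<theta> \<sigma> x) \<in> fls_int \<longleftrightarrow> j x \<in> fls_int"
proof -
  assume s: "\<sigma> \<in> G" and x: "x \<in> F"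
  have "\<sigma> (fls_nth (j x) n) = 0 \<longleftrightarrow> fls_nth (j x) n = 0" for n
    by (rule rhom_field_eq_0_iff[OF gal_k(3)[OF s] subfield_ks res_in[OF x]])
  then show ?thesis unfolding fls_int_iff j_\<theta>[OF s x] by simp
qed

text \<open>Since \<open>j\<close> is injective, identities between automorphisms can be checked on
  coefficients, where composition is evident.\<close>

lemma \<theta>_compose:
  assumes s: "\<sigma> \<in> G" and t: "\<tau> \<in> G"
  shows "\<theta> (compose ks \<sigma> \<tau>) = compose F (\<theta> \<sigma>) (\<theta> \<tau>)"
proof (rule gal_F_eqI)
  have st: "compose ks \<sigma> \<tau> \<in> G" by (rule galois_group_compose[OF subfield_setD(1)[OF subfield_ks] k_ks s t])
  show "\<theta> (compose ks \<sigma> \<tau>) \<in> carrier (galois_group F E)" by (rule \<theta>[OF st])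
  show c: "compose F (\<theta> \<sigma>) (\<theta> \<tau>) \<in> carrier (galois_group F E)"
    by (rule galois_group_compose[OF F'(1) E_F \<theta>[OF s] \<theta>[OF t]])
  fix x assume x: "x \<in> F"
  have tx: "\<theta> \<tau> x \<in> F" by (rule gal_F(5)[OF \<theta>[OF t] x])
  show "\<theta> (compose ks \<sigma> \<tau>) x = compose F (\<theta> \<sigma>) (\<theta> \<tau>) x"
  proof (rule j_eq[OF gal_F(5)[OF \<theta>[OF st] x] gal_F(5)[OF c x]], rule fls_eqI)
    fix n
    show "fls_nth (j (\<theta> (compose ks \<sigma> \<tau>) x)) n = fls_nth (j (compose F (\<theta> \<sigma>) (\<theta> \<tau>) x)) n"
      using x res_in[OF x, of n] by (simp add: j_\<theta>[OF st x] j_\<theta>[OF s tx] j_\<theta>[OF t x] compose_eq)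
  qed
qed

lemma \<theta>_const:
  assumes s: "\<sigma> \<in> G" and x: "x \<in> F" "x \<in> ks"
  shows "\<theta> \<sigma> x = \<sigma> x"
proof -
  note g = \<theta>[OF s]
  have "\<exists>m. is_min_poly k x m \<and> rsquarefree m" using x(2) unfolding separable_closure_of_iff separable_over_def .
  then obtain m where m: "is_min_poly k x m" "rsquarefree m" by (elim exE conjE)
  have m': "poly_over k m" "poly m x = 0" using m(1) unfolding is_min_poly_def by auto
  have kF: "k \<subseteq> F" using E E_F by blast
  \<comment> \<open>A conjugate of a constant is again a separable constant, so \<open>j\<close>
    sends both to constant series and the coefficient at 0 decides.\<close>
  have "poly m (\<theta> \<sigma> x) = 0"
    by (rule roots_min_poly_subset_closed[OF k F'(1) kF x(1) gal_F(3)[OF g] _ m']) (use gal_F(4)[OF g] E in auto)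
  then have sep: "\<theta> \<sigma> x \<in> ks" unfolding separable_closure_of_iff by (rule separable_overI[OF k m'(1) m(2)])
  have "fls_nth (j (\<theta> \<sigma> x)) 0 = \<sigma> (fls_nth (j x) 0)" by (rule j_\<theta>[OF s x(1)])
  then show ?thesis unfolding j_const[OF x] j_const[OF gal_F(5)[OF g x(1)] sep] by simp
qed

lemma \<theta>_weak_solution: "restriction_weak_solution k E F \<theta>"
  unfolding restriction_weak_solution_def weak_solution_def
proof (intro conjI ballI)
  show "\<theta> \<in> hom (absolute_galois_group k) (galois_group F E)"
    unfolding hom_def
  proof (intro CollectI conjI ballI)
    show "\<theta> \<in> G \<rightarrow> carrier (galois_group F E)" using \<theta> by (rule Pi_I)
    fix \<sigma> \<tau> assume s: "\<sigma> \<in> G" and t: "\<tau> \<in> G"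
    show "\<theta> (\<sigma> \<otimes>\<^bsub>absolute_galois_group k\<^esub> \<tau>) = \<theta> \<sigma> \<otimes>\<^bsub>galois_group F E\<^esub> \<theta> \<tau>"
      unfolding galois_group_mult[OF s t] galois_group_mult[OF \<theta>[OF s] \<theta>[OF t]] by (rule \<theta>_compose[OF s t])
  qed
  let ?R = "(\<lambda>z. fls_res (j z)) ` Z"
  show "continuous_map (krull_topology ks k) (krull_topology F E) \<theta>"
  proof (rule krull_continuous[OF subfield_setD(1)[OF subfield_ks] F'(1), of ?R])
    show "finite ?R" using Z by simp
    show "?R \<subseteq> ks" using res_in Z_F by blast
    fix \<sigma> \<tau> assume s: "\<sigma> \<in> G" and t: "\<tau> \<in> G" and agree: "\<And>r. r \<in> ?R \<Longrightarrow> \<sigma> r = \<tau> r"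
    show "\<theta> \<sigma> = \<theta> \<tau>"
    proof (rule gal_F_eqI_res[OF \<theta>[OF s] \<theta>[OF t]])
      fix z assume z: "z \<in> Z"
      have zF: "z \<in> F" using Z_F z by blast
      show "fls_res (j (\<theta> \<sigma> z)) = fls_res (j (\<theta> \<tau> z))"
        unfolding j_\<theta>[OF s zF] j_\<theta>[OF t zF] by (rule agree) (use z in simp)
    qed
  qed (rule \<theta>)
  fix \<sigma> assume s: "\<sigma> \<in> G"
  show "restrict (\<theta> \<sigma>) (constants_of k F) = restrict \<sigma> (constants_of k F)"
    by (rule restrict_ext) (use \<theta>_const[OF s] in \<open>simp add: constants_of_def\<close>)
qed

text \<open>An automorphism preserving the valuation ring \<open>V\<close> induces a homomorphism of
  the residue field \<open>M\<close> over \<open>k\<close>. This extends to some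
  \<open>\<sigma>\<close> in the absolute Galois group, and \<open>\<theta> \<sigma>\<close> has the
  same effect as \<open>\<gamma>\<close> on the residues of \<open>Z\<close>.\<close>

lemma decomposition_group_lift:
  assumes g: "\<gamma> \<in> decomposition_group \<Phi> F E"
  shows "\<exists>\<sigma>\<in>G. \<theta> \<sigma> = \<gamma>"
proof -
  have gG: "\<gamma> \<in> carrier (galois_group F E)" using g unfolding decomposition_group_def by simp
  have gint: "j (\<gamma> x) \<in> fls_int \<longleftrightarrow> j x \<in> fls_int" if "x \<in> F" for x
    using g that unfolding decomposition_group_def \<Phi>_None by simp
  note gr = rhomD[OF gal_F(3)[OF gG] F'(1)] and gF = gal_F(5)[OF gG]
  define V where "V = {x \<in> F. j x \<in> fls_int}"
  have V: "subring_set V"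
    unfolding subring_set_def V_def mem_Collect_eq
  proof (intro conjI ballI)
    show "0 \<in> F" "1 \<in> F" by (rule F'(2), rule F'(3))
    show "j 0 \<in> fls_int" "j 1 \<in> fls_int" unfolding j'(1,2) by (rule int'(1), rule int'(2))
    fix x assume "x \<in> {x \<in> F. j x \<in> fls_int}"
    then have x: "x \<in> F" "j x \<in> fls_int" by (simp_all only: mem_Collect_eq)
    show "- x \<in> F" by (rule F'(4)[OF x(1)])
    show "j (- x) \<in> fls_int" unfolding j'(5)[OF x(1)] by (rule int'(3)[OF x(2)])
    fix y assume "y \<in> {x \<in> F. j x \<in> fls_int}"
    then have y: "y \<in> F" "j y \<in> fls_int" by (simp_all only: mem_Collect_eq)
    show "x + y \<in> F" "x * y \<in> F" by (rule F'(5)[OF x(1) y(1)], rule F'(6)[OF x(1) y(1)])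
    show "j (x + y) \<in> fls_int" unfolding j'(3)[OF x(1) y(1)] by (rule int'(4)[OF x(2) y(2)])
    show "j (x * y) \<in> fls_int" unfolding j'(4)[OF x(1) y(1)] by (rule int'(5)[OF x(2) y(2)])
  qed
  have res_V: "rhom V (\<lambda>x. fls_res (j x))"
    by (rule rhom_comp[OF rhom_mono[OF j] rhom_fls_res]) (auto simp: V_def)
  have gV: "\<gamma> x \<in> V" if "x \<in> V" for x using that gF gint unfolding V_def by blast
  \<comment> \<open>The nonzero elements of the maximal ideal are those whose inverse is not
    integral; hence \<open>\<gamma>\<close> preserves this ideal along with
    \<open>V\<close>.\<close>
  have g0: "fls_res (j (\<gamma> x)) = 0" if x: "x \<in> V" "fls_res (j x) = 0" for x
  proof (cases "x = 0")
    case True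
    then show ?thesis using gr(2) j'(2) by simp
  next
    case False
    have xF: "x \<in> F" "j x \<in> fls_int" using x unfolding V_def by auto
    have iF: "inverse x \<in> F" by (rule F'(8)[OF xF(1)])
    have j0: "j x \<noteq> 0" using rhom_field_eq_0_iff[OF j subfield_F xF(1)] False by simp
    have ji: "j (inverse x) = inverse (j x)" by (rule rhom_field_inverse[OF j subfield_F xF(1)])
    have "inverse (j x) \<notin> fls_int"
    proof
      assume "inverse (j x) \<in> fls_int"
      from res'(4)[OF xF(2) this] show False using j0 x(2) by simp
    qed
    then have n: "j (\<gamma> (inverse x)) \<notin> fls_int" using gint[OF iF] ji by simp
    have "j (\<gamma> (inverse x)) = inverse (j (\<gamma> x))"
      unfolding rhom_field_inverse[OF gal_F(3)[OF gG] subfield_F xF(1)] by (rule rhom_field_inverse[OF j subfield_F gF[OF xF(1)]])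
    with n show ?thesis using fls_int_or_inverse[of "inverse (j (\<gamma> x))"] by simp
  qed
  define M where "M = (\<lambda>x. fls_res (j x)) ` V"
  \<comment> \<open>A residue is lifted to an arbitrary preimage in \<open>V\<close>; by
    \<open>g0\<close> the result does not depend on the lift.\<close>
  define g where "g c = fls_res (j (\<gamma> (SOME x. x \<in> V \<and> fls_res (j x) = c)))" for c
  have g_res: "g (fls_res (j x)) = fls_res (j (\<gamma> x))" if x: "x \<in> V" for x
  proof -
    define y where "y = (SOME y. y \<in> V \<and> fls_res (j y) = fls_res (j x))"
    have "y \<in> V \<and> fls_res (j y) = fls_res (j x)" unfolding y_def by (rule someI[of _ x]) (use x in simp)
    then have y: "y \<in> V" "fls_res (j y) = fls_res (j x)" by auto
    have "fls_res (j (y - x)) = 0" using rhomD(6)[OF res_V V y(1) x] y(2) by simp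
    then have "fls_res (j (\<gamma> (y - x))) = 0" by (rule g0[OF subring_setD(6)[OF V y(1) x]])
    moreover have "\<gamma> (y - x) = \<gamma> y - \<gamma> x" using gr(6) y(1) x unfolding V_def by simp
    ultimately have "fls_res (j (\<gamma> y)) = fls_res (j (\<gamma> x))" using rhomD(6)[OF res_V V gV[OF y(1)] gV[OF x]] by simp
    then show ?thesis unfolding g_def y_def .
  qed
  have VF: "x \<in> V \<Longrightarrow> x \<in> F" for x unfolding V_def by simp
  have kV: "c \<in> V" "fls_res (j c) = c" "\<gamma> c = c" if c: "c \<in> k" for c
  proof -
    have cF: "c \<in> F" "c \<in> ks" using c E E_F k_ks by auto
    show "c \<in> V" "fls_res (j c) = c" using \<Phi>_const[OF cF] cF(1) unfolding V_def \<Phi>_Some by auto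
    show "\<gamma> c = c" using gal_F(4)[OF gG] c E by blast
  qed
  have M: "subfield_set M"
    unfolding subfield_set_def
  proof
    show "subring_set M"
      unfolding subring_set_def
    proof (intro conjI ballI)
      note rv = rhomD[OF res_V V] and V' = subring_setD[OF V]
      show "0 \<in> M" unfolding M_def by (rule image_eqI[of _ _ 0]) (use rv V' in auto)
      show "1 \<in> M" unfolding M_def by (rule image_eqI[of _ _ 1]) (use rv V' in auto)
      fix a assume "a \<in> M"
      then obtain x where x: "x \<in> V" "a = fls_res (j x)" unfolding M_def by (elim imageE)
      show "- a \<in> M" unfolding M_def by (rule image_eqI[of _ _ "- x"]) (use rv(5)[OF x(1)] V'(3)[OF x(1)] x(2) in auto)
      fix b assume "b \<in> M"
      then obtain y where y: "y \<in> V" "b = fls_res (j y)" unfolding M_def by (elim imageE)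
      show "a + b \<in> M" unfolding M_def by (rule image_eqI[of _ _ "x + y"]) (use rv(3)[OF x(1) y(1)] V'(4)[OF x(1) y(1)] x(2) y(2) in auto)
      show "a * b \<in> M" unfolding M_def by (rule image_eqI[of _ _ "x * y"]) (use rv(4)[OF x(1) y(1)] V'(5)[OF x(1) y(1)] x(2) y(2) in auto)
    qed
    show "\<forall>a\<in>M. inverse a \<in> M"
    proof
      fix a assume aM: "a \<in> M"
      then obtain x where x: "x \<in> V" "a = fls_res (j x)" unfolding M_def by (elim imageE)
      show "inverse a \<in> M"
      proof (cases "a = 0")
        case True
        then show ?thesis using aM by simp
      next
        case False
        have xF: "x \<in> F" "j x \<in> fls_int" using x unfolding V_def by auto
        have ji: "j (inverse x) = inverse (j x)" by (rule rhom_field_inverse[OF j subfield_F xF(1)])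
        have ii: "inverse (j x) \<in> fls_int" using fls_int_inverse[OF xF(2)] False x(2) by simp
        have j0: "j x \<noteq> 0" using False x(2) by auto
        have "fls_res (j x) * fls_res (inverse (j x)) = 1" using res'(4)[OF xF(2) ii] j0 by simp
        then have "inverse a = fls_res (j (inverse x))" unfolding x(2) ji by (rule inverse_unique)
        moreover have "inverse x \<in> V" unfolding V_def using F'(8)[OF xF(1)] ii ji by simp
        ultimately show ?thesis unfolding M_def by (rule image_eqI)
      qed
    qed
  qed
  have gM: "rhom M g"
    unfolding rhom_def
  proof (intro conjI ballI)
    note rv = rhomD[OF res_V V] and V' = subring_setD[OF V]
    show "g 1 = 1" using g_res[OF V'(2)] gr(1) j'(1) by simp
    fix a b assume "a \<in> M" "b \<in> M"
    then obtain x y where x: "x \<in> V" "a = fls_res (j x)" and y: "y \<in> V" "b = fls_res (j y)" unfolding M_def by (elim imageE)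
    have gp: "\<gamma> (x + y) = \<gamma> x + \<gamma> y" "\<gamma> (x * y) = \<gamma> x * \<gamma> y" using gr(3,4) VF[OF x(1)] VF[OF y(1)] by auto
    have "g (a + b) = fls_res (j (\<gamma> (x + y)))" using g_res[OF V'(4)[OF x(1) y(1)]] rv(3)[OF x(1) y(1)] x(2) y(2) by simp
    also have "\<dots> = g a + g b" unfolding gp rv(3)[OF gV[OF x(1)] gV[OF y(1)]] x(2) y(2) g_res[OF x(1)] g_res[OF y(1)] ..
    finally show "g (a + b) = g a + g b" .
    have "g (a * b) = fls_res (j (\<gamma> (x * y)))" using g_res[OF V'(5)[OF x(1) y(1)]] rv(4)[OF x(1) y(1)] x(2) y(2) by simp
    also have "\<dots> = g a * g b" unfolding gp rv(4)[OF gV[OF x(1)] gV[OF y(1)]] x(2) y(2) g_res[OF x(1)] g_res[OF y(1)] ..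
    finally show "g (a * b) = g a * g b" .
  qed
  have kM: "k \<subseteq> M"
  proof
    fix c assume c: "c \<in> k"
    show "c \<in> M" unfolding M_def using kV(2)[OF c, symmetric] kV(1)[OF c] by (rule image_eqI)
  qed
  have gk: "g c = c" if "c \<in> k" for c using g_res[OF kV(1)[OF that]] kV(2,3)[OF that] by simp
  have "\<exists>\<sigma>\<in>G. \<forall>x\<in>M \<inter> ks. \<sigma> x = g x" by (rule galois_group_extend[OF k M kM gM gk])
  then obtain \<sigma> where s: "\<sigma> \<in> G" "\<forall>x\<in>M \<inter> ks. \<sigma> x = g x" by (elim bexE)
  have "\<theta> \<sigma> = \<gamma>"
  proof (rule gal_F_eqI_res[OF \<theta>[OF s(1)] gG])
    fix z assume z: "z \<in> Z"
    have zF: "z \<in> F" using Z_F z by blast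
    have zV: "z \<in> V" unfolding V_def using zF j_Z[OF z] by simp
    have "fls_res (j z) \<in> M \<inter> ks" using res_in[OF zF] unfolding M_def by (rule IntI[OF imageI[OF zV]])
    then have "\<sigma> (fls_res (j z)) = g (fls_res (j z))" by (rule s(2)[rule_format])
    then show "fls_res (j (\<theta> \<sigma> z)) = fls_res (j (\<gamma> z))" unfolding j_\<theta>[OF s(1) zF] g_res[OF zV] .
  qed
  then show ?thesis using s(1) by (intro bexI)
qed

lemma induced_weak_solution: "induced_weak_solution k E F \<Phi> \<theta>"
  unfolding induced_weak_solution_def
proof (intro conjI ballI allI impI)
  show "restriction_weak_solution k E F \<theta>" by (rule \<theta>_weak_solution)
  show "\<theta> ` G = decomposition_group \<Phi> F E"
  proof
    show "\<theta> ` G \<subseteq> decomposition_group \<Phi> F E"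
    proof
      fix \<gamma> assume "\<gamma> \<in> \<theta> ` G"
      then obtain \<sigma> where s: "\<sigma> \<in> G" "\<gamma> = \<theta> \<sigma>" by (elim imageE)
      show "\<gamma> \<in> decomposition_group \<Phi> F E"
        unfolding decomposition_group_def \<Phi>_None s(2) using \<theta>[OF s(1)] \<Phi>_\<theta>[OF s(1)] by simp
    qed
    show "decomposition_group \<Phi> F E \<subseteq> \<theta> ` G"
    proof
      fix \<gamma> assume "\<gamma> \<in> decomposition_group \<Phi> F E"
      from decomposition_group_lift[OF this] obtain \<sigma> where "\<sigma> \<in> G" "\<theta> \<sigma> = \<gamma>" by (elim bexE)
      then show "\<gamma> \<in> \<theta> ` G" by (intro image_eqI[of _ _ \<sigma>]) simp_all
    qed
  qed
  fix \<sigma> x a assume s: "\<sigma> \<in> G" and x: "x \<in> F" and a: "\<Phi> x = Some a"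
  show "\<Phi> (\<theta> \<sigma> x) = Some (\<sigma> a)"
    using a unfolding \<Phi>_Some \<Phi>_\<theta>[OF s x] j_\<theta>[OF s x] by auto
qed

end

section \<open>Extending the series point along the twist\<close>

lemma fls_nth_sum_const:
  "fls_nth (\<Sum>i\<in>I. fls_const (x i) * f i) n = (\<Sum>i\<in>I. x i * fls_nth (f i) n)"
  for x :: "'i \<Rightarrow> 'a::field"
  by (induction I rule: infinite_finite_induct) simp_all

text \<open>The finitely many elements of \<open>F\<close> to be controlled are expanded over
  \<open>Ks\<close> along a finite subset \<open>C\<close> of \<open>D\<close>.
  \<open>series_point\<close> embeds \<open>K(t)(C)\<close> with \<open>C\<close> integral, and
  linear disjointness adjoins \<open>Ks\<close> as constants. Since \<open>\<delta> \<sigma>\<close>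
  fixes \<open>D\<close>, only the factors from \<open>Ks\<close> move, which is the action on
  coefficients.\<close>

lemma (in twist) series_extension:
  assumes pac: "pac_extension K0 K" and A_eq: "A = adjoin K t e" and K0A: "adjoin K0 t e \<subseteq> A"
    and alg: "algebraically_independent K t e" and tA: "\<forall>i<e. t i \<in> A"
    and P: "finite P" "P \<subseteq> A"
  shows "\<exists>a j. (\<forall>i<e. a i \<in> K0) \<and> rhom F j \<and> (\<forall>c\<in>F. c \<in> Ks \<longrightarrow> j c = fls_const c) \<and>
    (\<forall>x\<in>F. j x \<in> fls_over Ks) \<and>
    (\<forall>\<sigma>\<in>G. \<forall>x\<in>F. \<forall>n. fls_nth (j (\<theta> \<sigma> x)) n = \<sigma> (fls_nth (j x) n)) \<and>
    (\<forall>x\<in>adjoin K0 t e. j x \<in> fls_over K0) \<and> (\<forall>i<e. j (t i) \<in> fls_int \<and> fls_res (j (t i)) = a i) \<and>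
    (\<forall>z\<in>Z. j z \<in> fls_int) \<and> inj_on (\<lambda>z. fls_res (j z)) Z \<and> (\<forall>x\<in>P. j x \<in> fls_int)"
proof -
  \<comment> \<open>Integral inverses make the differences of distinct conjugates units. For
    \<open>z = z'\<close> the entry is \<open>inverse 0 = 0\<close>, which is harmless.\<close>
  define V where "V = Z \<union> (\<lambda>(z, z'). inverse (z - z')) ` (Z \<times> Z) \<union> P"
  note Fs = subfield_setD[OF subfield_F] and Kss = subfield_setD[OF subfield_Ks]
  have fV: "finite V" unfolding V_def using Z P(1) by simp
  have invF: "inverse (z - z') \<in> F" if "z \<in> Z" "z' \<in> Z" for z z'
    by (intro Fs(8) Fs(7) subsetD[OF Z_F] that)
  have "V \<subseteq> F" unfolding V_def using Z_F P(2) A_F invF by auto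
  then have VT: "V \<subseteq> span_ring Ks D" using F_span_D by (rule subset_trans)
  from span_ring_common_basis[OF K K_Ks subfield_Ks fV VT]
  obtain C m where C: "C \<subseteq> D" "finite C" "\<forall>v\<in>V. \<forall>c\<in>C. m v c \<in> Ks" "\<forall>v\<in>V. v = (\<Sum>c\<in>C. m v c * c)"
    by (elim exE conjE)
  let ?D = "fgen (adjoin K t e \<union> C)"
  let ?R = "span_ring Ks ?D"
  have AD: "adjoin K t e \<subseteq> D" using E(2) E_D unfolding A_eq by (rule subset_trans)
  have sep: "separable_over (adjoin K t e) x" if "x \<in> D" for x using D_sep[OF that] unfolding A_eq .
  have "\<exists>a j. (\<forall>i<e. a i \<in> K0) \<and> rhom ?D j \<and> (\<forall>c\<in>K. j c = fls_const c) \<and> (\<forall>x\<in>?D. j x \<in> fls_over K) \<and>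
    (\<forall>x\<in>adjoin K0 t e. j x \<in> fls_over K0) \<and> (\<forall>i<e. j (t i) \<in> fls_int \<and> fls_res (j (t i)) = a i) \<and>
    (\<forall>x\<in>C. j x \<in> fls_int)"
    by (rule series_point[OF pac subfield_D lin_disj_D_Kb AD alg sep C(2,1)])
  then obtain a g where a: "\<forall>i<e. a i \<in> K0" and g: "rhom ?D g" "\<forall>c\<in>K. g c = fls_const c"
    "\<forall>x\<in>?D. g x \<in> fls_over K" "\<forall>x\<in>adjoin K0 t e. g x \<in> fls_over K0"
    "\<forall>i<e. g (t i) \<in> fls_int \<and> fls_res (g (t i)) = a i" "\<forall>x\<in>C. g x \<in> fls_int" by (elim exE conjE)
  have Dsub: "subfield_set ?D" by simp
  have D': "?D \<subseteq> D" by (rule fgen_minimal[OF subfield_D]) (use AD C(1) in simp)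
  have AD': "adjoin K t e \<subseteq> ?D" "C \<subseteq> ?D" using fgen_incl[of "adjoin K t e \<union> C"] by simp_all
  have KD': "K \<subseteq> ?D" using A(2) AD'(1) unfolding A_eq by (rule subset_trans)
  have ld: "lin_disj K Ks ?D" using lin_disj_D_Ks D' unfolding lin_disj_def by (meson subset_trans)
  have "\<exists>h. rhom ?R h \<and> (\<forall>x\<in>Ks. h x = fls_const x) \<and> (\<forall>y\<in>?D. h y = g y)"
    by (rule span_ring_hom[OF K subfield_Ks K_Ks Dsub KD' ld rhom_mono[OF rhom_fls_const subset_UNIV] g(1)])
      (simp add: g(2))
  then obtain j where j: "rhom ?R j" "\<forall>x\<in>Ks. j x = fls_const x" "\<forall>y\<in>?D. j y = g y" by (elim exE conjE)
  have R: "subring_set ?R" by (rule subring_set_span_ring[OF subfield_Ks Dsub])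
  have DR: "?D \<subseteq> ?R" by (rule subsetI, rule span_ring_right[OF Kss(3)])
  have D'T: "?D \<subseteq> T" using D' D_T by (rule subset_trans)
  have RT: "?R \<subseteq> T" by (rule span_ring_subset[OF subring_T Ks_T D'T])
  have AR: "A \<subseteq> ?R" using AD'(1) DR unfolding A_eq by (rule subset_trans)
  \<comment> \<open>As a ring algebraic over \<open>A\<close> it is a field, so \<open>A\<close> and
    \<open>Z\<close> in it bring in all of \<open>F\<close>.\<close>
  have Rf: "subfield_set ?R"
  proof (rule subfield_set_of_algebraic[OF A(1) R AR])
    fix x assume "x \<in> ?R"
    then have "x \<in> T" using RT by (rule rev_subsetD)
    then show "algebraic_over A x" by (intro separable_over_imp_algebraic T_sep)
  qed
  have vR: "v \<in> ?R" if v: "v \<in> V" for v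
  proof -
    have "(\<Sum>c\<in>C. m v c * c) \<in> ?R" by (rule span_ring_sum[OF C(2)]) (use C(3) v AD'(2) in auto)
    then show ?thesis by (simp only: C(4)[rule_format, OF v, symmetric])
  qed
  have ZR: "Z \<subseteq> ?R" by (rule subsetI, rule vR) (simp add: V_def)
  have FR: "F \<subseteq> ?R" unfolding F by (rule fgen_minimal[OF Rf]) (use AR ZR in simp)
  note jr = rhomD[OF j(1) R] and R' = subring_setD[OF R]
  have KsR: "x \<in> ?R" if "x \<in> Ks" for x by (rule span_ring_left[OF subfield_setD(3)[OF Dsub] that])
  have j_sum: "j (\<Sum>i\<in>I. x i * y i) = (\<Sum>i\<in>I. fls_const (x i) * g (y i))"
    if xy: "\<And>i. i \<in> I \<Longrightarrow> x i \<in> Ks" "\<And>i. i \<in> I \<Longrightarrow> y i \<in> ?D" for I :: "'i set" and x y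
  proof -
    have "j (\<Sum>i\<in>I. x i * y i) = (\<Sum>i\<in>I. j (x i * y i))"
      by (rule rhom_sum[OF j(1) R]) (intro R'(5) KsR xy subsetD[OF DR])
    also have "\<dots> = (\<Sum>i\<in>I. fls_const (x i) * g (y i))"
    proof (rule sum.cong)
      fix i assume i: "i \<in> I"
      show "j (x i * y i) = fls_const (x i) * g (y i)"
        unfolding jr(4)[OF KsR[OF xy(1)[OF i]] subsetD[OF DR xy(2)[OF i]]]
        using j(2,3) xy(1)[OF i] xy(2)[OF i] by simp
    qed simp
    finally show ?thesis .
  qed
  have rep: "\<exists>(n::nat) x y. (\<forall>i<n. x i \<in> Ks) \<and> (\<forall>i<n. y i \<in> ?D) \<and> z = (\<Sum>i<n. x i * y i)" if "z \<in> F" for z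
    by (rule span_ring_rep) (use that FR in blast)
  have gK: "fls_nth (g y) n \<in> K" if "y \<in> ?D" for y n
    using g(3) that unfolding fls_over_def by simp
  have jF: "\<forall>x\<in>F. j x \<in> fls_over Ks"
  proof
    fix z assume "z \<in> F"
    from rep[OF this] obtain n :: nat and x y
      where xy: "\<forall>i<n. x i \<in> Ks" "\<forall>i<n. y i \<in> ?D" and z: "z = (\<Sum>i<n. x i * y i)" by (elim exE conjE)
    have jz: "j z = (\<Sum>i<n. fls_const (x i) * g (y i))" unfolding z by (rule j_sum) (use xy in auto)
    have "fls_nth (j z) l \<in> Ks" for l
      unfolding jz fls_nth_sum_const
    proof (rule subring_set_sum[OF Kss(1)])
      fix i assume "i \<in> {..<n}"
      then show "x i * fls_nth (g (y i)) l \<in> Ks" using xy gK K_Ks by (intro Kss(6)) auto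
    qed
    then show "j z \<in> fls_over Ks" unfolding fls_over_def by simp
  qed
  have j\<theta>: "\<forall>\<sigma>\<in>G. \<forall>x\<in>F. \<forall>n. fls_nth (j (\<theta> \<sigma> x)) n = \<sigma> (fls_nth (j x) n)"
  proof (intro ballI allI)
    fix \<sigma> z l assume s: "\<sigma> \<in> G" and zF: "z \<in> F"
    from rep[OF zF] obtain n :: nat and x y
      where xy: "\<forall>i<n. x i \<in> Ks" "\<forall>i<n. y i \<in> ?D" and z: "z = (\<Sum>i<n. x i * y i)" by (elim exE conjE)
    note sD = galois_groupD[OF Kss(1) s] and T' = subring_setD[OF subring_T]
    note d = \<delta>[OF s] and dr = rhomD[OF \<delta>(1)[OF s] subring_T]
    have xyT: "x i \<in> T" "y i \<in> T" if "i < n" for i using xy that Ks_T D'T by auto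
    have "\<theta> \<sigma> z = \<delta> \<sigma> z" by (rule d(3)[OF zF, symmetric])
    also have "\<dots> = (\<Sum>i<n. \<delta> \<sigma> (x i * y i))"
      unfolding z by (rule rhom_sum[OF d(1) subring_T]) (use xyT T'(5) in simp)
    also have "\<dots> = (\<Sum>i<n. \<sigma> (x i) * y i)"
    proof (rule sum.cong)
      fix i assume "i \<in> {..<n}"
      then have i: "i < n" by simp
      have "y i \<in> D" using xy(2) i D' by auto
      then have "\<delta> \<sigma> (y i) = y i" using s unfolding D_def by simp
      then show "\<delta> \<sigma> (x i * y i) = \<sigma> (x i) * y i"
        unfolding dr(4)[OF xyT[OF i]] using d(2)[of "x i"] xy(1) i by simp
    qed simp
    finally have tz: "\<theta> \<sigma> z = (\<Sum>i<n. \<sigma> (x i) * y i)" .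
    have jt: "j (\<theta> \<sigma> z) = (\<Sum>i<n. fls_const (\<sigma> (x i)) * g (y i))"
      unfolding tz by (rule j_sum) (use xy sD(5) in auto)
    have jz: "j z = (\<Sum>i<n. fls_const (x i) * g (y i))" unfolding z by (rule j_sum) (use xy in auto)
    have "\<sigma> (fls_nth (j z) l) = (\<Sum>i<n. \<sigma> (x i * fls_nth (g (y i)) l))"
      unfolding jz fls_nth_sum_const
    proof (rule rhom_sum[OF sD(3) Kss(1)])
      fix i assume "i \<in> {..<n}"
      then have "x i \<in> Ks" "fls_nth (g (y i)) l \<in> Ks" using xy gK K_Ks by auto
      then show "x i * fls_nth (g (y i)) l \<in> Ks" by (rule Kss(6))
    qed
    also have "\<dots> = (\<Sum>i<n. \<sigma> (x i) * fls_nth (g (y i)) l)"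
    proof (rule sum.cong)
      fix i assume "i \<in> {..<n}"
      then have xi: "x i \<in> Ks" and yi: "fls_nth (g (y i)) l \<in> K" using xy gK by auto
      show "\<sigma> (x i * fls_nth (g (y i)) l) = \<sigma> (x i) * fls_nth (g (y i)) l"
        unfolding rhomD(4)[OF sD(3) Kss(1) xi subsetD[OF K_Ks yi]] sD(4)[OF yi] ..
    qed simp
    finally show "fls_nth (j (\<theta> \<sigma> z)) l = \<sigma> (fls_nth (j z) l)" unfolding jt fls_nth_sum_const by simp
  qed
  have jV: "j v \<in> fls_int" if v: "v \<in> V" for v
  proof -
    have "j (\<Sum>c\<in>C. m v c * c) = (\<Sum>c\<in>C. fls_const (m v c) * g c)"
      by (rule j_sum) (use C(3) v AD'(2) in auto)
    then have "j v = (\<Sum>c\<in>C. fls_const (m v c) * g c)" by (simp only: C(4)[rule_format, OF v, symmetric])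
    moreover have "(\<Sum>c\<in>C. fls_const (m v c) * g c) \<in> fls_int"
      by (rule subring_set_sum[OF subring_fls_int], rule subring_setD(5)[OF subring_fls_int fls_const_int])
        (rule g(6)[rule_format])
    ultimately show ?thesis by simp
  qed
  have jZ: "\<forall>z\<in>Z. j z \<in> fls_int" by (rule ballI, rule jV) (simp add: V_def)
  have jP: "\<forall>x\<in>P. j x \<in> fls_int" by (rule ballI, rule jV) (simp add: V_def)
  have inj: "inj_on (\<lambda>z. fls_res (j z)) Z"
  proof (rule inj_onI, rule ccontr)
    fix z z' assume z: "z \<in> Z" "z' \<in> Z" and eq: "fls_res (j z) = fls_res (j z')" and ne: "z \<noteq> z'"
    have wV: "inverse (z - z') \<in> V" unfolding V_def using z by (intro UnI1 UnI2 image_eqI[of _ _ "(z, z')"]) auto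
    have zR: "z \<in> ?R" "z' \<in> ?R" using z ZR by auto
    \<comment> \<open>If the residues coincided, the unit \<open>j z - j z'\<close> would have
      residue 0.\<close>
    have "j ((z - z') * inverse (z - z')) = (j z - j z') * j (inverse (z - z'))"
      unfolding jr(4)[OF R'(6)[OF zR] vR[OF wV]] jr(6)[OF zR] ..
    then have one: "(j z - j z') * j (inverse (z - z')) = 1" using ne jr(1) by simp
    have zi: "j z \<in> fls_int" "j z' \<in> fls_int" using jZ z by simp_all
    note rr = rhomD[OF rhom_fls_res subring_fls_int]
    have "fls_res ((j z - j z') * j (inverse (z - z'))) = (fls_res (j z) - fls_res (j z')) * fls_res (j (inverse (z - z')))"
      unfolding rr(4)[OF subring_setD(6)[OF subring_fls_int zi] jV[OF wV]] rr(6)[OF zi] ..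
    then show False unfolding one eq using rr(1) by simp
  qed
  have j_K0: "\<forall>x\<in>adjoin K0 t e. j x \<in> fls_over K0"
  proof
    fix x assume x: "x \<in> adjoin K0 t e"
    then have "x \<in> ?D" using K0A AD'(1) unfolding A_eq by auto
    then show "j x \<in> fls_over K0" using j(3) g(4) x by simp
  qed
  have j_t: "\<forall>i<e. j (t i) \<in> fls_int \<and> fls_res (j (t i)) = a i"
  proof (intro allI impI)
    fix i assume i: "i < e"
    then have "t i \<in> ?D" using tA[rule_format, OF i] AD'(1) unfolding A_eq by auto
    then show "j (t i) \<in> fls_int \<and> fls_res (j (t i)) = a i" using j(3) g(5) i by simp
  qed
  have j_const: "\<forall>c\<in>F. c \<in> Ks \<longrightarrow> j c = fls_const c" using j(2) by simp
  have "rhom F j" by (rule rhom_mono[OF j(1) FR])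
  then show ?thesis
    using a j_const jF j\<theta> j_K0 j_t jZ inj jP by (intro exI[of _ a] exI[of _ j] conjI)
qed

section \<open>The series point over the smaller base field\<close>

definition fls_map :: "('a::zero \<Rightarrow> 'b::zero) \<Rightarrow> 'a fls \<Rightarrow> 'b fls"
  where "fls_map h f = Abs_fls (\<lambda>n. h (fls_nth f n))"

lemma fls_nth_fls_map: "h 0 = 0 \<Longrightarrow> fls_nth (fls_map h f) n = h (fls_nth f n)"
  unfolding fls_map_def by (rule nth_Abs_fls_lower_bound[of "fls_subdegree f"]) simp

lemma rhom_fls_map:
  fixes h :: "'a::field \<Rightarrow> 'b::field"
  assumes k: "subfield_set k" and h: "rhom k h"
  shows "rhom (fls_over k) (fls_map h)"
proof -
  note h' = rhomD[OF h subfield_setD(1)[OF k]] and k' = subfield_setD[OF k]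
  note nth = fls_nth_fls_map[of h, OF h'(2)]
  have c: "fls_nth f n \<in> k" if "f \<in> fls_over k" for f n using that unfolding fls_over_def by simp
  \<comment> \<open>Injectivity on \<open>k\<close> preserves the order of a series, so both
    convolutions run over the same index range.\<close>
  have sub: "fls_subdegree (fls_map h f) = fls_subdegree f" if f: "f \<in> fls_over k" for f
  proof (cases "f = 0")
    case True
    have "fls_map h 0 = 0" by (rule fls_eqI) (simp add: nth h'(2))
    then show ?thesis using True by simp
  next
    case False
    then have "fls_nth f (fls_subdegree f) \<noteq> 0" by simp
    then have "h (fls_nth f (fls_subdegree f)) \<noteq> 0" using rhom_field_eq_0_iff[OF h k c[OF f]] by simp
    then show ?thesis by (intro fls_subdegree_eqI) (simp_all add: nth h'(2))
  qed
  show ?thesis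
    unfolding rhom_def
  proof (intro conjI ballI)
    show "fls_map h 1 = 1" by (rule fls_eqI) (simp add: nth h'(1,2))
    fix f g assume f: "f \<in> fls_over k" and g: "g \<in> fls_over k"
    show "fls_map h (f + g) = fls_map h f + fls_map h g"
      by (rule fls_eqI) (simp add: nth h'(3)[OF c[OF f] c[OF g]])
    show "fls_map h (f * g) = fls_map h f * fls_map h g"
    proof (rule fls_eqI)
      fix n
      let ?I = "{fls_subdegree f..n - fls_subdegree g}"
      have "h (\<Sum>i\<in>?I. fls_nth f i * fls_nth g (n - i)) = (\<Sum>i\<in>?I. h (fls_nth f i * fls_nth g (n - i)))"
        by (rule rhom_sum[OF h k'(1)]) (intro k'(6) c f g)
      also have "\<dots> = (\<Sum>i\<in>?I. h (fls_nth f i) * h (fls_nth g (n - i)))"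
        by (rule sum.cong) (simp_all add: h'(4)[OF c[OF f] c[OF g]])
      finally show "fls_nth (fls_map h (f * g)) n = fls_nth (fls_map h f * fls_map h g) n"
        unfolding nth fls_times_nth(2) sub[OF f] sub[OF g] .
    qed
  qed
qed

lemma poly_pderiv_lin_prod_neq_0:
  assumes "finite S" "c \<in> S"
  shows "poly (pderiv (lin_prod S)) c \<noteq> 0"
proof -
  have "lin_prod S = [:- c, 1:] * lin_prod (S - {c})" using assms by (rule prod.remove)
  then have "poly (pderiv (lin_prod S)) c = poly (lin_prod (S - {c})) c"
    by (simp only: pderiv_mult) (simp add: pderiv_pCons)
  then show ?thesis using poly_lin_prod_eq_0_iff[of "S - {c}" c] assms(1) by simp
qed

text \<open>The setting of the upper problem before a solution is available: \<open>j\<close> maps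
  the base field \<open>A\<close> to series over \<open>k\<close>, and the action on
  \<open>F\<close> is to be recovered from the Galois action on coefficients.\<close>

locale series_point_galois =
  fixes k A F Z :: "'a::alg_closed_field set" and j :: "'a \<Rightarrow> 'a fls"
  assumes k: "subfield_set k" and A: "subfield_set A" and Z: "finite Z" and F: "F = fgen (A \<union> Z)"
    and Z_closed: "\<And>z. z \<in> Z \<Longrightarrow> \<exists>f. poly_over A f \<and> rsquarefree f \<and> poly f z = 0 \<and> {y. poly f y = 0} \<subseteq> Z"
    and j: "rhom F j" and j_A: "\<And>x. x \<in> A \<Longrightarrow> j x \<in> fls_over k"
    and j_Z: "\<And>z. z \<in> Z \<Longrightarrow> j z \<in> fls_int" and res_inj: "inj_on (\<lambda>z. fls_res (j z)) Z"
begin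

abbreviation "ks \<equiv> separable_closure_of k"

lemma subfield_F: "subfield_set F" unfolding F by simp
lemma subfield_ks: "subfield_set ks" by (rule subfield_set_separable_closure[OF k])
lemma A_F: "A \<subseteq> F" unfolding F using fgen_incl[of "A \<union> Z"] by simp
lemma Z_F: "Z \<subseteq> F" unfolding F using fgen_incl[of "A \<union> Z"] by simp
lemma k_ks: "k \<subseteq> ks" by (rule subset_separable_closure[OF k])
lemmas F' = subfield_setD[OF subfield_F]
lemmas j' = rhomD[OF j subfield_setD(1)[OF subfield_F]]

lemma conjugates:
  assumes z: "z \<in> Z"
  shows "\<exists>Y. finite Y \<and> Y \<subseteq> Z \<and> z \<in> Y \<and> (\<forall>i. poly.coeff (lin_prod Y) i \<in> A)"
proof -
  from Z_closed[OF z] obtain f where f: "poly_over A f" "rsquarefree f" "poly f z = 0" "{y. poly f y = 0} \<subseteq> Z"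
    by (elim exE conjE)
  let ?Y = "{y. poly f y = 0}"
  have feq: "f = smult (lead_coeff f) (lin_prod ?Y)" by (rule rsquarefree_eq_lin_prod[OF f(2)])
  have lc: "lead_coeff f \<noteq> 0" using f(2) unfolding rsquarefree_def by simp
  have "poly.coeff (lin_prod ?Y) i \<in> A" for i
  proof -
    have "poly.coeff f i = lead_coeff f * poly.coeff (lin_prod ?Y) i"
      using arg_cong[OF feq, of "\<lambda>p. poly.coeff p i"] by (simp only: coeff_smult)
    then have "poly.coeff f i / lead_coeff f = poly.coeff (lin_prod ?Y) i" using lc by simp
    moreover have "poly.coeff f i / lead_coeff f \<in> A"
      using f(1) unfolding poly_over_def by (intro subfield_setD(9)[OF A]) simp_all
    ultimately show ?thesis by simp
  qed
  moreover have "finite ?Y" using f(4) Z by (rule finite_subset)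
  ultimately show ?thesis using f(3,4) by (intro exI[of _ ?Y] conjI allI) simp_all
qed

lemma j_lin_prod:
  assumes "finite Y" "Y \<subseteq> Z"
  shows "j (poly.coeff (lin_prod Y) i) = poly.coeff (\<Prod>y\<in>Y. [:- j y, 1:]) i"
  by (rule conjunct2[OF coeff_lin_prod_hom[OF F'(1) j assms(1)]]) (use assms(2) Z_F in blast)

text \<open>The conjugates of \<open>z\<close> have distinct residues, so the polynomial of these
  residues is separable over \<open>k\<close> and the residue of \<open>z\<close> lies in
  \<open>ks\<close>. Newton's method over \<open>ks\<close> finds a root with this residue, and
  uniqueness identifies it with \<open>j z\<close>.\<close>

lemma j_Z_over:
  assumes z: "z \<in> Z"
  shows "j z \<in> fls_over ks"
proof -
  from conjugates[OF z] obtain Y where Y: "finite Y" "Y \<subseteq> Z" "z \<in> Y" "\<forall>i. poly.coeff (lin_prod Y) i \<in> A"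
    by (elim exE conjE)
  define \<eta> where "\<eta> y = fls_regpart (j y)" for y
  have \<eta>: "fps_to_fls (\<eta> y) = j y" if "y \<in> Y" for y
  proof -
    have "y \<in> Z" using that Y(2) by blast
    from j_Z[OF this] obtain u where "j y = fps_to_fls u" by (elim rangeE)
    then show ?thesis unfolding \<eta>_def by simp
  qed
  have \<eta>0: "fps_nth (\<eta> y) 0 = fls_res (j y)" for y unfolding \<eta>_def by simp
  define M where "M = (\<Prod>y\<in>Y. [:- \<eta> y, 1:])"
  have cM: "poly.coeff M i \<in> fps_over k" for i
  proof -
    have "fps_to_fls (poly.coeff M i) = poly.coeff (\<Prod>y\<in>Y. [:- fps_to_fls (\<eta> y), 1:]) i"
      unfolding M_def by (rule conjunct2[OF coeff_lin_prod_hom[OF subring_set_UNIV rhom_fps_to_fls Y(1)]]) simp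
    also have "(\<Prod>y\<in>Y. [:- fps_to_fls (\<eta> y), 1:]) = (\<Prod>y\<in>Y. [:- j y, 1:])"
      by (rule prod.cong) (simp_all add: \<eta>)
    also have "poly.coeff \<dots> i = j (poly.coeff (lin_prod Y) i)" by (rule j_lin_prod[OF Y(1,2), symmetric])
    finally have "fps_to_fls (poly.coeff M i) \<in> fls_over k" using j_A Y(4) by simp
    then show ?thesis using fps_over_to_fls[OF subfield_setD(2)[OF k]] by simp
  qed
  define c where "c = fls_res (j z)"
  let ?Y' = "(\<lambda>y. fls_res (j y)) ` Y"
  have M0: "map_poly (\<lambda>f. fps_nth f 0) M = lin_prod ?Y'"
  proof (rule poly_eqI)
    fix i
    have "fps_nth (poly.coeff M i) 0 = poly.coeff (\<Prod>y\<in>Y. [:- fps_nth (\<eta> y) 0, 1:]) i"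
      unfolding M_def by (rule conjunct2[OF coeff_lin_prod_hom[OF subring_set_UNIV rhom_fps_nth_0 Y(1)]]) simp
    also have "(\<Prod>y\<in>Y. [:- fps_nth (\<eta> y) 0, 1:]) = lin_prod ?Y'"
      unfolding \<eta>0 using prod.reindex[OF inj_on_subset[OF res_inj Y(2)], of "\<lambda>x. [:- x, 1:]"] by (simp add: comp_def)
    finally show "poly.coeff (map_poly (\<lambda>f. fps_nth f 0) M) i = poly.coeff (lin_prod ?Y') i"
      by (simp add: coeff_map_poly)
  qed
  have fY': "finite ?Y'" using Y(1) by simp
  have cY': "c \<in> ?Y'" unfolding c_def using Y(3) by (rule imageI)
  have "poly_over k (lin_prod ?Y')"
    unfolding poly_over_def M0[symmetric] using cM unfolding fps_over_def by (simp add: coeff_map_poly)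
  then have cks: "c \<in> ks"
    unfolding separable_closure_of_iff
    by (rule separable_overI[OF k _ rsquarefree_lin_prod[OF fY']]) (use cY' poly_lin_prod_eq_0_iff[OF fY', of c] in simp)
  have res_poly: "fps_nth (poly f (fps_const c)) 0 = poly (map_poly (\<lambda>f. fps_nth f 0) f) c" for f :: "'a fps poly"
    using rhom_poly_UNIV[OF rhom_fps_nth_0, of f "fps_const c"] by simp
  have root: "fps_nth (poly M (fps_const c)) 0 = 0"
    unfolding res_poly M0 using cY' poly_lin_prod_eq_0_iff[OF fY', of c] by simp
  have der: "fps_nth (poly (pderiv M) (fps_const c)) 0 \<noteq> 0"
    unfolding res_poly map_poly_pderiv_UNIV[OF rhom_fps_nth_0] M0 by (rule poly_pderiv_lin_prod_neq_0[OF fY' cY'])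
  have cM': "poly.coeff M i \<in> fps_over ks" for i using cM[of i] k_ks unfolding fps_over_def by blast
  have "\<exists>y \<in> fps_over ks. fps_nth y 0 = c \<and> poly M y = 0"
    by (rule fps_newton_exists[OF subfield_ks cM' cks root der])
  then obtain y where y: "y \<in> fps_over ks" "fps_nth y 0 = c" "poly M y = 0" by (elim bexE conjE)
  \<comment> \<open>\<open>M\<close> splits over power series with coefficients in the whole type,
    so the root found is one of the \<open>\<eta> y'\<close>; the residue forces
    \<open>y' = z\<close>.\<close>
  have "(\<Prod>y'\<in>Y. y - \<eta> y') = 0" using y(3) unfolding M_def poly_prod by simp
  then obtain y' where y': "y' \<in> Y" "y = \<eta> y'" using Y(1) by (auto simp: prod_zero_iff)
  have "fls_res (j y') = fls_res (j z)" using y(2) unfolding y'(2) \<eta>0 c_def .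
  then have "y' = z" by (rule inj_onD[OF res_inj]) (use y'(1) Y(2) z in auto)
  then have "fps_to_fls y = j z" using \<eta>[OF y'(1)] y'(2) by simp
  then show ?thesis using y(1) fps_over_to_fls[OF subfield_setD(2)[OF subfield_ks], of y] by simp
qed

lemma fls_over_ks: "f \<in> fls_over k \<Longrightarrow> f \<in> fls_over ks"
  using k_ks unfolding fls_over_def by blast

lemma j_F:
  assumes x: "x \<in> F"
  shows "j x \<in> fls_over ks"
proof -
  have "j ` fgen (A \<union> Z) \<subseteq> fls_over ks"
  proof (rule rhom_fgen_image_subset[OF _ subfield_set_fls_over[OF subfield_ks]])
    show "rhom (fgen (A \<union> Z)) j" using j unfolding F .
    show "j ` (A \<union> Z) \<subseteq> fls_over ks" using j_A j_Z_over fls_over_ks by auto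
  qed
  then show ?thesis using x unfolding F by (rule subsetD[OF _ imageI])
qed

lemma galois_action:
  assumes s: "\<sigma> \<in> carrier (absolute_galois_group k)"
  shows "\<exists>\<gamma>. \<gamma> \<in> carrier (galois_group F A) \<and> (\<forall>x\<in>F. \<forall>n. fls_nth (j (\<gamma> x)) n = \<sigma> (fls_nth (j x) n))"
proof -
  note sD = galois_groupD[OF subfield_setD(1)[OF subfield_ks] s]
  note s' = rhomD[OF sD(3) subfield_setD(1)[OF subfield_ks]]
  note nth = fls_nth_fls_map[of \<sigma>, OF s'(2)]
  define h where "h x = fls_map \<sigma> (j x)" for x
  have h: "rhom F h"
    unfolding h_def by (rule rhom_comp[OF j rhom_fls_map[OF subfield_ks sD(3)]]) (use j_F in auto)
  note h' = rhomD[OF h F'(1)]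
  have hA: "h x = j x" if "x \<in> A" for x
  proof (rule fls_eqI)
    fix n
    have "fls_nth (j x) n \<in> k" using j_A[OF that] unfolding fls_over_def by simp
    then show "fls_nth (h x) n = fls_nth (j x) n" unfolding h_def nth by (rule sD(4))
  qed
  have hZ: "\<exists>y\<in>Z. h z = j y" if z: "z \<in> Z" for z
  proof -
    from conjugates[OF z] obtain Y where Y: "finite Y" "Y \<subseteq> Z" "z \<in> Y" "\<forall>i. poly.coeff (lin_prod Y) i \<in> A"
      by (elim exE conjE)
    have pF: "poly_over F (lin_prod Y)" unfolding poly_over_def using Y(4) A_F by blast
    have "map_poly h (lin_prod Y) = (\<Prod>y\<in>Y. [:- j y, 1:])"
      by (rule poly_eqI) (use hA Y(4) in \<open>simp add: coeff_map_poly h'(2) j_lin_prod[OF Y(1,2)]\<close>)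
    moreover have "h (poly (lin_prod Y) z) = poly (map_poly h (lin_prod Y)) (h z)"
      by (rule rhom_poly[OF h F'(1) pF]) (use z Z_F in blast)
    moreover have "poly (lin_prod Y) z = 0" using poly_lin_prod_eq_0_iff[OF Y(1)] Y(3) by simp
    ultimately have "poly (\<Prod>y\<in>Y. [:- j y, 1:]) (h z) = 0" using h'(2) by simp
    then have "(\<Prod>y\<in>Y. h z - j y) = 0" unfolding poly_prod by simp
    then obtain y where "y \<in> Y" "h z = j y" using Y(1) by (auto simp: prod_zero_iff)
    then show ?thesis using Y(2) by blast
  qed
  have hF: "h x \<in> j ` F" if "x \<in> F" for x
  proof -
    have "h ` fgen (A \<union> Z) \<subseteq> j ` F"
    proof (rule rhom_fgen_image_subset[OF _ subfield_set_image[OF j subfield_F]])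
      show "rhom (fgen (A \<union> Z)) h" using h unfolding F .
      show "h ` (A \<union> Z) \<subseteq> j ` F"
      proof
        fix w assume "w \<in> h ` (A \<union> Z)"
        then obtain u where u: "u \<in> A \<union> Z" "w = h u" by (elim imageE)
        from u(1) show "w \<in> j ` F"
        proof
          assume "u \<in> A"
          then show ?thesis using hA A_F u(2) by blast
        next
          assume "u \<in> Z"
          from hZ[OF this] obtain y where "y \<in> Z" "h u = j y" by (elim bexE)
          then show ?thesis using Z_F u(2) by blast
        qed
      qed
    qed
    then show ?thesis using that unfolding F by (rule subsetD[OF _ imageI])
  qed
  define \<gamma> where "\<gamma> = (\<lambda>x\<in>F. inv_into F j (h x))"
  have j\<gamma>: "j (\<gamma> x) = h x" if "x \<in> F" for x
    unfolding \<gamma>_def using that f_inv_into_f[OF hF[OF that]] by simp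
  have \<gamma>F: "\<gamma> x \<in> F" if "x \<in> F" for x
    unfolding \<gamma>_def using that inv_into_into[OF hF[OF that]] by simp
  have j_eq: "x = y" if "x \<in> F" "y \<in> F" "j x = j y" for x y
    by (rule inj_onD[OF rhom_field_inj_on[OF j subfield_F] that(3,1,2)])
  have \<gamma>A: "\<gamma> x = x" if x: "x \<in> A" for x
  proof (rule j_eq)
    show xF: "x \<in> F" using x A_F by blast
    show "\<gamma> x \<in> F" by (rule \<gamma>F[OF xF])
    show "j (\<gamma> x) = j x" unfolding j\<gamma>[OF xF] by (rule hA[OF x])
  qed
  have \<gamma>: "rhom F \<gamma>"
    unfolding rhom_def
  proof (intro conjI ballI)
    show "\<gamma> 1 = 1" by (rule \<gamma>A[OF subfield_setD(3)[OF A]])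
    fix x y assume x: "x \<in> F" and y: "y \<in> F"
    note gx = \<gamma>F[OF x] and gy = \<gamma>F[OF y]
    show "\<gamma> (x + y) = \<gamma> x + \<gamma> y"
      by (rule j_eq[OF \<gamma>F[OF F'(5)[OF x y]] F'(5)[OF gx gy]])
        (simp add: j\<gamma>[OF F'(5)[OF x y]] j'(3)[OF gx gy] j\<gamma>[OF x] j\<gamma>[OF y] h'(3)[OF x y])
    show "\<gamma> (x * y) = \<gamma> x * \<gamma> y"
      by (rule j_eq[OF \<gamma>F[OF F'(6)[OF x y]] F'(6)[OF gx gy]])
        (simp add: j\<gamma>[OF F'(6)[OF x y]] j'(4)[OF gx gy] j\<gamma>[OF x] j\<gamma>[OF y] h'(4)[OF x y])
  qed
  have inj: "inj_on \<gamma> F" by (rule rhom_field_inj_on[OF \<gamma> subfield_F])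
  have "\<gamma> ` Z \<subseteq> Z"
  proof
    fix w assume "w \<in> \<gamma> ` Z"
    then obtain z where z: "z \<in> Z" "w = \<gamma> z" by (elim imageE)
    from hZ[OF z(1)] obtain y where y: "y \<in> Z" "h z = j y" by (elim bexE)
    have zF: "z \<in> F" "y \<in> F" using z y Z_F by auto
    have "\<gamma> z = y" by (rule j_eq[OF \<gamma>F[OF zF(1)] zF(2)]) (simp add: j\<gamma>[OF zF(1)] y(2))
    then show "w \<in> Z" using z(2) y(1) by simp
  qed
  \<comment> \<open>An injective self-map of a finite set is onto; this is the source of
    surjectivity of \<open>\<gamma>\<close>.\<close>
  then have ZZ: "\<gamma> ` Z = Z" by (rule endo_inj_surj[OF Z _ inj_on_subset[OF inj Z_F]])
  have "F \<subseteq> \<gamma> ` F"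
  proof -
    have "A \<subseteq> \<gamma> ` F"
    proof
      fix x assume x: "x \<in> A"
      show "x \<in> \<gamma> ` F" using \<gamma>A[OF x, symmetric] subsetD[OF A_F x] by (rule image_eqI)
    qed
    moreover have "Z \<subseteq> \<gamma> ` F" using image_mono[OF Z_F, of \<gamma>] unfolding ZZ .
    ultimately have "fgen (A \<union> Z) \<subseteq> \<gamma> ` F" by (intro fgen_minimal[OF subfield_set_image[OF \<gamma> subfield_F]]) simp
    then show ?thesis unfolding F[symmetric] .
  qed
  moreover have "\<gamma> ` F \<subseteq> F" using \<gamma>F by (rule image_subsetI)
  ultimately have bij: "bij_betw \<gamma> F F" using inj unfolding bij_betw_def by (intro conjI equalityI)
  have "\<gamma> \<in> extensional F" unfolding \<gamma>_def by simp
  then have "\<gamma> \<in> carrier (galois_group F A)"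
    unfolding galois_group_carrier_iff[OF F'(1)] using bij \<gamma> \<gamma>A by (intro conjI ballI)
  moreover have "fls_nth (j (\<gamma> x)) n = \<sigma> (fls_nth (j x) n)" if "x \<in> F" for x n
    unfolding j\<gamma>[OF that] h_def nth ..
  ultimately show ?thesis by (intro exI[of _ \<gamma>] conjI ballI allI)
qed

end

section \<open>The lifting property\<close>

text \<open>A finite basis is closed under conjugation, and normality keeps the new points inside
  \<open>N\<close>.\<close>

lemma finite_galois_generators:
  fixes A :: "'a::alg_closed_field set"
  assumes gal: "finite_galois_extension A N"
  shows "\<exists>Z. finite Z \<and> Z \<subseteq> N \<and> N = fgen (A \<union> Z) \<and>
    (\<forall>z\<in>Z. \<exists>f. poly_over A f \<and> rsquarefree f \<and> poly f z = 0 \<and> {y. poly f y = 0} \<subseteq> Z)"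
proof -
  have fe: "subfield_set A" "subfield_set N" "A \<subseteq> N"
    and sep: "\<And>x. x \<in> N \<Longrightarrow> separable_over A x"
    and normal: "\<And>x. x \<in> N \<Longrightarrow> \<exists>p. is_min_poly A x p \<and> {y. poly p y = 0} \<subseteq> N"
    and fin: "ring.finite_dimension univ_field A N"
    using gal unfolding finite_galois_extension_def separable_algebraic_extension_def normal_extension_def field_extension_iff
    by simp_all
  from finite_dimension_generators[OF fe fin] obtain S where S: "finite S" "S \<subseteq> N" "N = fgen (A \<union> S)" by (elim exE conjE)
  have sepS: "separable_over A z" if "z \<in> S" for z by (rule sep[OF subsetD[OF S(2) that]])
  have "\<exists>Z'. finite Z' \<and> S \<subseteq> Z' \<and>
    (\<forall>z\<in>Z'. \<exists>f. poly_over A f \<and> rsquarefree f \<and> poly f z = 0 \<and> {y. poly f y = 0} \<subseteq> Z') \<and>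
    (\<forall>z\<in>Z'. \<exists>y\<in>S. \<forall>f. is_min_poly A y f \<longrightarrow> poly f z = 0)"
    by (rule finite_root_closure[OF fe(1) S(1) sepS])
  then obtain Z where Z: "finite Z" "S \<subseteq> Z"
    "\<forall>z\<in>Z. \<exists>f. poly_over A f \<and> rsquarefree f \<and> poly f z = 0 \<and> {y. poly f y = 0} \<subseteq> Z"
    "\<forall>z\<in>Z. \<exists>y\<in>S. \<forall>f. is_min_poly A y f \<longrightarrow> poly f z = 0" by (elim exE conjE)
  have ZN: "Z \<subseteq> N"
  proof
    fix z assume "z \<in> Z"
    from Z(4)[rule_format, OF this] obtain y where y: "y \<in> S" "\<forall>f. is_min_poly A y f \<longrightarrow> poly f z = 0" by (elim bexE)
    from normal[OF subsetD[OF S(2) y(1)]] obtain p where p: "is_min_poly A y p" "{y. poly p y = 0} \<subseteq> N" by (elim exE conjE)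
    have "poly p z = 0" by (rule y(2)[rule_format, OF p(1)])
    then show "z \<in> N" using p(2) by (intro subsetD[OF p(2)] CollectI)
  qed
  have "N \<subseteq> fgen (A \<union> Z)" unfolding S(3) by (rule fgen_mono) (use Z(2) in auto)
  moreover have "fgen (A \<union> Z) \<subseteq> N" by (rule fgen_minimal[OF fe(2)]) (use fe(3) ZN in simp)
  ultimately have "N = fgen (A \<union> Z)" by (rule equalityI)
  then show ?thesis using Z(1,3) ZN by (intro exI[of _ Z] conjI)
qed

lemma restriction_weak_solutionD:
  fixes K :: "'a::alg_closed_field set"
  assumes K: "subfield_set K" and F: "subfield_set F" "E \<subseteq> F" and w: "restriction_weak_solution K E F \<theta>"
  shows "\<sigma> \<in> carrier (absolute_galois_group K) \<Longrightarrow> \<theta> \<sigma> \<in> carrier (galois_group F E)"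
    and "\<sigma> \<in> carrier (absolute_galois_group K) \<Longrightarrow> \<tau> \<in> carrier (absolute_galois_group K) \<Longrightarrow>
      \<theta> (compose (separable_closure_of K) \<sigma> \<tau>) = compose F (\<theta> \<sigma>) (\<theta> \<tau>)"
    and "\<theta> (\<lambda>x\<in>separable_closure_of K. x) = (\<lambda>x\<in>F. x)"
    and "\<sigma> \<in> carrier (absolute_galois_group K) \<Longrightarrow> x \<in> F \<Longrightarrow> x \<in> separable_closure_of K \<Longrightarrow> \<theta> \<sigma> x = \<sigma> x"
proof -
  let ?s = "separable_closure_of K" and ?G = "carrier (absolute_galois_group K)"
  have s: "subring_set ?s" by (rule subfield_setD(1)[OF subfield_set_separable_closure[OF K]])
  have F': "subring_set F" by (rule subfield_setD(1)[OF F(1)])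
  have hom: "\<theta> \<in> hom (absolute_galois_group K) (galois_group F E)"
    and res: "\<And>\<sigma>. \<sigma> \<in> ?G \<Longrightarrow> restrict (\<theta> \<sigma>) (constants_of K F) = restrict \<sigma> (constants_of K F)"
    using w unfolding restriction_weak_solution_def weak_solution_def by simp_all
  show mem: "\<theta> \<sigma> \<in> carrier (galois_group F E)" if "\<sigma> \<in> ?G" for \<sigma>
    using hom that unfolding hom_def by auto
  show comp: "\<theta> (compose ?s \<sigma> \<tau>) = compose F (\<theta> \<sigma>) (\<theta> \<tau>)" if st: "\<sigma> \<in> ?G" "\<tau> \<in> ?G" for \<sigma> \<tau>
  proof -
    have "\<theta> (\<sigma> \<otimes>\<^bsub>absolute_galois_group K\<^esub> \<tau>) = \<theta> \<sigma> \<otimes>\<^bsub>galois_group F E\<^esub> \<theta> \<tau>"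
      using hom st unfolding hom_def by simp
    then show ?thesis unfolding galois_group_mult[OF st] galois_group_mult[OF mem[OF st(1)] mem[OF st(2)]] .
  qed
  show "\<theta> \<sigma> x = \<sigma> x" if "\<sigma> \<in> ?G" "x \<in> F" "x \<in> ?s" for \<sigma> x
    using fun_cong[OF res[OF that(1)], of x] that(2,3) by (simp add: constants_of_def)
  let ?one = "\<lambda>x\<in>?s. x"
  have one: "?one \<in> ?G" by (rule galois_group_one_mem[OF s subset_separable_closure[OF K]])
  have "compose ?s ?one ?one = ?one" by (rule ext) (simp add: compose_def)
  \<comment> \<open>An idempotent injective map is the identity.\<close>
  then have idem: "\<theta> ?one = compose F (\<theta> ?one) (\<theta> ?one)" using comp[OF one one] by simp
  note e = galois_groupD[OF F' mem[OF one]]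
  show "\<theta> ?one = (\<lambda>x\<in>F. x)"
  proof (rule extensionalityI[OF e(1)])
    fix x assume x: "x \<in> F"
    have "\<theta> ?one x = \<theta> ?one (\<theta> ?one x)" using fun_cong[OF idem, of x] compose_eq[OF x, of "\<theta> ?one" "\<theta> ?one"] by (rule trans)
    then have "x = \<theta> ?one x" by (rule inj_onD[OF bij_betw_imp_inj_on[OF e(2)] _ x e(5)[OF x]])
    then show "\<theta> ?one x = (\<lambda>x\<in>F. x) x" using x by simp
  qed simp
qed

text \<open>The preimage of the identity is open, so it contains every automorphism that fixes a
  suitable finite \<open>W\<close> pointwise. If \<open>\<sigma>\<close> and \<open>\<tau>\<close>
  agree on \<open>W\<close>, the quotient of the two has trivial image.\<close>

lemma restriction_weak_solution_finite:
  fixes K :: "'a::alg_closed_field set"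
  assumes K: "subfield_set K" and E: "subfield_set E" and Z: "finite Z" and F: "F = fgen (E \<union> Z)"
    and w: "restriction_weak_solution K E F \<theta>"
  shows "\<exists>W. finite W \<and> W \<subseteq> separable_closure_of K \<and>
    (\<forall>\<sigma>\<in>carrier (absolute_galois_group K). \<forall>\<tau>\<in>carrier (absolute_galois_group K).
      (\<forall>w\<in>W. \<sigma> w = \<tau> w) \<longrightarrow> \<theta> \<sigma> = \<theta> \<tau>)"
proof -
  let ?s = "separable_closure_of K" and ?G = "carrier (absolute_galois_group K)"
  have Fs: "subfield_set F" unfolding F by simp
  have EF: "E \<subseteq> F" and ZF: "Z \<subseteq> F" unfolding F using fgen_incl[of "E \<union> Z"] by simp_all
  note D = restriction_weak_solutionD[OF K Fs EF w]
  have sf: "subfield_set ?s" by (rule subfield_set_separable_closure[OF K])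
  note s = subfield_setD(1)[OF sf] and F' = subfield_setD(1)[OF Fs] and Ks = subset_separable_closure[OF K]
  let ?one = "\<lambda>x\<in>?s. x"
  have one: "?one \<in> ?G" by (rule galois_group_one_mem[OF s Ks])
  have oneF: "(\<lambda>x\<in>F. x) \<in> carrier (galois_group F E)" by (rule galois_group_one_mem[OF F' EF])
  let ?U = "{\<tau> \<in> carrier (galois_group F E). \<forall>r\<in>Z. \<tau> r = (\<lambda>x\<in>F. x) r}"
  let ?S = "{\<sigma> \<in> ?G. \<theta> \<sigma> \<in> ?U}"
  have "continuous_map (krull_topology ?s K) (krull_topology F E) \<theta>"
    using w unfolding restriction_weak_solution_def weak_solution_def by simp
  then have cont: "\<And>U. openin (krull_topology F E) U \<Longrightarrow> openin (krull_topology ?s K) {\<sigma> \<in> ?G. \<theta> \<sigma> \<in> U}"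
    unfolding continuous_map_def topspace_krull[OF s] by (elim conjE) (drule spec, drule mp, assumption+)
  have S: "openin (krull_topology ?s K) ?S" by (rule cont, rule openin_krull[OF F' Z ZF oneF])
  have "?one \<in> ?S" using one oneF D(3) by simp
  from krull_neighbourhood[OF s S this] obtain W where W: "finite W" "W \<subseteq> ?s"
    "\<forall>\<tau>\<in>?G. (\<forall>r\<in>W. \<tau> r = ?one r) \<longrightarrow> \<tau> \<in> ?S" by (elim exE conjE)
  have "\<theta> \<sigma> = \<theta> \<tau>" if sG: "\<sigma> \<in> ?G" and tG: "\<tau> \<in> ?G" and agree: "\<forall>w\<in>W. \<sigma> w = \<tau> w" for \<sigma> \<tau>
  proof -
    have "\<exists>\<tau>'. \<tau>' \<in> ?G \<and> (\<forall>x\<in>?s. \<tau> (\<tau>' x) = x) \<and> (\<forall>x\<in>?s. \<tau>' (\<tau> x) = x)"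
    proof (rule galois_group_inverse[OF sf Ks tG])
      fix \<tau>' assume "\<tau>' \<in> ?G" "\<And>x. x \<in> ?s \<Longrightarrow> \<tau> (\<tau>' x) = x" "\<And>x. x \<in> ?s \<Longrightarrow> \<tau>' (\<tau> x) = x"
      then show ?thesis by (intro exI[of _ \<tau>'] conjI ballI)
    qed
    then obtain \<tau>' where t': "\<tau>' \<in> ?G" "\<forall>x\<in>?s. \<tau> (\<tau>' x) = x" "\<forall>x\<in>?s. \<tau>' (\<tau> x) = x" by (elim exE conjE)
    note sD = galois_groupD[OF s sG]
    let ?\<rho> = "compose ?s \<tau>' \<sigma>"
    have \<rho>: "?\<rho> \<in> ?G" by (rule galois_group_compose[OF s Ks t'(1) sG])
    have "\<forall>r\<in>W. ?\<rho> r = ?one r"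
    proof
      fix r assume r: "r \<in> W"
      then have rs: "r \<in> ?s" using W(2) by blast
      show "?\<rho> r = ?one r" using rs agree r t'(3)[rule_format, OF rs] by (simp add: compose_eq)
    qed
    from W(3)[rule_format, OF \<rho> this[rule_format]] have \<rho>U: "\<theta> ?\<rho> \<in> carrier (galois_group F E)" "\<forall>r\<in>Z. \<theta> ?\<rho> r = (\<lambda>x\<in>F. x) r"
      by simp_all
    note rD = galois_groupD[OF F' \<rho>U(1)]
    have \<rho>id: "\<theta> ?\<rho> x = x" if x: "x \<in> F" for x
    proof (rule rhom_fgen_eqI[of "E \<union> Z" "\<theta> ?\<rho>" "\<lambda>x. x"])
      show "rhom (fgen (E \<union> Z)) (\<theta> ?\<rho>)" using rD(3) unfolding F .
      show "rhom (fgen (E \<union> Z)) (\<lambda>x. x)" by (rule rhom_id)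
      show "x \<in> fgen (E \<union> Z)" using x unfolding F .
      fix r assume "r \<in> E \<union> Z"
      then show "\<theta> ?\<rho> r = r"
      proof
        assume "r \<in> E"
        then show ?thesis by (rule rD(4))
      next
        assume r: "r \<in> Z"
        then have "r \<in> F" using ZF by blast
        then show ?thesis using \<rho>U(2) r by simp
      qed
    qed
    have "\<sigma> = compose ?s \<tau> ?\<rho>"
    proof (rule extensionalityI[OF sD(1)])
      show "compose ?s \<tau> ?\<rho> \<in> extensional ?s" by (simp add: compose_def)
      fix x assume x: "x \<in> ?s"
      show "\<sigma> x = compose ?s \<tau> ?\<rho> x" using x t'(2)[rule_format, OF sD(5)[OF x]] by (simp add: compose_eq)
    qed
    then have "\<theta> \<sigma> = compose F (\<theta> \<tau>) (\<theta> ?\<rho>)" using D(2)[OF tG \<rho>] by simp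
    also have "\<dots> = \<theta> \<tau>"
    proof (rule extensionalityI[of _ F])
      show "compose F (\<theta> \<tau>) (\<theta> ?\<rho>) \<in> extensional F" by (simp add: compose_def)
      show "\<theta> \<tau> \<in> extensional F" by (rule galois_groupD(1)[OF F' D(1)[OF tG]])
      fix x assume x: "x \<in> F"
      show "compose F (\<theta> \<tau>) (\<theta> ?\<rho>) x = \<theta> \<tau> x" using x \<rho>id[OF x] by (simp add: compose_eq)
    qed
    finally show ?thesis .
  qed
  then show ?thesis using W(1,2) by (intro exI[of _ W] conjI ballI impI)
qed

lemma restrict_galois:
  fixes K0 K :: "'a::alg_closed_field set"
  assumes K0: "subfield_set K0" and K: "subfield_set K" "K0 \<subseteq> K" and s: "\<sigma> \<in> carrier (absolute_galois_group K)"
  shows "restrict \<sigma> (separable_closure_of K0) \<in> carrier (absolute_galois_group K0)"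
proof -
  let ?s = "separable_closure_of K" and ?s0 = "separable_closure_of K0"
  have s0: "subring_set ?s0" by (rule subfield_setD(1)[OF subfield_set_separable_closure[OF K0]])
  note sD = galois_groupD[OF subfield_setD(1)[OF subfield_set_separable_closure[OF K(1)]] s]
  have h: "rhom ?s0 \<sigma>" by (rule rhom_mono[OF sD(3) separable_closure_mono[OF K(2,1)]])
  have fix_K0: "\<sigma> a = a" if "a \<in> K0" for a by (rule sD(4)[OF subsetD[OF K(2) that]])
  have bij: "bij_betw \<sigma> ?s0 ?s0" by (rule hom_separable_closure_bij[OF K0 h fix_K0])
  show ?thesis
    unfolding galois_group_carrier_iff[OF s0]
  proof (intro conjI ballI)
    show "bij_betw (restrict \<sigma> ?s0) ?s0 ?s0" using bij by (simp add: bij_betw_def inj_on_def)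
    show "rhom ?s0 (restrict \<sigma> ?s0)" by (rule rhom_cong[OF h s0]) simp
    show "restrict \<sigma> ?s0 x = x" if "x \<in> K0" for x
      using that fix_K0[OF that] subsetD[OF subset_separable_closure[OF K0] that] by simp
  qed simp
qed

lemma geometric_lifting:
  fixes K0 K E F0 :: "'a::alg_closed_field set"
  assumes pac: "pac_extension K0 K"
    and prob: "rational_double_embedding_problem K0 K E t e F0"
    and weak: "lower_weak_solution K E F0 \<theta>"
    and r: "r \<in> adjoin K t e" "r \<noteq> 0"
  shows "\<exists>\<Phi> \<theta>0 a. geometric_weak_solution K0 K E t e F0 \<Phi> \<theta> \<theta>0 \<and>
    (\<forall>i<e. \<Phi> (t i) = Some (a i) \<and> a i \<in> K0) \<and> (\<exists>b. b \<noteq> 0 \<and> has_value_at id K e t r a b)"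
proof -
  have K0: "subfield_set K0" and K: "subfield_set K" and K0K: "K0 \<subseteq> K"
    using prob unfolding rational_double_embedding_problem_def field_extension_iff by simp_all
  have reg: "regular_extension K E" and sepbasis: "separating_transcendence_basis K E t e"
    and gal: "finite_galois_extension (adjoin K0 t e) F0" and EF0: "E \<subseteq> compositum F0 K"
    using prob unfolding rational_double_embedding_problem_def by simp_all
  have E: "subfield_set E" and KE: "K \<subseteq> E" using reg unfolding regular_extension_def field_extension_iff by simp_all
  have tE: "t i \<in> E" if "i < e" for i
    using sepbasis that unfolding separating_transcendence_basis_def transcendence_basis_def by simp
  have alg: "algebraically_independent K t e"
    using sepbasis unfolding separating_transcendence_basis_def transcendence_basis_def by simp
  define A0 where "A0 = adjoin K0 t e"
  define A where "A = adjoin K t e"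
  define F where "F = compositum F0 K"
  have A0: "subfield_set A0" and A: "subfield_set A" unfolding A0_def A_def adjoin_def by simp_all
  have incA0: "K0 \<subseteq> A0" "t ` {..<e} \<subseteq> A0" unfolding A0_def adjoin_def using fgen_incl[of "K0 \<union> t ` {..<e}"] by simp_all
  have incA: "K \<subseteq> A" "t ` {..<e} \<subseteq> A" unfolding A_def adjoin_def using fgen_incl[of "K \<union> t ` {..<e}"] by simp_all
  have A0A: "A0 \<subseteq> A" unfolding A0_def A_def adjoin_def by (rule fgen_mono) (use K0K in auto)
  have AE: "A \<subseteq> E" unfolding A_def adjoin_def by (rule fgen_minimal[OF E]) (use KE tE in auto)
  have tA: "\<forall>i<e. t i \<in> A" using incA(2) by auto
  from finite_galois_generators[OF gal] obtain Z where Z: "finite Z" "Z \<subseteq> F0" "F0 = fgen (A0 \<union> Z)"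
    "\<forall>z\<in>Z. \<exists>f. poly_over A0 f \<and> rsquarefree f \<and> poly f z = 0 \<and> {y. poly f y = 0} \<subseteq> Z"
    unfolding A0_def by (elim exE conjE)
  have Z_closed0: "\<exists>f. poly_over A0 f \<and> rsquarefree f \<and> poly f z = 0 \<and> {y. poly f y = 0} \<subseteq> Z" if "z \<in> Z" for z
    by (rule Z(4)[rule_format, OF that])
  have Z_closed: "\<exists>f. poly_over A f \<and> rsquarefree f \<and> poly f z = 0 \<and> {y. poly f y = 0} \<subseteq> Z" if z: "z \<in> Z" for z
  proof -
    from Z_closed0[OF z] obtain f where f: "poly_over A0 f" "rsquarefree f" "poly f z = 0" "{y. poly f y = 0} \<subseteq> Z"
      by (elim exE conjE)
    show ?thesis using poly_over_mono[OF f(1) A0A] f(2-4) by (intro exI[of _ f] conjI)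
  qed
  have Fsub: "subfield_set F" unfolding F_def compositum_def by simp
  have F0F: "F0 \<subseteq> F" and KF: "K \<subseteq> F" unfolding F_def compositum_def using fgen_incl[of "F0 \<union> K"] by simp_all
  have EF: "E \<subseteq> F" using EF0 unfolding F_def .
  have ZF: "Z \<subseteq> F" using Z(2) F0F by (rule subset_trans)
  have AF: "A \<subseteq> F" using AE EF by (rule subset_trans)
  have F_A: "F = fgen (A \<union> Z)"
  proof
    have F0': "F0 \<subseteq> fgen (A \<union> Z)" unfolding Z(3) by (rule fgen_mono) (use A0A in auto)
    have "A \<subseteq> fgen (A \<union> Z)" using fgen_incl[of "A \<union> Z"] by simp
    with incA(1) have "K \<subseteq> fgen (A \<union> Z)" by (rule subset_trans)
    with F0' show "F \<subseteq> fgen (A \<union> Z)"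
      unfolding F_def compositum_def by (intro fgen_minimal[OF subfield_set_fgen]) simp
    show "fgen (A \<union> Z) \<subseteq> F" by (rule fgen_minimal[OF Fsub]) (use AF ZF in simp)
  qed
  have F_E: "F = fgen (E \<union> Z)"
  proof
    show "F \<subseteq> fgen (E \<union> Z)" unfolding F_A by (rule fgen_mono) (use AE in auto)
    show "fgen (E \<union> Z) \<subseteq> F" by (rule fgen_minimal[OF Fsub]) (use EF ZF in simp)
  qed
  have w: "restriction_weak_solution K E F \<theta>" using weak unfolding lower_weak_solution_def F_def .
  note wD = restriction_weak_solutionD[OF K Fsub EF w]
  from restriction_weak_solution_finite[OF K E Z(1) F_E w] obtain W
    where W: "finite W" "W \<subseteq> separable_closure_of K"
    "\<forall>\<sigma>\<in>carrier (absolute_galois_group K). \<forall>\<tau>\<in>carrier (absolute_galois_group K).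
      (\<forall>w\<in>W. \<sigma> w = \<tau> w) \<longrightarrow> \<theta> \<sigma> = \<theta> \<tau>" by (elim exE conjE)
  interpret tw: twist K A E F Z W \<theta>
  proof (unfold_locales)
    show "\<theta> \<sigma> = \<theta> \<tau>" if "\<sigma> \<in> carrier (absolute_galois_group K)" "\<tau> \<in> carrier (absolute_galois_group K)"
      "\<And>w. w \<in> W \<Longrightarrow> \<sigma> w = \<tau> w" for \<sigma> \<tau>
      by (rule W(3)[rule_format, OF that(1,2)]) (rule that(3))
    show "lin_disj K (algebraic_closure_of K) E" by (rule regular_extension_lin_disj[OF reg])
  qed (fact K A incA(1) E AE EF Z(1) F_A Z_closed wD W(1,2))+
  let ?C = "carrier (mpoly_ring K e)"
  let ?ev = "mpoly_eval id t"
  obtain p q where pq: "p \<in> ?C" "q \<in> ?C" "?ev q \<noteq> 0" "r = ?ev p / ?ev q"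
    using r(1) unfolding adjoin_eq_fractions[OF K] mem_Collect_eq by (elim exE conjE)
  have p0: "?ev p \<noteq> 0" using r(2) pq(4) by auto
  have evA: "?ev u \<in> A" if "u \<in> ?C" for u
    by (rule mpoly_eval_in[OF subfield_setD(1)[OF A] that]) (use incA tA in auto)
  \<comment> \<open>Integral inverses make numerator and denominator of \<open>r\<close> units, so
    neither vanishes at \<open>a\<close>.\<close>
  define P where "P = {inverse (?ev p), inverse (?ev q)}"
  have P: "finite P" "P \<subseteq> A" unfolding P_def using subfield_setD(8)[OF A evA[OF pq(1)]] subfield_setD(8)[OF A evA[OF pq(2)]] by simp_all
  from tw.series_extension[OF pac A_def A0A[unfolded A0_def] alg tA P]
  obtain a j where a: "\<forall>i<e. a i \<in> K0" and j: "rhom F j"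
    and j_const: "\<forall>c\<in>F. c \<in> separable_closure_of K \<longrightarrow> j c = fls_const c"
    and j_F: "\<forall>x\<in>F. j x \<in> fls_over (separable_closure_of K)"
    and j_\<theta>: "\<forall>\<sigma>\<in>carrier (absolute_galois_group K). \<forall>x\<in>F. \<forall>n. fls_nth (j (\<theta> \<sigma> x)) n = \<sigma> (fls_nth (j x) n)"
    and j_A0: "\<forall>x\<in>adjoin K0 t e. j x \<in> fls_over K0"
    and j_t: "\<forall>i<e. j (t i) \<in> fls_int \<and> fls_res (j (t i)) = a i"
    and j_Z: "\<forall>z\<in>Z. j z \<in> fls_int" and res_inj: "inj_on (\<lambda>z. fls_res (j z)) Z"
    and j_P: "\<forall>x\<in>P. j x \<in> fls_int" by (elim exE conjE)
  \<comment> \<open>Stated for variable fields because it is applied to \<open>F\<close> over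
    \<open>E\<close> and to \<open>F0\<close> over \<open>A0\<close>.\<close>
  have stable: "\<gamma> z \<in> Z" if g: "\<gamma> \<in> carrier (galois_group N B)" and N: "subfield_set N" "Z \<subseteq> N"
    and B: "subfield_set B" "A0 \<subseteq> B" "B \<subseteq> N" and z: "z \<in> Z" for \<gamma> z N B
  proof -
    from Z_closed0[OF z] obtain f where f: "poly_over A0 f" "poly f z = 0" "{y. poly f y = 0} \<subseteq> Z"
      by (elim exE conjE)
    note gD = galois_groupD[OF subfield_setD(1)[OF N(1)] g]
    have "poly f (\<gamma> z) = 0"
      by (rule roots_min_poly_subset_closed[OF B(1) subfield_setD(1)[OF N(1)] B(3) subsetD[OF N(2) z] gD(3) gD(4)
          poly_over_mono[OF f(1) B(2)] f(2)])
    then show ?thesis by (intro subsetD[OF f(3)] CollectI)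
  qed
  \<comment> \<open>\<open>\<theta> \<sigma>\<close> fixes \<open>x\<close>, so every coefficient of
    \<open>j x\<close> is fixed by all \<open>\<sigma>\<close> and descends to
    \<open>K\<close>.\<close>
  have j_E: "j x \<in> fls_over K" if x: "x \<in> E" for x
    unfolding fls_over_def
  proof (intro CollectI allI)
    fix n
    have xF: "x \<in> F" using x EF by blast
    show "fls_nth (j x) n \<in> K"
    proof (rule absolute_galois_fixed[OF K])
      show "fls_nth (j x) n \<in> separable_closure_of K" using j_F xF unfolding fls_over_def by simp
      fix \<sigma> assume s: "\<sigma> \<in> carrier (absolute_galois_group K)"
      have "\<theta> \<sigma> x = x" by (rule galois_groupD(4)[OF subfield_setD(1)[OF Fsub] wD(1)[OF s] x])
      then show "\<sigma> (fls_nth (j x) n) = fls_nth (j x) n" using j_\<theta> s xF by metis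
    qed
  qed
  interpret low: series_place K E F Z j \<theta>
  proof (unfold_locales)
    show "\<gamma> z \<in> Z" if "\<gamma> \<in> carrier (galois_group F E)" "z \<in> Z" for \<gamma> z
      by (rule stable[OF that(1) Fsub ZF E subset_trans[OF A0A AE] EF that(2)])
    show "j c = fls_const c" if "c \<in> F" "c \<in> separable_closure_of K" for c using j_const that by simp
    show "j x \<in> fls_over (separable_closure_of K)" if "x \<in> F" for x using j_F that by simp
    show "j z \<in> fls_int" if "z \<in> Z" for z using j_Z that by simp
    show "fls_nth (j (\<theta> \<sigma> x)) n = \<sigma> (fls_nth (j x) n)"
      if "\<sigma> \<in> carrier (absolute_galois_group K)" "x \<in> F" for \<sigma> x n
      by (rule j_\<theta>[rule_format, OF that])
  qed (fact K KE Z(1) F_E j j_E res_inj wD(1))+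
  have F0: "subfield_set F0" unfolding Z(3) by simp
  have j0: "rhom F0 j" by (rule rhom_mono[OF j F0F])
  interpret gal: series_point_galois K0 A0 F0 Z j
  proof (unfold_locales)
    show "j x \<in> fls_over K0" if "x \<in> A0" for x using j_A0 that unfolding A0_def by simp
    show "j z \<in> fls_int" if "z \<in> Z" for z using j_Z that by simp
  qed (fact K0 A0 Z(1,3) Z_closed0 j0 res_inj)+
  \<comment> \<open>The coefficient condition pins down \<open>\<gamma>\<close>, since
    \<open>j\<close> is injective on \<open>F0\<close>; \<open>SOME\<close> only names it.\<close>
  define \<theta>0 where "\<theta>0 \<sigma> = (SOME \<gamma>. \<gamma> \<in> carrier (galois_group F0 A0) \<and>
    (\<forall>x\<in>F0. \<forall>n. fls_nth (j (\<gamma> x)) n = \<sigma> (fls_nth (j x) n)))" for \<sigma>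
  have \<theta>0: "\<theta>0 \<sigma> \<in> carrier (galois_group F0 A0) \<and> (\<forall>x\<in>F0. \<forall>n. fls_nth (j (\<theta>0 \<sigma> x)) n = \<sigma> (fls_nth (j x) n))"
    if "\<sigma> \<in> carrier (absolute_galois_group K0)" for \<sigma>
    unfolding \<theta>0_def by (rule someI_ex[OF gal.galois_action[OF that]])
  have s0s: "separable_closure_of K0 \<subseteq> separable_closure_of K" by (rule separable_closure_mono[OF K0K K])
  interpret up: series_place K0 A0 F0 Z j \<theta>0
  proof (unfold_locales)
    show "\<gamma> z \<in> Z" if "\<gamma> \<in> carrier (galois_group F0 A0)" "z \<in> Z" for \<gamma> z
      by (rule stable[OF that(1) F0 Z(2) A0 subset_refl gal.A_F that(2)])
    show "j c = fls_const c" if "c \<in> F0" "c \<in> separable_closure_of K0" for c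
      using j_const subsetD[OF F0F that(1)] subsetD[OF s0s that(2)] by simp
    show "fls_nth (j (\<theta>0 \<sigma> x)) n = \<sigma> (fls_nth (j x) n)"
      if "\<sigma> \<in> carrier (absolute_galois_group K0)" "x \<in> F0" for \<sigma> x n
      using \<theta>0[OF that(1)] that(2) by simp
    show "\<theta>0 \<sigma> \<in> carrier (galois_group F0 A0)" if "\<sigma> \<in> carrier (absolute_galois_group K0)" for \<sigma>
      using \<theta>0[OF that] by simp
    show "j x \<in> fls_over (separable_closure_of K0)" if "x \<in> F0" for x by (rule gal.j_F[OF that])
  qed (fact K0 incA0(1) Z(1,3) j0 gal.j_A gal.j_Z res_inj)+
  \<comment> \<open>Both sides act by \<open>\<sigma>\<close> on the coefficients of
    \<open>j x\<close>, which lie in the smaller separable closure; injectivity of \<open>j\<close>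
    does the rest.\<close>
  have compat: "restrict (\<theta> \<sigma>) F0 = \<theta>0 (restrict \<sigma> (separable_closure_of K0))"
    if s: "\<sigma> \<in> carrier (absolute_galois_group K)" for \<sigma>
  proof -
    let ?\<rho> = "restrict \<sigma> (separable_closure_of K0)"
    have \<rho>: "?\<rho> \<in> carrier (absolute_galois_group K0)" by (rule restrict_galois[OF K0 K K0K s])
    note t0 = up.gal_F[OF up.\<theta>[OF \<rho>]]
    show ?thesis
    proof (rule extensionalityI[of _ F0])
      show "\<theta>0 ?\<rho> \<in> extensional F0" by (rule t0(1))
      fix x assume x: "x \<in> F0"
      have xF: "x \<in> F" using x F0F by blast
      have "\<theta> \<sigma> x = \<theta>0 ?\<rho> x"
      proof (rule low.j_eq[OF low.gal_F(5)[OF wD(1)[OF s] xF] subsetD[OF F0F t0(5)[OF x]]], rule fls_eqI)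
        fix n
        have "fls_nth (j x) n \<in> separable_closure_of K0" by (rule up.res_in[OF x])
        then show "fls_nth (j (\<theta> \<sigma> x)) n = fls_nth (j (\<theta>0 ?\<rho> x)) n"
          unfolding low.j_\<theta>[OF s xF] up.j_\<theta>[OF \<rho> x] by simp
      qed
      then show "restrict (\<theta> \<sigma>) F0 x = \<theta>0 ?\<rho> x" using x by simp
    qed simp
  qed
  have geo: "geometric_weak_solution K0 K E t e F0 low.\<Phi> \<theta> \<theta>0"
    unfolding geometric_weak_solution_def double_weak_solution_def upper_weak_solution_def lower_weak_solution_def
      F_def[symmetric] A0_def[symmetric]
    using up.\<theta>_weak_solution w compat low.unramified_rational up.unramified_rational
      low.induced_weak_solution up.induced_weak_solution by (intro conjI ballI)
  have ev: "j (?ev u) \<in> fls_int \<and> fls_res (j (?ev u)) = mpoly_eval id a u" if u: "u \<in> ?C" for u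
  proof -
    have uk: "Poly_Mapping.lookup u m \<in> K" "m \<in> Poly_Mapping.keys u \<Longrightarrow> Poly_Mapping.keys m \<subseteq> {..<e}" for m
      using u unfolding mpoly_ring_carrier by blast+
    have jK: "j c = fls_const c" if "c \<in> K" for c
      using j_const subsetD[OF KF that] subsetD[OF subset_separable_closure[OF K] that] by simp
    let ?V = "{x \<in> F. j x \<in> fls_int}"
    have ji: "j (?ev u) = mpoly_eval (\<lambda>c. j (id c)) (\<lambda>i. j (t i)) u"
    proof (rule mpoly_eval_comp[OF j subfield_setD(1)[OF Fsub]])
      show "id (Poly_Mapping.lookup u m) \<in> F" for m using uk(1) KF by auto
      show "t i \<in> F" if "m \<in> Poly_Mapping.keys u" "i \<in> Poly_Mapping.keys m" for m i
        using uk(2)[OF that(1)] that(2) tA AF by auto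
    qed
    have mem: "j (?ev u) \<in> fls_int"
      unfolding ji
    proof (rule mpoly_eval_in[OF subring_fls_int u])
      show "j (id c) \<in> fls_int" if "c \<in> K" for c using jK[OF that] fls_const_int[of c] by simp
      show "j (t i) \<in> fls_int" if "i < e" for i using j_t that by simp
    qed
    have "fls_res (j (?ev u)) = mpoly_eval (\<lambda>c. fls_res (j (id c))) (\<lambda>i. fls_res (j (t i))) u"
      unfolding ji
    proof (rule mpoly_eval_comp[OF rhom_fls_res subring_fls_int])
      show "j (id (Poly_Mapping.lookup u m)) \<in> fls_int" for m
        using jK[OF uk(1)[of m]] fls_const_int[of "Poly_Mapping.lookup u m"] by simp
      show "j (t i) \<in> fls_int" if "m \<in> Poly_Mapping.keys u" "i \<in> Poly_Mapping.keys m" for m i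
        using uk(2)[OF that(1)] that(2) j_t by auto
    qed
    also have "\<dots> = mpoly_eval id (\<lambda>i. fls_res (j (t i))) u"
      unfolding mpoly_eval_def using jK uk(1) by simp
    also have "\<dots> = mpoly_eval id a u" by (rule mpoly_eval_cong[OF u]) (use j_t in simp)
    finally show ?thesis using mem by blast
  qed
  have ev0: "mpoly_eval id a u \<noteq> 0" if u: "u \<in> ?C" "?ev u \<noteq> 0" "inverse (?ev u) \<in> P" for u
  proof
    assume z: "mpoly_eval id a u = 0"
    have uF: "?ev u \<in> F" using evA[OF u(1)] AF by blast
    have i: "j (inverse (?ev u)) \<in> fls_int" using j_P u(3) by simp
    have "j (?ev u) * j (inverse (?ev u)) = j (?ev u * inverse (?ev u))"
      by (rule low.j'(4)[OF uF low.F'(8)[OF uF], symmetric])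
    then have "j (?ev u) * j (inverse (?ev u)) = 1" using u(2) low.j'(1) by simp
    then have "fls_res (j (?ev u)) * fls_res (j (inverse (?ev u))) = 1"
      using low.res'(4)[OF conjunct1[OF ev[OF u(1)]] i] by simp
    then show False using conjunct2[OF ev[OF u(1)]] z by simp
  qed
  have pa: "mpoly_eval id a p \<noteq> 0" and qa: "mpoly_eval id a q \<noteq> 0"
    by (rule ev0[OF pq(1) p0], simp add: P_def) (rule ev0[OF pq(2,3)], simp add: P_def)
  have "has_value_at id K e t r a (mpoly_eval id a p / mpoly_eval id a q)"
    unfolding has_value_at_def using pq(3,4) qa by (intro bexI[OF _ pq(1)] bexI[OF _ pq(2)] conjI refl)
  moreover have "mpoly_eval id a p / mpoly_eval id a q \<noteq> 0" using pa qa by simp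
  ultimately have val: "\<exists>b. b \<noteq> 0 \<and> has_value_at id K e t r a b" by (intro exI conjI)
  have "\<forall>i<e. low.\<Phi> (t i) = Some (a i) \<and> a i \<in> K0" using j_t a unfolding low.\<Phi>_Some by simp
  with geo val show ?thesis by (intro exI[of _ low.\<Phi>] exI[of _ \<theta>0] exI[of _ a] conjI)
qed

theorem proposition4p6:
  fixes K0 K E F0 :: "'a::alg_closed_field set"
    and t :: "nat \<Rightarrow> 'a"
    and e :: nat
    and \<theta> :: "('a \<Rightarrow> 'a) \<Rightarrow> ('a \<Rightarrow> 'a)"
  assumes "pac_extension K0 K"
    and "rational_double_embedding_problem K0 K E t e F0"
    and "lower_weak_solution K E F0 \<theta>"
  shows "(\<exists>\<Phi> \<theta>0. geometric_weak_solution K0 K E t e F0 \<Phi> \<theta> \<theta>0) \<and>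
    (\<forall>r \<in> adjoin K t e. r \<noteq> 0 \<longrightarrow>
       (\<exists>\<Phi> \<theta>0 a. geometric_weak_solution K0 K E t e F0 \<Phi> \<theta> \<theta>0 \<and>
          (\<forall>i<e. \<Phi> (t i) = Some (a i) \<and> a i \<in> K0) \<and>
          (\<exists>b. b \<noteq> 0 \<and> has_value_at id K e t r a b)))"
proof (intro conjI ballI impI)
  \<comment> \<open>The claim without a side condition is the case \<open>r = 1\<close>.\<close>
  have "1 \<in> adjoin K t e" unfolding adjoin_def by (rule subfield_setD(3)[OF subfield_set_fgen])
  from geometric_lifting[OF assms this one_neq_zero]
  show "\<exists>\<Phi> \<theta>0. geometric_weak_solution K0 K E t e F0 \<Phi> \<theta> \<theta>0" by (elim exE conjE) (intro exI)
next
  fix r assume "r \<in> adjoin K t e" "r \<noteq> 0"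
  then show "\<exists>\<Phi> \<theta>0 a. geometric_weak_solution K0 K E t e F0 \<Phi> \<theta> \<theta>0 \<and>
    (\<forall>i<e. \<Phi> (t i) = Some (a i) \<and> a i \<in> K0) \<and> (\<exists>b. b \<noteq> 0 \<and> has_value_at id K e t r a b)"
    by (rule geometric_lifting[OF assms])
qed

end
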